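(* Let $\varphi: P^m \to N^n$ be an isometric immersion of a complete non-compact Riemannian manifold $P^m$ into a Riemannian manifold $N^n$ with bounded geometry. Assume that the mean curvature vector $\vec H_P$ of $\varphi$ satisfies $\Vert \vec H_P\Vert_{L^p(P)} <\infty$ for one $p$ with $m \leq p \leq \infty$. Then $P^m$ is properly immersed in $N^n$ (i.e. $\varphi$ is a proper map) if and only if $\operatorname{Vol}(\varphi^{-1}(B^N_t)) < \infty$ for all $t>0$, where $B^N_t$ denotes any geodesic ball of radius $t$ in the ambient manifold $N$.
   Context: A complete and non-compact Riemannian manifold $N$ has bounded geometry if its sectional curvatures are bounded from above, $K_N\le b$ for some $b\in\mathbb{R}^+$, and its injectivity radius $i_0(N)=\inf\{i_N(p): p\in N\}$ is positive (possibly $+\infty$), where $i_N(p)$ is the injectivity radius at $p$. $\operatorname{Vol}$ is the $m$-dimensional Riemannian volume of $P$. The mean curvature vector $\vec H_P$ is the (normalized) trace of the second fundamental form of $\varphi$, and $\Vert \vec H_P\Vert_{L^p(P)}$ is the $L^p$-norm on $P$ of the function $x\mapsto\Vert\vec H_P(x)\Vert$. *)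

theory Defs
  imports "HOL-Analysis.Analysis" "HOL-Probability.Essential_Supremum"
begin

section \<open>Smooth functions between open subsets of Euclidean spaces\<close>

definition pd :: "'m::finite \<Rightarrow> (real^'m \<Rightarrow> 'b::real_normed_vector) \<Rightarrow> real^'m \<Rightarrow> 'b" where
  "pd i f x = frechet_derivative f (at x) (axis i 1)"

text \<open>The notions below are only meaningful for open \<open>S\<close>, and are only used there.\<close>

fun Ck_on :: "nat \<Rightarrow> (real^'m::finite) set \<Rightarrow> (real^'m \<Rightarrow> 'b::real_normed_vector) \<Rightarrow> bool" where
  "Ck_on 0 S f = continuous_on S f"
| "Ck_on (Suc k) S f = (f differentiable_on S \<and> (\<forall>i. Ck_on k S (pd i f)))"

definition smooth_on :: "(real^'m::finite) set \<Rightarrow> (real^'m \<Rightarrow> 'b::real_normed_vector) \<Rightarrow> bool" where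
  "smooth_on S f \<longleftrightarrow> (\<forall>k. Ck_on k S f)"

definition jacobian :: "(real^'m::finite \<Rightarrow> real^'n::finite) \<Rightarrow> real^'m \<Rightarrow> real^'m^'n" where
  "jacobian f x = matrix (frechet_derivative f (at x))"


section \<open>Riemannian manifolds\<close>

text \<open>A manifold is a whole type \<open>'a\<close> (Hausdorff and second countable) with an atlas. A chart is
  a pair \<open>(U, x)\<close> with domain \<open>U\<close> and coordinate map \<open>x\<close>; the values of \<open>x\<close> outside \<open>U\<close> are
  irrelevant. The metric is given by its coefficient matrix \<open>(g\<^sub>i\<^sub>j)\<close> in each chart, as a function
  of the coordinates. The dimension is the cardinality of the index type \<open>'m\<close>.\<close>

type_synonym ('a, 'm) chart = "'a set \<times> ('a \<Rightarrow> real^'m)"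

record ('a, 'm::finite) riem =
  atlas :: "('a, 'm) chart set"
  gmat :: "('a, 'm) chart \<Rightarrow> real^'m \<Rightarrow> real^'m^'m"

abbreviation cdom :: "('a, 'm::finite) chart \<Rightarrow> 'a set" where "cdom \<equiv> fst"
abbreviation cmap :: "('a, 'm::finite) chart \<Rightarrow> 'a \<Rightarrow> real^'m" where "cmap \<equiv> snd"
abbreviation cinv :: "('a, 'm::finite) chart \<Rightarrow> real^'m \<Rightarrow> 'a" where
  "cinv c \<equiv> inv_into (cdom c) (cmap c)"

definition ip :: "real^'m^'m::finite \<Rightarrow> real^'m \<Rightarrow> real^'m \<Rightarrow> real" where
  "ip G v w = v \<bullet> (G *v w)"

definition smooth_atlas ::
  "('a::{t2_space,second_countable_topology}, 'm::finite) chart set \<Rightarrow> bool" where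
  "smooth_atlas A \<longleftrightarrow>
     (\<Union>c\<in>A. cdom c) = UNIV \<and>
     (\<forall>c\<in>A. open (cdom c) \<and> open (cmap c ` cdom c) \<and>
        homeomorphism (cdom c) (cmap c ` cdom c) (cmap c) (cinv c)) \<and>
     (\<forall>c\<in>A. \<forall>d\<in>A. smooth_on (cmap c ` (cdom c \<inter> cdom d)) (cmap d \<circ> cinv c))"

definition riemannian_manifold ::
  "('a::{t2_space,second_countable_topology}, 'm::finite) riem \<Rightarrow> bool" where
  "riemannian_manifold M \<longleftrightarrow>
     connected (UNIV :: 'a set) \<and> smooth_atlas (atlas M) \<and>
     (\<forall>c\<in>atlas M. smooth_on (cmap c ` cdom c) (gmat M c) \<and>
        (\<forall>x\<in>cmap c ` cdom c. transpose (gmat M c x) = gmat M c x \<and>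
           (\<forall>v. v \<noteq> 0 \<longrightarrow> ip (gmat M c x) v v > 0))) \<and>
     (\<forall>c\<in>atlas M. \<forall>d\<in>atlas M. \<forall>q\<in>cdom c \<inter> cdom d.
        let J = jacobian (cmap d \<circ> cinv c) (cmap c q)
        in gmat M c (cmap c q) = transpose J ** gmat M d (cmap d q) ** J)"

text \<open>An arbitrary chart around a point; it is only used to evaluate expressions that do not
  depend on the chart.\<close>

definition chart_at :: "('a, 'm::finite) riem \<Rightarrow> 'a \<Rightarrow> ('a, 'm) chart" where
  "chart_at M q = (SOME c. c \<in> atlas M \<and> q \<in> cdom c)"


section \<open>Distance and volume\<close>

definition pw_C1_curve :: "('a::topological_space, 'm::finite) riem \<Rightarrow> (real \<Rightarrow> 'a) \<Rightarrow> bool" where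
  "pw_C1_curve M \<gamma> \<longleftrightarrow> continuous_on {0..1} \<gamma> \<and>
     (\<forall>c\<in>atlas M. \<forall>a b. 0 \<le> a \<and> a \<le> b \<and> b \<le> 1 \<and> \<gamma> ` {a..b} \<subseteq> cdom c \<longrightarrow>
        (cmap c \<circ> \<gamma>) piecewise_C1_differentiable_on {a..b})"

definition speed :: "('a, 'm::finite) riem \<Rightarrow> (real \<Rightarrow> 'a) \<Rightarrow> real \<Rightarrow> real" where
  "speed M \<gamma> t =
     (let c = chart_at M (\<gamma> t); v = vector_derivative (cmap c \<circ> \<gamma>) (at t)
      in sqrt (ip (gmat M c (cmap c (\<gamma> t))) v v))"

definition curve_length :: "('a, 'm::finite) riem \<Rightarrow> (real \<Rightarrow> 'a) \<Rightarrow> ennreal" where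
  "curve_length M \<gamma> = (\<integral>\<^sup>+ t\<in>{0..1}. ennreal (speed M \<gamma> t) \<partial>lborel)"

text \<open>The infimum is finite because manifolds are connected, so \<^const>\<open>enn2real\<close> loses nothing.\<close>

definition rdist :: "('a::topological_space, 'm::finite) riem \<Rightarrow> 'a \<Rightarrow> 'a \<Rightarrow> real" where
  "rdist M p q =
     enn2real (INF \<gamma>\<in>{\<gamma>. pw_C1_curve M \<gamma> \<and> \<gamma> 0 = p \<and> \<gamma> 1 = q}. curve_length M \<gamma>)"

definition geodesic_ball ::
  "('a::topological_space, 'm::finite) riem \<Rightarrow> 'a \<Rightarrow> real \<Rightarrow> 'a set" where
  "geodesic_ball M p t = Metric_space.mball UNIV (rdist M) p t"

definition complete_riem :: "('a::topological_space, 'm::finite) riem \<Rightarrow> bool" where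
  "complete_riem M \<longleftrightarrow> Metric_space.mcomplete UNIV (rdist M)"

text \<open>The Riemannian volume is the unique Borel measure that is given by
  \<open>sqrt (det g) dx\<close> in every chart.\<close>

definition riem_vol :: "('a::topological_space, 'm::finite) riem \<Rightarrow> 'a measure" where
  "riem_vol M = (THE \<mu>. sets \<mu> = sets borel \<and>
     (\<forall>c\<in>atlas M. \<forall>A\<in>sets borel. A \<subseteq> cdom c \<longrightarrow>
        emeasure \<mu> A = (\<integral>\<^sup>+ x\<in>cmap c ` A. ennreal (sqrt (det (gmat M c x))) \<partial>lborel)))"


section \<open>Connection and curvature\<close>

text \<open>\<open>christoffel G k i j x\<close> is $\Gamma^k_{ij}(x)$ for the metric coefficients \<open>G\<close>.\<close>

definition christoffel ::
  "(real^'m::finite \<Rightarrow> real^'m^'m) \<Rightarrow> 'm \<Rightarrow> 'm \<Rightarrow> 'm \<Rightarrow> real^'m \<Rightarrow> real" where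
  "christoffel G k i j x =
     (1/2) * (\<Sum>l\<in>UNIV. matrix_inv (G x) $ k $ l *
        (pd i (\<lambda>y. G y $ j $ l) x + pd j (\<lambda>y. G y $ i $ l) x - pd l (\<lambda>y. G y $ i $ j) x))"

text \<open>\<open>riem_tensor G l k i j\<close> is the \<open>l\<close>-th component of $R(\partial_i,\partial_j)\partial_k$, with
  $R(X,Y) = \nabla_X\nabla_Y - \nabla_Y\nabla_X - \nabla_{[X,Y]}$.\<close>

definition riem_tensor ::
  "(real^'m::finite \<Rightarrow> real^'m^'m) \<Rightarrow> 'm \<Rightarrow> 'm \<Rightarrow> 'm \<Rightarrow> 'm \<Rightarrow> real^'m \<Rightarrow> real" where
  "riem_tensor G l k i j x =
     pd i (christoffel G l j k) x - pd j (christoffel G l i k) x +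
     (\<Sum>r\<in>UNIV. christoffel G l i r x * christoffel G r j k x
                - christoffel G l j r x * christoffel G r i k x)"

definition curv_op ::
  "(real^'m::finite \<Rightarrow> real^'m^'m) \<Rightarrow> real^'m \<Rightarrow> real^'m \<Rightarrow> real^'m \<Rightarrow> real^'m \<Rightarrow> real^'m" where
  "curv_op G x u v w =
     (\<chi> l. \<Sum>i\<in>UNIV. \<Sum>j\<in>UNIV. \<Sum>k\<in>UNIV. u $ i * v $ j * w $ k * riem_tensor G l k i j x)"

definition sec_curv ::
  "(real^'m::finite \<Rightarrow> real^'m^'m) \<Rightarrow> real^'m \<Rightarrow> real^'m \<Rightarrow> real^'m \<Rightarrow> real" where
  "sec_curv G x u v = ip (G x) (curv_op G x u v v) u /
     (ip (G x) u u * ip (G x) v v - (ip (G x) u v)\<^sup>2)"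

definition sec_curv_le :: "('a, 'm::finite) riem \<Rightarrow> real \<Rightarrow> bool" where
  "sec_curv_le M b \<longleftrightarrow>
     (\<forall>c\<in>atlas M. \<forall>x\<in>cmap c ` cdom c. \<forall>u v. u \<noteq> v \<and> independent {u, v} \<longrightarrow>
        sec_curv (gmat M c) x u v \<le> b)"


section \<open>Geodesics, exponential map, injectivity radius\<close>

text \<open>Geodesics are parametrised by \<open>[0,1]\<close>; in coordinates they satisfy
  $\sigma''^k = -\Gamma^k_{ij}(\sigma)\,\sigma'^i\sigma'^j$.\<close>

definition geodesic :: "('a::topological_space, 'm::finite) riem \<Rightarrow> (real \<Rightarrow> 'a) \<Rightarrow> bool" where
  "geodesic M \<gamma> \<longleftrightarrow> continuous_on {0..1} \<gamma> \<and>
     (\<forall>c\<in>atlas M. \<exists>v. \<forall>t\<in>{0..1}. \<gamma> t \<in> cdom c \<longrightarrow>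
        ((cmap c \<circ> \<gamma>) has_vector_derivative v t) (at t within {0..1}) \<and>
        (v has_vector_derivative
           (\<chi> k. - (\<Sum>i\<in>UNIV. \<Sum>j\<in>UNIV.
               christoffel (gmat M c) k i j (cmap c (\<gamma> t)) * v t $ i * v t $ j)))
          (at t within {0..1}))"

text \<open>The tangent space at \<open>p\<close> is identified with \<open>real^'m\<close> by means of a chart \<open>c\<close> around \<open>p\<close>.\<close>

definition exp_geodesic ::
  "('a::topological_space, 'm::finite) riem \<Rightarrow> ('a, 'm) chart \<Rightarrow> 'a \<Rightarrow> real^'m \<Rightarrow> (real \<Rightarrow> 'a) \<Rightarrow> bool" where
  "exp_geodesic M c p v \<gamma> \<longleftrightarrow> geodesic M \<gamma> \<and> \<gamma> 0 = p \<and>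
     ((cmap c \<circ> \<gamma>) has_vector_derivative v) (at 0 within {0..1})"

definition exp_map ::
  "('a::topological_space, 'm::finite) riem \<Rightarrow> ('a, 'm) chart \<Rightarrow> 'a \<Rightarrow> real^'m \<Rightarrow> 'a" where
  "exp_map M c p v = (THE q. \<exists>\<gamma>. exp_geodesic M c p v \<gamma> \<and> \<gamma> 1 = q)"

definition diffeo_onto_image ::
  "('a::topological_space, 'm::finite) riem \<Rightarrow> (real^'m) set \<Rightarrow> (real^'m \<Rightarrow> 'a) \<Rightarrow> bool" where
  "diffeo_onto_image M B E \<longleftrightarrow>
     open B \<and> open (E ` B) \<and> inj_on E B \<and> continuous_on B E \<and>
     (\<forall>d\<in>atlas M. smooth_on {v\<in>B. E v \<in> cdom d} (cmap d \<circ> E) \<and>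
        smooth_on (cmap d ` (cdom d \<inter> E ` B)) (inv_into B E \<circ> cinv d))"

definition inj_radius_at :: "('a::topological_space, 'm::finite) riem \<Rightarrow> 'a \<Rightarrow> ereal" where
  "inj_radius_at M p = Sup (ereal ` {r. r > 0 \<and>
     (\<exists>c\<in>atlas M. p \<in> cdom c \<and>
       (let B = {v. sqrt (ip (gmat M c (cmap c p)) v v) < r}
        in (\<forall>v\<in>B. \<exists>\<gamma>. exp_geodesic M c p v \<gamma>) \<and> diffeo_onto_image M B (exp_map M c p)))})"

definition inj_radius :: "('a::topological_space, 'm::finite) riem \<Rightarrow> ereal" where
  "inj_radius M = (INF p. inj_radius_at M p)"

definition bounded_geometry :: "('a::topological_space, 'm::finite) riem \<Rightarrow> bool" where
  "bounded_geometry M \<longleftrightarrow> complete_riem M \<and> \<not> compact (UNIV :: 'a set) \<and>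
     (\<exists>b>0. sec_curv_le M b) \<and> inj_radius M > 0"


section \<open>Isometric immersions and mean curvature\<close>

abbreviation coord_map ::
  "('a, 'm::finite) chart \<Rightarrow> ('b, 'n::finite) chart \<Rightarrow> ('a \<Rightarrow> 'b) \<Rightarrow> real^'m \<Rightarrow> real^'n" where
  "coord_map c d \<phi> \<equiv> cmap d \<circ> \<phi> \<circ> cinv c"

definition isometric_immersion ::
  "('a::topological_space, 'm::finite) riem \<Rightarrow> ('b::topological_space, 'n::finite) riem \<Rightarrow>
     ('a \<Rightarrow> 'b) \<Rightarrow> bool" where
  "isometric_immersion P N \<phi> \<longleftrightarrow> continuous_on UNIV \<phi> \<and>
     (\<forall>c\<in>atlas P. \<forall>d\<in>atlas N.
        smooth_on (cmap c ` (cdom c \<inter> \<phi> -` cdom d)) (coord_map c d \<phi>) \<and>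
        (\<forall>q\<in>cdom c \<inter> \<phi> -` cdom d.
           let J = jacobian (coord_map c d \<phi>) (cmap c q)
           in inj ((*v) J) \<and>
              gmat P c (cmap c q) = transpose J ** gmat N d (cmap d (\<phi> q)) ** J))"

text \<open>Second fundamental form by the Gauss formula, in the charts \<open>c\<close> of \<open>P\<close> and \<open>d\<close> of \<open>N\<close>:
  $\alpha(\partial_i,\partial_j) = \bar\nabla_{\partial_i} d\varphi(\partial_j) -
   d\varphi(\nabla_{\partial_i}\partial_j)$.\<close>

definition second_ff ::
  "('a, 'm::finite) riem \<Rightarrow> ('b, 'n::finite) riem \<Rightarrow> ('a \<Rightarrow> 'b) \<Rightarrow>
     ('a, 'm) chart \<Rightarrow> ('b, 'n) chart \<Rightarrow> 'm \<Rightarrow> 'm \<Rightarrow> real^'m \<Rightarrow> real^'n" where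
  "second_ff P N \<phi> c d i j x =
     (let f = coord_map c d \<phi>
      in pd i (pd j f) x
         + (\<chi> k. \<Sum>r\<in>UNIV. \<Sum>s\<in>UNIV.
              christoffel (gmat N d) k r s (f x) * pd i f x $ r * pd j f x $ s)
         - (\<Sum>k\<in>UNIV. christoffel (gmat P c) k i j x *\<^sub>R pd k f x))"

definition mean_curv ::
  "('a, 'm::finite) riem \<Rightarrow> ('b, 'n::finite) riem \<Rightarrow> ('a \<Rightarrow> 'b) \<Rightarrow>
     ('a, 'm) chart \<Rightarrow> ('b, 'n) chart \<Rightarrow> real^'m \<Rightarrow> real^'n" where
  "mean_curv P N \<phi> c d x =
     (1 / real CARD('m)) *\<^sub>R
       (\<Sum>i\<in>UNIV. \<Sum>j\<in>UNIV. matrix_inv (gmat P c x) $ i $ j *\<^sub>R second_ff P N \<phi> c d i j x)"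

definition mean_curv_norm ::
  "('a, 'm::finite) riem \<Rightarrow> ('b, 'n::finite) riem \<Rightarrow> ('a \<Rightarrow> 'b) \<Rightarrow> 'a \<Rightarrow> real" where
  "mean_curv_norm P N \<phi> q =
     (let c = chart_at P q; d = chart_at N (\<phi> q); H = mean_curv P N \<phi> c d (cmap c q)
      in sqrt (ip (gmat N d (cmap d (\<phi> q))) H H))"

definition Lp_norm :: "ennreal \<Rightarrow> 'a measure \<Rightarrow> ('a \<Rightarrow> real) \<Rightarrow> ennreal" where
  "Lp_norm p M f =
     (if p = \<infinity> then esssup M (\<lambda>x. ennreal \<bar>f x\<bar>)
      else let I = \<integral>\<^sup>+ x. ennreal (\<bar>f x\<bar> powr enn2real p) \<partial>M
           in if I = \<infinity> then \<infinity> else ennreal (enn2real I powr (1 / enn2real p)))"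

definition proper :: "('a::topological_space \<Rightarrow> 'b::topological_space) \<Rightarrow> bool" where
  "proper f \<longleftrightarrow> continuous_on UNIV f \<and> (\<forall>K. compact K \<longrightarrow> compact (f -` K))"

end

theory Submission
  imports Defs
begin

text \<open>If \<open>K\<close> is compact and \<open>\<phi> -` K\<close> is not, then \<open>\<phi> -` K\<close> is unbounded by Hopf--Rinow, and \<open>P\<close> contains
  infinitely many disjoint intrinsic balls of a fixed radius whose centers are mapped close to one
  point \<open>l\<close> of \<open>N\<close>. If preimages of balls have finite volume, then the volumes of these balls, and the
  \<open>L\<^sup>p\<close>-norms of the mean curvature \<open>H\<close> on them, tend to \<open>0\<close>. In a chart around \<open>l\<close>, let \<open>u\<close> be half the
  squared distance to \<open>\<phi> \<xi>\<close> with respect to the metric frozen at \<open>\<phi> \<xi>\<close>. With \<open>r\<close> the intrinsic distance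
  to \<open>\<xi>\<close>, its restriction to \<open>P\<close> satisfies \<open>|grad u| \<le> (1 + C r) r\<close> and
  \<open>Laplace u \<ge> m (1 - C r - (1 + C r) r |H|)\<close>. Testing this with functions of \<open>r\<close> gives a monotonicity
  inequality for the volumes of intrinsic balls. By a dyadic argument, Vitali's covering lemma and De
  Giorgi's iteration, a ball on which the volume and the integral of \<open>1 + |H|\<close> are small would have
  volume \<open>0\<close> at half its radius. The converse is Hopf--Rinow in \<open>N\<close>.\<close>

section \<open>Calculus on open subsets of Euclidean spaces\<close>

text \<open>As the images of the centers are close to the single point \<open>l\<close>, the
  constants \<open>R\<close> and \<open>C\<close> of one chart serve all of them. The intrinsic
  distance \<open>r\<close> is merely Lipschitz, so the divergence theorem is proved as an
  inequality, with a one-sided bound for the decrease of a monotone function of \<open>r\<close>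
  along the gradient of \<open>u\<close>. Since |H| is only in L^p, the integral of r^(1-m) (1 +
  |H|) in the monotonicity inequality cannot be bounded at a single center. Instead, for each center
  of a thin ball of size \<rho> there is a scale \<open>t\<close> at which the volume of the ball of
  radius \<open>4 * t\<close> is at most a constant times \<rho> times the integral of 1 + |H| over
  the ball of radius \<open>t\<close>; otherwise the densities of all dyadic balls would stay below
  the lower bound for small balls. Vitali's lemma adds this up: V(s) is at most a constant times
  V(s')^(1/m) times the integral of 1 + |H| over the ball of radius s'. This substitutes for the
  Sobolev inequality of submanifolds. For p \<ge> m, a Young-type inequality bounds the integral by
  a small multiple of V(s')^(1 - 1/m), so each step of the iteration gains a fixed factor.\<close>

abbreviation fd :: "('a::real_normed_vector \<Rightarrow> 'b::real_normed_vector) \<Rightarrow> 'a \<Rightarrow> 'a \<Rightarrow> 'b" where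
  "fd f x \<equiv> frechet_derivative f (at x)"

text \<open>The outer derivative is in direction \<open>u\<close>. Fixing \<open>v\<close> first
  avoids derivatives of maps into a space of linear maps.\<close>

definition sd :: "('a::real_normed_vector \<Rightarrow> 'b::real_normed_vector) \<Rightarrow> 'a \<Rightarrow> 'a \<Rightarrow> 'a \<Rightarrow> 'b" where
  "sd f x u v = fd (\<lambda>y. fd f y v) x u"

lemma fd_works: "f differentiable at x \<Longrightarrow> (f has_derivative fd f x) (at x)"
  by (simp add: frechet_derivative_works)

lemma fd_eqI: "(f has_derivative f') (at x) \<Longrightarrow> fd f x = f'"
  by (rule frechet_derivative_at[symmetric])

lemma linear_fd: "f differentiable at x \<Longrightarrow> linear (fd f x)"
  by (meson fd_works has_derivative_linear)

lemma has_derivative_cong_open: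
  assumes "open S" "x \<in> S" "\<And>y. y \<in> S \<Longrightarrow> f y = g y"
  shows "(f has_derivative f') (at x) \<longleftrightarrow> (g has_derivative f') (at x)"
  using assms by (metis has_derivative_transform_within_open)

lemma fd_cong:
  assumes "open S" "x \<in> S" "\<And>y. y \<in> S \<Longrightarrow> f y = g y"
  shows "fd f x = fd g x"
  unfolding frechet_derivative_def using has_derivative_cong_open[OF assms] by simp

lemma fd_chain:
  assumes "f differentiable at x" "g differentiable at (f x)"
  shows "fd (\<lambda>y. g (f y)) x v = fd g (f x) (fd f x v)"
proof -
  have "((g \<circ> f) has_derivative (fd g (f x) \<circ> fd f x)) (at x)"
    by (intro diff_chain_at fd_works assms)
  then show ?thesis
    using fd_eqI by (fastforce simp: o_def)
qed

lemma smooth_on_differentiable: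
  "smooth_on S f \<Longrightarrow> open S \<Longrightarrow> x \<in> S \<Longrightarrow> f differentiable at x"
  unfolding smooth_on_def
  by (metis Ck_on.simps(2) at_within_open differentiable_on_def)

lemma smooth_on_pd: "smooth_on S f \<Longrightarrow> smooth_on S (pd i f)"
  unfolding smooth_on_def using Ck_on.simps(2) by blast

lemma smooth_on_continuous: "smooth_on S f \<Longrightarrow> continuous_on S f"
  unfolding smooth_on_def using Ck_on.simps(1) by blast

lemma vec_basis_sum: "(v::real^'m) = (\<Sum>i\<in>UNIV. v $ i *\<^sub>R axis i 1)"
  by (simp add: vec_eq_iff axis_def if_distrib cong: if_cong)

lemma linear_axis_sum:
  fixes L :: "real^'m \<Rightarrow> 'b::real_vector"
  assumes "linear L" shows "L v = (\<Sum>i\<in>UNIV. v $ i *\<^sub>R L (axis i 1))"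
  by (subst vec_basis_sum) (simp add: linear_sum[OF assms] linear_scale[OF assms] del: scaleR_vec_def)

lemma fd_pd:
  fixes f :: "real^'m \<Rightarrow> 'b::real_normed_vector"
  assumes "f differentiable at x"
  shows "fd f x v = (\<Sum>i\<in>UNIV. v $ i *\<^sub>R pd i f x)"
  unfolding pd_def by (rule linear_axis_sum[OF linear_fd[OF assms]])

text \<open>\<open>smooth_on\<close> speaks of iterated partial derivatives only. On
  \<open>S\<close> the map \<open>\<lambda>y. fd f y v\<close> is a combination of them with
  constant coefficients, so it is differentiable and \<open>sd\<close> becomes the usual double
  sum.\<close>

lemma smooth_fd_differentiable:
  fixes f :: "real^'m \<Rightarrow> 'b::real_normed_vector"
  assumes "smooth_on S f" "open S" "x \<in> S"
  shows "(\<lambda>y. fd f y v) differentiable at x"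
    and "sd f x u v = (\<Sum>i\<in>UNIV. \<Sum>j\<in>UNIV. (u $ i * v $ j) *\<^sub>R pd i (pd j f) x)"
proof -
  have D: "((\<lambda>y. \<Sum>j\<in>UNIV. v $ j *\<^sub>R pd j f y) has_derivative
      (\<lambda>u. \<Sum>j\<in>UNIV. v $ j *\<^sub>R fd (pd j f) x u)) (at x)"
    by (intro has_derivative_sum has_derivative_scaleR_right fd_works
        smooth_on_differentiable[OF smooth_on_pd[OF assms(1)] assms(2,3)])
  have E: "((\<lambda>y. fd f y v) has_derivative (\<lambda>u. \<Sum>j\<in>UNIV. v $ j *\<^sub>R fd (pd j f) x u)) (at x)"
    by (subst has_derivative_cong_open[OF assms(2,3)])
      (rule fd_pd[OF smooth_on_differentiable[OF assms(1,2)]] D, assumption?)+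
  then show "(\<lambda>y. fd f y v) differentiable at x" by (auto simp: differentiable_def)
  have "sd f x u v = (\<Sum>j\<in>UNIV. v $ j *\<^sub>R (\<Sum>i\<in>UNIV. u $ i *\<^sub>R pd i (pd j f) x))"
    unfolding sd_def fd_eqI[OF E]
    by (simp add: fd_pd[OF smooth_on_differentiable[OF smooth_on_pd[OF assms(1)] assms(2,3)]])
  also have "\<dots> = (\<Sum>j\<in>UNIV. \<Sum>i\<in>UNIV. (u $ i * v $ j) *\<^sub>R pd i (pd j f) x)"
    by (simp add: scaleR_sum_right mult.commute)
  finally show "sd f x u v = (\<Sum>i\<in>UNIV. \<Sum>j\<in>UNIV. (u $ i * v $ j) *\<^sub>R pd i (pd j f) x)"
    by (subst sum.swap)
qed

lemma smooth_fd_continuous: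
  fixes f :: "real^'m \<Rightarrow> 'b::real_normed_vector"
  assumes "smooth_on S f" "open S" "continuous_on T p" "continuous_on T v" "p ` T \<subseteq> S"
  shows "continuous_on T (\<lambda>z. fd f (p z) (v z))"
proof -
  have "continuous_on T (\<lambda>z. \<Sum>i\<in>UNIV. v z $ i *\<^sub>R pd i f (p z))"
    by (intro continuous_intros assms continuous_on_compose2[OF smooth_on_continuous[OF smooth_on_pd[OF assms(1)]] assms(3)])
  moreover have "fd f (p z) (v z) = (\<Sum>i\<in>UNIV. v z $ i *\<^sub>R pd i f (p z))" if "z \<in> T" for z
    using that assms(5) by (intro fd_pd smooth_on_differentiable[OF assms(1,2)]) auto
  ultimately show ?thesis
    by (metis (no_types, lifting) continuous_on_cong)
qed

lemma smooth_sd_continuous: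
  fixes f :: "real^'m \<Rightarrow> 'b::real_normed_vector"
  assumes "smooth_on S f" "open S" "continuous_on T p" "continuous_on T u" "continuous_on T v" "p ` T \<subseteq> S"
  shows "continuous_on T (\<lambda>z. sd f (p z) (u z) (v z))"
proof -
  have "continuous_on T (\<lambda>z. \<Sum>i\<in>UNIV. \<Sum>j\<in>UNIV. (u z $ i * v z $ j) *\<^sub>R pd i (pd j f) (p z))"
    by (intro continuous_intros assms
        continuous_on_compose2[OF smooth_on_continuous[OF smooth_on_pd[OF smooth_on_pd[OF assms(1)]]] assms(3)])
  moreover have "sd f (p z) (u z) (v z) = (\<Sum>i\<in>UNIV. \<Sum>j\<in>UNIV. (u z $ i * v z $ j) *\<^sub>R pd i (pd j f) (p z))" if "z \<in> T" for z
    using that assms(6) by (intro smooth_fd_differentiable[OF assms(1,2)]) auto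
  ultimately show ?thesis
    by (metis (no_types, lifting) continuous_on_cong)
qed

lemma sd_bilinear:
  fixes f :: "real^'m \<Rightarrow> 'b::real_normed_vector"
  assumes "smooth_on S f" "open S" "x \<in> S"
  shows "bilinear (sd f x)"
  unfolding bilinear_def
proof (intro conjI allI)
  note E = smooth_fd_differentiable(2)[OF assms]
  show "linear (\<lambda>y. sd f x u y)" for u
    by (rule linearI) (simp_all add: E algebra_simps scaleR_sum_right sum.distrib)
  show "linear (\<lambda>y. sd f x y u)" for u
    by (rule linearI) (simp_all add: E algebra_simps scaleR_sum_right sum.distrib)
qed

lemma sd_has_derivative:
  fixes f :: "real^'m \<Rightarrow> 'b::real_normed_vector"
  assumes "smooth_on S f" "open S" "x \<in> S"
  shows "((\<lambda>y. fd f y v) has_derivative (\<lambda>u. sd f x u v)) (at x)"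
  using fd_works[OF smooth_fd_differentiable(1)[OF assms]] by (simp add: sd_def)

text \<open>The mean value theorem twice: in direction \<open>u\<close> for \<open>p\<close>, the
  difference of \<open>f\<close> along two parallel edges, then in direction \<open>v\<close> for
  the derivative of \<open>f\<close> that results.\<close>

lemma second_difference_mvt:
  fixes f :: "real^'m \<Rightarrow> real"
  assumes f: "smooth_on S f" "open S" and h: "0 < h"
    and S: "\<And>s t. 0 \<le> s \<Longrightarrow> s \<le> h \<Longrightarrow> 0 \<le> t \<Longrightarrow> t \<le> h \<Longrightarrow> x + s *\<^sub>R u + t *\<^sub>R v \<in> S"
  obtains s t where "0 < s" "s < h" "0 < t" "t < h"
    "f (x + h *\<^sub>R u + h *\<^sub>R v) - f (x + h *\<^sub>R u) - f (x + h *\<^sub>R v) + f x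
       = h\<^sup>2 * sd f (x + s *\<^sub>R u + t *\<^sub>R v) v u"
proof -
  define p where "p s = f (x + s *\<^sub>R u + h *\<^sub>R v) - f (x + s *\<^sub>R u)" for s
  have d: "((\<lambda>s. f (x + s *\<^sub>R u + t *\<^sub>R v)) has_derivative (\<lambda>r. fd f (x + s *\<^sub>R u + t *\<^sub>R v) (r *\<^sub>R u))) (at s)"
    if "0 \<le> s" "s \<le> h" "0 \<le> t" "t \<le> h" for s t
    by (rule has_derivative_compose[of "\<lambda>s. x + s *\<^sub>R u + t *\<^sub>R v" "\<lambda>r. r *\<^sub>R u"])
      (auto intro!: derivative_eq_intros fd_works smooth_on_differentiable[OF f] S that)
  have dp: "(p has_derivative (\<lambda>r. fd f (x + s *\<^sub>R u + h *\<^sub>R v) (r *\<^sub>R u) - fd f (x + s *\<^sub>R u) (r *\<^sub>R u))) (at s)"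
    if "0 \<le> s" "s \<le> h" for s
    unfolding p_def using d[OF that, of h] d[OF that, of 0] h by (auto intro!: has_derivative_diff)
  obtain s where s: "0 < s" "s < h"
    "p h - p 0 = fd f (x + s *\<^sub>R u + h *\<^sub>R v) ((h - 0) *\<^sub>R u) - fd f (x + s *\<^sub>R u) ((h - 0) *\<^sub>R u)"
  proof -
    have "continuous_on {0..h} p"
      using dp by (meson atLeastAtMost_iff continuous_at_imp_continuous_on has_derivative_continuous)
    from mvt[OF h this dp] obtain s where "s \<in> {0<..<h}" "p h - p 0 =
      fd f (x + s *\<^sub>R u + h *\<^sub>R v) ((h - 0) *\<^sub>R u) - fd f (x + s *\<^sub>R u) ((h - 0) *\<^sub>R u)" by auto
    then show ?thesis using that[of s] by simp
  qed
  have d2: "((\<lambda>t. fd f (x + s *\<^sub>R u + t *\<^sub>R v) (h *\<^sub>R u)) has_derivative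
      (\<lambda>r. sd f (x + s *\<^sub>R u + t *\<^sub>R v) (r *\<^sub>R v) (h *\<^sub>R u))) (at t)" if "0 \<le> t" "t \<le> h" for t
    by (rule has_derivative_compose[of "\<lambda>t. x + s *\<^sub>R u + t *\<^sub>R v" "\<lambda>r. r *\<^sub>R v"])
      (auto intro!: derivative_eq_intros sd_has_derivative[OF f] S that s less_imp_le)
  obtain t where t: "0 < t" "t < h"
    "fd f (x + s *\<^sub>R u + h *\<^sub>R v) (h *\<^sub>R u) - fd f (x + s *\<^sub>R u + 0 *\<^sub>R v) (h *\<^sub>R u)
      = sd f (x + s *\<^sub>R u + t *\<^sub>R v) ((h - 0) *\<^sub>R v) (h *\<^sub>R u)"
  proof -
    have "continuous_on {0..h} (\<lambda>t. fd f (x + s *\<^sub>R u + t *\<^sub>R v) (h *\<^sub>R u))"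
      using d2 by (meson atLeastAtMost_iff continuous_at_imp_continuous_on has_derivative_continuous)
    from mvt[OF h this d2] that show ?thesis by (metis less_imp_le)
  qed
  have bl: "bilinear (sd f (x + s *\<^sub>R u + t *\<^sub>R v))"
    by (rule sd_bilinear[OF f]) (use s t S in auto)
  have "sd f (x + s *\<^sub>R u + t *\<^sub>R v) (h *\<^sub>R v) (h *\<^sub>R u) = h\<^sup>2 * sd f (x + s *\<^sub>R u + t *\<^sub>R v) v u"
    by (simp add: bilinear_lmul[OF bl] bilinear_rmul[OF bl] power2_eq_square del: scaleR_vec_def)
  then show ?thesis
    using that[of s t] s t h by (simp add: p_def)
qed

text \<open>Both orders of differentiation are compared with the same second difference of
  \<open>f\<close>, which by \<open>second_difference_mvt\<close> is \<open>h\<^sup>2\<close> times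
  either of them at points near \<open>x\<close>; then continuity of \<open>sd\<close> is
  used.\<close>

lemma sd_sym_real:
  fixes f :: "real^'m \<Rightarrow> real"
  assumes f: "smooth_on S f" "open S" "x \<in> S"
  shows "sd f x u v = sd f x v u"
proof -
  obtain e where e: "e > 0" "ball x e \<subseteq> S" using f openE by blast
  \<comment> \<open>Parallelograms with factor less than \<open>k\<close> stay in the ball; the
    \<open>+ 1\<close> is for \<open>u = v = 0\<close>.\<close>
  define k where "k = e / (norm u + norm v + 1)"
  have k: "k > 0" unfolding k_def using e by (simp add: add_nonneg_pos)
  have inS: "x + s *\<^sub>R u + t *\<^sub>R v \<in> S" if "0 \<le> s" "s \<le> h" "0 \<le> t" "t \<le> h" "h < k" for s t h
  proof -
    have "norm (s *\<^sub>R u + t *\<^sub>R v) \<le> s * norm u + t * norm v"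
      using that by (metis abs_of_nonneg norm_scaleR norm_triangle_ineq)
    also have "\<dots> \<le> h * norm u + h * norm v" using that by (intro add_mono mult_right_mono) auto
    also have "\<dots> \<le> h * (norm u + norm v + 1)" using that by (simp add: algebra_simps)
    also have "\<dots> < e"
      using \<open>h < k\<close> norm_ge_zero[of u] norm_ge_zero[of v] unfolding k_def
      by (subst (asm) pos_less_divide_eq) (auto simp: add_nonneg_pos)
    finally show ?thesis using e by (auto simp: dist_norm add.assoc norm_minus_commute add.commute
          intro!: subsetD[OF e(2)])
  qed
  have lim: "\<exists>d>0. \<forall>s t. 0 \<le> s \<and> s \<le> d \<and> 0 \<le> t \<and> t \<le> d \<longrightarrow> \<bar>sd f (x + s *\<^sub>R u + t *\<^sub>R v) a b - sd f x a b\<bar> < r"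
    if "r > 0" for r a b
  proof -
    have "continuous_on S (\<lambda>y. sd f y a b)"
      by (rule smooth_sd_continuous[OF f(1,2)]) auto
    then have "continuous (at x) (\<lambda>y. sd f y a b)"
      using f continuous_on_eq_continuous_at by blast
    then have "\<exists>d>0. \<forall>y. dist y x < d \<longrightarrow> dist (sd f y a b) (sd f x a b) < r"
      using that unfolding continuous_at_eps_delta by simp
    then obtain d where d: "d > 0" and d': "\<And>y. dist y x < d \<Longrightarrow> dist (sd f y a b) (sd f x a b) < r"
      by auto
    then have d: "d > 0" "\<And>y. norm (y - x) < d \<Longrightarrow> \<bar>sd f y a b - sd f x a b\<bar> < r"
      by (simp_all add: dist_norm)
    define q where "q = d / (norm u + norm v + 1) / 2"
    have q: "q > 0" unfolding q_def using d by (simp add: add_nonneg_pos)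
    have "norm (s *\<^sub>R u + t *\<^sub>R v) < d" if "0 \<le> s" "s \<le> q" "0 \<le> t" "t \<le> q" for s t
    proof -
      have "norm (s *\<^sub>R u + t *\<^sub>R v) \<le> s * norm u + t * norm v"
        using that by (metis abs_of_nonneg norm_scaleR norm_triangle_ineq)
      also have "\<dots> \<le> q * norm u + q * norm v" using that by (intro add_mono mult_right_mono) auto
      also have "\<dots> \<le> q * (norm u + norm v + 1)" using q by (simp add: algebra_simps)
      also have "\<dots> = d / 2" unfolding q_def using norm_ge_zero[of u] norm_ge_zero[of v]
        by (simp add: field_simps add_nonneg_eq_0_iff)
      finally show ?thesis using d by simp
    qed
    then show ?thesis using q d by (intro exI[of _ q]) (simp add: add.assoc)
  qed
  have "\<bar>sd f x u v - sd f x v u\<bar> \<le> 2 * r" if r: "r > 0" for r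
  proof -
    obtain d1 where d1: "d1 > 0" "\<And>s t. 0 \<le> s \<and> s \<le> d1 \<and> 0 \<le> t \<and> t \<le> d1 \<Longrightarrow> \<bar>sd f (x + s *\<^sub>R u + t *\<^sub>R v) u v - sd f x u v\<bar> < r"
      using lim[OF r] by metis
    obtain d2 where d2: "d2 > 0" "\<And>s t. 0 \<le> s \<and> s \<le> d2 \<and> 0 \<le> t \<and> t \<le> d2 \<Longrightarrow> \<bar>sd f (x + s *\<^sub>R u + t *\<^sub>R v) v u - sd f x v u\<bar> < r"
      using lim[OF r] by metis
    define h where "h = min (k/2) (min d1 d2)"
    have h: "0 < h" "h < k" "h \<le> d1" "h \<le> d2" unfolding h_def using k d1 d2 by auto
    have in1: "x + s *\<^sub>R u + t *\<^sub>R v \<in> S" and in2: "x + t *\<^sub>R v + s *\<^sub>R u \<in> S"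
      if "0 \<le> s" "s \<le> h" "0 \<le> t" "t \<le> h" for s t
      using inS[OF that h(2)] by (simp_all add: algebra_simps)
    obtain s t where st: "0 < s" "s < h" "0 < t" "t < h"
      "f (x + h *\<^sub>R u + h *\<^sub>R v) - f (x + h *\<^sub>R u) - f (x + h *\<^sub>R v) + f x = h\<^sup>2 * sd f (x + s *\<^sub>R u + t *\<^sub>R v) v u"
      by (rule second_difference_mvt[OF f(1,2) h(1) in1])
    obtain s' t' where st': "0 < s'" "s' < h" "0 < t'" "t' < h"
      "f (x + h *\<^sub>R v + h *\<^sub>R u) - f (x + h *\<^sub>R v) - f (x + h *\<^sub>R u) + f x = h\<^sup>2 * sd f (x + s' *\<^sub>R v + t' *\<^sub>R u) u v"
      by (rule second_difference_mvt[OF f(1,2) h(1) in2])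
    have "h\<^sup>2 * sd f (x + s *\<^sub>R u + t *\<^sub>R v) v u = h\<^sup>2 * sd f (x + t' *\<^sub>R u + s' *\<^sub>R v) u v"
      using st(5) st'(5) by (simp add: algebra_simps)
    then have "sd f (x + s *\<^sub>R u + t *\<^sub>R v) v u = sd f (x + t' *\<^sub>R u + s' *\<^sub>R v) u v" using h by simp
    then show ?thesis using d1(2)[of t' s'] d2(2)[of s t] st st' h by (smt (verit))
  qed
  note B = this
  have "\<bar>sd f x u v - sd f x v u\<bar> \<le> 0 + e" if "e > 0" for e
    using B[of "e / 2"] that by simp
  then have "\<bar>sd f x u v - sd f x v u\<bar> \<le> 0"
    by (rule field_le_epsilon)
  then show ?thesis by simp
qed

section \<open>Smoothness and second derivatives under linear maps and composition\<close>

lemma Ck_on_cong: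
  fixes f :: "real^'m \<Rightarrow> 'b::real_normed_vector"
  assumes "open S" "\<And>y. y \<in> S \<Longrightarrow> f y = g y"
  shows "Ck_on k S f = Ck_on k S g"
  using assms(2)
proof (induction k arbitrary: f g)
  case 0
  then show ?case by (auto intro: continuous_on_cong)
next
  case (Suc k)
  have "pd i f y = pd i g y" if "y \<in> S" for i y
    unfolding pd_def using fd_cong[OF assms(1) that Suc.prems] by simp
  then have "Ck_on k S (pd i f) = Ck_on k S (pd i g)" for i by (rule Suc.IH)
  moreover have "f differentiable_on S \<longleftrightarrow> g differentiable_on S"
    unfolding differentiable_on_eq_differentiable_at[OF assms(1)] differentiable_def
    using has_derivative_cong_open[OF assms(1) _ Suc.prems] by simp
  ultimately show ?case by simp
qed

lemma fd_bounded_linear: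
  assumes "bounded_linear L" "f differentiable at x"
  shows "fd (\<lambda>y. L (f y)) x v = L (fd f x v)"
  using fd_eqI[OF bounded_linear.has_derivative[OF assms(1) fd_works[OF assms(2)]]] by simp

lemma Ck_on_bounded_linear:
  fixes f :: "real^'m \<Rightarrow> 'b::real_normed_vector"
  assumes "bounded_linear L" "open S" "Ck_on k S f"
  shows "Ck_on k S (\<lambda>y. L (f y))"
  using assms(3)
proof (induction k arbitrary: f)
  case 0
  then show ?case by (simp add: bounded_linear.continuous_on[OF assms(1)])
next
  case (Suc k)
  have d: "f differentiable at y" if "y \<in> S" for y
    using Suc.prems that assms(2) by (simp add: differentiable_on_eq_differentiable_at)
  have "(\<lambda>y. L (f y)) differentiable at y" if "y \<in> S" for y
    using bounded_linear.has_derivative[OF assms(1) fd_works[OF d[OF that]]] by (auto simp: differentiable_def)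
  moreover have "Ck_on k S (pd i (\<lambda>y. L (f y)))" for i
  proof -
    have "Ck_on k S (\<lambda>y. L (pd i f y))" using Suc by simp
    moreover have "L (pd i f y) = pd i (\<lambda>y. L (f y)) y" if "y \<in> S" for y
      unfolding pd_def by (simp add: fd_bounded_linear[OF assms(1) d[OF that]])
    ultimately show ?thesis
      using Ck_on_cong[OF assms(2), of "\<lambda>y. L (pd i f y)" "pd i (\<lambda>y. L (f y))" k] by simp
  qed
  ultimately show ?case by (simp add: assms(2) differentiable_on_eq_differentiable_at)
qed

lemma smooth_on_bounded_linear:
  fixes f :: "real^'m \<Rightarrow> 'b::real_normed_vector"
  assumes "bounded_linear L" "open S" "smooth_on S f"
  shows "smooth_on S (\<lambda>y. L (f y))"
  using assms Ck_on_bounded_linear unfolding smooth_on_def by blast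

lemma sd_bounded_linear:
  fixes f :: "real^'m \<Rightarrow> 'b::real_normed_vector"
  assumes "bounded_linear L" "smooth_on S f" "open S" "x \<in> S"
  shows "sd (\<lambda>y. L (f y)) x u v = L (sd f x u v)"
proof -
  have "sd (\<lambda>y. L (f y)) x u v = fd (\<lambda>y. L (fd f y v)) x u"
    unfolding sd_def
    by (subst fd_cong[OF assms(3,4)]) (auto intro: fd_bounded_linear[OF assms(1)] smooth_on_differentiable[OF assms(2,3)])
  then show ?thesis
    unfolding sd_def using fd_bounded_linear[OF assms(1) smooth_fd_differentiable(1)[OF assms(2-4)]] by simp
qed

lemma sd_sym:
  fixes f :: "real^'m \<Rightarrow> real^'n"
  assumes "smooth_on S f" "open S" "x \<in> S"
  shows "sd f x u v = sd f x v u"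
proof (subst vec_eq_iff, rule allI)
  fix i
  have b: "bounded_linear (\<lambda>y::real^'n. y $ i)" by (rule bounded_linear_vec_nth)
  show "sd f x u v $ i = sd f x v u $ i"
    using sd_sym_real[OF smooth_on_bounded_linear[OF b assms(2,1)] assms(2,3)] sd_bounded_linear[OF b assms] by metis
qed

text \<open>Both arguments of \<open>fd g (f y) (fd f y v)\<close> depend on \<open>y\<close>.
  Expanding in the coordinates of \<open>fd f y v\<close> turns it into a sum of products, to which
  the product rule applies.\<close>

lemma sd_chain:
  fixes f :: "real^'m \<Rightarrow> real^'n" and g :: "real^'n \<Rightarrow> 'b::real_normed_vector"
  assumes f: "smooth_on S f" "open S" "x \<in> S" and g: "smooth_on T g" "open T" "f ` S \<subseteq> T"
  shows "sd (\<lambda>y. g (f y)) x u v = sd g (f x) (fd f x u) (fd f x v) + fd g (f x) (sd f x u v)"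
    and "fd (\<lambda>y. g (f y)) x v = fd g (f x) (fd f x v)"
    and "((\<lambda>y. fd (\<lambda>y. g (f y)) y v) has_derivative (\<lambda>u. sd g (f x) (fd f x u) (fd f x v) + fd g (f x) (sd f x u v))) (at x)"
proof -
  have df: "f differentiable at y" if "y \<in> S" for y by (rule smooth_on_differentiable[OF f(1,2) that])
  have dg: "g differentiable at (f y)" if "y \<in> S" for y
    by (rule smooth_on_differentiable[OF g(1,2)]) (use g that in auto)
  have c: "fd (\<lambda>y. g (f y)) y v = fd g (f y) (fd f y v)" if "y \<in> S" for y
    by (rule fd_chain[OF df[OF that] dg[OF that]])
  then show "fd (\<lambda>y. g (f y)) x v = fd g (f x) (fd f x v)" using f(3) by blast
  have c2: "fd g (f y) (fd f y v) = (\<Sum>i\<in>UNIV. fd f y v $ i *\<^sub>R pd i g (f y))" if "y \<in> S" for y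
    by (rule fd_pd[OF dg[OF that]])
  have fx: "f x \<in> T" using f g by auto
  have D: "((\<lambda>y. \<Sum>i\<in>UNIV. fd f y v $ i *\<^sub>R pd i g (f y)) has_derivative
     (\<lambda>u. \<Sum>i\<in>UNIV. fd f x v $ i *\<^sub>R fd (pd i g) (f x) (fd f x u) + sd f x u v $ i *\<^sub>R pd i g (f x))) (at x)"
  proof (intro has_derivative_sum has_derivative_scaleR)
    show "((\<lambda>y. fd f y v $ i) has_derivative (\<lambda>u. sd f x u v $ i)) (at x)" for i
      by (rule bounded_linear.has_derivative[OF bounded_linear_vec_nth sd_has_derivative[OF f]])
    show "((\<lambda>y. pd i g (f y)) has_derivative (\<lambda>u. fd (pd i g) (f x) (fd f x u))) (at x)" for i
      using diff_chain_at[OF fd_works[OF df[OF f(3)]] fd_works[OF smooth_on_differentiable[OF smooth_on_pd[OF g(1)] g(2) fx]]]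
      by (simp add: o_def)
  qed
  have E: "(\<Sum>i\<in>UNIV. fd f x v $ i *\<^sub>R fd (pd i g) (f x) (fd f x u) + sd f x u v $ i *\<^sub>R pd i g (f x))
     = sd g (f x) (fd f x u) (fd f x v) + fd g (f x) (sd f x u v)" for u
  proof -
    have "(\<Sum>i\<in>UNIV. fd f x v $ i *\<^sub>R fd (pd i g) (f x) (fd f x u)) = sd g (f x) (fd f x u) (fd f x v)"
      unfolding smooth_fd_differentiable(2)[OF g(1,2) fx]
      by (subst sum.swap) (simp add: fd_pd[OF smooth_on_differentiable[OF smooth_on_pd[OF g(1)] g(2) fx]] scaleR_sum_right mult.commute)
    then show ?thesis
      unfolding fd_pd[OF dg[OF f(3)]] by (simp add: sum.distrib)
  qed
  show H: "((\<lambda>y. fd (\<lambda>y. g (f y)) y v) has_derivative (\<lambda>u. sd g (f x) (fd f x u) (fd f x v) + fd g (f x) (sd f x u v))) (at x)"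
    using D unfolding E
    by (subst has_derivative_cong_open[OF f(2,3)]) (auto simp: c c2)
  show "sd (\<lambda>y. g (f y)) x u v = sd g (f x) (fd f x u) (fd f x v) + fd g (f x) (sd f x u v)"
    unfolding sd_def[of "\<lambda>y. g (f y)"] using fd_eqI[OF H] by simp
qed

section \<open>Inner products given by matrices\<close>

definition posdef :: "real^'m^'m::finite \<Rightarrow> bool" where
  "posdef G \<longleftrightarrow> transpose G = G \<and> (\<forall>v. v \<noteq> 0 \<longrightarrow> ip G v v > 0)"

lemma ip_sum: "ip G v w = (\<Sum>i\<in>UNIV. \<Sum>j\<in>UNIV. v $ i * G $ i $ j * w $ j)"
  by (simp add: ip_def inner_vec_def matrix_vector_mult_def sum_distrib_left mult.assoc)

lemma ip_add_left: "ip G (u + v) w = ip G u w + ip G v w"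
  and ip_add_right: "ip G w (u + v) = ip G w u + ip G w v"
  and ip_diff_left: "ip G (u - v) w = ip G u w - ip G v w"
  and ip_diff_right: "ip G w (u - v) = ip G w u - ip G w v"
  and ip_scale_left: "ip G (c *\<^sub>R v) w = c * ip G v w"
  and ip_scale_right: "ip G w (c *\<^sub>R v) = c * ip G w v"
  and ip_zero_left: "ip G 0 w = 0"
  and ip_zero_right: "ip G w 0 = 0"
  by (simp_all add: ip_def inner_simps matrix_vector_right_distrib matrix_vector_mult_diff_distrib
      matrix_vector_mult_scaleR)

lemma ip_minus_left: "ip G (- v) w = - ip G v w"
  and ip_minus_right: "ip G w (- v) = - ip G w v"
  by (simp_all add: ip_sum sum_negf)

lemmas ip_simps = ip_add_left ip_add_right ip_diff_left ip_diff_right ip_scale_left ip_scale_right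
  ip_zero_left ip_zero_right ip_minus_left ip_minus_right

lemma ip_add_mat: "ip (G + H) v w = ip G v w + ip H v w"
  and ip_scale_mat: "ip (c *\<^sub>R G) v w = c * ip G v w"
  and ip_diff_mat: "ip (G - H) v w = ip G v w - ip H v w"
  by (simp_all add: ip_sum algebra_simps sum.distrib sum_distrib_left sum_subtractf)

lemma bounded_linear_ip_mat: "bounded_linear (\<lambda>G. ip G v w)"
  by (rule linear_conv_bounded_linear[THEN iffD1], rule linearI) (simp_all add: ip_add_mat ip_scale_mat)

lemma linear_ip_right: "linear (ip G v)"
  by (rule linearI) (simp_all add: ip_simps)

lemma ip_transpose: "ip (transpose G) v w = ip G w v"
  by (simp add: ip_def dot_lmul_matrix[symmetric] vector_transpose_matrix inner_commute)

lemma ip_sym: "transpose G = G \<Longrightarrow> ip G v w = ip G w v"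
  using ip_transpose by metis

lemma posdef_sym: "posdef G \<Longrightarrow> ip G v w = ip G w v"
  unfolding posdef_def using ip_sym by blast

lemma posdef_pos: "posdef G \<Longrightarrow> v \<noteq> 0 \<Longrightarrow> ip G v v > 0"
  unfolding posdef_def by blast

lemma posdef_nonneg: "posdef G \<Longrightarrow> ip G v v \<ge> 0"
  by (cases "v = 0") (auto simp: ip_simps intro: less_imp_le posdef_pos)

lemma posdef_eq0: "posdef G \<Longrightarrow> ip G v v = 0 \<longleftrightarrow> v = 0"
  by (metis ip_zero_left less_irrefl posdef_pos)

lemma ip_congruence: "ip (transpose J ** G ** J) v w = ip G (J *v v) (J *v w)"
proof -
  have "ip (transpose J ** G ** J) v w = (transpose J *v (G *v (J *v w))) \<bullet> v"
    by (simp add: ip_def matrix_vector_mul_assoc matrix_mul_assoc inner_commute)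
  then show ?thesis
    by (simp only: transpose_matrix_vector dot_lmul_matrix) (simp only: ip_def inner_commute)
qed

lemma ip_nondeg:
  assumes "posdef G" "\<And>w. ip G u w = ip G v w" shows "u = v"
proof -
  have "ip G (u - v) (u - v) = 0" using assms(2) by (simp add: ip_diff_left)
  then show ?thesis using posdef_eq0[OF assms(1)] by auto
qed

lemma ip_Cauchy_Schwarz:
  assumes "posdef G"
  shows "\<bar>ip G v w\<bar> \<le> sqrt (ip G v v) * sqrt (ip G w w)"
proof (cases "w = 0")
  case False
  then have p: "ip G w w > 0" using assms posdef_pos by blast
  define t where "t = ip G v w / ip G w w"
  have "0 \<le> ip G (v - t *\<^sub>R w) (v - t *\<^sub>R w)" by (rule posdef_nonneg[OF assms])
  also have "\<dots> = ip G v v - 2 * t * ip G v w + t * t * ip G w w"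
    by (simp add: ip_simps posdef_sym[OF assms, of w v] algebra_simps)
  also have "\<dots> = ip G v v - (ip G v w)\<^sup>2 / ip G w w"
    using p by (simp add: t_def field_simps power2_eq_square)
  finally have "(ip G v w)\<^sup>2 \<le> ip G v v * ip G w w" using p by (simp add: field_simps)
  then have "sqrt ((ip G v w)\<^sup>2) \<le> sqrt (ip G v v * ip G w w)" by (rule real_sqrt_le_mono)
  then show ?thesis by (simp add: real_sqrt_mult)
qed (simp add: ip_simps)

text \<open>A \<open>G\<close>-orthonormal set of maximal cardinality spans, by the Gram--Schmidt step.\<close>

lemma posdef_frame:
  fixes G :: "real^'m::finite^'m"
  assumes G: "posdef G"
  obtains A :: "real^'m^'m" where "transpose A ** G ** A = mat 1"
proof -
  define ON where "ON B \<longleftrightarrow> (\<forall>u\<in>B. \<forall>v\<in>B. ip G u v = (if u = v then 1 else 0))" for B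
  have ind: "independent B" if "ON B" "finite B" for B
  proof (rule independent_if_scalars_zero[OF that(2)])
    fix f x assume "(\<Sum>b\<in>B. f b *\<^sub>R b) = 0" and x: "x \<in> B"
    then have "0 = ip G x (\<Sum>b\<in>B. f b *\<^sub>R b)" by (simp add: ip_simps)
    also have "\<dots> = (\<Sum>b\<in>B. f b * ip G x b)"
      by (simp add: linear_sum[OF linear_ip_right] ip_simps)
    also have "\<dots> = (\<Sum>b\<in>B. if b = x then f b else 0)"
      by (rule sum.cong) (use that x in \<open>auto simp: ON_def\<close>)
    also have "\<dots> = f x" using x that by simp
    finally show "f x = 0" by simp
  qed
  define S where "S = {n. \<exists>B. ON B \<and> finite B \<and> card B = n}"
  have S0: "0 \<in> S" unfolding S_def ON_def by (auto intro!: exI[of _ "{}"])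
  have "\<forall>n\<in>S. n \<le> CARD('m)"
    unfolding S_def using ind independent_bound by fastforce
  then have fS: "finite S" by (meson finite_nat_set_iff_bounded_le)
  have "Max S \<in> S" using S0 fS by (intro Max_in) auto
  then obtain B where B: "ON B" "finite B" "card B = Max S" unfolding S_def by auto
  have sp: "span B = UNIV"
  proof (rule ccontr)
    assume "span B \<noteq> UNIV"
    then obtain v where v: "v \<notin> span B" by auto
    define w where "w = v - (\<Sum>b\<in>B. ip G b v *\<^sub>R b)"
    have w0: "w \<noteq> 0"
    proof
      assume "w = 0"
      then have "v = (\<Sum>b\<in>B. ip G b v *\<^sub>R b)" by (simp add: w_def)
      moreover have "\<dots> \<in> span B" by (intro span_sum span_scale span_base)
      ultimately show False using v by simp
    qed
    have wB: "ip G b w = 0" if b: "b \<in> B" for b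
    proof -
      have "ip G b (\<Sum>c\<in>B. ip G c v *\<^sub>R c) = (\<Sum>c\<in>B. ip G c v * ip G b c)"
        by (simp add: linear_sum[OF linear_ip_right] ip_simps)
      also have "\<dots> = (\<Sum>c\<in>B. if c = b then ip G c v else 0)"
        by (rule sum.cong) (use B b in \<open>auto simp: ON_def\<close>)
      also have "\<dots> = ip G b v" using B b by simp
      finally show ?thesis by (simp add: w_def ip_simps)
    qed
    have pw: "ip G w w > 0" by (rule posdef_pos[OF G w0])
    define e where "e = (1 / sqrt (ip G w w)) *\<^sub>R w"
    have e1: "ip G e e = 1" using pw by (simp add: e_def ip_simps)
    have eB: "ip G b e = 0" "ip G e b = 0" if "b \<in> B" for b
      using wB[OF that] posdef_sym[OF G, of b w] by (simp_all add: e_def ip_simps)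
    have "e \<notin> B" using eB e1 by force
    moreover have "ON (insert e B)" using B(1) eB e1 unfolding ON_def by force
    ultimately have "Suc (Max S) = card (insert e B) \<and> card (insert e B) \<in> S"
      using B(2,3) by (subst (2) S_def) auto
    then have "Suc (Max S) \<in> S" by metis
    then show False using Max_ge[OF fS] by force
  qed
  have "card B = CARD('m)"
  proof -
    have "dim (UNIV :: (real^'m) set) = card B"
      using sp ind[OF B(1,2)] by (metis dim_span_eq_card_independent)
    then show ?thesis by simp
  qed
  then obtain b where b: "bij_betw b (UNIV :: 'm set) B"
    using B(2) by (metis finite_same_card_bij finite)
  define A :: "real^'m^'m" where "A = (\<chi> i j. b j $ i)"
  have Aax: "A *v axis j 1 = b j" for j
    by (simp add: A_def matrix_vector_mult_def vec_eq_iff axis_def if_distrib cong: if_cong)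
  have "transpose A ** G ** A = mat 1"
  proof (subst vec_eq_iff, intro allI, subst vec_eq_iff, intro allI)
    fix i j
    have "(transpose A ** G ** A) $ i $ j = ip (transpose A ** G ** A) (axis i 1) (axis j 1)"
      by (simp add: ip_def matrix_vector_mult_basis column_def inner_axis' )
    also have "\<dots> = ip G (b i) (b j)" by (simp add: ip_congruence Aax)
    also have "\<dots> = (if i = j then 1 else 0)"
      using B(1) b unfolding ON_def bij_betw_def inj_on_def by auto
    finally show "(transpose A ** G ** A) $ i $ j = mat 1 $ i $ j" by (simp add: mat_def)
  qed
  then show ?thesis by (rule that)
qed

section \<open>Orthonormal frames: for \<open>A\<close> from \<open>posdef_frame\<close> the vectors
  \<open>col A k\<close> are a \<open>G\<close>-orthonormal basis\<close>

definition col :: "real^'m^'n \<Rightarrow> 'm::finite \<Rightarrow> real^'n::finite" where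
  "col A k = A *v axis k 1"

lemma col_nth: "col A k $ i = A $ i $ k"
  by (simp add: col_def matrix_vector_mult_basis column_def)

lemma matrix_inv_works:
  fixes G :: "real^'m::finite^'m"
  assumes "invertible G"
  shows "matrix_inv G ** G = mat 1" "G ** matrix_inv G = mat 1"
  using someI_ex[OF assms[unfolded invertible_def], folded matrix_inv_def] by blast+

text \<open>A left inverse of a square matrix is also a right inverse, so the hypothesis gives
  \<open>(A ** transpose A) ** G = mat 1\<close>. The rest is read off from these two
  equations.\<close>

lemma frame_props:
  fixes G A :: "real^'m::finite^'m"
  assumes "transpose A ** G ** A = mat 1"
  shows "matrix_inv G = A ** transpose A" "invertible G" "invertible A" "(det A)\<^sup>2 * det G = 1"
    "ip G (col A i) (col A j) = (if i = j then 1 else 0)" "G ** matrix_inv G = mat 1" "matrix_inv G ** G = mat 1"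
proof -
  show inA: "invertible A" unfolding invertible_left_inverse using assms by (rule exI)
  have R: "A ** (transpose A ** G) = mat 1"
    using assms matrix_left_right_inverse[of "transpose A ** G" A] by simp
  then have R': "(A ** transpose A) ** G = mat 1" by (simp add: matrix_mul_assoc)
  show inG: "invertible G" unfolding invertible_left_inverse using R' by (rule exI)
  have "matrix_inv G ** G = mat 1 \<and> G ** matrix_inv G = mat 1"
    using inG matrix_inv_works by blast
  then show "G ** matrix_inv G = mat 1" "matrix_inv G ** G = mat 1" by blast+
  moreover have "(A ** transpose A) ** (G ** matrix_inv G) = ((A ** transpose A) ** G) ** matrix_inv G"
    by (simp only: matrix_mul_assoc)
  ultimately show "matrix_inv G = A ** transpose A" by (simp add: R')
  have "det (transpose A ** G ** A) = det A * det G * det A" by (simp add: det_mul)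
  then show "(det A)\<^sup>2 * det G = 1" by (simp add: assms power2_eq_square algebra_simps)
  show "ip G (col A i) (col A j) = (if i = j then 1 else 0)"
    unfolding col_def ip_congruence[symmetric] assms by (simp add: ip_def inner_axis') (simp add: axis_def)
qed

lemma posdef_det_pos:
  fixes G :: "real^'m::finite^'m"
  assumes "posdef G" shows "det G > 0"
proof -
  obtain A :: "real^'m^'m" where "transpose A ** G ** A = mat 1" by (rule posdef_frame[OF assms])
  from frame_props(4)[OF this] have *: "(det A)\<^sup>2 * det G = 1" .
  show ?thesis
  proof (rule ccontr)
    assume "\<not> 0 < det G"
    then have "(det A)\<^sup>2 * det G \<le> 0" by (intro mult_nonneg_nonpos) auto
    then show False using * by simp
  qed
qed

lemma posdef_inv:
  fixes G :: "real^'m::finite^'m"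
  assumes "posdef G"
  shows "G ** matrix_inv G = mat 1" "matrix_inv G ** G = mat 1"
    "ip G (matrix_inv G *v u) w = u \<bullet> w" "ip G w (matrix_inv G *v u) = w \<bullet> u"
proof -
  obtain A :: "real^'m^'m" where A: "transpose A ** G ** A = mat 1" by (rule posdef_frame[OF assms])
  show *: "G ** matrix_inv G = mat 1" "matrix_inv G ** G = mat 1" by (rule frame_props(6)[OF A], rule frame_props(7)[OF A])
  show "ip G w (matrix_inv G *v u) = w \<bullet> u" for w u
    by (simp add: ip_def matrix_vector_mul_assoc *)
  then show "ip G (matrix_inv G *v u) w = u \<bullet> w"
    by (simp add: posdef_sym[OF assms, of "matrix_inv G *v u"] inner_commute)
qed

lemma frame_expand:
  fixes G A :: "real^'m::finite^'m"
  assumes "transpose A ** G ** A = mat 1"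
  shows "v = (\<Sum>k\<in>UNIV. ip G (col A k) v *\<^sub>R col A k)"
proof -
  have R: "A ** (transpose A ** G) = mat 1"
    using assms matrix_left_right_inverse[of "transpose A ** G" A] by simp
  have c: "(transpose A *v (G *v v)) $ k = ip G (col A k) v" for k
    by (subst matrix_vector_mult_def[of "transpose A"]) (simp add: ip_def inner_vec_def col_nth transpose_def)
  have "v = A *v (transpose A *v (G *v v))" using R by (simp add: matrix_vector_mul_assoc matrix_mul_assoc)
  also have "\<dots> = (\<Sum>k\<in>UNIV. (transpose A *v (G *v v)) $ k *\<^sub>R col A k)"
    by (rule trans[OF linear_axis_sum[of "(*v) A"]]) (simp_all add: col_def)
  finally show ?thesis by (simp only: c)
qed

text \<open>Holds because \<open>matrix_inv G = A ** transpose A\<close>. The left side is the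
  contraction in \<open>mean_curv\<close>, which thus becomes a sum over an orthonormal
  basis.\<close>

lemma frame_trace:
  fixes G A :: "real^'m::finite^'m" and B :: "real^'m \<Rightarrow> real^'m \<Rightarrow> 'b::real_vector"
  assumes A: "transpose A ** G ** A = mat 1" and B: "\<And>v. linear (B v)" "\<And>w. linear (\<lambda>v. B v w)"
  shows "(\<Sum>i\<in>UNIV. \<Sum>j\<in>UNIV. matrix_inv G $ i $ j *\<^sub>R B (axis i 1) (axis j 1)) = (\<Sum>k\<in>UNIV. B (col A k) (col A k))"
proof -
  have "B (col A k) (col A k) = (\<Sum>i\<in>UNIV. \<Sum>j\<in>UNIV. (A $ i $ k * A $ j $ k) *\<^sub>R B (axis i 1) (axis j 1))" for k
  proof -
    have "B (col A k) (col A k) = (\<Sum>i\<in>UNIV. col A k $ i *\<^sub>R B (axis i 1) (col A k))"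
      by (rule linear_axis_sum[OF B(2)])
    also have "\<dots> = (\<Sum>i\<in>UNIV. col A k $ i *\<^sub>R (\<Sum>j\<in>UNIV. col A k $ j *\<^sub>R B (axis i 1) (axis j 1)))"
      by (subst linear_axis_sum[OF B(1)]) simp
    finally show ?thesis by (simp add: col_nth scaleR_sum_right)
  qed
  then have "(\<Sum>k\<in>UNIV. B (col A k) (col A k)) = (\<Sum>k\<in>UNIV. \<Sum>i\<in>UNIV. \<Sum>j\<in>UNIV. (A $ i $ k * A $ j $ k) *\<^sub>R B (axis i 1) (axis j 1))"
    by simp
  also have "\<dots> = (\<Sum>i\<in>UNIV. \<Sum>j\<in>UNIV. \<Sum>k\<in>UNIV. (A $ i $ k * A $ j $ k) *\<^sub>R B (axis i 1) (axis j 1))"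
    by (subst sum.swap, subst (2) sum.swap) (rule refl)
  also have "\<dots> = (\<Sum>i\<in>UNIV. \<Sum>j\<in>UNIV. (\<Sum>k\<in>UNIV. A $ i $ k * A $ j $ k) *\<^sub>R B (axis i 1) (axis j 1))"
    by (simp add: scaleR_sum_left)
  also have "\<dots> = (\<Sum>i\<in>UNIV. \<Sum>j\<in>UNIV. matrix_inv G $ i $ j *\<^sub>R B (axis i 1) (axis j 1))"
    by (simp add: frame_props(1)[OF A] matrix_matrix_mult_def transpose_def)
  finally show ?thesis by simp
qed

lemma trace_axis: "trace (M::real^'m::finite^'m) = (\<Sum>k\<in>UNIV. (M *v axis k 1) $ k)"
  by (simp add: trace_def matrix_vector_mult_basis column_def)

text \<open>\<open>transpose A ** G\<close> is the inverse of \<open>A\<close>, and the trace is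
  invariant under conjugation.\<close>

lemma frame_trace_linear:
  fixes G A M :: "real^'m::finite^'m"
  assumes A: "transpose A ** G ** A = mat 1"
  shows "trace M = (\<Sum>k\<in>UNIV. ip G (col A k) (M *v col A k))"
proof -
  have R: "A ** (transpose A ** G) = mat 1"
    using A matrix_left_right_inverse[of "transpose A ** G" A] by simp
  have "trace M = trace (A ** (transpose A ** G) ** M)" by (simp add: R)
  also have "\<dots> = trace ((transpose A ** G) ** M ** A)"
    by (metis matrix_mul_assoc trace_mul_sym)
  also have "\<dots> = (\<Sum>k\<in>UNIV. axis k 1 \<bullet> ((transpose A ** (G ** M)) *v (A *v axis k 1)))"
    by (simp add: trace_axis matrix_vector_mul_assoc matrix_mul_assoc inner_axis')
  also have "\<dots> = (\<Sum>k\<in>UNIV. ip (transpose A ** (G ** M) ** A) (axis k 1) (axis k 1))"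
    by (simp add: ip_def matrix_vector_mul_assoc)
  also have "\<dots> = (\<Sum>k\<in>UNIV. ip G (col A k) (M *v col A k))"
    unfolding ip_congruence by (simp add: ip_def col_def matrix_vector_mul_assoc matrix_mul_assoc)
  finally show ?thesis .
qed

text \<open>In the Leibniz formula, differentiating the factor of index \<open>i\<close> leaves the
  product over \<open>j \<noteq> i\<close>. A permutation other than the identity moves some such
  \<open>j\<close>, where the entry of the identity matrix is 0; so only \<open>p = id\<close>
  contributes.\<close>

lemma has_derivative_det_1:
  "(det has_derivative trace) (at (mat 1 :: real^'m::finite^'m))"
proof -
  have nz: "(\<Prod>j\<in>UNIV - {i}. (mat 1 :: real^'m^'m) $ j $ p j) = (if p = id then 1 else 0)"
    if p: "p permutes UNIV" for p and i :: 'm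
  proof (cases "p = id")
    case True then show ?thesis by (simp add: mat_def)
  next
    case False
    have "\<exists>j. j \<noteq> i \<and> p j \<noteq> j"
    proof (rule ccontr)
      assume "\<not> (\<exists>j. j \<noteq> i \<and> p j \<noteq> j)"
      then have h: "\<And>j. j \<noteq> i \<Longrightarrow> p j = j" by blast
      moreover have "p i = i"
      proof (rule ccontr)
        assume n: "p i \<noteq> i"
        then have "p (p i) = p i" using h by blast
        then show False using n permutes_inj[OF p] by (metis injD)
      qed
      ultimately show False using False by (metis eq_id_iff)
    qed
    then obtain j where j: "j \<noteq> i" "p j \<noteq> j" by blast
    have "(mat 1 :: real^'m^'m) $ j $ p j = 0" using j by (simp add: mat_def)
    then show ?thesis using j False by (auto intro!: prod_zero)
  qed
  have *: "((\<lambda>X::real^'m^'m. of_int (sign p) * (\<Prod>i\<in>UNIV. X $ i $ p i)) has_derivative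
     (\<lambda>H. of_int (sign p) * (\<Sum>i\<in>UNIV. H $ i $ p i * (\<Prod>j\<in>UNIV - {i}. mat 1 $ j $ p j)))) (at (mat 1))" for p
    by (intro has_derivative_mult_right has_derivative_prod) (auto intro!: derivative_eq_intros bounded_linear_imp_has_derivative
        bounded_linear_compose[OF bounded_linear_vec_nth bounded_linear_vec_nth])
  have "((\<lambda>X::real^'m^'m. \<Sum>p\<in>{p. p permutes UNIV}. of_int (sign p) * (\<Prod>i\<in>UNIV. X $ i $ p i)) has_derivative
     (\<lambda>H. \<Sum>p\<in>{p. p permutes UNIV}. of_int (sign p) * (\<Sum>i\<in>UNIV. H $ i $ p i * (\<Prod>j\<in>UNIV - {i}. mat 1 $ j $ p j)))) (at (mat 1))"
    by (intro has_derivative_sum *)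
  moreover have "(\<Sum>p\<in>{p. p permutes UNIV}. of_int (sign p) * (\<Sum>i\<in>UNIV. H $ i $ p i * (\<Prod>j\<in>UNIV - {i}. mat 1 $ j $ p j))) = trace H" for H :: "real^'m^'m"
  proof -
    have "(\<Sum>p\<in>{p. p permutes UNIV}. of_int (sign p) * (\<Sum>i\<in>UNIV. H $ i $ p i * (\<Prod>j\<in>UNIV - {i}. mat 1 $ j $ p j)))
      = (\<Sum>p\<in>{p. p permutes (UNIV::'m set)}. if p = id then trace H else 0)"
      by (rule sum.cong) (auto simp: nz trace_def sign_id)
    also have "\<dots> = trace H" by (simp add: permutes_id finite_permutations)
    finally show ?thesis .
  qed
  ultimately show ?thesis unfolding det_def[abs_def] by simp
qed

text \<open>Factor out \<open>det G\<close> and differentiate at the identity.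
  \<open>frame_trace_inv\<close> turns the trace in this formula into a sum over a frame.\<close>

lemma has_derivative_det:
  fixes G :: "real^'m::finite^'m"
  assumes "invertible G"
  shows "(det has_derivative (\<lambda>H. det G * trace (matrix_inv G ** H))) (at G)"
proof -
  have inv: "matrix_inv G ** G = mat 1" "G ** matrix_inv G = mat 1" using assms matrix_inv_works by blast+
  have e: "det X = det G * det (matrix_inv G ** X)" for X
    unfolding det_mul[symmetric] by (simp add: matrix_mul_assoc inv)
  have bl: "bounded_linear (\<lambda>X. matrix_inv G ** X)"
    by (rule linear_conv_bounded_linear[THEN iffD1], rule linearI)
      (simp_all add: matrix_add_ldistrib matrix_scalar_ac scalar_matrix_assoc flip: scalar_mult_eq_scaleR)
  have d1: "(det has_derivative trace) (at (matrix_inv G ** G))" unfolding inv by (rule has_derivative_det_1)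
  have "((\<lambda>X. det (matrix_inv G ** X)) has_derivative (\<lambda>H. trace (matrix_inv G ** H))) (at G)"
    by (rule has_derivative_compose[OF bounded_linear_imp_has_derivative[OF bl] d1])
  then have "((\<lambda>X. det G * det (matrix_inv G ** X)) has_derivative (\<lambda>H. det G * trace (matrix_inv G ** H))) (at G)"
    by (rule has_derivative_mult_right)
  then show ?thesis unfolding e[symmetric] .
qed

lemma frame_trace_inv:
  fixes G A H :: "real^'m::finite^'m"
  assumes A: "transpose A ** G ** A = mat 1"
  shows "trace (matrix_inv G ** H) = (\<Sum>k\<in>UNIV. ip H (col A k) (col A k))"
  unfolding frame_trace_linear[OF A] using frame_props(6)[OF A]
  by (simp add: ip_def matrix_vector_mul_assoc matrix_mul_assoc)

text \<open>By Cramer's rule the entries are rational functions of the entries of \<open>G\<close>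
  and \<open>b\<close>; continuity and differentiability of the inverse follow.\<close>

lemma matrix_inv_mult_cramer:
  fixes G :: "real^'m::finite^'m"
  assumes "invertible G"
  shows "matrix_inv G *v b = (\<chi> k. det (\<chi> i j. if j = k then b $ i else G $ i $ j) / det G)"
proof -
  have "det G \<noteq> 0" using assms invertible_det_nz by blast
  moreover have "G *v (matrix_inv G *v b) = b"
    using assms by (simp add: matrix_vector_mul_assoc matrix_inv_works)
  ultimately show ?thesis using cramer by blast
qed

section \<open>Regularity of determinants, inverse matrices and inner products\<close>

lemma continuous_on_det:
  fixes G :: "'z::topological_space \<Rightarrow> real^'m::finite^'m"
  assumes "continuous_on S G"
  shows "continuous_on S (\<lambda>z. det (G z))"
  unfolding det_def by (intro continuous_intros assms)

lemma continuous_on_inv_mult: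
  fixes G :: "'z::topological_space \<Rightarrow> real^'m::finite^'m"
  assumes G: "continuous_on S G" "\<And>z. z \<in> S \<Longrightarrow> posdef (G z)" and b: "continuous_on S b"
  shows "continuous_on S (\<lambda>z. matrix_inv (G z) *v b z)"
proof -
  have d: "det (G z) \<noteq> 0" if "z \<in> S" for z using posdef_det_pos[OF G(2)[OF that]] by simp
  then have inv: "invertible (G z)" if "z \<in> S" for z using that invertible_det_nz by blast
  have "continuous_on S (\<lambda>z. \<chi> k. det (\<chi> i j. if j = k then b z $ i else G z $ i $ j) / det (G z))"
  proof (intro continuous_on_vec_lambda continuous_on_divide continuous_on_det G(1) ballI d)
    show "continuous_on S (\<lambda>z. if j = k then b z $ i else G z $ i $ j)" for i j k
      by (cases "j = k") (auto intro!: continuous_intros G b)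
  qed
  then show ?thesis
    by (subst continuous_on_cong[OF refl matrix_inv_mult_cramer[OF inv]])
qed

lemma matrix_inv_component: "matrix_inv (G::real^'m::finite^'m) $ i $ j = (matrix_inv G *v axis j 1) $ i"
  by (simp add: matrix_vector_mult_basis column_def)

lemma continuous_on_ip:
  assumes "continuous_on S G" "continuous_on S u" "continuous_on S v"
  shows "continuous_on S (\<lambda>z. ip (G z) (u z) (v z))"
  unfolding ip_sum by (intro continuous_intros assms)

text \<open>Only the existence of a derivative is stated; its value is read off in
  \<open>Z_derivative\<close> from the linear equation that the vector solves.\<close>

lemma has_derivative_inv_mult:
  fixes G :: "real^'p \<Rightarrow> real^'m::finite^'m"
  assumes S: "open S" "x \<in> S" and G: "(G has_derivative G') (at x)" "\<And>z. z \<in> S \<Longrightarrow> posdef (G z)"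
    and b: "(b has_derivative b') (at x)"
  shows "(\<lambda>z. matrix_inv (G z) *v b z) differentiable (at x)"
proof -
  have d: "det (G z) \<noteq> 0" if "z \<in> S" for z using posdef_det_pos[OF G(2)[OF that]] by simp
  then have inv: "invertible (G z)" if "z \<in> S" for z using that invertible_det_nz by blast
  have dG: "(\<lambda>z. G z $ i $ j) differentiable at x" for i j
    using bounded_linear.has_derivative[OF bounded_linear_compose[OF bounded_linear_vec_nth bounded_linear_vec_nth] G(1)]
    unfolding differentiable_def by blast
  have db: "(\<lambda>z. b z $ i) differentiable at x" for i
    using bounded_linear.has_derivative[OF bounded_linear_vec_nth b]
    unfolding differentiable_def by blast
  have ddet: "(\<lambda>z. det (M z)) differentiable at x" if "\<And>i j. (\<lambda>z. M z $ i $ j) differentiable at x" for M :: "real^'p \<Rightarrow> real^'m^'m"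
  proof -
    have "(\<lambda>z. of_int (sign p) * (\<Prod>i\<in>UNIV. M z $ i $ p i)) differentiable at x" for p
    proof -
      have "\<forall>i. \<exists>D. ((\<lambda>z. M z $ i $ p i) has_derivative D) (at x)" using that unfolding differentiable_def by blast
      then obtain D where "\<And>i. ((\<lambda>z. M z $ i $ p i) has_derivative D i) (at x)" by metis
      then show ?thesis unfolding differentiable_def
        by (intro exI) (rule has_derivative_mult_right[OF has_derivative_prod], blast)
    qed
    then show ?thesis unfolding det_def by (intro differentiable_sum) (auto simp: finite_permutations)
  qed
  have c: "(\<lambda>z. det (\<chi> i j. if j = k then b z $ i else G z $ i $ j) / det (G z)) differentiable at x" for k
  proof (rule differentiable_divide)
    show "(\<lambda>z. det (\<chi> i j. if j = k then b z $ i else G z $ i $ j)) differentiable at x"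
    proof (rule ddet)
      show "(\<lambda>z. (\<chi> i j. if j = k then b z $ i else G z $ i $ j) $ i $ j) differentiable at x" for i j
        by (cases "j = k") (simp_all add: db dG)
    qed
  qed (use ddet[OF dG] d[OF S(2)] in auto)
  have "\<forall>k. \<exists>D. ((\<lambda>z. det (\<chi> i j. if j = k then b z $ i else G z $ i $ j) / det (G z)) has_derivative D) (at x)"
    using c unfolding differentiable_def by blast
  from choice[OF this] obtain D where D: "\<And>k. ((\<lambda>z. det (\<chi> i j. if j = k then b z $ i else G z $ i $ j) / det (G z)) has_derivative D k) (at x)"
    by blast
  have "((\<lambda>z. \<chi> k. det (\<chi> i j. if j = k then b z $ i else G z $ i $ j) / det (G z)) has_derivative (\<lambda>h. \<chi> k. D k h)) (at x)"
    by (subst has_derivative_componentwise_within) (auto simp: Basis_vec_def inner_axis D)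
  then have "((\<lambda>z. matrix_inv (G z) *v b z) has_derivative (\<lambda>h. \<chi> k. D k h)) (at x)"
    by (subst has_derivative_cong_open[OF S matrix_inv_mult_cramer[OF inv]])
  then show ?thesis unfolding differentiable_def by blast
qed

section \<open>Lengths of curves\<close>

lemma vd_chain:
  assumes "(b has_vector_derivative v) (at t)" "f differentiable at (b t)"
  shows "((\<lambda>s. f (b s)) has_vector_derivative fd f (b t) v) (at t)"
proof -
  have "((\<lambda>s. f (b s)) has_derivative (\<lambda>h. fd f (b t) (h *\<^sub>R v))) (at t)"
    using has_derivative_compose[OF assms(1)[unfolded has_vector_derivative_def] fd_works[OF assms(2)]] .
  then show ?thesis
    unfolding has_vector_derivative_def by (simp add: linear_scale[OF linear_fd[OF assms(2)]])
qed

lemma vd_cong_open: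
  assumes "open A" "t \<in> A" "\<And>s. s \<in> A \<Longrightarrow> f s = g s"
  shows "(f has_vector_derivative v) (at t) \<longleftrightarrow> (g has_vector_derivative v) (at t)"
  unfolding has_vector_derivative_def by (rule has_derivative_cong_open[OF assms])

lemma isCont_open_nhd:
  assumes "isCont f t" "open U" "f t \<in> U"
  obtains A where "open A" "t \<in> A" "\<And>s. s \<in> A \<Longrightarrow> f s \<in> U"
  using assms continuous_at_open[of t f] by blast

locale rmfd =
  fixes M :: "('a::{t2_space,second_countable_topology}, 'm::finite) riem"
  assumes rm: "riemannian_manifold M"
begin

abbreviation img :: "('a, 'm) chart \<Rightarrow> (real^'m) set" where
  "img c \<equiv> cmap c ` cdom c"

lemma sa: "smooth_atlas (atlas M)" and conn: "connected (UNIV :: 'a set)"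
  using rm by (auto simp: riemannian_manifold_def)

lemma chart_ex: "\<exists>c\<in>atlas M. q \<in> cdom c"
  using sa unfolding smooth_atlas_def by blast

lemma chart_at: "chart_at M q \<in> atlas M" "q \<in> cdom (chart_at M q)"
  using someI_ex[of "\<lambda>c. c \<in> atlas M \<and> q \<in> cdom c"] chart_ex[of q] unfolding chart_at_def by blast+

lemma open_cdom: "c \<in> atlas M \<Longrightarrow> open (cdom c)"
  and open_img: "c \<in> atlas M \<Longrightarrow> open (img c)"
  and homeo: "c \<in> atlas M \<Longrightarrow> homeomorphism (cdom c) (img c) (cmap c) (cinv c)"
  using sa unfolding smooth_atlas_def by blast+

lemma cont_cmap: "c \<in> atlas M \<Longrightarrow> continuous_on (cdom c) (cmap c)"
  and cont_cinv: "c \<in> atlas M \<Longrightarrow> continuous_on (img c) (cinv c)"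
  and cinv_cmap: "c \<in> atlas M \<Longrightarrow> q \<in> cdom c \<Longrightarrow> cinv c (cmap c q) = q"
  and cmap_cinv: "x \<in> img c \<Longrightarrow> cmap c (cinv c x) = x"
  and cinv_in: "x \<in> img c \<Longrightarrow> cinv c x \<in> cdom c"
  using homeo unfolding homeomorphism_def by (blast, blast, blast, auto intro: f_inv_into_f inv_into_into)

lemma inj_cmap: "c \<in> atlas M \<Longrightarrow> inj_on (cmap c) (cdom c)"
  using cinv_cmap by (metis inj_on_inverseI)

lemma open_cmap_image: "c \<in> atlas M \<Longrightarrow> open U \<Longrightarrow> open (cmap c ` (cdom c \<inter> U))"
  using homeomorphism_imp_open_map[OF homeo, of c "cdom c \<inter> U"] open_img open_cdom
  by (metis (no_types, lifting) inf_le1 open_Int openin_open_eq)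

lemma open_cinv_image: "c \<in> atlas M \<Longrightarrow> open V \<Longrightarrow> V \<subseteq> img c \<Longrightarrow> open (cinv c ` V)"
  using homeomorphism_imp_open_map[OF homeomorphism_symD[OF homeo], of c V] open_img open_cdom
  by (metis open_subset openin_open_trans)

lemma smooth_trans:
  "c \<in> atlas M \<Longrightarrow> d \<in> atlas M \<Longrightarrow> smooth_on (cmap c ` (cdom c \<inter> cdom d)) (cmap d \<circ> cinv c)"
  using sa unfolding smooth_atlas_def by blast

lemma smooth_g: "c \<in> atlas M \<Longrightarrow> smooth_on (img c) (gmat M c)"
  using rm unfolding riemannian_manifold_def by blast

lemma posdef_g: "c \<in> atlas M \<Longrightarrow> x \<in> img c \<Longrightarrow> posdef (gmat M c x)"
  using rm unfolding riemannian_manifold_def posdef_def by blast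

lemma cont_g: "c \<in> atlas M \<Longrightarrow> continuous_on (img c) (gmat M c)"
  by (rule smooth_on_continuous[OF smooth_g])

lemma trans_differentiable:
  assumes "c \<in> atlas M" "d \<in> atlas M" "q \<in> cdom c" "q \<in> cdom d"
  shows "(cmap d \<circ> cinv c) differentiable at (cmap c q)"
  by (rule smooth_on_differentiable[OF smooth_trans[OF assms(1,2)] open_cmap_image[OF assms(1) open_cdom[OF assms(2)]]])
    (use assms in auto)

lemma jacobian_mult: "f differentiable at x \<Longrightarrow> jacobian f x *v v = fd f x v"
  unfolding jacobian_def by (simp add: linear_fd matrix_works)

lemma metric_trans:
  assumes "c \<in> atlas M" "d \<in> atlas M" "q \<in> cdom c" "q \<in> cdom d"
  shows "ip (gmat M c (cmap c q)) v w =
     ip (gmat M d (cmap d q)) (fd (cmap d \<circ> cinv c) (cmap c q) v) (fd (cmap d \<circ> cinv c) (cmap c q) w)"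
proof -
  let ?J = "jacobian (cmap d \<circ> cinv c) (cmap c q)"
  have "gmat M c (cmap c q) = transpose ?J ** gmat M d (cmap d q) ** ?J"
    using rm assms unfolding riemannian_manifold_def Let_def by blast
  then show ?thesis
    by (simp add: ip_congruence jacobian_mult[OF trans_differentiable[OF assms]])
qed

text \<open>\<open>speed\<close> uses an arbitrary chart; by \<open>metric_trans\<close> the
  derivative of a transition map is isometric, so any chart may be used. Continuity at
  \<open>t\<close> keeps the curve in both charts near \<open>t\<close>.\<close>

lemma speed_eq:
  assumes c: "c \<in> atlas M" "\<gamma> t \<in> cdom c" and cont: "isCont \<gamma> t"
    and v: "((cmap c \<circ> \<gamma>) has_vector_derivative v) (at t)"
  shows "speed M \<gamma> t = sqrt (ip (gmat M c (cmap c (\<gamma> t))) v v)"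
proof -
  define d where "d = chart_at M (\<gamma> t)"
  have d: "d \<in> atlas M" "\<gamma> t \<in> cdom d" using chart_at unfolding d_def by auto
  let ?t = "cmap d \<circ> cinv c"
  have "open (cdom c \<inter> cdom d)" by (intro open_Int open_cdom c d)
  then obtain A where A: "open A" "t \<in> A" "\<And>s. s \<in> A \<Longrightarrow> \<gamma> s \<in> cdom c \<inter> cdom d"
    by (rule isCont_open_nhd[OF cont, of "cdom c \<inter> cdom d"]) (use c d in auto)
  have "((\<lambda>s. ?t ((cmap c \<circ> \<gamma>) s)) has_vector_derivative fd ?t ((cmap c \<circ> \<gamma>) t) v) (at t)"
    by (rule vd_chain[OF v]) (subst o_apply, rule trans_differentiable[OF c(1) d(1) c(2) d(2)])
  then have "((cmap d \<circ> \<gamma>) has_vector_derivative fd ?t (cmap c (\<gamma> t)) v) (at t)"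
    by (subst vd_cong_open[OF A(1,2), of "cmap d \<circ> \<gamma>" "\<lambda>s. ?t ((cmap c \<circ> \<gamma>) s)"])
      (use A(3) c cinv_cmap in auto)
  then have "vector_derivative (cmap d \<circ> \<gamma>) (at t) = fd ?t (cmap c (\<gamma> t)) v"
    by (rule vector_derivative_at)
  then show ?thesis
    unfolding speed_def Let_def d_def[symmetric] using metric_trans[OF c(1) d(1) c(2) d(2)] by simp
qed

text \<open>\<open>pw_C1_curve\<close> on an arbitrary interval, as curves have to be cut and
  joined.\<close>

definition pwc :: "(real \<Rightarrow> 'a) \<Rightarrow> real \<Rightarrow> real \<Rightarrow> bool" where
  "pwc \<gamma> a b \<longleftrightarrow> continuous_on {a..b} \<gamma> \<and>
     (\<forall>c\<in>atlas M. \<forall>u v. a \<le> u \<and> u \<le> v \<and> v \<le> b \<and> \<gamma> ` {u..v} \<subseteq> cdom c \<longrightarrow>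
        (cmap c \<circ> \<gamma>) piecewise_C1_differentiable_on {u..v})"

text \<open>The interval is open because \<open>speed\<close> uses the two-sided derivative, which
  at the endpoints depends on the curve outside \<open>{a..b}\<close>. Hence \<open>len_cong\<close>
  asks for agreement in the interior only.\<close>

definition len :: "(real \<Rightarrow> 'a) \<Rightarrow> real \<Rightarrow> real \<Rightarrow> ennreal" where
  "len \<gamma> a b = (\<integral>\<^sup>+ t. ennreal (indicator {a<..<b} t * speed M \<gamma> t) \<partial>lborel)"

lemma pw_C1_curve_pwc: "pw_C1_curve M \<gamma> \<longleftrightarrow> pwc \<gamma> 0 1"
  unfolding pw_C1_curve_def pwc_def by blast

lemma AE_finite_lborel:
  "finite S \<Longrightarrow> (\<And>t::real. t \<notin> S \<Longrightarrow> P t) \<Longrightarrow> AE t in lborel. P t"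
  by (rule AE_I'[of S]) (auto simp: finite_imp_null_set_lborel)

lemma curve_length_len: "curve_length M \<gamma> = len \<gamma> 0 1"
  unfolding curve_length_def len_def
  by (rule nn_integral_cong_AE, rule AE_finite_lborel[of "{0,1}"]) (auto split: split_indicator)

lemma pwc_sub: "pwc \<gamma> a b \<Longrightarrow> a \<le> a' \<Longrightarrow> b' \<le> b \<Longrightarrow> pwc \<gamma> a' b'"
  unfolding pwc_def by (meson atLeastatMost_subset_iff continuous_on_subset order_trans)

lemma pwc_isCont: "pwc \<gamma> a b \<Longrightarrow> a < t \<Longrightarrow> t < b \<Longrightarrow> isCont \<gamma> t"
  unfolding pwc_def by (metis atLeastAtMost_iff continuous_on_interior greaterThanLessThan_iff interior_atLeastAtMost_real)

lemma local_chart: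
  fixes a b t :: real
  assumes "continuous_on {a..b} \<gamma>" "t \<in> {a..b}"
  obtains c d where "c \<in> atlas M" "0 < d" "\<And>s. s \<in> {a..b} \<Longrightarrow> \<bar>s - t\<bar> < d \<Longrightarrow> \<gamma> s \<in> cdom c"
proof -
  obtain c where c: "c \<in> atlas M" "\<gamma> t \<in> cdom c" using chart_ex by blast
  obtain A where A: "open A" "A \<inter> {a..b} = \<gamma> -` cdom c \<inter> {a..b}"
    using iffD1[OF continuous_on_open_invariant assms(1), rule_format, OF open_cdom[OF c(1)]] by (auto intro: that)
  have "t \<in> A \<inter> {a..b}" unfolding A(2) using c assms by simp
  then have "t \<in> A" by simp
  then obtain d where "d > 0" "ball t d \<subseteq> A" using A openE by blast
  have "\<gamma> s \<in> cdom c" if "s \<in> {a..b}" "\<bar>s - t\<bar> < d" for s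
  proof -
    have "s \<in> A \<inter> {a..b}" using that \<open>ball t d \<subseteq> A\<close> by (auto simp: dist_real_def abs_minus_commute)
    then show ?thesis unfolding A(2) by auto
  qed
  then show ?thesis using c \<open>d > 0\<close> by (intro that[of c d])
qed

text \<open>Bisection by \<open>Bolzano\<close>: the claim survives joining two intervals, and it
  holds on intervals so short that one chart contains the curve, where the speed is continuous off a
  finite set.\<close>

lemma pwc_regular:
  assumes g: "pwc \<gamma> a b" and ab: "a \<le> b"
  shows "\<exists>S. finite S \<and> (\<forall>t\<in>{a<..<b} - S. \<exists>c\<in>atlas M. \<gamma> t \<in> cdom c \<and> (cmap c \<circ> \<gamma>) differentiable (at t)) \<and>
     (\<lambda>t. indicator {a<..<b} t * speed M \<gamma> t) \<in> borel_measurable borel"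
proof -
  define Q where "Q u v = (\<exists>S. finite S \<and> (\<forall>t\<in>{u<..<v} - S. \<exists>c\<in>atlas M. \<gamma> t \<in> cdom c \<and> (cmap c \<circ> \<gamma>) differentiable (at t)) \<and>
     (\<lambda>t. indicator {u<..<v} t * speed M \<gamma> t) \<in> borel_measurable borel)" for u v
  have "a \<le> a \<and> b \<le> b \<longrightarrow> Q a b"
  proof (rule Bolzano[OF ab, where P="\<lambda>u v. a \<le> u \<and> v \<le> b \<longrightarrow> Q u v"])
    fix u w v assume h: "a \<le> u \<and> w \<le> b \<longrightarrow> Q u w" "a \<le> w \<and> v \<le> b \<longrightarrow> Q w v" "u \<le> w" "w \<le> v"
    show "a \<le> u \<and> v \<le> b \<longrightarrow> Q u v"
    proof
      assume "a \<le> u \<and> v \<le> b"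
      then have q: "Q u w" "Q w v" using h by auto
      obtain S where S: "finite S" "\<forall>t\<in>{u<..<w} - S. \<exists>c\<in>atlas M. \<gamma> t \<in> cdom c \<and> (cmap c \<circ> \<gamma>) differentiable (at t)"
        "(\<lambda>t. indicator {u<..<w} t * speed M \<gamma> t) \<in> borel_measurable borel" using q(1) unfolding Q_def by blast
      obtain S' where S': "finite S'" "\<forall>t\<in>{w<..<v} - S'. \<exists>c\<in>atlas M. \<gamma> t \<in> cdom c \<and> (cmap c \<circ> \<gamma>) differentiable (at t)"
        "(\<lambda>t. indicator {w<..<v} t * speed M \<gamma> t) \<in> borel_measurable borel" using q(2) unfolding Q_def by blast
      show "Q u v" unfolding Q_def
      proof (intro exI[of _ "insert w (S \<union> S')"] conjI ballI)
        show "finite (insert w (S \<union> S'))" using S S' by simp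
        show "\<exists>c\<in>atlas M. \<gamma> t \<in> cdom c \<and> (cmap c \<circ> \<gamma>) differentiable (at t)" if "t \<in> {u<..<v} - insert w (S \<union> S')" for t
          using that S(2) S'(2) by (cases "t < w") auto
        \<comment> \<open>Neither open interval contains \<open>w\<close>, hence the extra term at
          \<open>w\<close>.\<close>
        have "(\<lambda>t. indicator {u<..<w} t * speed M \<gamma> t + indicator {w<..<v} t * speed M \<gamma> t
            + (if t = w then indicator {u<..<v} w * speed M \<gamma> w else 0)) \<in> borel_measurable borel"
          by (intro borel_measurable_add S S') simp
        also have "(\<lambda>t. indicator {u<..<w} t * speed M \<gamma> t + indicator {w<..<v} t * speed M \<gamma> t
            + (if t = w then indicator {u<..<v} w * speed M \<gamma> w else 0)) = (\<lambda>t. indicator {u<..<v} t * speed M \<gamma> t)"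
          using h(3,4) by (auto simp: fun_eq_iff indicator_def)
        finally show "(\<lambda>t. indicator {u<..<v} t * speed M \<gamma> t) \<in> borel_measurable borel" .
      qed
    qed
  next
    fix t assume t: "a \<le> t" "t \<le> b"
    obtain c d where cd: "c \<in> atlas M" "0 < d" "\<And>s. s \<in> {a..b} \<Longrightarrow> \<bar>s - t\<bar> < d \<Longrightarrow> \<gamma> s \<in> cdom c"
      by (rule local_chart[of a b \<gamma> t]) (use g t in \<open>auto simp: pwc_def\<close>)
    have "Q u v" if uv: "u \<le> t \<and> t \<le> v \<and> v - u < d" "a \<le> u \<and> v \<le> b" for u v
    proof -
      have dom: "\<gamma> s \<in> cdom c" if "s \<in> {u..v}" for s using cd(3)[of s] uv that by auto
      then have "\<gamma> ` {u..v} \<subseteq> cdom c" by blast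
      then have "(cmap c \<circ> \<gamma>) piecewise_C1_differentiable_on {u..v}"
        using g cd(1) uv unfolding pwc_def by auto
      then obtain S where S: "finite S" "(cmap c \<circ> \<gamma>) C1_differentiable_on {u..v} - S"
        unfolding piecewise_C1_differentiable_on_def by blast
      then obtain D where D: "\<And>s. s \<in> {u..v} - S \<Longrightarrow> ((cmap c \<circ> \<gamma>) has_vector_derivative D s) (at s)"
          "continuous_on ({u..v} - S) D" unfolding C1_differentiable_on_def by blast
      let ?U = "{u<..<v} - S"
      have sp: "speed M \<gamma> s = sqrt (ip (gmat M c (cmap c (\<gamma> s))) (D s) (D s))" if "s \<in> ?U" for s
        by (rule speed_eq[OF cd(1)]) (use that dom D pwc_isCont[OF g, of s] uv in auto)
      have cg: "continuous_on ?U (\<lambda>s. cmap c (\<gamma> s))"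
        by (rule continuous_on_compose2[OF cont_cmap[OF cd(1)]])
          (use g dom uv in \<open>auto simp: pwc_def elim!: continuous_on_subset\<close>)
      have "continuous_on ?U (\<lambda>s. sqrt (ip (gmat M c (cmap c (\<gamma> s))) (D s) (D s)))"
        by (intro continuous_intros continuous_on_ip continuous_on_compose2[OF cont_g[OF cd(1)] cg])
          (use D dom in \<open>auto elim!: continuous_on_subset\<close>)
      then have "continuous_on ?U (speed M \<gamma>)" using sp by (subst continuous_on_cong[OF refl]) auto
      then have m: "(\<lambda>t. indicator ?U t *\<^sub>R speed M \<gamma> t) \<in> borel_measurable borel"
        using S(1) by (intro borel_measurable_continuous_on_indicator) (auto intro!: borel_open open_Diff finite_imp_closed)
      have "(\<lambda>t. indicator {u<..<v} t * speed M \<gamma> t) =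
          (\<lambda>t. indicator ?U t *\<^sub>R speed M \<gamma> t + (\<Sum>s\<in>S. if t = s then indicator {u<..<v} s * speed M \<gamma> s else 0))"
        using S(1) by (auto split: split_indicator)
      moreover have "\<dots> \<in> borel_measurable borel" by (intro borel_measurable_add m borel_measurable_sum) simp
      ultimately have "(\<lambda>t. indicator {u<..<v} t * speed M \<gamma> t) \<in> borel_measurable borel" by simp
      moreover have "(cmap c \<circ> \<gamma>) differentiable at s" if "s \<in> {u<..<v} - S" for s
        by (rule differentiableI_vector[OF D(1)]) (use that in auto)
      ultimately show ?thesis unfolding Q_def
        using S(1) dom cd(1) by (intro exI[of _ S] conjI ballI bexI[of _ c]) auto
    qed
    then show "\<exists>d>0. \<forall>u v. u \<le> t \<and> t \<le> v \<and> v - u < d \<longrightarrow> a \<le> u \<and> v \<le> b \<longrightarrow> Q u v"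
      using cd(2) by (intro exI[of _ d] conjI allI impI) simp_all
  qed
  then show ?thesis unfolding Q_def by simp
qed

text \<open>Derivatives here are two-sided, so at \<open>u\<close> and \<open>v\<close> they depend
  on values outside \<open>{u..v}\<close>. Adding both endpoints to the exceptional set repairs
  this.\<close>

lemma pw_C1_cong:
  assumes "f piecewise_C1_differentiable_on {u..v}" "\<And>t. t \<in> {u..v} \<Longrightarrow> f t = g t"
  shows "g piecewise_C1_differentiable_on {u..v::real}"
proof -
  obtain S where S: "finite S" "f C1_differentiable_on {u..v} - S" and c: "continuous_on {u..v} f"
    using assms(1) unfolding piecewise_C1_differentiable_on_def by blast
  then obtain D where D: "\<And>s. s \<in> {u..v} - S \<Longrightarrow> (f has_vector_derivative D s) (at s)"
      "continuous_on ({u..v} - S) D" unfolding C1_differentiable_on_def by blast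
  have "(g has_vector_derivative D s) (at s)" if "s \<in> {u..v} - (S \<union> {u,v})" for s
    using D(1)[of s] vd_cong_open[of "{u<..<v}" s f g] that assms(2) by auto
  then have "g C1_differentiable_on {u..v} - (S \<union> {u,v})" unfolding C1_differentiable_on_def
    by (intro exI[of _ D]) (auto intro: continuous_on_subset[OF D(2)])
  moreover have "continuous_on {u..v} g" using c assms(2) by (metis continuous_on_cong)
  ultimately show ?thesis unfolding piecewise_C1_differentiable_on_def using S(1)
    by (metis finite.emptyI finite_UnI finite_insert)
qed

lemma pw_C1_join:
  assumes "f piecewise_C1_differentiable_on {a..b}" "f piecewise_C1_differentiable_on {b..c}" "a \<le> b" "b \<le> (c::real)"
  shows "f piecewise_C1_differentiable_on {a..c}"
  using piecewise_C1_differentiable_cases[OF assms refl] by simp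

lemma pwc_cong:
  assumes "pwc \<gamma> a b" "\<And>t. t \<in> {a..b} \<Longrightarrow> \<gamma> t = \<delta> t"
  shows "pwc \<delta> a b"
  unfolding pwc_def
proof (intro conjI ballI allI impI)
  show "continuous_on {a..b} \<delta>" using assms unfolding pwc_def by (metis continuous_on_cong)
  fix c u v assume h: "c \<in> atlas M" "a \<le> u \<and> u \<le> v \<and> v \<le> b \<and> \<delta> ` {u..v} \<subseteq> cdom c"
  then have "\<gamma> ` {u..v} \<subseteq> cdom c" using assms(2) by fastforce
  then have "(cmap c \<circ> \<gamma>) piecewise_C1_differentiable_on {u..v}" using assms(1) h unfolding pwc_def by blast
  then show "(cmap c \<circ> \<delta>) piecewise_C1_differentiable_on {u..v}"
    by (rule pw_C1_cong) (use assms(2) h in auto)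
qed

lemma pwc_join:
  assumes "pwc \<gamma> a b" "pwc \<gamma> b c" "a \<le> b" "b \<le> c"
  shows "pwc \<gamma> a c"
  unfolding pwc_def
proof (intro conjI ballI allI impI)
  have "{a..c} = {a..b} \<union> {b..c}" using assms by auto
  then show "continuous_on {a..c} \<gamma>"
    using assms(1,2) unfolding pwc_def by (simp add: continuous_on_closed_Un)
  fix d u v assume h: "d \<in> atlas M" "a \<le> u \<and> u \<le> v \<and> v \<le> c \<and> \<gamma> ` {u..v} \<subseteq> cdom d"
  have 1: "(cmap d \<circ> \<gamma>) piecewise_C1_differentiable_on {u..min v b}" if "u \<le> b"
  proof -
    have "\<gamma> ` {u..min v b} \<subseteq> cdom d" using h by (auto simp: image_subset_iff)
    then show ?thesis using assms(1) h that unfolding pwc_def by auto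
  qed
  have 2: "(cmap d \<circ> \<gamma>) piecewise_C1_differentiable_on {max u b..v}" if "b \<le> v"
  proof -
    have "\<gamma> ` {max u b..v} \<subseteq> cdom d" using h by (auto simp: image_subset_iff)
    then show ?thesis using assms(2) h that unfolding pwc_def by auto
  qed
  consider "v \<le> b" | "b \<le> u" | "u \<le> b" "b \<le> v" by linarith
  then show "(cmap d \<circ> \<gamma>) piecewise_C1_differentiable_on {u..v}"
  proof cases
    case 1
    then show ?thesis using \<open>u \<le> b \<Longrightarrow> _\<close> h by (simp add: min_def)
  next
    case 2
    then show ?thesis using \<open>b \<le> v \<Longrightarrow> _\<close> h by (simp add: max_def split: if_splits)
  next
    case 3
    then show ?thesis using 1 2 by (intro pw_C1_join[of _ u b v]) (auto simp: min_def max_def split: if_splits)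
  qed
qed

lemma pwc_affine:
  assumes "pwc \<gamma> l r" "(\<lambda>t. \<alpha> * t + \<beta>) ` {a..b} \<subseteq> {l..r}"
  shows "pwc (\<lambda>t. \<gamma> (\<alpha> * t + \<beta>)) a b"
  unfolding pwc_def
proof (intro conjI ballI allI impI)
  show "continuous_on {a..b} (\<lambda>t. \<gamma> (\<alpha> * t + \<beta>))"
    by (rule continuous_on_compose2[of "{l..r}" \<gamma>]) (use assms in \<open>auto simp: pwc_def intro!: continuous_intros\<close>)
  fix c u v assume h: "c \<in> atlas M" "a \<le> u \<and> u \<le> v \<and> v \<le> b \<and> (\<lambda>t. \<gamma> (\<alpha> * t + \<beta>)) ` {u..v} \<subseteq> cdom c"
  have "\<exists>u' v'. (\<lambda>t. \<alpha> * t + \<beta>) ` {u..v} = {u'..v'} \<and> u' \<le> v'"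
    using h by (cases "\<alpha> \<ge> 0") (auto simp: image_affinity_atLeastAtMost mult_left_mono mult_left_mono_neg)
  then obtain u' v' where uv: "(\<lambda>t. \<alpha> * t + \<beta>) ` {u..v} = {u'..v'}" "u' \<le> v'" by blast
  have "{u'..v'} \<subseteq> {l..r}" using h unfolding uv(1)[symmetric]
    by (intro order_trans[OF image_mono assms(2)]) auto
  moreover have "\<gamma> ` {u'..v'} \<subseteq> cdom c" using h unfolding uv(1)[symmetric] by auto
  ultimately have "(cmap c \<circ> \<gamma>) piecewise_C1_differentiable_on {u'..v'}"
    using assms(1) h(1) uv(2) unfolding pwc_def by auto
  then have "((cmap c \<circ> \<gamma>) \<circ> (\<lambda>t. \<alpha> *\<^sub>R t + \<beta>)) piecewise_C1_differentiable_on {u..v}"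
    by (intro piecewise_C1_differentiable_affine) (simp add: uv(1))
  then show "(cmap c \<circ> (\<lambda>t. \<gamma> (\<alpha> * t + \<beta>))) piecewise_C1_differentiable_on {u..v}"
    by (simp add: o_def)
qed

lemma speed_cong:
  assumes "open A" "t \<in> A" "\<And>s. s \<in> A \<Longrightarrow> \<gamma> s = \<delta> s"
  shows "speed M \<gamma> t = speed M \<delta> t"
proof -
  have "\<gamma> t = \<delta> t" using assms by blast
  moreover have "vector_derivative (cmap c \<circ> \<gamma>) (at t) = vector_derivative (cmap c \<circ> \<delta>) (at t)" for c :: "('a, 'm) chart"
    unfolding vector_derivative_def using vd_cong_open[OF assms(1,2), of "cmap c \<circ> \<gamma>" "cmap c \<circ> \<delta>"] assms(3) by simp
  ultimately show ?thesis unfolding speed_def by simp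
qed

lemma len_cong:
  assumes "\<And>t. a < t \<Longrightarrow> t < b \<Longrightarrow> \<gamma> t = \<delta> t"
  shows "len \<gamma> a b = len \<delta> a b"
proof -
  have "speed M \<gamma> t = speed M \<delta> t" if "t \<in> {a<..<b}" for t
    using assms by (intro speed_cong[OF _ that]) auto
  then show ?thesis unfolding len_def by (intro nn_integral_cong) (auto split: split_indicator)
qed

lemma pwc_measurable:
  assumes "pwc \<gamma> a b" "a \<le> b"
  shows "(\<lambda>t. indicator {a<..<b} t * speed M \<gamma> t) \<in> borel_measurable borel"
  using pwc_regular[OF assms] by blast

lemma speed_nonneg: "speed M \<gamma> t \<ge> 0"
proof -
  have "cmap c q \<in> img c" if "q \<in> cdom c" for c :: "('a,'m) chart" and q using that by blast
  then show ?thesis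
    unfolding speed_def Let_def using chart_at by (intro real_sqrt_ge_zero posdef_nonneg posdef_g) auto
qed

lemma len_join:
  assumes "pwc \<gamma> a c" "a \<le> b" "b \<le> c"
  shows "len \<gamma> a c = len \<gamma> a b + len \<gamma> b c"
proof -
  have m: "(\<lambda>t. indicator {a<..<b} t * speed M \<gamma> t) \<in> borel_measurable borel"
     "(\<lambda>t. indicator {b<..<c} t * speed M \<gamma> t) \<in> borel_measurable borel"
    using assms by (auto intro!: pwc_measurable pwc_sub[OF assms(1)])
  have "len \<gamma> a c = (\<integral>\<^sup>+ t. ennreal (indicator {a<..<b} t * speed M \<gamma> t) + ennreal (indicator {b<..<c} t * speed M \<gamma> t) \<partial>lborel)"
    unfolding len_def
    by (rule nn_integral_cong_AE, rule AE_finite_lborel[of "{b}"]) (use assms in \<open>auto split: split_indicator\<close>)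
  also have "\<dots> = len \<gamma> a b + len \<gamma> b c"
    unfolding len_def using m by (intro nn_integral_add) auto
  finally show ?thesis .
qed

text \<open>The factor may be negative: \<open>ed_sym_le\<close> reverses curves with \<alpha> = -1.
  The speed scales by \<open>\<bar>\<alpha>\<bar>\<close> off finitely many points, and substitution
  in the integral removes this factor.\<close>

lemma len_affine:
  assumes g: "pwc \<gamma> l r" "l \<le> r" and al: "\<alpha> \<noteq> 0" and im: "\<And>t. t \<in> {a<..<b} \<longleftrightarrow> \<alpha> * t + \<beta> \<in> {l<..<r}"
  shows "len (\<lambda>t. \<gamma> (\<alpha> * t + \<beta>)) a b = len \<gamma> l r"
proof -
  obtain S where S: "finite S" "\<forall>t\<in>{l<..<r} - S. \<exists>c\<in>atlas M. \<gamma> t \<in> cdom c \<and> (cmap c \<circ> \<gamma>) differentiable (at t)"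
    using pwc_regular[OF g] by blast
  let ?s = "\<lambda>t. \<alpha> * t + \<beta>"
  have sp: "speed M (\<lambda>t. \<gamma> (?s t)) t = \<bar>\<alpha>\<bar> * speed M \<gamma> (?s t)" if t: "t \<in> {a<..<b}" "?s t \<notin> S" for t
  proof -
    have st: "?s t \<in> {l<..<r}" using im[of t] t by blast
    then obtain c where c: "c \<in> atlas M" "\<gamma> (?s t) \<in> cdom c" "(cmap c \<circ> \<gamma>) differentiable (at (?s t))"
      using S t by blast
    then obtain v where v: "((cmap c \<circ> \<gamma>) has_vector_derivative v) (at (?s t))"
      using vector_derivative_works by blast
    have ic: "isCont \<gamma> (?s t)" using st by (intro pwc_isCont[OF g(1)]) auto
    have "(?s has_real_derivative \<alpha>) (at t)" by (auto intro!: derivative_eq_intros)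
    then have "((cmap c \<circ> \<gamma>) \<circ> ?s has_vector_derivative \<alpha> *\<^sub>R v) (at t)"
      using v by (intro vector_diff_chain_at) (auto simp: has_real_derivative_iff_has_vector_derivative)
    then have "speed M (\<lambda>t. \<gamma> (?s t)) t = sqrt (ip (gmat M c (cmap c (\<gamma> (?s t)))) (\<alpha> *\<^sub>R v) (\<alpha> *\<^sub>R v))"
      using c(1,2) ic by (intro speed_eq) (auto simp: o_def intro!: continuous_intros isCont_o2[where g=\<gamma>])
    also have "\<dots> = \<bar>\<alpha>\<bar> * speed M \<gamma> (?s t)"
      by (subst speed_eq[OF c(1,2) ic v])
        (simp add: ip_simps real_sqrt_mult flip: power2_eq_square mult.assoc)
    finally show ?thesis .
  qed
  have S': "finite (?s -` S)" using S al by (intro finite_vimageI) (auto simp: inj_on_def)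
  have "len (\<lambda>t. \<gamma> (?s t)) a b = (\<integral>\<^sup>+ t. \<bar>\<alpha>\<bar> * ennreal (indicator {l<..<r} (?s t) * speed M \<gamma> (?s t)) \<partial>lborel)"
    unfolding len_def
  proof (rule nn_integral_cong_AE, rule AE_finite_lborel[OF S'])
    fix t assume "t \<notin> ?s -` S"
    then have "indicator {a<..<b} t * speed M (\<lambda>t. \<gamma> (?s t)) t = \<bar>\<alpha>\<bar> * (indicator {l<..<r} (?s t) * speed M \<gamma> (?s t))"
      using sp[of t] im[of t] by (cases "t \<in> {a<..<b}") (auto simp: indicator_def)
    then show "ennreal (indicator {a<..<b} t * speed M (\<lambda>t. \<gamma> (?s t)) t)
        = ennreal \<bar>\<alpha>\<bar> * ennreal (indicator {l<..<r} (?s t) * speed M \<gamma> (?s t))"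
      by (simp add: ennreal_mult speed_nonneg)
  qed
  also have "\<dots> = \<bar>\<alpha>\<bar> * (\<integral>\<^sup>+ t. ennreal (indicator {l<..<r} (\<beta> + \<alpha> * t) * speed M \<gamma> (\<beta> + \<alpha> * t)) \<partial>lborel)"
  proof (subst nn_integral_cmult[symmetric])
    have "(\<lambda>t. indicator {l<..<r} (\<beta> + \<alpha> * t) * speed M \<gamma> (\<beta> + \<alpha> * t)) \<in> borel_measurable borel"
      by (rule measurable_compose[OF _ pwc_measurable[OF g]]) simp
    then show "(\<lambda>t. ennreal (indicator {l<..<r} (\<beta> + \<alpha> * t) * speed M \<gamma> (\<beta> + \<alpha> * t))) \<in> borel_measurable lborel" by simp
  qed (simp add: add.commute)
  also have "\<dots> = (\<integral>\<^sup>+ t. ennreal (indicator {l<..<r} t * speed M \<gamma> t) \<partial>lborel)"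
    by (rule nn_integral_real_affine[symmetric]) (use pwc_measurable[OF g] al in auto)
  finally show ?thesis unfolding len_def .
qed

end

section \<open>The Riemannian distance\<close>

lemma pw_C1_compose:
  fixes f :: "real^'m \<Rightarrow> real^'n"
  assumes b: "b piecewise_C1_differentiable_on {u..v::real}" "b ` {u..v} \<subseteq> S" and f: "open S" "smooth_on S f"
  shows "(\<lambda>t. f (b t)) piecewise_C1_differentiable_on {u..v}"
proof -
  obtain X where X: "finite X" "b C1_differentiable_on {u..v} - X" and c: "continuous_on {u..v} b"
    using b(1) unfolding piecewise_C1_differentiable_on_def by blast
  then obtain D where D: "\<And>s. s \<in> {u..v} - X \<Longrightarrow> (b has_vector_derivative D s) (at s)"
      "continuous_on ({u..v} - X) D" unfolding C1_differentiable_on_def by blast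
  have "((\<lambda>t. f (b t)) has_vector_derivative fd f (b s) (D s)) (at s)" if "s \<in> {u..v} - X" for s
    by (rule vd_chain[OF D(1)[OF that]], rule smooth_on_differentiable[OF f(2,1)]) (use b that in auto)
  moreover have "continuous_on ({u..v} - X) (\<lambda>s. fd f (b s) (D s))"
  proof (rule smooth_fd_continuous[OF f(2,1), where p=b and v=D])
    show "continuous_on ({u..v} - X) b" using c by (rule continuous_on_subset) simp
    show "b ` ({u..v} - X) \<subseteq> S" using b(2) by (rule order_trans[OF image_mono, rotated]) simp
  qed (rule D(2))
  ultimately have "(\<lambda>t. f (b t)) C1_differentiable_on {u..v} - X"
    unfolding C1_differentiable_on_def by (intro exI[of _ "\<lambda>s. fd f (b s) (D s)"] conjI ballI)
  moreover have "continuous_on {u..v} (\<lambda>t. f (b t))"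
    by (rule continuous_on_compose2[OF smooth_on_continuous[OF f(2)] c b(2)])
  ultimately show ?thesis unfolding piecewise_C1_differentiable_on_def using X(1) by blast
qed

lemma closed_reaches_left_limit:
  fixes \<gamma> :: "real \<Rightarrow> 'a::t2_space"
  assumes "closed C" "continuous_on {a..b} \<gamma>" "a < b" "\<And>t. a \<le> t \<Longrightarrow> t < b \<Longrightarrow> \<gamma> t \<in> C"
  shows "\<gamma> b \<in> C"
proof -
  have "closed (\<gamma> -` C \<inter> {a..b})"
    by (rule continuous_on_closed_vimage[THEN iffD1, rule_format, OF _ assms(2,1)]) simp
  moreover have "{a..<b} \<subseteq> \<gamma> -` C \<inter> {a..b}" using assms(4) by auto
  ultimately have "closure {a..<b} \<subseteq> \<gamma> -` C \<inter> {a..b}" by (rule closure_minimal[rotated])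
  moreover have "b \<in> closure {a..<b}" using assms(3) by simp
  ultimately show ?thesis by blast
qed

context rmfd
begin

text \<open>One chart around each parameter suffices: a transition map carries the regularity to any
  other chart, and \<open>Bolzano\<close> joins the short intervals.\<close>

lemma pwcI:
  assumes cont: "continuous_on {a..b} \<gamma>"
    and loc: "\<And>t. t \<in> {a..b} \<Longrightarrow> \<exists>c\<in>atlas M. \<exists>d>0. \<forall>u v. a \<le> u \<and> u \<le> t \<and> t \<le> v \<and> v \<le> b \<and> v - u < d \<longrightarrow>
        \<gamma> ` {u..v} \<subseteq> cdom c \<and> (cmap c \<circ> \<gamma>) piecewise_C1_differentiable_on {u..v}"
  shows "pwc \<gamma> a b"
  unfolding pwc_def
proof (intro conjI ballI allI impI)
  fix e u0 v0 assume e: "e \<in> atlas M" and h: "a \<le> u0 \<and> u0 \<le> v0 \<and> v0 \<le> b \<and> \<gamma> ` {u0..v0} \<subseteq> cdom e"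
  have "u0 \<le> u0 \<and> v0 \<le> v0 \<longrightarrow> (cmap e \<circ> \<gamma>) piecewise_C1_differentiable_on {u0..v0}"
  proof (rule Bolzano[where P="\<lambda>u v. u0 \<le> u \<and> v \<le> v0 \<longrightarrow> (cmap e \<circ> \<gamma>) piecewise_C1_differentiable_on {u..v}"])
    show "u0 \<le> v0" using h by simp
    show "u0 \<le> u \<and> v \<le> v0 \<longrightarrow> (cmap e \<circ> \<gamma>) piecewise_C1_differentiable_on {u..v}"
      if "u0 \<le> u \<and> w \<le> v0 \<longrightarrow> (cmap e \<circ> \<gamma>) piecewise_C1_differentiable_on {u..w}"
        "u0 \<le> w \<and> v \<le> v0 \<longrightarrow> (cmap e \<circ> \<gamma>) piecewise_C1_differentiable_on {w..v}" "u \<le> w" "w \<le> v" for u w v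
      using that pw_C1_join[of "cmap e \<circ> \<gamma>" u w v] by auto
    fix t assume t: "u0 \<le> t" "t \<le> v0"
    obtain c d where cd: "c \<in> atlas M" "d > 0" "\<And>u v. a \<le> u \<and> u \<le> t \<and> t \<le> v \<and> v \<le> b \<and> v - u < d \<Longrightarrow>
        \<gamma> ` {u..v} \<subseteq> cdom c \<and> (cmap c \<circ> \<gamma>) piecewise_C1_differentiable_on {u..v}"
      using loc[of t] t h by auto
    have "(cmap e \<circ> \<gamma>) piecewise_C1_differentiable_on {u..v}"
      if uv: "u \<le> t \<and> t \<le> v \<and> v - u < d" "u0 \<le> u \<and> v \<le> v0" for u v
    proof -
      have 1: "\<gamma> ` {u..v} \<subseteq> cdom c" "(cmap c \<circ> \<gamma>) piecewise_C1_differentiable_on {u..v}"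
        using cd(3)[of u v] uv h by auto
      have 2: "\<gamma> ` {u..v} \<subseteq> cdom e" using h uv by (auto simp: image_subset_iff)
      have "(\<lambda>t. (cmap e \<circ> cinv c) ((cmap c \<circ> \<gamma>) t)) piecewise_C1_differentiable_on {u..v}"
        by (rule pw_C1_compose[OF 1(2) _ open_cmap_image[OF cd(1) open_cdom[OF e]] smooth_trans[OF cd(1) e]])
          (use 1 2 in auto)
      then show ?thesis
        by (rule pw_C1_cong) (use 1(1) cinv_cmap[OF cd(1)] in \<open>auto simp: image_subset_iff\<close>)
    qed
    then show "\<exists>d>0. \<forall>u v. u \<le> t \<and> t \<le> v \<and> v - u < d \<longrightarrow> u0 \<le> u \<and> v \<le> v0 \<longrightarrow> (cmap e \<circ> \<gamma>) piecewise_C1_differentiable_on {u..v}"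
      using cd(2) by (intro exI[of _ d] conjI allI impI) simp_all
  qed
  then show "(cmap e \<circ> \<gamma>) piecewise_C1_differentiable_on {u0..v0}" by simp
qed (rule cont)

text \<open>\<open>rdist\<close> before \<open>enn2real\<close>. With values in
  \<open>ennreal\<close> the triangle inequality precedes finiteness, which is derived from it in
  \<open>ed_finite\<close>.\<close>

definition ed :: "'a \<Rightarrow> 'a \<Rightarrow> ennreal" where
  "ed p q = (INF \<gamma>\<in>{\<gamma>. pw_C1_curve M \<gamma> \<and> \<gamma> 0 = p \<and> \<gamma> 1 = q}. curve_length M \<gamma>)"

lemma rdist_ed: "rdist M p q = enn2real (ed p q)"
  unfolding rdist_def ed_def ..

lemma ed_le:
  assumes "pwc \<gamma> a b" "a < b"
  shows "ed (\<gamma> a) (\<gamma> b) \<le> len \<gamma> a b"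
proof -
  let ?d = "\<lambda>t. \<gamma> ((b - a) * t + a)"
  have im: "(\<lambda>t. (b - a) * t + a) ` {0..1} \<subseteq> {a..b}"
    using assms(2) by (auto simp: image_affinity_atLeastAtMost)
  have "pwc ?d 0 1" by (rule pwc_affine[OF assms(1) im])
  moreover have "t \<in> {0<..<1} \<longleftrightarrow> (b - a) * t + a \<in> {a<..<b}" for t
  proof -
    have "((b - a) * t + a < b) = ((b - a) * t < (b - a) * 1)" by auto
    then have "((b - a) * t + a < b) = (t < 1)"
      using assms(2) by (simp only: mult_less_cancel_left_pos diff_gt_0_iff_gt)
    then show ?thesis using assms(2) by (auto simp: zero_less_mult_iff)
  qed
  then have "len ?d 0 1 = len \<gamma> a b"
    by (intro len_affine[OF assms(1)]) (use assms(2) in auto)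
  ultimately show ?thesis unfolding ed_def
    by (intro INF_lower2[of ?d]) (simp_all add: pw_C1_curve_pwc curve_length_len)
qed

lemma ed_less:
  assumes "ed p q < r"
  obtains \<gamma> where "pwc \<gamma> 0 1" "\<gamma> 0 = p" "\<gamma> 1 = q" "len \<gamma> 0 1 < r"
  using assms unfolding ed_def INF_less_iff by (auto simp: pw_C1_curve_pwc curve_length_len)

lemma pwc_chart_curve:
  assumes c: "c \<in> atlas M" and x: "\<And>t. t \<in> {0..1} \<Longrightarrow> x + t *\<^sub>R w \<in> img c"
  shows "pwc (\<lambda>t. cinv c (x + t *\<^sub>R w)) 0 1"
    and "\<And>t. t \<in> {0<..<1} \<Longrightarrow> speed M (\<lambda>t. cinv c (x + t *\<^sub>R w)) t = sqrt (ip (gmat M c (x + t *\<^sub>R w)) w w)"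
proof -
  let ?g = "\<lambda>t. cinv c (x + t *\<^sub>R w)"
  show p: "pwc ?g 0 1"
  proof (rule pwcI)
    show "continuous_on {0..1} ?g"
      by (rule continuous_on_compose2[OF cont_cinv[OF c]]) (use x in \<open>auto intro!: continuous_intros\<close>)
    fix t :: real assume t: "t \<in> {0..1}"
    have "?g ` {u..v} \<subseteq> cdom c \<and> (cmap c \<circ> ?g) piecewise_C1_differentiable_on {u..v}" if "0 \<le> u" "v \<le> 1" for u v
    proof
      show "?g ` {u..v} \<subseteq> cdom c" using x that cinv_in by auto
      have "(\<lambda>t. x + t *\<^sub>R w) piecewise_C1_differentiable_on {u..v}"
        by (intro C1_differentiable_imp_piecewise) (auto simp: C1_differentiable_on_def intro!: exI[of _ "\<lambda>_. w"]
            derivative_eq_intros)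
      then show "(cmap c \<circ> ?g) piecewise_C1_differentiable_on {u..v}"
        by (rule pw_C1_cong) (use x that cmap_cinv in auto)
    qed
    then show "\<exists>c\<in>atlas M. \<exists>d>0. \<forall>u v. 0 \<le> u \<and> u \<le> t \<and> t \<le> v \<and> v \<le> 1 \<and> v - u < d \<longrightarrow>
        ?g ` {u..v} \<subseteq> cdom c \<and> (cmap c \<circ> ?g) piecewise_C1_differentiable_on {u..v}"
      using c by (intro bexI[of _ c] exI[of _ 1]) auto
  qed
  fix t :: real assume t: "t \<in> {0<..<1}"
  have xt: "x + t *\<^sub>R w \<in> img c" using x t by auto
  have "((\<lambda>t. x + t *\<^sub>R w) has_vector_derivative w) (at t)" by (auto intro!: derivative_eq_intros)
  then have "((cmap c \<circ> ?g) has_vector_derivative w) (at t)"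
    by (subst vd_cong_open[of "{0<..<1}" t _ "\<lambda>t. x + t *\<^sub>R w"]) (use t x cmap_cinv in auto)
  then have "speed M ?g t = sqrt (ip (gmat M c (cmap c (?g t))) w w)"
    by (intro speed_eq c) (use xt cinv_in pwc_isCont[OF p] t in auto)
  then show "speed M ?g t = sqrt (ip (gmat M c (x + t *\<^sub>R w)) w w)" using cmap_cinv[OF xt] by simp
qed

lemma ed_segment:
  assumes c: "c \<in> atlas M" and s: "closed_segment x y \<subseteq> img c" and B: "B \<ge> 0"
    "\<And>z. z \<in> closed_segment x y \<Longrightarrow> ip (gmat M c z) (y - x) (y - x) \<le> B\<^sup>2"
  shows "ed (cinv c x) (cinv c y) \<le> ennreal B"
proof -
  let ?g = "\<lambda>t. cinv c (x + t *\<^sub>R (y - x))"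
  have seg: "x + t *\<^sub>R (y - x) \<in> closed_segment x y" if "t \<in> {0..1}" for t
    using that unfolding closed_segment_def by (auto simp: algebra_simps intro!: exI[of _ t])
  have "ed (?g 0) (?g 1) \<le> len ?g 0 1"
    by (rule ed_le[OF pwc_chart_curve(1)[OF c]]) (use seg s in auto)
  also have "\<dots> \<le> (\<integral>\<^sup>+ (t::real). ennreal B * indicator {0<..<1} t \<partial>lborel)"
    unfolding len_def
  proof (rule nn_integral_mono)
    fix t :: real
    show "ennreal (indicator {0<..<1} t * speed M ?g t) \<le> ennreal B * indicator {0<..<1} t"
    proof (cases "t \<in> {0<..<1}")
      case True
      then have "x + t *\<^sub>R (y - x) \<in> closed_segment x y" using seg by auto
      then have "speed M ?g t \<le> B"
        using pwc_chart_curve(2)[OF c, of x "y - x" t] seg s True B real_le_lsqrt[OF B(1) B(2)]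
        by (metis (no_types, lifting) real_sqrt_abs real_sqrt_le_iff abs_of_nonneg subsetD)
      then show ?thesis using True by (simp add: ennreal_leI)
    qed simp
  qed
  also have "\<dots> = ennreal B" by (simp add: nn_integral_cmult)
  finally show ?thesis by simp
qed

lemma ed_refl: "ed p p = 0"
proof -
  obtain c where c: "c \<in> atlas M" "p \<in> cdom c" using chart_ex by blast
  have "ed (cinv c (cmap c p)) (cinv c (cmap c p)) \<le> ennreal 0"
    by (rule ed_segment) (use c in \<open>auto simp: ip_simps\<close>)
  then show ?thesis using cinv_cmap[OF c] by simp
qed

lemma ed_sym_le: "ed q p \<le> ed p q"
  unfolding ed_def[of p q]
proof (rule INF_greatest)
  fix \<gamma> assume "\<gamma> \<in> {\<gamma>. pw_C1_curve M \<gamma> \<and> \<gamma> 0 = p \<and> \<gamma> 1 = q}"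
  then have g: "pwc \<gamma> 0 1" "\<gamma> 0 = p" "\<gamma> 1 = q" by (auto simp: pw_C1_curve_pwc)
  let ?d = "\<lambda>t. \<gamma> ((-1) * t + 1)"
  have "pwc ?d 0 1" by (rule pwc_affine[OF g(1)]) (auto)
  then have "ed (?d 0) (?d 1) \<le> len ?d 0 1" by (rule ed_le) simp
  also have "len ?d 0 1 = len \<gamma> 0 1" by (rule len_affine[OF g(1)]) auto
  finally show "ed q p \<le> curve_length M \<gamma>" using g by (simp add: curve_length_len)
qed

lemma ed_sym: "ed p q = ed q p"
  using ed_sym_le by (simp add: antisym)

lemma ed_triangle: "ed p r \<le> ed p q + ed q r"
proof (rule ennreal_le_epsilon)
  fix e :: real assume fin: "ed p q + ed q r < top" and e: "0 < e"
  have "ed p q < ed p q + ennreal (e/2)" "ed q r < ed q r + ennreal (e/2)"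
    using fin e by (auto simp: less_top[symmetric] ennreal_add_less_top)
  then obtain g h where g: "pwc g 0 1" "g 0 = p" "g 1 = q" "len g 0 1 < ed p q + ennreal (e/2)"
    and h: "pwc h 0 1" "h 0 = q" "h 1 = r" "len h 0 1 < ed q r + ennreal (e/2)"
    by (metis ed_less)
  \<comment> \<open>The shift is written \<open>1 * t + (-1)\<close> to have the form of
    \<open>pwc_affine\<close> and \<open>len_affine\<close>.\<close>
  define k where "k t = (if t \<le> 1 then g t else h (1 * t + (-1)))" for t :: real
  have k1: "pwc k 0 1" by (rule pwc_cong[OF g(1)]) (simp add: k_def)
  have "pwc (\<lambda>t. h (1 * t + (-1))) 1 2" by (rule pwc_affine[OF h(1)]) auto
  then have k2: "pwc k 1 2" by (rule pwc_cong) (use g h in \<open>auto simp: k_def\<close>)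
  have k: "pwc k 0 2" by (rule pwc_join[OF k1 k2]) auto
  have "ed (k 0) (k 2) \<le> len k 0 2" by (rule ed_le[OF k]) simp
  also have "\<dots> = len k 0 1 + len k 1 2" by (rule len_join[OF k]) auto
  also have "len k 0 1 = len g 0 1" by (rule len_cong) (simp add: k_def)
  also have "len k 1 2 = len (\<lambda>t. h (1 * t + (-1))) 1 2" by (rule len_cong) (simp add: k_def)
  also have "\<dots> = len h 0 1" by (rule len_affine[OF h(1)]) auto
  also have "len g 0 1 + len h 0 1 \<le> (ed p q + ennreal (e/2)) + (ed q r + ennreal (e/2))"
    using g h by (intro add_mono) auto
  also have "\<dots> = ed p q + ed q r + (ennreal (e/2) + ennreal (e/2))" by (simp add: algebra_simps)
  also have "ennreal (e/2) + ennreal (e/2) = ennreal e" using e by (simp flip: ennreal_plus)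
  finally show "ed p r \<le> ed p q + ed q r + ennreal e" using g h by (simp add: k_def)
qed

text \<open>By compactness of \<open>K\<close> times the unit sphere, and homogeneity in
  \<open>v\<close>. In \<open>chart_lower_bound\<close> the positive minimum takes the place of the
  maximum.\<close>

lemma chart_segment_bound:
  assumes c: "c \<in> atlas M" and K: "compact K" "K \<subseteq> img c"
  obtains B where "B > 0" "\<And>z v. z \<in> K \<Longrightarrow> sqrt (ip (gmat M c z) v v) \<le> B * norm v"
proof -
  have "compact (K \<times> sphere (0::real^'m) 1)" using K by (intro compact_Times) auto
  moreover have "continuous_on (K \<times> sphere 0 1) (\<lambda>(z,v). sqrt (ip (gmat M c z) v v))"
    unfolding case_prod_beta
    by (intro continuous_intros continuous_on_ip continuous_on_compose2[OF cont_g[OF c]]) (use K in auto)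
  ultimately have "bounded ((\<lambda>(z,v). sqrt (ip (gmat M c z) v v)) ` (K \<times> sphere 0 1))"
    by (intro compact_imp_bounded compact_continuous_image)
  then obtain B where B: "B > 0" "\<And>z v. z \<in> K \<Longrightarrow> v \<in> sphere 0 1 \<Longrightarrow> \<bar>sqrt (ip (gmat M c z) v v)\<bar> \<le> B"
    unfolding bounded_pos by auto
  have "sqrt (ip (gmat M c z) v v) \<le> B * norm v" if z: "z \<in> K" for z v
  proof (cases "v = 0")
    case False
    have "sqrt (ip (gmat M c z) v v) = norm v * sqrt (ip (gmat M c z) ((1 / norm v) *\<^sub>R v) ((1 / norm v) *\<^sub>R v))"
      using False by (simp add: ip_simps real_sqrt_mult real_sqrt_divide)
    also have "\<dots> \<le> norm v * B"
      using B(2)[OF z, of "(1 / norm v) *\<^sub>R v"] False by (intro mult_left_mono) auto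
    finally show ?thesis by (simp add: mult.commute)
  qed (simp add: ip_simps)
  then show ?thesis using B(1) that by blast
qed

lemma chart_lower_bound:
  assumes c: "c \<in> atlas M" and K: "compact K" "K \<subseteq> img c"
  obtains l where "l > 0" "\<And>z v. z \<in> K \<Longrightarrow> l * norm v \<le> sqrt (ip (gmat M c z) v v)"
proof (cases "K = {}")
  case True
  then show ?thesis using that[of 1] by auto
next
  case False
  define f where "f = (\<lambda>zv. sqrt (ip (gmat M c (fst zv)) (snd zv) (snd zv)))"
  have "axis undefined 1 \<in> sphere (0::real^'m) 1" by simp
  then have ne: "K \<times> sphere (0::real^'m) 1 \<noteq> {}" using False by blast
  have "compact (K \<times> sphere (0::real^'m) 1)" using K by (intro compact_Times) auto
  moreover have "continuous_on (K \<times> sphere 0 1) f" unfolding f_def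
    by (intro continuous_intros continuous_on_ip continuous_on_compose2[OF cont_g[OF c]]) (use K in auto)
  ultimately obtain m where m: "m \<in> K \<times> sphere 0 1" "\<And>w. w \<in> K \<times> sphere 0 1 \<Longrightarrow> f m \<le> f w"
    using continuous_attains_inf[OF _ ne] by blast
  have pos: "f m > 0" unfolding f_def
    by (intro real_sqrt_gt_zero posdef_pos[OF posdef_g[OF c]]) (use m K in auto)
  have "f m * norm v \<le> sqrt (ip (gmat M c z) v v)" if z: "z \<in> K" for z v
  proof (cases "v = 0")
    case F: False
    have "sqrt (ip (gmat M c z) v v) = f (z, (1 / norm v) *\<^sub>R v) * norm v"
      using F by (simp add: f_def ip_simps real_sqrt_mult real_sqrt_divide)
    moreover have "f m * norm v \<le> \<dots>" using F z by (intro mult_right_mono m(2)) auto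
    ultimately show ?thesis by simp
  qed (simp add: ip_simps)
  then show ?thesis using pos that by blast
qed

lemma nhd_ed_finite:
  obtains U where "open U" "q \<in> U" "\<And>q'. q' \<in> U \<Longrightarrow> ed q q' < top"
proof -
  obtain c where c: "c \<in> atlas M" "q \<in> cdom c" using chart_ex by blast
  let ?x = "cmap c q"
  have "?x \<in> img c" using c by blast
  then obtain r where r: "r > 0" "cball ?x r \<subseteq> img c" using open_img[OF c(1)] open_contains_cball by blast
  obtain B where B: "B > 0" "\<And>z v. z \<in> cball ?x r \<Longrightarrow> sqrt (ip (gmat M c z) v v) \<le> B * norm v"
    by (rule chart_segment_bound[OF c(1) compact_cball r(2)]) blast
  have "ed q (cinv c y) < top" if y: "y \<in> ball ?x r" for y
  proof -
    have s: "closed_segment ?x y \<subseteq> cball ?x r" using y r by (intro closed_segment_subset) auto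
    have "ed (cinv c ?x) (cinv c y) \<le> ennreal (B * norm (y - ?x))"
    proof (rule ed_segment[OF c(1)])
      show "closed_segment ?x y \<subseteq> img c" using s r by blast
      show "ip (gmat M c z) (y - ?x) (y - ?x) \<le> (B * norm (y - ?x))\<^sup>2" if "z \<in> closed_segment ?x y" for z
        using B(2)[of z "y - ?x"] that s B(1) by (intro sqrt_le_D) auto
    qed (use B in auto)
    then show ?thesis using cinv_cmap[OF c] by (metis ennreal_less_top order_le_less_trans)
  qed
  moreover have "open (cinv c ` ball ?x r)" using r c by (intro open_cinv_image) auto
  moreover have "q \<in> cinv c ` ball ?x r" using cinv_cmap[OF c] r by (metis centre_in_ball image_eqI)
  ultimately show ?thesis using that[of "cinv c ` ball ?x r"] by blast
qed

text \<open>The points at finite distance from \<open>p\<close> form an open set with open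
  complement, and the manifold is connected.\<close>

lemma ed_finite: "ed p q < top"
proof -
  let ?A = "{q. ed p q < top}"
  have 1: "open ?A"
  proof (subst open_subopen, intro ballI)
    fix x assume "x \<in> ?A"
    obtain U where "open U" "x \<in> U" "\<And>q'. q' \<in> U \<Longrightarrow> ed x q' < top" by (rule nhd_ed_finite[of x]) blast
    then have "y \<in> ?A" if "y \<in> U" for y
      using that \<open>x \<in> ?A\<close> by (auto simp: ennreal_add_less_top intro!: order_le_less_trans[OF ed_triangle[of p y x]])
    then show "\<exists>T. open T \<and> x \<in> T \<and> T \<subseteq> ?A" using \<open>open U\<close> \<open>x \<in> U\<close> by blast
  qed
  have 2: "open (- ?A)"
  proof (subst open_subopen, intro ballI)
    fix x assume "x \<in> - ?A"
    obtain U where U: "open U" "x \<in> U" "\<And>q'. q' \<in> U \<Longrightarrow> ed x q' < top" by (rule nhd_ed_finite[of x]) blast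
    have "y \<in> - ?A" if "y \<in> U" for y
    proof
      assume "y \<in> ?A"
      then have "ed p y + ed y x < top" using U(3)[OF that] ed_sym[of x y] by (simp add: ennreal_add_less_top)
      then have "ed p x < top" using ed_triangle[of p x y] by (rule order_le_less_trans[rotated])
      then show False using \<open>x \<in> - ?A\<close> by simp
    qed
    then show "\<exists>T. open T \<and> x \<in> T \<and> T \<subseteq> - ?A" using U by blast
  qed
  have "?A \<inter> UNIV = {} \<or> - ?A \<inter> UNIV = {}" by (rule connectedD[OF conn 1 2]) blast+
  moreover have "p \<in> ?A" by (simp add: ed_refl)
  ultimately have "q \<in> ?A" by blast
  then show ?thesis by simp
qed

abbreviation dist_M :: "'a \<Rightarrow> 'a \<Rightarrow> real" where "dist_M \<equiv> rdist M"

lemma ennreal_rdist: "ennreal (dist_M p q) = ed p q"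
  unfolding rdist_ed using ed_finite by simp

lemma rdist_nonneg: "dist_M p q \<ge> 0"
  unfolding rdist_ed by simp

lemma rdist_le_iff: "B \<ge> 0 \<Longrightarrow> dist_M p q \<le> B \<longleftrightarrow> ed p q \<le> ennreal B"
  by (simp flip: ennreal_rdist)

lemma rdist_less_iff: "dist_M p q < B \<longleftrightarrow> ed p q < ennreal B"
  by (simp flip: ennreal_rdist add: ennreal_less_iff rdist_nonneg)

lemma rdist_refl: "dist_M p p = 0"
  by (simp add: rdist_ed ed_refl)

lemma rdist_sym: "dist_M p q = dist_M q p"
  by (simp add: rdist_ed ed_sym)

lemma rdist_triangle: "dist_M p r \<le> dist_M p q + dist_M q r"
  using ed_triangle[of p r q] by (simp flip: ennreal_rdist ennreal_plus add: rdist_nonneg)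

text \<open>Integrate \<open>ip H w \<beta>'\<close> along \<open>\<beta> = cmap c \<circ> \<gamma>\<close> and use Cauchy--Schwarz.\<close>

lemma coord_length:
  assumes c: "c \<in> atlas M" and g: "pwc \<gamma> a b" "a \<le> b" "\<gamma> ` {a..b} \<subseteq> cdom c" and H: "posdef H" and k: "\<kappa> > 0"
    "\<And>t v. t \<in> {a..b} \<Longrightarrow> sqrt (ip H v v) \<le> \<kappa> * sqrt (ip (gmat M c (cmap c (\<gamma> t))) v v)"
  defines "w \<equiv> cmap c (\<gamma> b) - cmap c (\<gamma> a)"
  shows "ennreal (sqrt (ip H w w)) \<le> ennreal \<kappa> * len \<gamma> a b"
proof (cases "len \<gamma> a b = top")
  case True
  then show ?thesis using k(1) by (simp add: ennreal_mult_top)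
next
  case False
  let ?f = "\<lambda>t. indicator {a<..<b} t * speed M \<gamma> t"
  have fi: "integrable lborel ?f"
    using pwc_measurable[OF g(1,2)] False unfolding len_def
    by (intro integrableI_nonneg) (auto simp: speed_nonneg less_top)
  have L: "len \<gamma> a b = ennreal (integral\<^sup>L lborel ?f)"
    unfolding len_def by (rule nn_integral_eq_integral[OF fi]) (simp add: speed_nonneg)
  let ?L = "integral\<^sup>L lborel ?f"
  have "(?f has_integral ?L) UNIV" by (rule has_integral_integral_lborel[OF fi])
  moreover have "(\<lambda>t. if t \<in> {a..b} then ?f t else 0) = ?f" by (auto split: split_indicator)
  ultimately have I1: "(?f has_integral ?L) {a..b}"
    using has_integral_restrict_UNIV[of "{a..b}" ?f ?L] by simp
  have "(cmap c \<circ> \<gamma>) piecewise_C1_differentiable_on {a..b}" using g c unfolding pwc_def by blast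
  then obtain S where S: "finite S" "(cmap c \<circ> \<gamma>) C1_differentiable_on {a..b} - S" and cont: "continuous_on {a..b} (cmap c \<circ> \<gamma>)"
    unfolding piecewise_C1_differentiable_on_def by blast
  then obtain D where D: "\<And>s. s \<in> {a..b} - S \<Longrightarrow> ((cmap c \<circ> \<gamma>) has_vector_derivative D s) (at s)"
    unfolding C1_differentiable_on_def by blast
  define D' where "D' t = (if t \<in> {a<..<b} - S then D t else 0)" for t
  have "(D' has_integral ((cmap c \<circ> \<gamma>) b - (cmap c \<circ> \<gamma>) a)) {a..b}"
    by (rule fundamental_theorem_of_calculus_interior_strong[OF S(1) g(2), where f="cmap c \<circ> \<gamma>"]) (use D cont in \<open>auto simp: D'_def\<close>)
  then have "(D' has_integral w) {a..b}" by (simp add: w_def)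
  then have "((ip H w \<circ> D') has_integral (ip H w w)) {a..b}"
    by (rule has_integral_linear) (simp add: linear_ip_right flip: linear_conv_bounded_linear)
  moreover have "((\<lambda>t. sqrt (ip H w w) * \<kappa> * ?f t) has_integral sqrt (ip H w w) * \<kappa> * ?L) {a..b}"
    by (rule has_integral_mult_right[OF I1])
  ultimately have le: "ip H w w \<le> sqrt (ip H w w) * \<kappa> * ?L"
  proof (rule has_integral_le)
    fix t assume t: "t \<in> {a..b}"
    show "(ip H w \<circ> D') t \<le> sqrt (ip H w w) * \<kappa> * ?f t"
    proof (cases "t \<in> {a<..<b} - S")
      case True
      have "speed M \<gamma> t = sqrt (ip (gmat M c (cmap c (\<gamma> t))) (D t) (D t))"
        by (rule speed_eq[OF c]) (use True g D pwc_isCont[OF g(1)] in auto)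
      then have "sqrt (ip H (D t) (D t)) \<le> \<kappa> * speed M \<gamma> t" using k(2)[OF t] by simp
      moreover have "ip H w (D t) \<le> sqrt (ip H w w) * sqrt (ip H (D t) (D t))"
        using ip_Cauchy_Schwarz[OF H, of w "D t"] by linarith
      moreover have "sqrt (ip H w w) * sqrt (ip H (D t) (D t)) \<le> sqrt (ip H w w) * (\<kappa> * speed M \<gamma> t)"
        using calculation(1) by (intro mult_left_mono) (simp_all add: posdef_nonneg[OF H])
      ultimately show ?thesis using True by (simp add: D'_def mult.assoc)
    next
      case False
      then have "D' t = 0" unfolding D'_def by (rule if_not_P)
      then show ?thesis using k(1) by (simp add: ip_simps posdef_nonneg[OF H] speed_nonneg)
    qed
  qed
  have "sqrt (ip H w w) \<le> \<kappa> * ?L"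
  proof (cases "ip H w w = 0")
    case True
    then show ?thesis using k(1) by (simp add: speed_nonneg)
  next
    case False
    then have p: "ip H w w > 0" using posdef_nonneg[OF H, of w] by simp
    then have "sqrt (ip H w w) * sqrt (ip H w w) \<le> sqrt (ip H w w) * (\<kappa> * ?L)" using le by (simp add: mult.assoc)
    then show ?thesis using p by (simp only: mult_le_cancel_left_pos real_sqrt_gt_0_iff)
  qed
  then show ?thesis unfolding L using k(1) by (simp flip: ennreal_mult' add: ennreal_leI)
qed

lemma ip_mat1: "ip (mat 1) v w = v \<bullet> w"
  by (simp add: ip_def)

lemma posdef_mat1: "posdef (mat 1)"
  by (simp add: posdef_def ip_mat1)

text \<open>Up to the first exit time \<open>t0\<close> the lower bound \<mu> for the metric lets
  the coordinates move by at most L / \<mu> < s (\<open>coord_length\<close>), so the curve is still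
  away from the boundary at \<open>t0\<close>.\<close>

lemma curve_stays:
  assumes c: "c \<in> atlas M" and s: "cball x s \<subseteq> img c" "s > 0" and l: "\<mu> > 0"
    "\<And>z v. z \<in> cball x s \<Longrightarrow> \<mu> * norm v \<le> sqrt (ip (gmat M c z) v v)"
    and g: "pwc \<gamma> 0 1" "\<gamma> 0 = cinv c x" "len \<gamma> 0 1 < ennreal (\<mu> * s)" and t: "t \<in> {0..1}"
  shows "\<gamma> t \<in> cinv c ` ball x s"
proof (rule ccontr)
  assume out: "\<gamma> t \<notin> cinv c ` ball x s"
  let ?U = "cinv c ` ball x s"
  have bs: "ball x s \<subseteq> img c" using s by (meson ball_subset_cball order_trans)
  have oU: "open ?U" using bs c by (intro open_cinv_image) auto
  have Uc: "?U \<subseteq> cdom c" using bs cinv_in by auto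
  have cg: "continuous_on {0..1} \<gamma>" using g unfolding pwc_def by blast
  define T where "T = \<gamma> -` (- ?U) \<inter> {0..1}"
  have "closed T" unfolding T_def
    by (rule continuous_on_closed_vimage[THEN iffD1, rule_format, OF _ cg]) (use oU in auto)
  moreover have "t \<in> T" using t out unfolding T_def by auto
  moreover have bb: "bdd_below T" unfolding T_def by (meson Int_lower2 bdd_below_Icc bdd_below_mono)
  ultimately have iT: "Inf T \<in> T" by (intro closed_contains_Inf) auto
  define t0 where "t0 = Inf T"
  have t0: "t0 \<in> {0..1}" "\<gamma> t0 \<notin> ?U" using iT unfolding t0_def T_def by auto
  have before: "\<gamma> r \<in> ?U" if "0 \<le> r" "r < t0" for r
  proof (rule ccontr)
    assume "\<gamma> r \<notin> ?U"
    then have "r \<in> T" using that t0 unfolding T_def by auto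
    then show False using cInf_lower[OF _ bb] that unfolding t0_def by fastforce
  qed
  have "\<gamma> 0 \<in> ?U" using g s by auto
  then have t0p: "0 < t0" using t0 by (metis atLeastAtMost_iff order_le_less)
  have lfin: "len \<gamma> 0 1 < top" using g(3) by (metis ennreal_less_top order_less_trans)
  define L where "L = enn2real (len \<gamma> 0 1)"
  have L: "len \<gamma> 0 1 = ennreal L" "0 \<le> L" unfolding L_def using lfin by auto
  then have Ls: "L < \<mu> * s" using g(3) by (simp add: ennreal_less_iff)
  have xi: "x \<in> img c" using s by auto
  have near: "norm (cmap c (\<gamma> r) - x) \<le> L / \<mu>" if r: "0 \<le> r" "r < t0" for r
  proof -
    have inU: "\<gamma> u \<in> ?U" if "u \<in> {0..r}" for u using before that r by auto
    have pr: "pwc \<gamma> 0 r" by (rule pwc_sub[OF g(1)]) (use r t0 in auto)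
    have img: "\<gamma> ` {0..r} \<subseteq> cdom c" using inU Uc by blast
    have "ennreal (sqrt (ip (mat 1) (cmap c (\<gamma> r) - cmap c (\<gamma> 0)) (cmap c (\<gamma> r) - cmap c (\<gamma> 0)))) \<le> ennreal (1/\<mu>) * len \<gamma> 0 r"
    proof (rule coord_length[OF c pr r(1) img posdef_mat1])
      fix u v assume "u \<in> {0..r}"
      then obtain y where "y \<in> ball x s" "\<gamma> u = cinv c y" using inU[of u] by blast
      then have "cmap c (\<gamma> u) \<in> ball x s" using bs cmap_cinv[of y c] by auto
      then show "sqrt (ip (mat 1) v v) \<le> 1 / \<mu> * sqrt (ip (gmat M c (cmap c (\<gamma> u))) v v)"
        using l by (simp add: ip_mat1 field_simps flip: norm_eq_sqrt_inner)
    qed (use l in simp)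
    also have "len \<gamma> 0 r \<le> len \<gamma> 0 1" using len_join[OF g(1), of r] r t0 by simp
    finally have "ennreal (sqrt (ip (mat 1) (cmap c (\<gamma> r) - cmap c (\<gamma> 0)) (cmap c (\<gamma> r) - cmap c (\<gamma> 0))))
        \<le> ennreal (1/\<mu>) * ennreal L" unfolding L(1) by (simp add: mult_left_mono)
    also have "ennreal (1/\<mu>) * ennreal L = ennreal (1/\<mu> * L)"
      by (rule ennreal_mult[symmetric]) (use l L in auto)
    finally have "ennreal (norm (cmap c (\<gamma> r) - x)) \<le> ennreal (1/\<mu> * L)"
      unfolding g(2) cmap_cinv[OF xi] ip_mat1 norm_eq_sqrt_inner .
    then show ?thesis using l L by simp
  qed
  \<comment> \<open>The image of a closed ball is compact, hence closed, so it contains the limit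
    point \<open>\<gamma> t0\<close> too.\<close>
  define C where "C = cinv c ` cball x (L / \<mu>)"
  have "L / \<mu> < s" using Ls l by (simp add: field_simps)
  then have sub: "cball x (L/\<mu>) \<subseteq> ball x s" by auto
  have "compact C" unfolding C_def
    by (intro compact_continuous_image compact_cball continuous_on_subset[OF cont_cinv[OF c]]) (use sub bs in blast)
  then have clC: "closed C" by (rule compact_imp_closed)
  have ct0: "continuous_on {0..t0} \<gamma>" using cg t0 by (auto elim: continuous_on_subset)
  have inC: "\<gamma> r \<in> C" if "0 \<le> r" "r < t0" for r
  proof -
    have "\<gamma> r = cinv c (cmap c (\<gamma> r))" using before[OF that] Uc cinv_cmap[OF c] by auto
    then show ?thesis using near[OF that] unfolding C_def by (auto simp: dist_norm norm_minus_commute)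
  qed
  have "\<gamma> t0 \<in> C" by (rule closed_reaches_left_limit[OF clC ct0 t0p inC])
  then show False using t0(2) sub unfolding C_def by auto
qed

end

section \<open>The Hopf--Rinow theorem\<close>

context rmfd
begin

text \<open>A curve from \<open>q\<close> of length less than \<open>l * s\<close> stays in the
  coordinate ball of radius \<open>s\<close> (\<open>curve_stays\<close>).\<close>

lemma rdist_nhd_subset:
  assumes "open U" "q \<in> U"
  obtains e where "e > 0" "\<And>q'. dist_M q q' < e \<Longrightarrow> q' \<in> U"
proof -
  obtain c where c: "c \<in> atlas M" "q \<in> cdom c" using chart_ex by blast
  let ?x = "cmap c q"
  have "open (cmap c ` (cdom c \<inter> U))" by (rule open_cmap_image[OF c(1) assms(1)])
  moreover have "?x \<in> cmap c ` (cdom c \<inter> U)" using c assms by blast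
  ultimately obtain s where s: "s > 0" "cball ?x s \<subseteq> cmap c ` (cdom c \<inter> U)"
    using open_contains_cball by blast
  then have si: "cball ?x s \<subseteq> img c" by blast
  obtain l where l: "l > 0" "\<And>z v. z \<in> cball ?x s \<Longrightarrow> l * norm v \<le> sqrt (ip (gmat M c z) v v)"
    by (rule chart_lower_bound[OF c(1) compact_cball si]) blast
  have "q' \<in> U" if "dist_M q q' < l * s" for q'
  proof -
    have "ed q q' < ennreal (l * s)" using that by (simp add: rdist_less_iff)
    then obtain g where g: "pwc g 0 1" "g 0 = q" "g 1 = q'" "len g 0 1 < ennreal (l * s)" by (rule ed_less)
    have "g 1 \<in> cinv c ` ball ?x s"
      by (rule curve_stays[OF c(1) si s(1) l g(1) _ g(4)]) (use g(2) cinv_cmap[OF c] in auto)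
    then obtain y where y: "y \<in> ball ?x s" "q' = cinv c y" using g(3) by blast
    then have "y \<in> cball ?x s" by simp
    then obtain p where "p \<in> cdom c \<inter> U" "y = cmap c p" using s(2) by blast
    then show "q' \<in> U" using y cinv_cmap[OF c(1)] by auto
  qed
  then show ?thesis using that[of "l * s"] s l by simp
qed

lemma nhd_subset_rdist:
  assumes "e > 0"
  obtains U where "open U" "q \<in> U" "\<And>q'. q' \<in> U \<Longrightarrow> dist_M q q' < e"
proof -
  obtain c where c: "c \<in> atlas M" "q \<in> cdom c" using chart_ex by blast
  let ?x = "cmap c q"
  have "?x \<in> img c" using c by blast
  then obtain r where r: "r > 0" "cball ?x r \<subseteq> img c" using open_img[OF c(1)] open_contains_cball by blast
  obtain B where B: "B > 0" "\<And>z v. z \<in> cball ?x r \<Longrightarrow> sqrt (ip (gmat M c z) v v) \<le> B * norm v"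
    by (rule chart_segment_bound[OF c(1) compact_cball r(2)]) blast
  define s where "s = min r (e / (2 * B))"
  have s: "s > 0" "s \<le> r" "B * s < e" using r B assms unfolding s_def by (auto simp: min_def field_simps)
  have "dist_M q (cinv c y) < e" if y: "y \<in> ball ?x s" for y
  proof -
    have sg: "closed_segment ?x y \<subseteq> cball ?x r" using y r s by (intro closed_segment_subset) auto
    have "ed (cinv c ?x) (cinv c y) \<le> ennreal (B * norm (y - ?x))"
    proof (rule ed_segment[OF c(1)])
      show "closed_segment ?x y \<subseteq> img c" using sg r by blast
      show "ip (gmat M c z) (y - ?x) (y - ?x) \<le> (B * norm (y - ?x))\<^sup>2" if "z \<in> closed_segment ?x y" for z
        using B(2)[of z "y - ?x"] that sg B(1) by (intro sqrt_le_D) auto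
    qed (use B in auto)
    then have "dist_M q (cinv c y) \<le> B * norm (y - ?x)"
      using cinv_cmap[OF c] B(1) by (subst rdist_le_iff) auto
    also have "\<dots> \<le> B * s" using y B(1) by (intro mult_left_mono) (auto simp: dist_norm norm_minus_commute)
    finally show ?thesis using s by simp
  qed
  moreover have "ball ?x s \<subseteq> img c" using r s by (meson ball_subset_cball order_trans subset_cball)
  then have "open (cinv c ` ball ?x s)" using c by (intro open_cinv_image) auto
  moreover have "q \<in> cinv c ` ball ?x s" using cinv_cmap[OF c] s by (metis centre_in_ball image_eqI)
  ultimately show ?thesis using that[of "cinv c ` ball ?x s"] by blast
qed

lemma rdist_zero: "dist_M p q = 0 \<longleftrightarrow> p = q"
proof
  assume z: "dist_M p q = 0"
  show "p = q"
  proof (rule ccontr)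
    assume "p \<noteq> q"
    then obtain e where "e > 0" "\<And>q'. dist_M p q' < e \<Longrightarrow> q' \<in> - {q}"
      using rdist_nhd_subset[of "- {q}" p] by (auto simp: open_Compl)
    then show False using z by force
  qed
qed (simp add: rdist_refl)

end

sublocale rmfd \<subseteq> MS: Metric_space UNIV "rdist M"
  by unfold_locales (auto simp: rdist_nonneg rdist_sym rdist_zero rdist_triangle)

context rmfd
begin

text \<open>\<open>Hopf_Rinow\<close> uses this to pass from total boundedness and completeness for
  \<open>rdist\<close> to compactness in the topology of the type.\<close>

lemma mtopology_eq: "MS.mtopology = euclidean"
  unfolding topology_eq
proof
  fix S :: "'a set"
  show "openin MS.mtopology S = openin euclidean S"
  proof
    assume S: "openin MS.mtopology S"
    have H: "\<exists>T. open T \<and> x \<in> T \<and> T \<subseteq> S" if "x \<in> S" for x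
    proof -
      obtain e where e: "e > 0" "MS.mball x e \<subseteq> S" using S \<open>x \<in> S\<close> unfolding MS.openin_mtopology by blast
      obtain U where U: "open U" "x \<in> U" "\<And>q'. q' \<in> U \<Longrightarrow> dist_M x q' < e"
        by (rule nhd_subset_rdist[OF e(1), of x]) blast
      then have "U \<subseteq> S" using e(2) by auto
      then show ?thesis using U by blast
    qed
    have "open S" by (rule iffD2[OF open_subopen], intro ballI, rule H)
    then show "openin euclidean S" by simp
  next
    assume "openin euclidean S"
    then have S: "open S" by simp
    have "\<exists>r>0. MS.mball x r \<subseteq> S" if xS: "x \<in> S" for x
    proof -
      obtain e where "e > 0" "\<And>q'. dist_M x q' < e \<Longrightarrow> q' \<in> S"
        by (rule rdist_nhd_subset[OF S xS]) blast
      then show ?thesis by (intro exI[of _ e]) auto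
    qed
    then show "openin MS.mtopology S" unfolding MS.openin_mtopology by blast
  qed
qed

lemma continuous_rdist: "continuous_on UNIV (dist_M p)"
proof -
  have "\<exists>A. open A \<and> x \<in> A \<and> (\<forall>y\<in>A. dist (dist_M p y) (dist_M p x) < e)" if e: "e > 0" for x e
  proof -
    obtain U where U: "open U" "x \<in> U" "\<And>q'. q' \<in> U \<Longrightarrow> dist_M x q' < e"
      by (rule nhd_subset_rdist[OF e, of x]) blast
    have "dist (dist_M p y) (dist_M p x) \<le> dist_M x y" for y
      using rdist_triangle[of p y x] rdist_triangle[of p x y] rdist_sym[of x y] by (simp add: dist_real_def)
    then show ?thesis using U by (intro exI[of _ U]) (auto intro: order_le_less_trans)
  qed
  note N = this
  have "(dist_M p \<longlongrightarrow> dist_M p x) (at x)" for x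
    unfolding tendsto_iff eventually_at_topological
  proof (intro allI impI)
    fix e :: real assume "e > 0"
    from N[OF this, of x] obtain A where "open A" "x \<in> A" "\<forall>y\<in>A. dist (dist_M p y) (dist_M p x) < e" by blast
    then show "\<exists>S. open S \<and> x \<in> S \<and> (\<forall>y\<in>S. y \<noteq> x \<longrightarrow> y \<in> UNIV \<longrightarrow> dist (dist_M p y) (dist_M p x) < e)"
      by (intro exI[of _ A]) simp
  qed
  then show ?thesis by (simp add: continuous_on_eq_continuous_at continuous_at)
qed

definition cb :: "'a \<Rightarrow> real \<Rightarrow> 'a set" where "cb p r = {q. dist_M p q \<le> r}"

lemma closed_cb: "closed (cb p r)"
proof -
  have "closed (dist_M p -` {..r})"
    using continuous_closed_vimage[OF closed_atMost] continuous_rdist continuous_on_eq_continuous_at[OF open_UNIV] by blast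
  then show ?thesis unfolding cb_def vimage_def by simp
qed

lemma open_db: "open {q. dist_M p q < r}"
proof -
  have "open (dist_M p -` {..<r})"
    using continuous_open_vimage[OF open_lessThan] continuous_rdist continuous_on_eq_continuous_at[OF open_UNIV] by blast
  then show ?thesis unfolding vimage_def by simp
qed

text \<open>The length up to \<open>t\<close> is an indefinite integral, hence continuous in
  \<open>t\<close>; the intermediate value theorem finds the point.\<close>

lemma curve_split:
  assumes g: "pwc g 0 1" and L: "len g 0 1 = ennreal L" "0 \<le> v" "v \<le> L"
  obtains t where "t \<in> {0..1}" "len g 0 t = ennreal v" "len g t 1 = ennreal (L - v)"
proof -
  let ?f = "\<lambda>t. indicator {0<..<1} t * speed M g t"
  have fm: "?f \<in> borel_measurable borel" by (rule pwc_measurable[OF g]) simp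
  have fi: "integrable lborel ?f"
    using fm L(1) unfolding len_def by (intro integrableI_nonneg) (auto simp: speed_nonneg)
  have si: "set_integrable lborel {0..t} ?f" for t
    unfolding set_integrable_def by (rule integrable_mult_indicator[OF _ fi]) simp
  define F where "F t = integral {0..t} ?f" for t
  have F: "len g 0 t = ennreal (F t)" "0 \<le> F t" if t: "t \<in> {0..1}" for t
  proof -
    have e: "AE x in lborel. indicator {0<..<t} x * speed M g x = indicator {0..t} x *\<^sub>R ?f x"
      by (rule AE_finite_lborel[of "{0,t,1}"]) (use t in \<open>auto split: split_indicator\<close>)
    have "len g 0 t = (\<integral>\<^sup>+ x. ennreal (indicator {0..t} x *\<^sub>R ?f x) \<partial>lborel)"
      unfolding len_def by (rule nn_integral_cong_AE) (use e in eventually_elim, simp only:)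
    also have "\<dots> = ennreal (LINT x:{0..t}|lborel. ?f x)"
      unfolding set_lebesgue_integral_def using si[of t] unfolding set_integrable_def
      by (rule nn_integral_eq_integral) (simp add: speed_nonneg)
    finally show "len g 0 t = ennreal (F t)" unfolding F_def using set_borel_integral_eq_integral(2)[OF si] by simp
    show "0 \<le> F t" unfolding F_def
      by (rule integral_nonneg[OF set_borel_integral_eq_integral(1)[OF si]]) (simp add: speed_nonneg)
  qed
  have "continuous_on {0..1} F" unfolding F_def
    by (rule indefinite_integral_continuous_1[OF set_borel_integral_eq_integral(1)[OF si]])
  moreover have "F 0 = 0" unfolding F_def by simp
  moreover have "F 1 = L" using F[of 1] L by simp
  ultimately obtain t where t: "0 \<le> t" "t \<le> 1" "F t = v" using IVT'[of F 0 v 1] L by auto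
  have "len g 0 1 = len g 0 t + len g t 1" by (rule len_join[OF g t(1,2)])
  then have "ennreal L = ennreal v + len g t 1" using F[of t] t L by simp
  then have "len g t 1 = ennreal L - ennreal v"
    using ennreal_add_diff_cancel_left[of "ennreal v" "len g t 1"] by simp
  then have "len g t 1 = ennreal (L - v)" using L by (simp add: ennreal_minus)
  then show ?thesis using that[of t] t F[of t] by simp
qed

lemma length_space:
  assumes "dist_M p q < a + b" "a > 0" "b > 0"
  obtains z where "dist_M p z < a" "dist_M z q < b"
proof -
  have "ed p q < ennreal (a + b)" using assms by (simp add: rdist_less_iff)
  then obtain g where g: "pwc g 0 1" "g 0 = p" "g 1 = q" "len g 0 1 < ennreal (a + b)" by (rule ed_less)
  define L where "L = enn2real (len g 0 1)"
  have L: "len g 0 1 = ennreal L" "0 \<le> L"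
    unfolding L_def by (simp_all add: ennreal_enn2real[OF order_less_trans[OF g(4) ennreal_less_top]])
  have La: "L < a + b" using g(4) L by (simp add: ennreal_less_iff)
  show ?thesis
  proof (cases "L < a")
    case True
    have "ed p q \<le> ennreal L" using ed_le[OF g(1)] g L by simp
    then have "dist_M p q \<le> L" using L by (simp add: rdist_le_iff)
    then show ?thesis using that[of q] True assms by (simp add: rdist_refl)
  next
    case False
    \<comment> \<open>The midpoint of \<open>max 0 (L - b)\<close> and \<open>a\<close>: the first
      part of the curve must be shorter than \<open>a\<close> and the rest shorter than
      \<open>b\<close>.\<close>
    define v where "v = (max 0 (L - b) + a) / 2"
    have v: "0 \<le> v" "v \<le> L" "v < a" "L - v < b" unfolding v_def using assms False La by (auto simp: max_def field_simps)
    obtain t where t: "t \<in> {0..1}" "len g 0 t = ennreal v" "len g t 1 = ennreal (L - v)"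
      by (rule curve_split[OF g(1) L(1) v(1,2)]) blast
    have "ed p (g t) \<le> ennreal v"
    proof (cases "t = 0")
      case False
      then show ?thesis using ed_le[OF pwc_sub[OF g(1)], of 0 t] t g by auto
    qed (simp add: g ed_refl)
    moreover have "ed (g t) q \<le> ennreal (L - v)"
    proof (cases "t = 1")
      case False
      then show ?thesis using ed_le[OF pwc_sub[OF g(1)], of t 1] t g by auto
    qed (simp add: g ed_refl)
    ultimately have "dist_M p (g t) \<le> v" "dist_M (g t) q \<le> L - v" using v by (simp_all add: rdist_le_iff)
    then show ?thesis using that[of "g t"] v by simp
  qed
qed

lemma locally_compact_cb:
  obtains e where "e > 0" "compact (cb x e)"
proof -
  obtain c where c: "c \<in> atlas M" "x \<in> cdom c" using chart_ex by blast
  have "cmap c x \<in> img c" using c by blast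
  then obtain r where r: "r > 0" "cball (cmap c x) r \<subseteq> img c"
    using open_img[OF c(1)] open_contains_cball by blast
  have bs: "ball (cmap c x) r \<subseteq> img c" using r by (meson ball_subset_cball order_trans)
  have 1: "open (cinv c ` ball (cmap c x) r)" by (rule open_cinv_image[OF c(1) open_ball bs])
  have 2: "x \<in> cinv c ` ball (cmap c x) r"
    by (rule image_eqI[of _ _ "cmap c x"]) (use cinv_cmap[OF c] r in auto)
  obtain e where e: "e > 0" "\<And>q'. dist_M x q' < e \<Longrightarrow> q' \<in> cinv c ` ball (cmap c x) r"
    by (rule rdist_nhd_subset[OF 1 2]) blast
  have "compact (cinv c ` cball (cmap c x) r)"
    by (intro compact_continuous_image compact_cball continuous_on_subset[OF cont_cinv[OF c(1)] r(2)])
  moreover have "cb x (e/2) \<subseteq> cinv c ` cball (cmap c x) r"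
    using e unfolding cb_def by (force intro!: subsetD[OF image_mono[OF ball_subset_cball]])
  ultimately have "compact (cb x (e/2))" using closed_cb compact_Int_closed by (metis inf.absorb2)
  then show ?thesis using that[of "e/2"] e by simp
qed

lemma compact_finite_net:
  assumes "compact K" "e > 0"
  obtains F where "finite F" "F \<subseteq> K" "\<And>q. q \<in> K \<Longrightarrow> \<exists>x\<in>F. dist_M x q < e"
proof -
  have "K \<subseteq> (\<Union>x\<in>K. {q. dist_M x q < e})" using assms(2) by (auto simp: rdist_refl)
  then obtain F where "F \<subseteq> K" "finite F" "K \<subseteq> (\<Union>x\<in>F. {q. dist_M x q < e})"
    using compactE_image[OF assms(1), of K "\<lambda>x. {q. dist_M x q < e}"] open_db by blast
  then show ?thesis by (intro that[of F]) auto
qed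

text \<open>Cohn-Vossen's argument: the supremum of the radii of compact balls cannot be finite.\<close>

lemma Hopf_Rinow:
  assumes compl: "complete_riem M"
  shows "compact (cb p r)"
proof (rule ccontr)
  assume nc: "\<not> compact (cb p r)"
  have mono: "compact (cb p s)" if "compact (cb p t)" "s \<le> t" for s t
  proof -
    have "cb p s \<subseteq> cb p t" using that by (auto simp: cb_def)
    then show ?thesis using that closed_cb compact_Int_closed by (metis inf.absorb2)
  qed
  define R where "R = {s. 0 \<le> s \<and> compact (cb p s)}"
  have "cb p 0 = {p}" unfolding cb_def using rdist_nonneg rdist_zero by (auto simp: order_antisym_conv)
  then have R0: "0 \<in> R" unfolding R_def by simp
  have bd: "s \<le> r" if "s \<in> R" for s
  proof (rule ccontr)
    assume "\<not> s \<le> r"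
    then have "compact (cb p r)" using mono[of s r] that unfolding R_def by simp
    then show False using nc by simp
  qed
  have bdd: "bdd_above R" by (rule bdd_aboveI[of _ r]) (rule bd)
  define \<rho> where "\<rho> = Sup R"
  have rho: "0 \<le> \<rho>" unfolding \<rho>_def by (rule cSup_upper[OF R0 bdd])
  have below: "compact (cb p s)" if sr: "s < \<rho>" for s
  proof -
    obtain t where "t \<in> R" "s < t"
      by (rule less_cSupE[of s R]) (use sr R0 in \<open>auto simp: \<rho>_def\<close>)
    then show ?thesis using mono[of t s] unfolding R_def by auto
  qed
  \<comment> \<open>By \<open>length_space\<close> some \<open>z\<close> in the ball of radius
    \<open>\<rho> - e\<close> is at distance less than \<open>2 * e + h\<close> from
    \<open>q\<close>. If \<open>\<rho> \<le> e\<close>, the point \<open>p\<close> itself will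
    do.\<close>
  have approx: "\<exists>z. dist_M p z \<le> max 0 (\<rho> - e) \<and> dist_M z q < 2 * e + h" if eh: "e > 0" "h \<ge> 0" "dist_M p q \<le> \<rho> + h" for e h q
  proof (cases "\<rho> - e > 0")
    case True
    have "dist_M p q < (\<rho> - e) + (2 * e + h)" using eh by simp
    then obtain z where "dist_M p z < \<rho> - e" "dist_M z q < 2 * e + h"
      by (rule length_space) (use True eh in auto)
    then show ?thesis by (intro exI[of _ z]) auto
  next
    case False
    then show ?thesis using eh by (intro exI[of _ p]) (auto simp: rdist_refl)
  qed
  have "compact (cb p \<rho>)"
  proof (cases "\<rho> = 0")
    case True
    then show ?thesis using R0 unfolding R_def by auto
  next
    case False
    then have rp: "\<rho> > 0" using rho by simp
    \<comment> \<open>Every point of the closed ball is within \<open>2 * e'\<close> of a smaller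
      ball, which is compact and has a finite \<open>e'\<close>-net; hence the requirement
      \<open>3 * e' \<le> e\<close>.\<close>
    have "MS.mtotally_bounded (cb p \<rho>)" unfolding MS.mtotally_bounded_def
    proof (intro allI impI)
      fix e :: real assume e: "e > 0"
      define e' where "e' = min (e / 3) (\<rho> / 2)"
      have e': "e' > 0" "3 * e' \<le> e" "\<rho> - e' > 0" "\<rho> - e' < \<rho>" unfolding e'_def using e rp by auto
      have cK: "compact (cb p (\<rho> - e'))" by (rule below[OF e'(4)])
      obtain F where F: "finite F" "F \<subseteq> cb p (\<rho> - e')" "\<And>q. q \<in> cb p (\<rho> - e') \<Longrightarrow> \<exists>x\<in>F. dist_M x q < e'"
        using compact_finite_net[OF cK e'(1)] by blast
      have "q \<in> (\<Union>x\<in>F. MS.mball x e)" if qc: "q \<in> cb p \<rho>" for q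
      proof -
        obtain z where z: "dist_M p z \<le> max 0 (\<rho> - e')" "dist_M z q < 2 * e' + 0"
          using approx[OF e'(1), of 0 q] qc unfolding cb_def by auto
        then have "z \<in> cb p (\<rho> - e')" using e' unfolding cb_def by simp
        then obtain x where x: "x \<in> F" "dist_M x z < e'" using F by blast
        have "dist_M x q < e" using rdist_triangle[of x q z] x z e' by simp
        then show ?thesis using x by auto
      qed
      then show "\<exists>K. finite K \<and> K \<subseteq> cb p \<rho> \<and> cb p \<rho> \<subseteq> (\<Union>x\<in>K. MS.mball x e)"
        using F e' by (intro exI[of _ F]) (auto simp: cb_def)
    qed
    moreover have "MS.mcomplete" using compl unfolding complete_riem_def .
    ultimately have "compactin MS.mtopology (MS.mtopology closure_of cb p \<rho>)"
      using MS.mtotally_bounded_eq_compact_closure_of by blast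
    then show ?thesis unfolding mtopology_eq using closed_cb by simp
  qed
  define E where "E x = (SOME e. e > 0 \<and> compact (cb x e))" for x
  have E: "E x > 0 \<and> compact (cb x (E x))" for x
    unfolding E_def by (rule someI_ex) (use locally_compact_cb[of x] in blast)
  have "cb p \<rho> \<subseteq> (\<Union>x\<in>cb p \<rho>. {q. dist_M x q < E x / 2})" using E by (auto simp: rdist_refl)
  then obtain F where F: "F \<subseteq> cb p \<rho>" "finite F" "cb p \<rho> \<subseteq> (\<Union>x\<in>F. {q. dist_M x q < E x / 2})"
    using compactE_image[OF \<open>compact (cb p \<rho>)\<close>, of "cb p \<rho>" "\<lambda>x. {q. dist_M x q < E x / 2}"] open_db by blast
  have "p \<in> cb p \<rho>" using rho by (simp add: cb_def rdist_refl)
  then have Fne: "F \<noteq> {}" using F by blast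
  \<comment> \<open>\<open>approx\<close> with \<open>e = h = \<delta>\<close> adds
    \<open>3 * \<delta>\<close> to \<open>E x / 2\<close>, and the sum has to stay below
    \<open>E x\<close>.\<close>
  define \<delta> where "\<delta> = Min (E ` F) / 8"
  have dl: "\<delta> > 0" unfolding \<delta>_def using E F Fne by simp
  have dE: "8 * \<delta> \<le> E x" if "x \<in> F" for x unfolding \<delta>_def using F that by simp
  have "cb p (\<rho> + \<delta>) \<subseteq> (\<Union>x\<in>F. cb x (E x))"
  proof
    fix q assume "q \<in> cb p (\<rho> + \<delta>)"
    then obtain z where z: "dist_M p z \<le> max 0 (\<rho> - \<delta>)" "dist_M z q < 2 * \<delta> + \<delta>"
      using approx[of \<delta> \<delta> q] dl unfolding cb_def by auto
    then have "z \<in> cb p \<rho>" using rho dl unfolding cb_def by auto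
    then obtain x where x: "x \<in> F" "dist_M x z < E x / 2" using F by blast
    have "dist_M x q \<le> E x" using rdist_triangle[of x q z] x(2) z(2) dE[OF x(1)] dl by linarith
    then show "q \<in> (\<Union>x\<in>F. cb x (E x))" using x unfolding cb_def by auto
  qed
  moreover have "compact (\<Union>x\<in>F. cb x (E x))" using F E by (intro compact_UN) auto
  ultimately have "compact (cb p (\<rho> + \<delta>))" using closed_cb compact_Int_closed by (metis inf.absorb2)
  then have "\<rho> + \<delta> \<in> R" unfolding R_def using rho dl by simp
  then show False using cSup_upper[OF _ bdd] dl unfolding \<rho>_def by fastforce
qed

end

section \<open>Change of variables\<close>

text \<open>The change-of-variables theorem of the library requires a wellordered index type, so we
  transport it along a wellordered copy of the index type.\<close>

typedef 'm wo = "UNIV :: 'm set" morphisms of_wo to_wo ..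

instance wo :: (finite) finite
proof
  have "(UNIV :: 'a wo set) = to_wo ` UNIV"
    by (metis of_wo_inverse surj_def)
  then show "finite (UNIV :: 'a wo set)" by (metis finite finite_imageI)
qed

instantiation wo :: (finite) wellorder
begin

definition less_eq_wo :: "'a wo \<Rightarrow> 'a wo \<Rightarrow> bool" where
  "less_eq_wo x y \<longleftrightarrow> to_nat (of_wo x) \<le> to_nat (of_wo y)"

definition less_wo :: "'a wo \<Rightarrow> 'a wo \<Rightarrow> bool" where
  "less_wo x y \<longleftrightarrow> to_nat (of_wo x) < to_nat (of_wo y)"

instance
proof
  fix P :: "'a wo \<Rightarrow> bool" and a
  assume H: "\<And>x. (\<And>y. y < x \<Longrightarrow> P y) \<Longrightarrow> P x"
  show "P a"
  proof (induction a rule: measure_induct_rule[of "\<lambda>x. to_nat (of_wo x)"])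
    case (less x)
    show ?case by (rule H) (use less in \<open>simp add: less_wo_def\<close>)
  qed
qed (auto simp: less_eq_wo_def less_wo_def of_wo_inject)

end

definition to_w :: "real^'m::finite \<Rightarrow> real^'m wo" where "to_w x = (\<chi> i. x $ of_wo i)"
definition of_w :: "real^'m wo \<Rightarrow> real^'m::finite" where "of_w x = (\<chi> i. x $ to_wo i)"

lemma w_inverse [simp]: "of_w (to_w x) = x" "to_w (of_w y) = y"
  by (simp_all add: to_w_def of_w_def to_wo_inverse of_wo_inverse)

lemma to_w_inj: "to_w x = to_w y \<longleftrightarrow> x = y"
  using w_inverse(1) by metis

lemma bl_to_w: "bounded_linear to_w" and bl_of_w: "bounded_linear of_w"
  by (rule linear_conv_bounded_linear[THEN iffD1], rule linearI;
      simp add: to_w_def of_w_def vec_eq_iff)+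

lemma bij_of_wo: "bij of_wo"
  by (rule bijI') (auto simp: of_wo_inject intro: to_wo_inverse[symmetric])

text \<open>\<open>map_permutation UNIV f\<close> conjugates permutations by \<open>f\<close>; this
  is a bijection that preserves signs.\<close>

lemma det_reindex:
  fixes A :: "real^'m::finite^'m" and B :: "real^'k::finite^'k"
  assumes f: "bij f" and B: "\<And>i j. B $ i $ j = A $ f i $ f j"
  shows "det B = det A"
proof -
  let ?M = "map_permutation UNIV f"
  have bM: "bij_betw ?M {p. p permutes UNIV} {p. p permutes UNIV}"
  proof (rule bij_betw_byWitness[where f'="map_permutation UNIV (inv f)"])
    have fb: "bij_betw f UNIV UNIV" "bij_betw (inv f) UNIV UNIV" using f by (auto simp: bij_imp_bij_inv)
    show "\<forall>p\<in>{p. p permutes UNIV}. map_permutation UNIV (inv f) (?M p) = p"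
      using map_permutation_compose_inv[OF fb(1)] f by (simp add: bij_is_inj)
    show "\<forall>p\<in>{p. p permutes UNIV}. ?M (map_permutation UNIV (inv f) p) = p"
      using map_permutation_compose_inv[OF fb(2)] f by (simp add: bij_is_surj surj_f_inv_f)
    show "?M ` {p. p permutes UNIV} \<subseteq> {p. p permutes UNIV}"
      using map_permutation_permutes[OF fb(1)] by blast
    show "map_permutation UNIV (inv f) ` {p. p permutes UNIV} \<subseteq> {p. p permutes UNIV}"
      using map_permutation_permutes[OF fb(2)] by blast
  qed
  have inj: "inj_on f UNIV" using f by (simp add: bij_is_inj)
  have ap: "?M p (f i) = f (p i)" for p i by (rule map_permutation_apply[OF inj]) simp
  have "det A = (\<Sum>p\<in>{p. p permutes UNIV}. of_int (sign p) * (\<Prod>i\<in>UNIV. A $ i $ p i))"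
    by (simp add: det_def)
  also have "\<dots> = (\<Sum>p\<in>{p. p permutes UNIV}. of_int (sign (?M p)) * (\<Prod>i\<in>UNIV. A $ i $ ?M p i))"
    by (rule sum.reindex_bij_betw[OF bM, symmetric])
  also have "\<dots> = (\<Sum>p\<in>{p. p permutes UNIV}. of_int (sign p) * (\<Prod>i\<in>UNIV. B $ i $ p i))"
  proof (rule sum.cong[OF refl])
    fix p :: "'k \<Rightarrow> 'k" assume p: "p \<in> {p. p permutes UNIV}"
    have "(\<Prod>i\<in>UNIV. A $ i $ ?M p i) = (\<Prod>i\<in>UNIV. A $ f i $ ?M p (f i))"
      using f by (intro prod.reindex_bij_betw[symmetric])
    also have "\<dots> = (\<Prod>i\<in>UNIV. B $ i $ p i)" by (simp add: ap B)
    finally show "of_int (sign (?M p)) * (\<Prod>i\<in>UNIV. A $ i $ ?M p i) = of_int (sign p) * (\<Prod>i\<in>UNIV. B $ i $ p i)"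
      using sign_map_permutation[OF inj, of p] p by simp
  qed
  finally show ?thesis by (simp add: det_def)
qed

lemma measurable_w [measurable]: "to_w \<in> borel_measurable borel" "of_w \<in> borel_measurable borel"
  by (intro borel_measurable_continuous_onI bounded_linear.continuous_on[OF bl_to_w] bounded_linear.continuous_on[OF bl_of_w] continuous_on_id)+

lemma distr_to_w: "distr lborel borel to_w = (lborel :: (real^'m::finite wo) measure)"
proof (rule lborel_eqI[symmetric])
  fix l u :: "real^'m wo" assume lu: "\<And>b. b \<in> Basis \<Longrightarrow> l \<bullet> b \<le> u \<bullet> b"
  have le: "l $ i \<le> u $ i" for i using lu[of "axis i 1"] by (auto simp: Basis_vec_def inner_axis)
  have pr: "to_w -` box l u = box (of_w l) (of_w u)"
    unfolding box_def to_w_def of_w_def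
    by (auto simp: Basis_vec_def inner_axis) (metis to_wo_inverse UNIV_I, metis to_wo_inverse UNIV_I, metis of_wo_inverse, metis of_wo_inverse)
  have bp: "(\<Prod>b\<in>Basis. (u - l) \<bullet> b) = (\<Prod>i\<in>UNIV. u $ i - l $ i)" for u l :: "real^'k::finite"
  proof -
    have "Basis = range (\<lambda>i::'k. axis i (1::real))" by (auto simp: Basis_vec_def)
    then have "(\<Prod>b\<in>Basis. (u - l) \<bullet> b) = (\<Prod>b\<in>range (\<lambda>i::'k. axis i (1::real)). (u - l) \<bullet> b)" by simp
    also have "\<dots> = (\<Prod>i\<in>UNIV. (u - l) \<bullet> axis i 1)"
      by (rule prod.reindex_cong[OF _ refl]) (auto simp: inj_on_def axis_eq_axis)
    finally show ?thesis by (simp add: inner_axis)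
  qed
  have "emeasure (distr lborel borel to_w) (box l u) = emeasure lborel (box (of_w l) (of_w u))"
    by (subst emeasure_distr) (auto simp: pr)
  also have "\<dots> = ennreal (\<Prod>b\<in>Basis. (of_w u - of_w l) \<bullet> b)"
    by (rule emeasure_lborel_box) (use le in \<open>auto simp: Basis_vec_def inner_axis of_w_def\<close>)
  also have "(\<Prod>b\<in>Basis. (of_w u - of_w l) \<bullet> b) = (\<Prod>i\<in>UNIV. of_w u $ i - of_w l $ i)" by (rule bp)
  also have "\<dots> = (\<Prod>i\<in>UNIV. of_w u $ of_wo i - of_w l $ of_wo i)"
    using bij_of_wo by (intro prod.reindex_bij_betw[symmetric])
  also have "\<dots> = (\<Prod>b\<in>Basis. (u - l) \<bullet> b)" unfolding bp by (simp add: of_w_def of_wo_inverse)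
  finally show "emeasure (distr lborel borel to_w) (box l u) = ennreal (\<Prod>b\<in>Basis. (u - l) \<bullet> b)" .
qed simp

lemma nn_integral_to_w:
  "f \<in> borel_measurable borel \<Longrightarrow> (\<integral>\<^sup>+ x. f (to_w x) \<partial>lborel) = (\<integral>\<^sup>+ y. f y \<partial>lborel)"
  by (subst distr_to_w[symmetric], subst nn_integral_distr) auto

lemma to_w_image: "to_w ` A = of_w -` A"
  by (auto intro: image_eqI[of _ _ "of_w _"])

lemma to_w_image_borel: "A \<in> sets borel \<Longrightarrow> to_w ` A \<in> sets borel"
  unfolding to_w_image using measurable_sets[OF measurable_w(2), of A] by simp

lemma emeasure_to_w: "A \<in> sets borel \<Longrightarrow> emeasure lborel (to_w ` A) = emeasure lborel A"
  using to_w_image_borel[of A]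
  by (subst distr_to_w[symmetric], subst emeasure_distr) (auto simp: to_w_image vimage_def)

text \<open>The finite case is \<open>has_measure_differentiable_image\<close>. The same equivalence
  excludes an infinite integral over an image of finite measure, so in the remaining case both sides
  are infinite.\<close>

lemma emeasure_diff_image_wo:
  fixes g :: "real^'m::{finite,wellorder} \<Rightarrow> real^'m::{finite,wellorder}"
  assumes S: "S \<in> sets borel" "g ` S \<in> sets borel"
    and d: "\<And>x. x \<in> S \<Longrightarrow> (g has_derivative g' x) (at x)" and inj: "inj_on g S"
    and m: "(\<lambda>x. indicator S x * \<bar>det (matrix (g' x))\<bar>) \<in> borel_measurable borel"
  shows "emeasure lborel (g ` S) = (\<integral>\<^sup>+ x. ennreal (indicator S x * \<bar>det (matrix (g' x))\<bar>) \<partial>lborel)"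
proof -
  let ?h = "\<lambda>x. indicator S x * \<bar>det (matrix (g' x))\<bar>"
  have iff: "g ` S \<in> lmeasurable \<and> measure lebesgue (g ` S) = r \<longleftrightarrow> ((\<lambda>x. \<bar>det (matrix (g' x))\<bar>) has_integral r) S" for r
    by (rule has_measure_differentiable_image) (use S d inj in \<open>auto intro: has_derivative_at_withinI\<close>)
  have iff2: "((\<lambda>x. \<bar>det (matrix (g' x))\<bar>) has_integral r) S \<longleftrightarrow> (?h has_integral r) UNIV" for r
  proof -
    have "?h = (\<lambda>x. if x \<in> S then \<bar>det (matrix (g' x))\<bar> else 0)" by (auto simp: indicator_def)
    then show ?thesis by (simp add: has_integral_restrict_UNIV)
  qed
  have em: "emeasure lborel (g ` S) = emeasure lebesgue (g ` S)" using S by simp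
  show ?thesis
  proof (cases "(\<integral>\<^sup>+ x. ennreal (?h x) \<partial>lborel) = \<infinity>")
    case False
    then obtain r where r: "(\<integral>\<^sup>+ x. ennreal (?h x) \<partial>lborel) = ennreal r" "0 \<le> r"
      by (cases "\<integral>\<^sup>+ x. ennreal (?h x) \<partial>lborel") auto
    have "(?h has_integral r) UNIV" by (rule nn_integral_has_integral[OF m _ r]) simp
    then have "g ` S \<in> lmeasurable \<and> measure lebesgue (g ` S) = r" using iff iff2 by blast
    then have "emeasure lebesgue (g ` S) = ennreal r"
      using emeasure_eq_ennreal_measure[of lebesgue "g ` S"] unfolding fmeasurable_def by force
    then show ?thesis using r em by simp
  next
    case True
    have "emeasure lborel (g ` S) = \<infinity>"
    proof (rule ccontr)
      assume "emeasure lborel (g ` S) \<noteq> \<infinity>"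
      then have "emeasure lebesgue (g ` S) < \<infinity>" unfolding em by (simp add: less_top)
      then have "g ` S \<in> lmeasurable" using S(2) by (intro fmeasurableI) simp_all
      then have "(?h has_integral measure lebesgue (g ` S)) UNIV" using iff iff2 by blast
      then have "(\<integral>\<^sup>+ x. ennreal (?h x) \<partial>lborel) = measure lebesgue (g ` S)"
        by (intro nn_integral_has_integral_lborel m) auto
      then show False using True by simp
    qed
    then show ?thesis using True by simp
  qed
qed

lemma emeasure_diff_image:
  fixes g :: "real^'m::finite \<Rightarrow> real^'m"
  assumes S: "S \<in> sets borel" "g ` S \<in> sets borel"
    and d: "\<And>x. x \<in> S \<Longrightarrow> (g has_derivative g' x) (at x)" and inj: "inj_on g S"
    and m: "(\<lambda>x. indicator S x * \<bar>det (matrix (g' x))\<bar>) \<in> borel_measurable borel"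
  shows "emeasure lborel (g ` S) = (\<integral>\<^sup>+ x. ennreal (indicator S x * \<bar>det (matrix (g' x))\<bar>) \<partial>lborel)"
proof -
  let ?g = "\<lambda>z. to_w (g (of_w z))" and ?g' = "\<lambda>z v. to_w (g' (of_w z) (of_w v))"
  have im: "?g ` (to_w ` S) = to_w ` (g ` S)" by (simp add: image_image)
  have det: "det (matrix (?g' z)) = det (matrix (g' (of_w z)))" if "z \<in> to_w ` S" for z
  proof (rule det_reindex[OF bij_of_wo])
    fix i j :: "'m wo"
    have "of_w (axis j 1) = axis (of_wo j) 1"
      by (auto simp: of_w_def vec_eq_iff axis_def of_wo_inverse to_wo_inverse)
    then show "matrix (?g' z) $ i $ j = matrix (g' (of_w z)) $ of_wo i $ of_wo j"
      by (simp add: matrix_def to_w_def)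
  qed
  have ind: "indicator (to_w ` S) z * \<bar>det (matrix (?g' z))\<bar> = indicator S (of_w z) * \<bar>det (matrix (g' (of_w z)))\<bar>" for z
  proof (cases "z \<in> to_w ` S")
    case True
    then show ?thesis using det by (auto simp: to_w_image indicator_def)
  qed (simp add: to_w_image indicator_def)
  have m2: "(\<lambda>z. indicator S (of_w z) * \<bar>det (matrix (g' (of_w z)))\<bar>) \<in> borel_measurable borel"
    by (rule measurable_compose[OF measurable_w(2) m])
  have "emeasure lborel (g ` S) = emeasure lborel (?g ` (to_w ` S))"
    unfolding im using emeasure_to_w[OF S(2)] by simp
  also have "\<dots> = (\<integral>\<^sup>+ z. ennreal (indicator (to_w ` S) z * \<bar>det (matrix (?g' z))\<bar>) \<partial>lborel)"
  proof (rule emeasure_diff_image_wo)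
    show "to_w ` S \<in> sets borel" "?g ` (to_w ` S) \<in> sets borel" unfolding im using S by (auto intro: to_w_image_borel)
    show "(?g has_derivative ?g' z) (at z)" if "z \<in> to_w ` S" for z
    proof -
      have "of_w z \<in> S" using that by auto
      then have "(g has_derivative g' (of_w z)) (at (of_w z))" by (rule d)
      then have "((\<lambda>z. g (of_w z)) has_derivative (\<lambda>v. g' (of_w z) (of_w v))) (at z)"
        by (rule has_derivative_compose[OF bounded_linear_imp_has_derivative[OF bl_of_w]])
      then show ?thesis by (rule bounded_linear.has_derivative[OF bl_to_w])
    qed
    show "inj_on ?g (to_w ` S)" using inj unfolding inj_on_def by (auto simp: to_w_inj)
    show "(\<lambda>z. indicator (to_w ` S) z * \<bar>det (matrix (?g' z))\<bar>) \<in> borel_measurable borel" unfolding ind by (rule m2)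
  qed
  also have "\<dots> = (\<integral>\<^sup>+ x. ennreal (indicator S x * \<bar>det (matrix (g' x))\<bar>) \<partial>lborel)"
    unfolding ind using nn_integral_to_w[of "\<lambda>z. ennreal (indicator S (of_w z) * \<bar>det (matrix (g' (of_w z)))\<bar>)"] m2 by simp
  finally show ?thesis .
qed

text \<open>The formula for measures of images says that Lebesgue measure on the image of
  \<open>S\<close> is the push-forward of the measure on \<open>S\<close> whose density is the
  Jacobian determinant; \<open>f\<close> is integrated against both.\<close>

lemma nn_integral_change_of_variables:
  fixes g :: "real^'m::finite \<Rightarrow> real^'m"
  assumes S: "open S" and d: "\<And>x. x \<in> S \<Longrightarrow> (g has_derivative g' x) (at x)" and inj: "inj_on g S"
    and c: "continuous_on S (\<lambda>x. det (matrix (g' x)))"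
    and im: "\<And>B. B \<in> sets borel \<Longrightarrow> B \<subseteq> S \<Longrightarrow> g ` B \<in> sets borel"
    and f: "f \<in> borel_measurable borel"
  shows "(\<integral>\<^sup>+ y. f y * indicator (g ` S) y \<partial>lborel) =
    (\<integral>\<^sup>+ x. ennreal (indicator S x * \<bar>det (matrix (g' x))\<bar>) * f (g x) \<partial>lborel)"
proof -
  let ?h = "\<lambda>x. indicator S x * \<bar>det (matrix (g' x))\<bar>"
  \<comment> \<open>\<open>g\<close> is controlled on \<open>S\<close> only; extended by 0 it is
    Borel measurable everywhere.\<close>
  let ?g = "\<lambda>x. if x \<in> S then g x else 0"
  have hm: "(\<lambda>x. indicator T x * \<bar>det (matrix (g' x))\<bar>) \<in> borel_measurable borel" if "T \<in> sets borel" "T \<subseteq> S" for T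
  proof -
    have "(\<lambda>x. indicator T x *\<^sub>R \<bar>det (matrix (g' x))\<bar>) \<in> borel_measurable borel"
      by (rule borel_measurable_continuous_on_indicator[OF that(1)])
        (intro continuous_intros continuous_on_subset[OF c that(2)])
    then show ?thesis by simp
  qed
  have hS: "?h \<in> borel_measurable borel" using S by (intro hm) auto
  have cg: "continuous_on S g" using d by (meson continuous_at_imp_continuous_on has_derivative_continuous)
  have gm: "?g \<in> borel_measurable borel"
    by (rule borel_measurable_continuous_on_if) (use S cg in auto)
  have eq: "distr (density lborel (\<lambda>x. ennreal (?h x))) borel ?g = density lborel (indicator (g ` S))"
  proof (rule measure_eqI)
    fix B :: "(real^'m) set" assume "B \<in> sets (distr (density lborel (\<lambda>x. ennreal (?h x))) borel ?g)"
    then have B: "B \<in> sets borel" by simp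
    define T where "T = S \<inter> ?g -` B"
    have T: "T \<in> sets borel" "T \<subseteq> S" unfolding T_def using measurable_sets[OF gm B] S by auto
    have gT: "g ` T = g ` S \<inter> B" unfolding T_def by auto
    have "emeasure (distr (density lborel (\<lambda>x. ennreal (?h x))) borel ?g) B
        = (\<integral>\<^sup>+ x. ennreal (?h x) * indicator (?g -` B) x \<partial>lborel)"
      using B gm hS measurable_sets[OF gm B] by (subst emeasure_distr) (auto simp: emeasure_density)
    also have "\<dots> = (\<integral>\<^sup>+ x. ennreal (indicator T x * \<bar>det (matrix (g' x))\<bar>) \<partial>lborel)"
      by (rule nn_integral_cong) (auto simp: T_def indicator_def)
    also have "\<dots> = emeasure lborel (g ` T)"
      by (rule emeasure_diff_image[symmetric])
        (use T d inj im hm in \<open>auto intro: inj_on_subset\<close>)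
    also have "\<dots> = emeasure (density lborel (indicator (g ` S))) B"
      unfolding gT using B im[OF _ order_refl] S
      by (subst emeasure_density) (auto simp: indicator_inter_arith[symmetric] nn_integral_indicator)
    finally show "emeasure (distr (density lborel (\<lambda>x. ennreal (?h x))) borel ?g) B
        = emeasure (density lborel (indicator (g ` S))) B" .
  qed simp
  have gS: "g ` S \<in> sets borel" using im S by auto
  have "(\<integral>\<^sup>+ y. f y * indicator (g ` S) y \<partial>lborel) = (\<integral>\<^sup>+ y. f y \<partial>density lborel (indicator (g ` S)))"
    using f gS by (subst nn_integral_density) (auto simp: mult.commute)
  also have "\<dots> = (\<integral>\<^sup>+ x. f (?g x) \<partial>density lborel (\<lambda>x. ennreal (?h x)))"
    unfolding eq[symmetric] using f gm by (subst nn_integral_distr) auto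
  also have "\<dots> = (\<integral>\<^sup>+ x. ennreal (?h x) * f (?g x) \<partial>lborel)"
    using hS measurable_compose[OF gm f] by (subst nn_integral_density) auto
  also have "\<dots> = (\<integral>\<^sup>+ x. ennreal (?h x) * f (g x) \<partial>lborel)"
    by (rule nn_integral_cong) (auto simp: indicator_def)
  finally show ?thesis .
qed

section \<open>The Riemannian volume\<close>

lemma borel_preimage_on:
  fixes f :: "'x::topological_space \<Rightarrow> 'y::topological_space"
  assumes "open S" "continuous_on S f" "A \<in> sets borel"
  shows "{x \<in> S. f x \<in> A} \<in> sets borel"
proof -
  have "f \<in> measurable (restrict_space borel S) borel"
    by (rule borel_measurable_continuous_on_restrict[OF assms(2)])
  then have "f -` A \<inter> space (restrict_space borel S) \<in> sets (restrict_space borel S)"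
    using assms(3) by (rule measurable_sets)
  moreover have "f -` A \<inter> space (restrict_space borel S) = {x \<in> S. f x \<in> A}"
    by (auto simp: space_restrict_space)
  ultimately show ?thesis using assms(1) by (auto simp: sets_restrict_space)
qed

lemma norm_mat_vec_bound:
  fixes H :: "real^'m::finite^'n::finite"
  shows "norm (H *v w) \<le> real CARD('n) * (norm H * norm w)"
proof -
  have "norm (H *v w) \<le> (\<Sum>i\<in>UNIV. \<bar>(H *v w) $ i\<bar>)" by (rule norm_le_l1_cart)
  also have "\<dots> \<le> (\<Sum>i\<in>(UNIV::'n set). norm H * norm w)"
  proof (rule sum_mono)
    fix i :: 'n
    have "(H *v w) $ i = H $ i \<bullet> w" by (simp add: matrix_vector_mult_def inner_vec_def)
    then have "\<bar>(H *v w) $ i\<bar> \<le> norm (H $ i) * norm w" by (simp add: Cauchy_Schwarz_ineq2)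
    also have "\<dots> \<le> norm H * norm w" by (intro mult_right_mono Finite_Cartesian_Product.norm_nth_le) simp
    finally show "\<bar>(H *v w) $ i\<bar> \<le> norm H * norm w" .
  qed
  finally show ?thesis by simp
qed

lemma ip_mat_bound:
  fixes H :: "real^'m::finite^'m"
  shows "\<bar>ip H v w\<bar> \<le> real CARD('m) * norm H * norm v * norm w"
proof -
  have "\<bar>ip H v w\<bar> \<le> norm v * norm (H *v w)" unfolding ip_def by (rule Cauchy_Schwarz_ineq2)
  also have "\<dots> \<le> norm v * (real CARD('m) * (norm H * norm w))" by (intro mult_left_mono norm_mat_vec_bound) simp
  finally show ?thesis by (simp add: mult_ac)
qed

context rmfd
begin

definition dn :: "('a, 'm) chart \<Rightarrow> real^'m \<Rightarrow> real" where
  "dn c y = sqrt (det (gmat M c y))"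

lemma dn_pos: "c \<in> atlas M \<Longrightarrow> y \<in> img c \<Longrightarrow> dn c y > 0"
  unfolding dn_def using posdef_det_pos[OF posdef_g] by simp

lemma dn_nonneg: "c \<in> atlas M \<Longrightarrow> y \<in> img c \<Longrightarrow> dn c y \<ge> 0"
  using dn_pos less_imp_le by blast

lemma cont_dn: "c \<in> atlas M \<Longrightarrow> continuous_on (img c) (dn c)"
  unfolding dn_def[abs_def] by (intro continuous_intros continuous_on_det cont_g)

text \<open>Outside \<open>img c\<close> the value of \<open>inv_into\<close> is unspecified; a
  constant there makes the map Borel measurable.\<close>

definition cinv' :: "('a, 'm) chart \<Rightarrow> real^'m \<Rightarrow> 'a" where
  "cinv' c y = (if y \<in> img c then cinv c y else undefined)"

lemma cinv'_measurable:
  assumes c: "c \<in> atlas M" shows "cinv' c \<in> borel_measurable borel"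
proof -
  have "(\<lambda>y. if y \<in> img c then cinv c y else undefined) \<in> measurable borel borel"
    by (subst measurable_If_restrict_space_iff)
      (use borel_measurable_continuous_on_restrict[OF cont_cinv[OF c]] open_img[OF c] in auto)
  then show ?thesis by (simp add: cinv'_def[abs_def])
qed

lemma ind_dn_measurable:
  assumes c: "c \<in> atlas M" and A: "A \<in> sets borel" "A \<subseteq> img c"
  shows "(\<lambda>y. indicator A y * dn c y) \<in> borel_measurable borel"
proof -
  have "(\<lambda>y. indicator A y *\<^sub>R dn c y) \<in> borel_measurable borel"
    by (rule borel_measurable_continuous_on_indicator[OF A(1) continuous_on_subset[OF cont_dn[OF c] A(2)]])
  then show ?thesis by simp
qed

lemma img_borel: "c \<in> atlas M \<Longrightarrow> img c \<in> sets borel"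
  using open_img by simp

lemma cmap_image_borel:
  assumes c: "c \<in> atlas M" and A: "A \<in> sets borel" "A \<subseteq> cdom c"
  shows "cmap c ` A \<in> sets borel"
proof -
  have "cmap c ` A = {y \<in> img c. cinv c y \<in> A}"
    using A(2) cinv_cmap[OF c] cmap_cinv by (auto intro: rev_image_eqI)
  then show ?thesis using borel_preimage_on[OF open_img[OF c] cont_cinv[OF c] A(1)] by simp
qed

text \<open>The volume of one chart domain as a measure on the whole manifold, so that the volumes
  of different charts can be compared and summed.\<close>

definition mc :: "('a, 'm) chart \<Rightarrow> 'a measure" where
  "mc c = distr (density lborel (\<lambda>y. ennreal (indicator (img c) y * dn c y))) borel (cinv' c)"

lemma sets_mc [simp]: "sets (mc c) = sets borel"
  by (simp add: mc_def)

lemma nn_integral_mc: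
  assumes c: "c \<in> atlas M" and f: "f \<in> borel_measurable borel"
  shows "(\<integral>\<^sup>+ q. f q \<partial>mc c) = (\<integral>\<^sup>+ y. ennreal (indicator (img c) y * dn c y) * f (cinv c y) \<partial>lborel)"
proof -
  have m: "(\<lambda>y. indicator (img c) y * dn c y) \<in> borel_measurable borel"
    by (rule ind_dn_measurable[OF c img_borel[OF c] order_refl])
  have "(\<integral>\<^sup>+ q. f q \<partial>mc c) = (\<integral>\<^sup>+ y. ennreal (indicator (img c) y * dn c y) * f (cinv' c y) \<partial>lborel)"
    unfolding mc_def using cinv'_measurable[OF c] f m measurable_compose[OF cinv'_measurable[OF c] f]
    by (subst nn_integral_distr) (auto simp: nn_integral_density)
  also have "\<dots> = (\<integral>\<^sup>+ y. ennreal (indicator (img c) y * dn c y) * f (cinv c y) \<partial>lborel)"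
    by (rule nn_integral_cong) (auto simp: cinv'_def indicator_def)
  finally show ?thesis .
qed

lemma emeasure_mc:
  assumes c: "c \<in> atlas M" and A: "A \<in> sets borel" "A \<subseteq> cdom c"
  shows "emeasure (mc c) A = (\<integral>\<^sup>+ x\<in>cmap c ` A. ennreal (dn c x) \<partial>lborel)"
proof -
  have "emeasure (mc c) A = (\<integral>\<^sup>+ q. indicator A q \<partial>mc c)" using A by (simp add: nn_integral_indicator)
  also have "\<dots> = (\<integral>\<^sup>+ y. ennreal (indicator (img c) y * dn c y) * indicator A (cinv c y) \<partial>lborel)"
    by (rule nn_integral_mc[OF c]) (use A in simp)
  also have "\<dots> = (\<integral>\<^sup>+ x\<in>cmap c ` A. ennreal (dn c x) \<partial>lborel)"
  proof (rule nn_integral_cong)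
    fix y
    show "ennreal (indicator (img c) y * dn c y) * indicator A (cinv c y) = ennreal (dn c y) * indicator (cmap c ` A) y"
    proof (cases "y \<in> cmap c ` A")
      case True
      then obtain q where "q \<in> A" "y = cmap c q" by blast
      then have "cinv c y \<in> A" "y \<in> img c" using A cinv_cmap[OF c, of q] by auto
      then show ?thesis using True by simp
    next
      case False
      then have "\<not> (y \<in> img c \<and> cinv c y \<in> A)" using cmap_cinv[of y c] by (metis image_eqI)
      then show ?thesis using False by (auto simp: indicator_def)
    qed
  qed
  finally show ?thesis .
qed

lemma dn_trans:
  assumes "c \<in> atlas M" "d \<in> atlas M" "q \<in> cdom c" "q \<in> cdom d"
  shows "dn c (cmap c q) = \<bar>det (matrix (fd (cmap d \<circ> cinv c) (cmap c q)))\<bar> * dn d (cmap d q)"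
proof -
  let ?J = "jacobian (cmap d \<circ> cinv c) (cmap c q)"
  have "gmat M c (cmap c q) = transpose ?J ** gmat M d (cmap d q) ** ?J"
    using rm assms unfolding riemannian_manifold_def Let_def by blast
  then have "det (gmat M c (cmap c q)) = (det ?J)\<^sup>2 * det (gmat M d (cmap d q))"
    by (simp add: det_mul power2_eq_square)
  then show ?thesis by (simp add: dn_def real_sqrt_mult jacobian_def)
qed

text \<open>Change of variables along the transition map; by \<open>dn_trans\<close> the densities
  differ by its Jacobian determinant.\<close>

lemma mc_consistent:
  assumes c: "c \<in> atlas M" and d: "d \<in> atlas M" and A: "A \<in> sets borel" "A \<subseteq> cdom c" "A \<subseteq> cdom d"
  shows "emeasure (mc c) A = emeasure (mc d) A"
proof -
  let ?t = "cmap d \<circ> cinv c"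
  let ?S = "cmap c ` (cdom c \<inter> cdom d)"
  have oS: "open ?S" by (rule open_cmap_image[OF c open_cdom[OF d]])
  have sm: "smooth_on ?S ?t" by (rule smooth_trans[OF c d])
  have cdet: "continuous_on ?S (\<lambda>x. det (matrix (fd ?t x)))"
  proof (rule continuous_on_det)
    have "continuous_on ?S (\<lambda>x. \<chi> i j. fd ?t x (axis j 1) $ i)"
      by (intro continuous_on_vec_lambda continuous_on_component smooth_fd_continuous[OF sm oS]) auto
    then show "continuous_on ?S (\<lambda>x. matrix (fd ?t x))" by (simp add: matrix_def)
  qed
  have tc: "?t (cmap c q) = cmap d q" if "q \<in> cdom c" for q using cinv_cmap[OF c that] by simp
  have imA: "?t ` (cmap c ` B) = cmap d ` B" if "B \<subseteq> cdom c" for B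
    unfolding image_image by (rule image_cong[OF refl]) (use tc that in auto)
  have inj: "inj_on ?t ?S"
    unfolding inj_on_def using tc inj_cmap[OF d] by (auto simp: inj_on_def)
  define f where "f = (\<lambda>y. ennreal (indicator (cmap d ` A) y * dn d y))"
  have f: "f \<in> borel_measurable borel"
    unfolding f_def using ind_dn_measurable[OF d cmap_image_borel[OF d A(1,3)] image_mono[OF A(3)]] by simp
  have "(\<integral>\<^sup>+ y. f y * indicator (?t ` ?S) y \<partial>lborel) =
    (\<integral>\<^sup>+ x. ennreal (indicator ?S x * \<bar>det (matrix (fd ?t x))\<bar>) * f (?t x) \<partial>lborel)"
  proof (rule nn_integral_change_of_variables[OF oS _ inj cdet _ f])
    show "(?t has_derivative fd ?t x) (at x)" if "x \<in> ?S" for x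
      by (rule fd_works[OF smooth_on_differentiable[OF sm oS that]])
    fix B :: "(real^'m) set" assume B: "B \<in> sets borel" "B \<subseteq> ?S"
    have "cinv c ` B = {q \<in> cdom c. cmap c q \<in> B}"
    proof (intro equalityI subsetI)
      fix q assume "q \<in> {q \<in> cdom c. cmap c q \<in> B}"
      then show "q \<in> cinv c ` B" using cinv_cmap[OF c, of q] by (intro image_eqI[of _ _ "cmap c q"]) auto
    next
      fix q assume "q \<in> cinv c ` B"
      then obtain y where y: "y \<in> B" "q = cinv c y" by blast
      then have "y \<in> img c" using B by blast
      then show "q \<in> {q \<in> cdom c. cmap c q \<in> B}" using y cmap_cinv cinv_in by auto
    qed
    then have "cinv c ` B \<in> sets borel"
      using borel_preimage_on[OF open_cdom[OF c] cont_cmap[OF c] B(1)] by simp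
    moreover have "cinv c ` B \<subseteq> cdom d" using B cinv_cmap[OF c] by auto
    ultimately have "cmap d ` (cinv c ` B) \<in> sets borel" by (rule cmap_image_borel[OF d])
    then show "?t ` B \<in> sets borel" by (simp add: image_comp)
  qed
  moreover have "(\<integral>\<^sup>+ y. f y * indicator (?t ` ?S) y \<partial>lborel) = emeasure (mc d) A"
  proof -
    have "f y * indicator (?t ` ?S) y = ennreal (dn d y) * indicator (cmap d ` A) y" for y
      using imA[of "cdom c \<inter> cdom d"] A unfolding f_def by (auto simp: indicator_def)
    then show ?thesis unfolding emeasure_mc[OF d A(1,3)] by simp
  qed
  moreover have "(\<integral>\<^sup>+ x. ennreal (indicator ?S x * \<bar>det (matrix (fd ?t x))\<bar>) * f (?t x) \<partial>lborel) = emeasure (mc c) A"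
    unfolding emeasure_mc[OF c A(1,2)]
  proof (rule nn_integral_cong)
    fix x
    show "ennreal (indicator ?S x * \<bar>det (matrix (fd ?t x))\<bar>) * f (?t x) = ennreal (dn c x) * indicator (cmap c ` A) x"
    proof (cases "x \<in> ?S")
      case True
      then obtain q where q: "q \<in> cdom c" "q \<in> cdom d" "x = cmap c q" by blast
      have "q \<in> A \<longleftrightarrow> x \<in> cmap c ` A" "q \<in> A \<longleftrightarrow> cmap d q \<in> cmap d ` A"
        using inj_on_image_mem_iff[OF inj_cmap[OF c] q(1) A(2)] inj_on_image_mem_iff[OF inj_cmap[OF d] q(2) A(3)] q(3)
        by simp_all
      then show ?thesis unfolding f_def q(3) tc[OF q(1)] dn_trans[OF c d q(1,2)]
        using q True by (auto simp: indicator_def ennreal_mult')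
    next
      case False
      then have "x \<notin> cmap c ` A" using A by auto
      then show ?thesis using False by simp
    qed
  qed
  ultimately show ?thesis by simp
qed

definition is_vol :: "'a measure \<Rightarrow> bool" where
  "is_vol \<mu> \<longleftrightarrow> sets \<mu> = sets borel \<and>
     (\<forall>c\<in>atlas M. \<forall>A\<in>sets borel. A \<subseteq> cdom c \<longrightarrow> emeasure \<mu> A = emeasure (mc c) A)"

text \<open>By the Lindelof property countably many charts cover the manifold. After cutting their
  domains into disjoint pieces \<open>D n\<close>, the volume must be the sum of the chart volumes
  on the pieces; \<open>mc_consistent\<close> makes it agree with every other chart.\<close>

lemma is_vol_ex1: "\<exists>!\<mu>. is_vol \<mu>"
proof -
  obtain F where F: "F \<subseteq> cdom ` atlas M" "countable F" "\<Union>F = \<Union>(cdom ` atlas M)"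
    using Lindelof[of "cdom ` atlas M"] open_cdom by blast
  have UF: "\<Union>F = UNIV" unfolding F(3) using chart_ex by blast
  then have Fne: "F \<noteq> {}" by auto
  define ch where "ch U = (SOME c. c \<in> atlas M \<and> cdom c = U)" for U
  have ch: "ch U \<in> atlas M \<and> cdom (ch U) = U" if "U \<in> F" for U
    unfolding ch_def by (rule someI_ex) (use F that in blast)
  define e where "e n = ch (from_nat_into F n)" for n
  have e: "e n \<in> atlas M" "cdom (e n) = from_nat_into F n" for n
    unfolding e_def using ch[OF from_nat_into[OF Fne]] by auto
  have Ue: "(\<Union>n. cdom (e n)) = UNIV"
    unfolding e(2) using UF range_from_nat_into[OF Fne F(2)] by simp
  define D where "D = disjointed (\<lambda>n. cdom (e n))"
  have disD: "disjoint_family D" unfolding D_def by (rule disjoint_family_disjointed)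
  have UD: "(\<Union>n. D n) = UNIV" unfolding D_def UN_disjointed_eq by (rule Ue)
  have Dsub: "D n \<subseteq> cdom (e n)" for n unfolding D_def by (rule disjointed_subset)
  have "range D \<subseteq> sets borel"
    unfolding D_def by (rule sets.range_disjointed_sets) (use open_cdom[OF e(1)] in auto)
  then have Db: "D n \<in> sets borel" for n by auto
  have part: "emeasure \<mu> A = (\<Sum>n. emeasure \<mu> (A \<inter> D n))" if "sets \<mu> = sets borel" "A \<in> sets borel" for \<mu> A
  proof -
    have "(\<Sum>n. emeasure \<mu> (A \<inter> D n)) = emeasure \<mu> (\<Union>n. A \<inter> D n)"
      using disD that Db by (intro suminf_emeasure) (auto simp: disjoint_family_on_def)
    also have "(\<Union>n. A \<inter> D n) = A" using UD by auto
    finally show ?thesis ..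
  qed
  \<comment> \<open>A sum over \<open>n\<close> written as an integral, so that
    \<open>nn_integral_suminf\<close> gives countable additivity.\<close>
  define m where "m A = (\<integral>\<^sup>+ n. emeasure (mc (e n)) (A \<inter> D n) \<partial>count_space UNIV)" for A
  define \<mu> where "\<mu> = measure_of UNIV (sets borel) m"
  have sm: "sets \<mu> = sets borel" unfolding \<mu>_def using sets.sigma_sets_eq[of borel] by simp
  have em: "emeasure \<mu> A = m A" if "A \<in> sets borel" for A
    unfolding \<mu>_def
  proof (rule emeasure_measure_of_sigma)
    show "sigma_algebra UNIV (sets (borel :: 'a measure))" using sets.sigma_algebra_axioms[of borel] by simp
    show "positive (sets borel) m" by (simp add: positive_def m_def)
    show "countably_additive (sets borel) m"
    proof (rule countably_additiveI)
      fix A :: "nat \<Rightarrow> 'a set" assume A: "range A \<subseteq> sets borel" "disjoint_family A"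
      have "(\<Sum>i. m (A i)) = (\<integral>\<^sup>+ n. (\<Sum>i. emeasure (mc (e n)) (A i \<inter> D n)) \<partial>count_space UNIV)"
        unfolding m_def by (rule nn_integral_suminf[symmetric]) simp
      also have "\<dots> = m (\<Union>i. A i)" unfolding m_def
      proof (rule nn_integral_cong)
        fix n
        have "(\<Sum>i. emeasure (mc (e n)) (A i \<inter> D n)) = emeasure (mc (e n)) (\<Union>i. A i \<inter> D n)"
          using A Db by (intro suminf_emeasure) (auto simp: disjoint_family_on_def)
        moreover have "(\<Union>i. A i \<inter> D n) = (\<Union>i. A i) \<inter> D n" by auto
        ultimately show "(\<Sum>i. emeasure (mc (e n)) (A i \<inter> D n)) = emeasure (mc (e n)) ((\<Union>i. A i) \<inter> D n)"
          by simp
      qed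
      finally show "(\<Sum>i. m (A i)) = m (\<Union> (range A))" .
    qed
  qed (use that in auto)
  have "is_vol \<mu>" unfolding is_vol_def
  proof (intro conjI sm ballI impI)
    fix c A assume c: "c \<in> atlas M" and A: "A \<in> sets (borel :: 'a measure)" "A \<subseteq> cdom c"
    have "emeasure \<mu> A = (\<Sum>n. emeasure (mc (e n)) (A \<inter> D n))"
      unfolding em[OF A(1)] m_def by (simp add: nn_integral_count_space_nat)
    also have "\<dots> = (\<Sum>n. emeasure (mc c) (A \<inter> D n))"
      by (rule suminf_cong, rule mc_consistent[OF e(1) c]) (use A Db Dsub in auto)
    also have "\<dots> = emeasure (mc c) A" by (rule part[symmetric]) (use A in auto)
    finally show "emeasure \<mu> A = emeasure (mc c) A" .
  qed
  moreover have "\<nu> = \<mu>" if nu: "is_vol \<nu>" for \<nu>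
  proof (rule measure_eqI)
    show "sets \<nu> = sets \<mu>" using nu sm unfolding is_vol_def by simp
    fix A assume "A \<in> sets \<nu>"
    then have A: "A \<in> sets borel" using nu unfolding is_vol_def by simp
    have "emeasure \<nu> (A \<inter> D n) = emeasure \<mu> (A \<inter> D n)" for n
    proof -
      have "A \<inter> D n \<in> sets borel" "A \<inter> D n \<subseteq> cdom (e n)" using A Db Dsub by auto
      then show ?thesis using nu \<open>is_vol \<mu>\<close> e(1)[of n] unfolding is_vol_def by simp
    qed
    then show "emeasure \<nu> A = emeasure \<mu> A"
      using part[of \<nu> A] part[of \<mu> A] A nu sm unfolding is_vol_def by simp
  qed
  ultimately show ?thesis by blast
qed

abbreviation vol :: "'a measure" where "vol \<equiv> riem_vol M"

lemma is_vol: "is_vol vol"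
proof -
  have "is_vol \<mu> \<longleftrightarrow> (sets \<mu> = sets borel \<and>
     (\<forall>c\<in>atlas M. \<forall>A\<in>sets borel. A \<subseteq> cdom c \<longrightarrow>
        emeasure \<mu> A = (\<integral>\<^sup>+ x\<in>cmap c ` A. ennreal (sqrt (det (gmat M c x))) \<partial>lborel)))" for \<mu>
    unfolding is_vol_def using emeasure_mc by (simp add: dn_def)
  then have "vol = (THE \<mu>. is_vol \<mu>)" unfolding riem_vol_def by simp
  then show ?thesis using theI'[OF is_vol_ex1] by simp
qed

lemma sets_vol [simp]: "sets vol = sets borel"
  using is_vol unfolding is_vol_def by blast

lemma space_vol [simp]: "space vol = UNIV"
  using sets_eq_imp_space_eq[OF sets_vol] by simp

lemma measurable_vol [simp]: "measurable vol N = measurable borel N"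
  by (rule measurable_cong_sets) simp_all

lemma vol_chart: "c \<in> atlas M \<Longrightarrow> A \<in> sets borel \<Longrightarrow> A \<subseteq> cdom c \<Longrightarrow> emeasure vol A = emeasure (mc c) A"
  using is_vol unfolding is_vol_def by blast

lemma nn_integral_vol_chart:
  assumes c: "c \<in> atlas M" and f: "f \<in> borel_measurable borel" and z: "\<And>q. q \<notin> cdom c \<Longrightarrow> f q = 0"
  shows "(\<integral>\<^sup>+ q. f q \<partial>vol) = (\<integral>\<^sup>+ y. ennreal (indicator (img c) y * dn c y) * f (cinv c y) \<partial>lborel)"
proof -
  have cb: "cdom c \<in> sets borel" using open_cdom[OF c] by simp
  have "density vol (indicator (cdom c)) = density (mc c) (indicator (cdom c))"
  proof (rule measure_eqI)
    fix A assume "A \<in> sets (density vol (indicator (cdom c)))"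
    then have A: "A \<in> sets borel" by simp
    have "emeasure (density vol (indicator (cdom c))) A = emeasure vol (cdom c \<inter> A)"
      using A cb by (subst emeasure_density) (auto simp: indicator_inter_arith[symmetric])
    also have "\<dots> = emeasure (mc c) (cdom c \<inter> A)" by (rule vol_chart[OF c]) (use A cb in auto)
    also have "\<dots> = emeasure (density (mc c) (indicator (cdom c))) A"
      using A cb by (subst emeasure_density) (auto simp: indicator_inter_arith[symmetric] intro!: borel_measurable_indicator)
    finally show "emeasure (density vol (indicator (cdom c))) A = emeasure (density (mc c) (indicator (cdom c))) A" .
  qed simp
  then have "(\<integral>\<^sup>+ q. indicator (cdom c) q * f q \<partial>vol) = (\<integral>\<^sup>+ q. indicator (cdom c) q * f q \<partial>mc c)"
    using f cb by (subst (1 2) nn_integral_density[symmetric]) (auto simp: measurable_cong_sets[OF sets_mc refl])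
  moreover have "indicator (cdom c) q * f q = f q" for q using z by (auto simp: indicator_def)
  ultimately show ?thesis using nn_integral_mc[OF c f] by simp
qed

lemma vol_compact_finite:
  assumes K: "compact K" shows "emeasure vol K < \<infinity>"
proof -
  have "\<exists>V. open V \<and> q \<in> V \<and> emeasure vol V < \<infinity>" for q
  proof -
    obtain c where c: "c \<in> atlas M" "q \<in> cdom c" using chart_ex by blast
    have "cmap c q \<in> img c" using c by blast
    then obtain r where r: "r > 0" "cball (cmap c q) r \<subseteq> img c"
      using open_img[OF c(1)] open_contains_cball by blast
    let ?B = "ball (cmap c q) r"
    have Bi: "?B \<subseteq> img c" using r by (meson ball_subset_cball order_trans)
    have "bounded (dn c ` cball (cmap c q) r)"
      by (intro compact_imp_bounded compact_continuous_image continuous_on_subset[OF cont_dn[OF c(1)] r(2)] compact_cball)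
    then obtain b where b: "b > 0" "\<And>y. y \<in> cball (cmap c q) r \<Longrightarrow> \<bar>dn c y\<bar> \<le> b"
      unfolding bounded_pos by auto
    have o: "open (cinv c ` ?B)" by (rule open_cinv_image[OF c(1) open_ball Bi])
    have s: "cinv c ` ?B \<subseteq> cdom c" using Bi cinv_in by auto
    have i: "cmap c ` cinv c ` ?B = ?B" by (rule image_inv_into_cancel[OF refl Bi])
    have "emeasure vol (cinv c ` ?B) = (\<integral>\<^sup>+ x\<in>?B. ennreal (dn c x) \<partial>lborel)"
      using o s by (simp add: vol_chart[OF c(1)] emeasure_mc[OF c(1)] i)
    also have "\<dots> \<le> (\<integral>\<^sup>+ x. ennreal b * indicator ?B x \<partial>lborel)"
    proof (rule nn_integral_mono)
      fix x
      show "ennreal (dn c x) * indicator ?B x \<le> ennreal b * indicator ?B x"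
      proof (cases "x \<in> ?B")
        case True
        then have "dn c x \<le> b" using b(2)[of x] by auto
        then show ?thesis using True by (simp add: ennreal_leI)
      qed simp
    qed
    also have "\<dots> = ennreal b * emeasure lborel ?B" by (rule nn_integral_cmult_indicator) simp
    also have "\<dots> < \<infinity>" using emeasure_lborel_ball_finite[of "cmap c q" r] by (simp add: ennreal_mult_less_top)
    finally have "emeasure vol (cinv c ` ?B) < \<infinity>" .
    moreover have "q \<in> cinv c ` ?B" by (rule image_eqI[of _ _ "cmap c q"]) (use cinv_cmap[OF c] r in auto)
    ultimately show ?thesis using o by blast
  qed
  then obtain V where V: "\<And>q. open (V q) \<and> q \<in> V q \<and> emeasure vol (V q) < \<infinity>" by metis
  have "K \<subseteq> (\<Union>q\<in>K. V q)" using V by blast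
  then obtain F where F: "F \<subseteq> K" "finite F" "K \<subseteq> (\<Union>q\<in>F. V q)"
    using compactE_image[OF K, of K V] V by blast
  have "emeasure vol K \<le> emeasure vol (\<Union>q\<in>F. V q)"
    using F V by (intro emeasure_mono) (auto intro!: borel_open)
  also have "\<dots> \<le> (\<Sum>q\<in>F. emeasure vol (V q))"
    using F V by (intro emeasure_subadditive_finite) auto
  also have "\<dots> < \<infinity>" using F V by (simp add: ennreal_sum_less_top)
  finally show ?thesis .
qed

text \<open>Freeze the metric at the center \<open>x\<close> as \<open>G\<close>. Near
  \<open>x\<close> the metric is at most \<open>4 * G\<close>, so the ball of radius
  \<open>s\<close> contains the ellipsoid of \<open>G\<close>-radius \<open>s / 2\<close>, and the
  density is at least half of that at \<open>x\<close>. With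
  \<open>dn c x * \<bar>det A\<bar> = 1\<close> this gives half the volume of the Euclidean ball of
  radius \<open>s / 2\<close>, hence the denominator \<open>2 ^ (CARD('m) + 1)\<close>.\<close>

lemma vol_ball_lower:
  obtains s0 where "s0 > 0" "\<And>s. 0 < s \<Longrightarrow> s < s0 \<Longrightarrow>
    ennreal (unit_ball_vol (real CARD('m)) / 2 ^ (CARD('m) + 1) * s ^ CARD('m)) \<le> emeasure vol {q. dist_M \<xi> q < s}"
proof -
  obtain c where c: "c \<in> atlas M" "\<xi> \<in> cdom c" using chart_ex by blast
  define x where "x = cmap c \<xi>"
  have xi: "x \<in> img c" using c unfolding x_def by blast
  then obtain r where r: "r > 0" "cball x r \<subseteq> img c"
    using open_img[OF c(1)] open_contains_cball by blast
  define G where "G = gmat M c x"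
  have pG: "posdef G" unfolding G_def by (rule posdef_g[OF c(1) xi])
  obtain A :: "real^'m^'m" where A: "transpose A ** G ** A = mat 1" by (rule posdef_frame[OF pG])
  obtain l where l: "l > 0" "\<And>z v. z \<in> {x} \<Longrightarrow> l * norm v \<le> sqrt (ip (gmat M c z) v v)"
    by (rule chart_lower_bound[OF c(1), of "{x}"]) (use xi in auto)
  have lG: "l\<^sup>2 * (norm v)\<^sup>2 \<le> ip G v v" for v
  proof -
    have "(l * norm v)\<^sup>2 \<le> (sqrt (ip G v v))\<^sup>2" using l by (intro power_mono) (auto simp: G_def)
    then show ?thesis using posdef_nonneg[OF pG] by (simp add: power_mult_distrib)
  qed
  have xint: "x \<in> interior (img c)" using xi unfolding interior_open[OF open_img[OF c(1)]] .
  have ic: "isCont (gmat M c) x" "isCont (dn c) x"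
    by (rule continuous_on_interior[OF cont_g[OF c(1)] xint], rule continuous_on_interior[OF cont_dn[OF c(1)] xint])
  \<comment> \<open>The tolerances for these comparisons: by \<open>ip_mat_bound\<close> the first
    one changes the quadratic form by at most \<open>3 * ip G v v\<close>, and the second one keeps
    half of the density.\<close>
  have ps: "3 * l\<^sup>2 / real CARD('m) > 0" "dn c x / 2 > 0" using l(1) dn_pos[OF c(1) xi] by simp_all
  obtain d1 where d1: "d1 > 0" "\<forall>z. dist z x < d1 \<longrightarrow> dist (gmat M c z) G < 3 * l\<^sup>2 / real CARD('m)"
    using ic(1)[unfolded continuous_at_eps_delta, rule_format, OF ps(1)] unfolding G_def by blast
  obtain d2 where d2: "d2 > 0" "\<forall>z. dist z x < d2 \<longrightarrow> dist (dn c z) (dn c x) < dn c x / 2"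
    using ic(2)[unfolded continuous_at_eps_delta, rule_format, OF ps(2)] by blast
  define \<delta> where "\<delta> = min r (min d1 d2)"
  have dl: "\<delta> > 0" unfolding \<delta>_def using r d1 d2 by simp
  have Bi: "ball x \<delta> \<subseteq> img c" using r unfolding \<delta>_def by (auto intro!: subsetD[OF r(2)])
  have up: "ip (gmat M c z) v v \<le> 4 * ip G v v" if "z \<in> ball x \<delta>" for z v
  proof -
    have n: "norm (gmat M c z - G) \<le> 3 * l\<^sup>2 / real CARD('m)"
      using d1(2)[rule_format, of z] that unfolding \<delta>_def by (simp add: dist_norm norm_minus_commute)
    have "ip (gmat M c z) v v - ip G v v = ip (gmat M c z - G) v v" by (simp add: ip_diff_mat)
    also have "\<dots> \<le> real CARD('m) * norm (gmat M c z - G) * norm v * norm v" using ip_mat_bound[of "gmat M c z - G" v v] by linarith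
    also have "\<dots> \<le> real CARD('m) * (3 * l\<^sup>2 / real CARD('m)) * norm v * norm v"
      by (intro mult_right_mono mult_left_mono n) auto
    also have "\<dots> = 3 * (l\<^sup>2 * (norm v)\<^sup>2)" by (simp add: power2_eq_square)
    also have "\<dots> \<le> 3 * ip G v v" using lG by simp
    finally show ?thesis by simp
  qed
  have dlow: "dn c x / 2 \<le> dn c z" if "z \<in> ball x \<delta>" for z
  proof -
    have "\<bar>dn c z - dn c x\<bar> < dn c x / 2"
      using d2(2)[rule_format, of z] that unfolding \<delta>_def by (simp add: dist_real_def dist_commute)
    then show ?thesis by linarith
  qed
  have nA: "ip G (A *v w) (A *v w) = (norm w)\<^sup>2" for w
    unfolding ip_congruence[symmetric] A by (simp add: ip_mat1 power2_norm_eq_inner)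
  define g where "g w = x + A *v w" for w
  have main: "ennreal (unit_ball_vol (real CARD('m)) / 2 ^ (CARD('m) + 1) * s ^ CARD('m)) \<le> emeasure vol {q. dist_M \<xi> q < s}"
    if s: "0 < s" "s < 2 * l * \<delta>" for s
  proof -
    define E where "E = g ` ball 0 (s/2)"
    have gin: "g w \<in> ball x \<delta>" if "w \<in> ball 0 (s/2)" for w
    proof -
      have "l * norm (A *v w) \<le> sqrt (ip G (A *v w) (A *v w))" using l(2)[of x] by (simp add: G_def)
      also have "\<dots> = norm w" by (simp add: nA)
      also have "\<dots> < l * \<delta>" using that s by simp
      finally show ?thesis using l(1) by (simp add: g_def dist_norm)
    qed
    have E1: "E \<subseteq> ball x \<delta>" unfolding E_def using gin by blast
    have near: "dist_M \<xi> (g' ) < s" if "w \<in> ball 0 (s/2)" "g' = cinv c (g w)" for w g'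
    proof -
      have sg: "closed_segment x (g w) \<subseteq> ball x \<delta>"
        using gin[OF that(1)] dl by (intro closed_segment_subset) auto
      have "ed (cinv c x) (cinv c (g w)) \<le> ennreal (2 * norm w)"
      proof (rule ed_segment[OF c(1)])
        show "closed_segment x (g w) \<subseteq> img c" using sg Bi by blast
        fix z assume "z \<in> closed_segment x (g w)"
        then have "ip (gmat M c z) (g w - x) (g w - x) \<le> 4 * ip G (A *v w) (A *v w)"
          using up[of z "A *v w"] sg by (auto simp: g_def)
        then show "ip (gmat M c z) (g w - x) (g w - x) \<le> (2 * norm w)\<^sup>2" by (simp add: nA power_mult_distrib)
      qed simp
      then have "dist_M \<xi> g' \<le> 2 * norm w"
        using cinv_cmap[OF c] that(2) by (subst rdist_le_iff) (auto simp: x_def)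
      then show ?thesis using that(1) by simp
    qed
    have inA: "matrix_inv A ** A = mat 1" "A ** matrix_inv A = mat 1"
      using matrix_inv_works[OF frame_props(3)[OF A]] by blast+
    have Ev: "E = (\<lambda>y. matrix_inv A *v (y - x)) -` ball 0 (s/2)"
    proof (intro equalityI subsetI)
      fix y assume "y \<in> E"
      then show "y \<in> (\<lambda>y. matrix_inv A *v (y - x)) -` ball 0 (s/2)"
        by (auto simp: E_def g_def matrix_vector_mul_assoc inA)
    next
      fix y assume "y \<in> (\<lambda>y. matrix_inv A *v (y - x)) -` ball 0 (s/2)"
      then show "y \<in> E" unfolding E_def
        by (intro image_eqI[of _ _ "matrix_inv A *v (y - x)"]) (auto simp: g_def matrix_vector_mul_assoc inA)
    qed
    have oE: "open E" unfolding Ev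
      by (intro open_vimage open_ball continuous_intros linear_continuous_on_compose[where g="(*v) (matrix_inv A)"]) auto
    have Ei: "E \<subseteq> img c" using E1 Bi by blast
    have "emeasure lborel E = (\<integral>\<^sup>+ (w::real^'m). ennreal (indicator (ball 0 (s/2)) w * \<bar>det (matrix ((*v) A))\<bar>) \<partial>lborel)"
      unfolding E_def
    proof (rule emeasure_diff_image[where g'="\<lambda>_. (*v) A"])
      show "g ` ball 0 (s/2) \<in> sets borel" using oE unfolding E_def by simp
      show "(g has_derivative (*v) A) (at w)" for w
        unfolding g_def by (auto intro!: derivative_eq_intros bounded_linear_imp_has_derivative)
      show "inj_on g (ball 0 (s/2))"
      proof (rule inj_onI)
        fix u v assume "g u = g v"
        then have "matrix_inv A *v (A *v u) = matrix_inv A *v (A *v v)" by (simp add: g_def)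
        then show "u = v" by (simp add: matrix_vector_mul_assoc inA)
      qed
      show "(\<lambda>w. indicator (ball 0 (s/2)) w * \<bar>det (matrix ((*v) A))\<bar>) \<in> borel_measurable borel"
        by (intro borel_measurable_times borel_measurable_indicator) auto
    qed auto
    also have "\<dots> = (\<integral>\<^sup>+ (w::real^'m). ennreal \<bar>det A\<bar> * indicator (ball 0 (s/2)) w \<partial>lborel)"
      by (rule nn_integral_cong) (auto simp: indicator_def matrix_of_matrix_vector_mul)
    also have "\<dots> = ennreal \<bar>det A\<bar> * emeasure lborel (ball (0::real^'m) (s/2))"
      by (rule nn_integral_cmult_indicator) simp
    also have "\<dots> = ennreal (\<bar>det A\<bar> * (unit_ball_vol (real CARD('m)) * (s/2) ^ CARD('m)))"
      using s by (simp add: emeasure_ball ennreal_mult')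
    finally have mE: "emeasure lborel E = ennreal (\<bar>det A\<bar> * (unit_ball_vol (real CARD('m)) * (s/2) ^ CARD('m)))" .
    have dA: "dn c x * \<bar>det A\<bar> = 1"
    proof -
      have "dn c x * \<bar>det A\<bar> = sqrt (det G * (det A)\<^sup>2)" by (simp add: dn_def G_def real_sqrt_mult)
      then show ?thesis using frame_props(4)[OF A] by (simp add: mult.commute)
    qed
    have "dn c x / 2 * (\<bar>det A\<bar> * (unit_ball_vol (real CARD('m)) * (s/2) ^ CARD('m)))
      = (dn c x * \<bar>det A\<bar>) * (unit_ball_vol (real CARD('m)) / 2 ^ (CARD('m) + 1) * s ^ CARD('m))"
      by (simp add: power_divide)
    then have "ennreal (unit_ball_vol (real CARD('m)) / 2 ^ (CARD('m) + 1) * s ^ CARD('m))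
      = ennreal (dn c x / 2 * (\<bar>det A\<bar> * (unit_ball_vol (real CARD('m)) * (s/2) ^ CARD('m))))"
      unfolding dA by (simp only: mult_1)
    also have "\<dots> = ennreal (dn c x / 2) * emeasure lborel E"
      unfolding mE by (rule ennreal_mult') (use dn_pos[OF c(1) xi] in simp)
    also have "\<dots> = (\<integral>\<^sup>+ y. ennreal (dn c x / 2) * indicator E y \<partial>lborel)"
      using oE by (simp add: nn_integral_cmult_indicator)
    also have "\<dots> \<le> (\<integral>\<^sup>+ y. ennreal (dn c y) * indicator E y \<partial>lborel)"
    proof (rule nn_integral_mono)
      fix y
      show "ennreal (dn c x / 2) * indicator E y \<le> ennreal (dn c y) * indicator E y"
        using dlow[of y] E1 by (cases "y \<in> E") (auto intro!: ennreal_leI)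
    qed
    also have "\<dots> = emeasure vol (cinv c ` E)"
    proof -
      have "cmap c ` cinv c ` E = E" by (rule image_inv_into_cancel[OF refl Ei])
      moreover have "cinv c ` E \<subseteq> cdom c" using Ei cinv_in by auto
      ultimately show ?thesis
        using open_cinv_image[OF c(1) oE Ei] by (simp add: vol_chart[OF c(1)] emeasure_mc[OF c(1)])
    qed
    also have "\<dots> \<le> emeasure vol {q. dist_M \<xi> q < s}"
      using near open_db[of \<xi> s] unfolding E_def by (intro emeasure_mono) auto
    finally show ?thesis .
  qed
  show ?thesis using that[of "2 * l * \<delta>"] main l dl by simp
qed

end

section \<open>The divergence theorem in coordinates\<close>

lemma det_near_1:
  obtains \<delta> where "\<delta> > 0" "\<And>H :: real^'m::finite^'m. norm H < \<delta> \<Longrightarrow> \<bar>det (mat 1 + H) - 1 - trace H\<bar> \<le> norm H"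
proof -
  have "\<exists>d>0. \<forall>Y::real^'m^'m. norm (Y - mat 1) < d \<longrightarrow> norm (det Y - det (mat 1 :: real^'m^'m) - trace (Y - mat 1)) \<le> 1 * norm (Y - mat 1)"
    using has_derivative_det_1[where 'm='m] unfolding has_derivative_at_alt by (metis zero_less_one)
  then obtain d where d: "d > 0" "\<And>Y::real^'m^'m. norm (Y - mat 1) < d \<Longrightarrow> norm (det Y - det (mat 1 :: real^'m^'m) - trace (Y - mat 1)) \<le> 1 * norm (Y - mat 1)"
    by blast
  show ?thesis
  proof (rule that[OF d(1)])
    fix H :: "real^'m^'m" assume "norm H < d"
    then show "\<bar>det (mat 1 + H) - 1 - trace H\<bar> \<le> norm H" using d(2)[of "mat 1 + H"] by simp
  qed
qed

lemma trace_bound: "\<bar>trace H\<bar> \<le> real CARD('m) * norm (H :: real^'m::finite^'m)"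
proof -
  have "\<bar>trace H\<bar> \<le> (\<Sum>i\<in>UNIV. \<bar>H $ i $ i\<bar>)" unfolding trace_def by (rule sum_abs)
  also have "\<dots> \<le> (\<Sum>i\<in>(UNIV::'m set). norm H)"
    by (intro sum_mono order_trans[OF component_le_norm_cart Finite_Cartesian_Product.norm_nth_le])
  finally show ?thesis by simp
qed

lemma compact_bound:
  assumes "compact K" "continuous_on K f"
  obtains b where "b > 0" "\<And>x. x \<in> K \<Longrightarrow> norm (f x) \<le> b"
  using compact_imp_bounded[OF compact_continuous_image[OF assms(2,1)]] unfolding bounded_pos by auto

text \<open>The diffeomorphisms \<open>x \<mapsto> x + h Z x\<close> for small \<open>h\<close> replace the flow of \<open>Z\<close>.\<close>

locale shift_field =
  fixes Z :: "real^'m::finite \<Rightarrow> real^'m" and B :: "real^'m \<Rightarrow> real^'m^'m" and K :: "(real^'m) set"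
  assumes Zd: "\<And>x. (Z has_derivative (*v) (B x)) (at x)"
    and Bc: "continuous_on UNIV B"
    and K: "compact K" and Z0: "\<And>x. x \<notin> K \<Longrightarrow> Z x = 0"
begin

lemma B0: "x \<notin> K \<Longrightarrow> B x = 0"
proof -
  assume x: "x \<notin> K"
  have "open (- K)" using K by (simp add: compact_imp_closed open_Compl)
  then have "((\<lambda>_. 0) has_derivative (*v) (B x)) (at x)"
    using has_derivative_cong_open[of "- K" x Z "\<lambda>_. 0"] Z0 x Zd by auto
  then have "(*v) (B x) = (\<lambda>_. 0)" using has_derivative_unique has_derivative_const by blast
  then have "B x *v axis j 1 = 0" for j by metis
  then show "B x = 0" by (simp add: vec_eq_iff matrix_vector_mult_basis column_def)
qed

lemma B_bound: obtains b where "b > 0" "\<And>x. norm (B x) \<le> b"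
proof -
  obtain b where b: "b > 0" "\<And>x. x \<in> K \<Longrightarrow> norm (B x) \<le> b"
    using compact_bound[OF K continuous_on_subset[OF Bc]] by blast
  have "norm (B x) \<le> b" for x using b B0[of x] by (cases "x \<in> K") auto
  then show ?thesis using b that by blast
qed

lemma Z_lipschitz: obtains M where "M > 0" "\<And>x y. norm (Z x - Z y) \<le> M * norm (x - y)"
proof -
  obtain b where b: "b > 0" "\<And>x. norm (B x) \<le> b" using B_bound by blast
  have on: "onorm ((*v) (B x)) \<le> real CARD('m) * b" for x
  proof (rule onorm_le)
    fix v
    have "norm (B x *v v) \<le> real CARD('m) * (norm (B x) * norm v)" by (rule norm_mat_vec_bound)
    also have "\<dots> \<le> real CARD('m) * (b * norm v)" using b by (intro mult_left_mono mult_right_mono) auto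
    finally show "norm (B x *v v) \<le> real CARD('m) * b * norm v" by (simp add: mult_ac)
  qed
  have "norm (Z x - Z y) \<le> real CARD('m) * b * norm (x - y)" for x y
    by (rule differentiable_bound[of UNIV Z "\<lambda>x. (*v) (B x)"]) (use Zd on in auto)
  then show ?thesis using that[of "real CARD('m) * b"] b by simp
qed

definition T :: "real \<Rightarrow> real^'m \<Rightarrow> real^'m" where "T h x = x + h *\<^sub>R Z x"

lemma T_outside: "x \<notin> K \<Longrightarrow> T h x = x"
  by (simp add: T_def Z0)

lemma T_derivative: "(T h has_derivative (*v) (mat 1 + h *\<^sub>R B x)) (at x)"
proof -
  have "(T h has_derivative (\<lambda>v. v + h *\<^sub>R (B x *v v))) (at x)"
    unfolding T_def[abs_def] by (intro has_derivative_add has_derivative_ident has_derivative_scaleR_right Zd)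
  moreover have "v + h *\<^sub>R (B x *v v) = (mat 1 + h *\<^sub>R B x) *v v" for v
    by (simp add: matrix_vector_mult_add_rdistrib scaleR_matrix_vector_assoc)
  ultimately show ?thesis by simp
qed

text \<open>For \<open>h\<close> below \<open>1 / (2 * M)\<close>, with \<open>M\<close> a Lipschitz
  constant of \<open>Z\<close>, the map \<open>T h\<close> shrinks distances by at most the factor
  2. This gives injectivity and a Lipschitz inverse; surjectivity is Banach's fixed point theorem.
  Points outside \<open>K\<close> are fixed, so by injectivity no point of \<open>K\<close> leaves
  \<open>K\<close>.\<close>

lemma T_bij:
  obtains h0 where "h0 > 0" "\<And>h. 0 \<le> h \<Longrightarrow> h < h0 \<Longrightarrow> bij (T h)"
    "\<And>h. 0 \<le> h \<Longrightarrow> h < h0 \<Longrightarrow> continuous_on UNIV (inv (T h))"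
    "\<And>h x. 0 \<le> h \<Longrightarrow> h < h0 \<Longrightarrow> T h x \<in> K \<longleftrightarrow> x \<in> K"
proof -
  obtain M where M: "M > 0" "\<And>x y. norm (Z x - Z y) \<le> M * norm (x - y)" using Z_lipschitz by blast
  have exp: "norm (x - y) / 2 \<le> norm (T h x - T h y)" if h: "0 \<le> h" "h < 1 / (2 * M)" for h x y
  proof -
    have "h * M \<le> 1 / 2" using h M by (simp add: field_simps)
    then have "h * M * norm (x - y) \<le> 1 / 2 * norm (x - y)" by (rule mult_right_mono) simp
    moreover have "norm (h *\<^sub>R (Z x - Z y)) \<le> h * (M * norm (x - y))"
      using h M(2)[of x y] by (simp add: mult_left_mono)
    moreover have "norm (x - y) \<le> norm (T h x - T h y) + norm (h *\<^sub>R (Z x - Z y))"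
      using norm_triangle_ineq4[of "T h x - T h y" "h *\<^sub>R (Z x - Z y)"] by (simp add: T_def algebra_simps)
    ultimately show ?thesis by (simp add: mult.assoc)
  qed
  have bij: "bij (T h)" if h: "0 \<le> h" "h < 1 / (2 * M)" for h
  proof (rule bijI)
    show "inj (T h)"
    proof (rule injI)
      fix x y assume "T h x = T h y"
      then show "x = y" using exp[OF h, of x y] by simp
    qed
    show "surj (T h)"
      unfolding surj_def
    proof (rule allI)
      fix y
      have hM: "h * M \<le> 1 / 2" using h M by (simp add: field_simps)
      have "\<exists>!x. y - h *\<^sub>R Z x = x"
      proof (rule banach_fix_type[of "1/2"])
        have "norm (h *\<^sub>R Z x' - h *\<^sub>R Z x) \<le> 1 / 2 * norm (x - x')" for x x'
        proof -
          have "norm (h *\<^sub>R Z x' - h *\<^sub>R Z x) = h * norm (Z x' - Z x)" using h by (simp flip: scaleR_diff_right)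
          also have "\<dots> \<le> h * (M * norm (x' - x))" using h M(2) by (intro mult_left_mono) auto
          also have "\<dots> = (h * M) * norm (x - x')" by (simp add: norm_minus_commute)
          also have "\<dots> \<le> 1 / 2 * norm (x - x')" by (rule mult_right_mono[OF hM]) simp
          finally show ?thesis .
        qed
        then show "\<forall>x. \<forall>x'. dist (y - h *\<^sub>R Z x) (y - h *\<^sub>R Z x') \<le> 1 / 2 * dist x x'"
          by (simp add: dist_norm)
      qed auto
      then obtain x where "y - h *\<^sub>R Z x = x" by blast
      then show "\<exists>x. y = T h x" by (intro exI[of _ x]) (simp add: T_def algebra_simps)
    qed
  qed
  have inK: "T h x \<in> K \<longleftrightarrow> x \<in> K" if h: "0 \<le> h" "h < 1 / (2 * M)" for h x
  proof
    assume "T h x \<in> K" then show "x \<in> K" using T_outside[of x h] by metis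
  next
    assume "x \<in> K"
    show "T h x \<in> K"
    proof (rule ccontr)
      assume n: "T h x \<notin> K"
      then have "T h (T h x) = T h x" by (rule T_outside)
      then have "T h x = x" using bij[OF h] by (simp add: bij_def inj_eq)
      then show False using n \<open>x \<in> K\<close> by simp
    qed
  qed
  have cinv: "continuous_on UNIV (inv (T h))" if h: "0 \<le> h" "h < 1 / (2 * M)" for h
  proof -
    have "dist (inv (T h) y) (inv (T h) y') \<le> 2 * dist y y'" for y y'
      using exp[OF h, of "inv (T h) y" "inv (T h) y'"] bij[OF h] by (simp add: dist_norm bij_is_surj surj_f_inv_f)
    then have "2-lipschitz_on UNIV (inv (T h))" by (intro lipschitz_onI) auto
    then show ?thesis by (rule lipschitz_on_continuous_on)
  qed
  show ?thesis using that[of "1 / (2 * M)"] M bij inK cinv by simp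
qed

text \<open>First-order expansion of the determinant, with the uniform bound \<open>b\<close> of
  \<open>B\<close>; \<open>c * h < 1\<close> keeps the determinant positive.\<close>

lemma det_bounds:
  obtains h0 c where "h0 > 0" "c > 0"
    "\<And>h x. 0 \<le> h \<Longrightarrow> h < h0 \<Longrightarrow> \<bar>det (mat 1 + h *\<^sub>R B x) - 1\<bar> \<le> c * h"
    "\<And>h x. 0 \<le> h \<Longrightarrow> h < h0 \<Longrightarrow> det (mat 1 + h *\<^sub>R B x) > 0"
proof -
  obtain \<delta> where d: "\<delta> > 0" "\<And>H :: real^'m^'m. norm H < \<delta> \<Longrightarrow> \<bar>det (mat 1 + H) - 1 - trace H\<bar> \<le> norm H"
    by (rule det_near_1) blast
  obtain b where b: "b > 0" "\<And>x. norm (B x) \<le> b" using B_bound by blast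
  define c where "c = (real CARD('m) + 1) * b"
  have c: "c > 0" unfolding c_def using b by (simp add: add_pos_nonneg)
  define h0 where "h0 = min (\<delta> / b) (1 / c)"
  have h0: "h0 > 0" unfolding h0_def using d b c by simp
  have 1: "\<bar>det (mat 1 + h *\<^sub>R B x) - 1\<bar> \<le> c * h" if h: "0 \<le> h" "h < h0" for h x
  proof -
    have nh: "norm (h *\<^sub>R B x) \<le> h * b" using h b by (simp add: mult_left_mono)
    have "h < \<delta> / b" using h unfolding h0_def by simp
    then have "h * b < \<delta>" using b(1) by (simp add: field_simps)
    then have "\<bar>det (mat 1 + h *\<^sub>R B x) - 1 - trace (h *\<^sub>R B x)\<bar> \<le> h * b"
      using d(2)[of "h *\<^sub>R B x"] nh by linarith
    moreover have "\<bar>trace (h *\<^sub>R B x)\<bar> \<le> real CARD('m) * (h * b)"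
      by (rule order_trans[OF trace_bound mult_left_mono[OF nh]]) simp
    ultimately show ?thesis unfolding c_def by (simp add: algebra_simps)
  qed
  have 2: "det (mat 1 + h *\<^sub>R B x) > 0" if h: "0 \<le> h" "h < h0" for h x
  proof -
    have "h < 1 / c" using h unfolding h0_def by simp
    then have "c * h < 1" using c by (simp add: field_simps)
    then show ?thesis using 1[OF h, of x] by linarith
  qed
  show ?thesis using that[OF h0 c 1 2] .
qed

text \<open>Change of variables along \<open>T h\<close>; as \<open>T h\<close> preserves
  \<open>K\<close>, the indicator stays the same.\<close>

lemma transport:
  assumes h: "bij (T h)" "continuous_on UNIV (inv (T h))" "\<And>x. T h x \<in> K \<longleftrightarrow> x \<in> K"
    and pos: "\<And>x. det (mat 1 + h *\<^sub>R B x) > 0" and g: "continuous_on K g" "\<And>x. x \<in> K \<Longrightarrow> g x \<ge> 0"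
  shows "(\<integral>x. indicator K x * g x \<partial>lborel) = (\<integral>x. indicator K x * (g (T h x) * det (mat 1 + h *\<^sub>R B x)) \<partial>lborel)"
proof -
  have Kb: "K \<in> sets borel" using K by (simp add: borel_compact)
  have gm: "(\<lambda>x. indicator K x * g x) \<in> borel_measurable borel"
    using borel_measurable_continuous_on_indicator[OF Kb g(1)] by simp
  let ?D = "\<lambda>x. det (mat 1 + h *\<^sub>R B x)"
  have Tc: "continuous_on UNIV (T h)"
    using T_derivative by (meson continuous_at_imp_continuous_on has_derivative_continuous)
  have Dc: "continuous_on UNIV ?D" by (intro continuous_on_det continuous_intros Bc)
  have D': "matrix ((*v) (mat 1 + h *\<^sub>R B x)) = mat 1 + h *\<^sub>R B x" for x by (rule matrix_of_matrix_vector_mul)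
  have g2c: "continuous_on K (\<lambda>x. g (T h x) * ?D x)"
    by (intro continuous_intros continuous_on_compose2[OF g(1)] continuous_on_subset[OF Tc] continuous_on_subset[OF Dc])
      (use h(3) in auto)
  have gm2: "(\<lambda>x. indicator K x * (g (T h x) * ?D x)) \<in> borel_measurable borel"
    using borel_measurable_continuous_on_indicator[OF Kb g2c] by simp
  have nn: "indicator K x * g x \<ge> 0" for x using g(2) by (auto simp: indicator_def)
  have nn2: "indicator K x * (g (T h x) * ?D x) \<ge> 0" for x
    using g(2) h(3) pos[of x] by (auto simp: indicator_def)
  have "(\<integral>\<^sup>+ y. ennreal (indicator K y * g y) * indicator (T h ` UNIV) y \<partial>lborel) =
    (\<integral>\<^sup>+ x. ennreal (indicator UNIV x * \<bar>det (matrix ((*v) (mat 1 + h *\<^sub>R B x)))\<bar>) * ennreal (indicator K (T h x) * g (T h x)) \<partial>lborel)"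
  proof (rule nn_integral_change_of_variables[where g'="\<lambda>x. (*v) (mat 1 + h *\<^sub>R B x)"])
    show "inj (T h)" using h(1) by (rule bij_is_inj)
    show "continuous_on UNIV (\<lambda>x. det (matrix ((*v) (mat 1 + h *\<^sub>R B x))))" unfolding D' by (rule Dc)
    show "(\<lambda>y. ennreal (indicator K y * g y)) \<in> borel_measurable borel" using gm by simp
    fix A :: "(real^'m) set" assume A: "A \<in> sets borel"
    have "T h ` A = inv (T h) -` A" using bij_vimage_eq_inv_image[OF bij_imp_bij_inv[OF h(1)]] h(1) by (simp add: inv_inv_eq)
    then show "T h ` A \<in> sets borel"
      using measurable_sets[OF borel_measurable_continuous_onI[OF h(2)] A] by simp
  qed (use T_derivative in auto)
  moreover have "ennreal (indicator UNIV x * \<bar>det (matrix ((*v) (mat 1 + h *\<^sub>R B x)))\<bar>) * ennreal (indicator K (T h x) * g (T h x))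
      = ennreal (indicator K x * (g (T h x) * ?D x))" for x
    unfolding D' using pos[of x] g(2)[of "T h x"] h(3)[of x]
    by (cases "x \<in> K") (auto simp: ennreal_mult'[symmetric] mult.commute)
  moreover have "T h ` UNIV = UNIV" using h(1) by (simp add: bij_is_surj)
  ultimately have "(\<integral>\<^sup>+ y. ennreal (indicator K y * g y) \<partial>lborel) = (\<integral>\<^sup>+ x. ennreal (indicator K x * (g (T h x) * ?D x)) \<partial>lborel)"
    by simp
  then show ?thesis
    using gm gm2 nn nn2 by (simp add: integral_eq_nn_integral)
qed

end

lemma integrable_on_compact:
  fixes f :: "'a::euclidean_space \<Rightarrow> real"
  assumes K: "compact K" and f: "continuous_on K f"
  shows "integrable lborel (\<lambda>x. indicator K x * f x)"
  using borel_integrable_compact[OF K f] by simp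

lemma integrable_indicator_bounded:
  fixes f :: "'a::euclidean_space \<Rightarrow> real"
  assumes K: "compact K" and m: "(\<lambda>x. indicator K x * f x) \<in> borel_measurable borel" and b: "\<And>x. x \<in> K \<Longrightarrow> \<bar>f x\<bar> \<le> b"
  shows "integrable lborel (\<lambda>x. indicator K x * f x)"
proof (rule Bochner_Integration.integrable_bound)
  show "integrable lborel (\<lambda>x. indicator K x * b)"
    using integrable_on_compact[OF K, of "\<lambda>_. b"] by simp
  show "(\<lambda>x. indicator K x * f x) \<in> borel_measurable lborel" using m by simp
  show "AE x in lborel. norm (indicator K x * f x) \<le> norm (indicator K x * b)"
    using b by (intro AE_I2) (fastforce simp: indicator_def)
qed

text \<open>Transport the integral of \<open>w \<rho>\<close> along \<open>T h\<close> and differentiate at \<open>h = 0\<close>. As \<open>w\<close> is merely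
  Lipschitz, only a one-sided bound \<open>\<kappa>\<close> of its derivative along \<open>Z\<close> is available.\<close>

lemma (in shift_field) divergence_ineq:
  assumes Om: "open \<Omega>" "K \<subseteq> \<Omega>"
    and rho: "\<And>x. x \<in> \<Omega> \<Longrightarrow> (\<rho> has_derivative \<rho>' x) (at x)"
      "continuous_on (K \<times> K) (\<lambda>(x, y). \<rho>' x (Z y))" "\<And>x. x \<in> \<Omega> \<Longrightarrow> \<rho> x \<ge> 0"
    and w: "continuous_on K w" "\<And>x. x \<in> K \<Longrightarrow> w x \<ge> 0"
    and L: "\<And>x h. x \<in> K \<Longrightarrow> 0 \<le> h \<Longrightarrow> h < h1 \<Longrightarrow> \<bar>w (T h x) - w x\<bar> \<le> L * h" "h1 > 0"
    and kap: "(\<lambda>x. indicator K x * \<kappa> x) \<in> borel_measurable borel" "\<And>x. x \<in> K \<Longrightarrow> 0 \<le> \<kappa> x" "\<And>x. x \<in> K \<Longrightarrow> \<kappa> x \<le> kb"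
      "\<And>x e. x \<in> K \<Longrightarrow> e > 0 \<Longrightarrow> \<exists>\<delta>>0. \<forall>h. 0 \<le> h \<and> h < \<delta> \<longrightarrow> w x - w (T h x) \<le> (\<kappa> x + e) * h"
  shows "(\<integral>x. indicator K x * (w x * (\<rho>' x (Z x) + \<rho> x * trace (B x))) \<partial>lborel) \<le> (\<integral>x. indicator K x * (\<kappa> x * \<rho> x) \<partial>lborel)"
proof -
  obtain ha where ha: "ha > 0" "\<And>h. 0 \<le> h \<Longrightarrow> h < ha \<Longrightarrow> bij (T h)"
    "\<And>h. 0 \<le> h \<Longrightarrow> h < ha \<Longrightarrow> continuous_on UNIV (inv (T h))"
    "\<And>h x. 0 \<le> h \<Longrightarrow> h < ha \<Longrightarrow> T h x \<in> K \<longleftrightarrow> x \<in> K" by (rule T_bij) blast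
  obtain hb c where hb: "hb > 0" "c > 0"
    "\<And>h x. 0 \<le> h \<Longrightarrow> h < hb \<Longrightarrow> \<bar>det (mat 1 + h *\<^sub>R B x) - 1\<bar> \<le> c * h"
    "\<And>h x. 0 \<le> h \<Longrightarrow> h < hb \<Longrightarrow> det (mat 1 + h *\<^sub>R B x) > 0" by (rule det_bounds) blast
  define h0 where "h0 = min (min ha hb) (min h1 1)"
  have h0: "h0 > 0" "h0 \<le> ha" "h0 \<le> hb" "h0 \<le> h1" "h0 \<le> 1" unfolding h0_def using ha hb L by auto
  have Kb: "K \<in> sets borel" using K by (simp add: borel_compact)
  have Tc: "continuous_on UNIV (T h)" for h
    using T_derivative by (meson continuous_at_imp_continuous_on has_derivative_continuous)
  have rc: "continuous_on K \<rho>"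
    using rho(1) Om by (meson continuous_at_imp_continuous_on has_derivative_continuous subsetD)
  have rpc: "continuous_on K (\<lambda>x. \<rho>' x (Z x))"
  proof -
    have "continuous_on K (\<lambda>x. (x, x))" by (intro continuous_on_Pair continuous_on_id)
    then show ?thesis using continuous_on_compose2[OF rho(2), of K "\<lambda>x. (x, x)"] by auto
  qed
  have tc: "continuous_on K (\<lambda>x. trace (B x))" unfolding trace_def
    by (intro continuous_intros continuous_on_subset[OF Bc]) auto
  have Dc: "continuous_on K (\<lambda>x. det (mat 1 + h *\<^sub>R B x))" for h
    by (intro continuous_on_det continuous_intros continuous_on_subset[OF Bc]) auto
  obtain br where br': "br > 0" "\<And>x. x \<in> K \<Longrightarrow> norm (\<rho> x) \<le> br"
    by (rule compact_bound[OF K rc]) blast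
  have br: "br > 0" "\<And>x. x \<in> K \<Longrightarrow> \<rho> x \<le> br" using br'(1) order_trans[OF abs_ge_self br'(2)[unfolded real_norm_def]] by blast+
  obtain bp where bp': "bp > 0" "\<And>z. z \<in> K \<times> K \<Longrightarrow> norm ((\<lambda>(x, y). \<rho>' x (Z y)) z) \<le> bp"
    by (rule compact_bound[OF compact_Times[OF K K] rho(2)]) blast
  have bp: "bp > 0" "\<And>x y. x \<in> K \<Longrightarrow> y \<in> K \<Longrightarrow> \<bar>\<rho>' x (Z y)\<bar> \<le> bp"
    using bp'(1) bp'(2)[of "(_, _)"] by auto
  obtain bw where bw': "bw > 0" "\<And>x. x \<in> K \<Longrightarrow> norm (w x) \<le> bw"
    by (rule compact_bound[OF K w(1)]) blast
  have bw: "bw > 0" "\<And>x. x \<in> K \<Longrightarrow> w x \<le> bw" using bw'(1) order_trans[OF abs_ge_self bw'(2)[unfolded real_norm_def]] by blast+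
  have TK: "T h x \<in> K" if "x \<in> K" "0 \<le> h" "h < h0" for h x using ha(4)[of h x] that h0 by simp
  \<comment> \<open>Mean value theorem along the segment from \<open>x\<close> to
    \<open>T h x\<close>, which stays in \<open>K\<close>. The derivative is taken at one point of
    \<open>K\<close> in the direction of \<open>Z\<close> at another, whence the hypothesis on
    \<open>K \<times> K\<close>.\<close>
  have rlip: "\<bar>\<rho> (T h x) - \<rho> x\<bar> \<le> bp * h" if x: "x \<in> K" and h: "0 \<le> h" "h < h0" for x h
  proof (cases "h = 0")
    case False
    then have hp: "h > 0" using h by simp
    have "((\<lambda>t. \<rho> (T t x)) has_derivative (\<lambda>r. \<rho>' (T t x) (r *\<^sub>R Z x))) (at t)" if "0 \<le> t" "t \<le> h" for t
    proof (rule has_derivative_compose[of "\<lambda>t. T t x" "\<lambda>r. r *\<^sub>R Z x"])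
      show "((\<lambda>t. T t x) has_derivative (\<lambda>r. r *\<^sub>R Z x)) (at t)" unfolding T_def by (auto intro!: derivative_eq_intros)
      show "(\<rho> has_derivative \<rho>' (T t x)) (at (T t x))" using TK[OF x, of t] that h Om by (intro rho(1)) auto
    qed
    note dd = this
    have "continuous_on {0..h} (\<lambda>t. \<rho> (T t x))"
      using dd by (meson atLeastAtMost_iff continuous_at_imp_continuous_on has_derivative_continuous)
    from mvt[OF hp this dd] obtain t where t: "0 < t" "t < h" "\<rho> (T h x) - \<rho> (T 0 x) = \<rho>' (T t x) ((h - 0) *\<^sub>R Z x)"
      by (metis less_imp_le)
    have tK: "T t x \<in> K" using TK[OF x, of t] t h by simp
    then have "linear (\<rho>' (T t x))" using rho(1) Om has_derivative_linear by blast
    then have "\<rho> (T h x) - \<rho> x = h * \<rho>' (T t x) (Z x)" using t(3) by (simp add: T_def linear_scale)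
    then have "\<bar>\<rho> (T h x) - \<rho> x\<bar> = h * \<bar>\<rho>' (T t x) (Z x)\<bar>" using hp by (simp add: abs_mult)
    also have "\<dots> \<le> h * bp" using bp(2)[OF tK x] hp by (intro mult_left_mono) auto
    finally show ?thesis by (simp add: mult.commute)
  qed (simp add: T_def)
  \<comment> \<open>Dominated convergence is applied along this sequence of step sizes.\<close>
  define hn where "hn n = h0 / 2 * inverse (real (Suc n))" for n :: nat
  have hn: "0 < hn n" "hn n < h0" for n
  proof -
    have "inverse (real (Suc n)) \<le> 1" by (simp add: field_simps)
    then have "h0 / 2 * inverse (real (Suc n)) \<le> h0 / 2 * 1" using h0 by (intro mult_left_mono) auto
    then show "hn n < h0" unfolding hn_def using h0 by linarith
    show "0 < hn n" unfolding hn_def using h0 by (intro mult_pos_pos) auto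
  qed
  have hn0: "hn \<longlonglongrightarrow> 0"
    unfolding hn_def[abs_def] by (rule tendsto_mult_right_zero[OF LIMSEQ_inverse_real_of_nat])
  have TKn: "T (hn n) x \<in> K" if "x \<in> K" for n x
    using TK[OF that, of "hn n"] hn[of n] by simp
  define D where "D n x = det (mat 1 + hn n *\<^sub>R B x)" for n x
  \<comment> \<open>\<open>J n\<close> is the difference quotient of \<open>\<rho>\<close> times the
    Jacobian determinant, and converges. \<open>q n\<close> is that of \<open>w\<close>, which need
    not converge.\<close>
  define J where "J n x = (\<rho> (T (hn n) x) * D n x - \<rho> x) / hn n" for n x
  define q where "q n x = (w x - w (T (hn n) x)) / hn n" for n x
  have wTc: "continuous_on K (\<lambda>x. w (T (hn n) x))" for n
    by (rule continuous_on_compose2[OF w(1) continuous_on_subset[OF Tc]]) (use TKn in auto)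
  have rTc: "continuous_on K (\<lambda>x. \<rho> (T (hn n) x))" for n
    by (rule continuous_on_compose2[OF rc continuous_on_subset[OF Tc]]) (use TKn in auto)
  have Jc: "continuous_on K (J n)" for n unfolding J_def[abs_def] D_def
    by (intro continuous_intros rTc Dc rc) (use hn[of n] in auto)
  have qc: "continuous_on K (q n)" for n unfolding q_def[abs_def]
    by (intro continuous_intros wTc w(1)) (use hn[of n] in auto)
  \<comment> \<open>Discrete integration by parts: by \<open>transport\<close> the integral of
    \<open>w * \<rho>\<close> does not change along \<open>T\<close>, and subtracting the integral
    of \<open>w (T (hn n) x) * \<rho> x\<close> moves the difference quotient from
    \<open>\<rho>\<close> to \<open>w\<close>.\<close>
  have ident: "(\<integral>x. indicator K x * (w (T (hn n) x) * J n x) \<partial>lborel) = (\<integral>x. indicator K x * (q n x * \<rho> x) \<partial>lborel)" for n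
  proof -
    let ?h = "hn n"
    have hp: "0 \<le> ?h" "?h < ha" "?h < hb" using hn[of n] h0 by auto
    have tr: "(\<integral>x. indicator K x * (w x * \<rho> x) \<partial>lborel) = (\<integral>x. indicator K x * ((w (T ?h x) * \<rho> (T ?h x)) * D n x) \<partial>lborel)"
      unfolding D_def by (rule transport) (use ha hb hp w rc rho(3) Om in \<open>auto intro!: continuous_intros\<close>)
    have i1: "integrable lborel (\<lambda>x. indicator K x * (w x * \<rho> x))"
      by (intro integrable_on_compact K continuous_intros w(1) rc)
    have i2: "integrable lborel (\<lambda>x. indicator K x * ((w (T ?h x) * \<rho> (T ?h x)) * D n x))"
      unfolding D_def by (intro integrable_on_compact K continuous_intros wTc rTc Dc)
    have i3: "integrable lborel (\<lambda>x. indicator K x * (w (T ?h x) * \<rho> x))"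
      by (intro integrable_on_compact K continuous_intros wTc rc)
    have "(\<integral>x. indicator K x * (w (T ?h x) * J n x) \<partial>lborel)
       = (\<integral>x. (1 / ?h) * (indicator K x * ((w (T ?h x) * \<rho> (T ?h x)) * D n x) - indicator K x * (w (T ?h x) * \<rho> x)) \<partial>lborel)"
      by (rule Bochner_Integration.integral_cong) (auto simp: J_def field_simps)
    also have "\<dots> = (1 / ?h) * ((\<integral>x. indicator K x * ((w (T ?h x) * \<rho> (T ?h x)) * D n x) \<partial>lborel) - (\<integral>x. indicator K x * (w (T ?h x) * \<rho> x) \<partial>lborel))"
      using i2 i3 by simp
    also have "\<dots> = (1 / ?h) * ((\<integral>x. indicator K x * (w x * \<rho> x) \<partial>lborel) - (\<integral>x. indicator K x * (w (T ?h x) * \<rho> x) \<partial>lborel))"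
      by (simp only: tr)
    also have "\<dots> = (\<integral>x. (1 / ?h) * (indicator K x * (w x * \<rho> x) - indicator K x * (w (T ?h x) * \<rho> x)) \<partial>lborel)"
      using i1 i3 by simp
    also have "\<dots> = (\<integral>x. indicator K x * (q n x * \<rho> x) \<partial>lborel)"
      by (rule Bochner_Integration.integral_cong) (auto simp: q_def field_simps)
    finally show ?thesis .
  qed
  have qb: "\<bar>q n x\<bar> \<le> L" if "x \<in> K" for n x
  proof -
    have "\<bar>w (T (hn n) x) - w x\<bar> \<le> L * hn n" using L(1)[OF that, of "hn n"] hn[of n] h0 by auto
    then show ?thesis using hn(1)[of n] unfolding q_def by (simp add: field_simps abs_minus_commute)
  qed
  have Jb: "\<bar>J n x\<bar> \<le> bp + (br + bp) * c" if x: "x \<in> K" for n x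
  proof -
    let ?h = "hn n"
    have h: "0 \<le> ?h" "?h < h0" "?h \<le> 1" "0 < ?h" using hn[of n] h0 by auto
    have d1: "\<bar>D n x - 1\<bar> \<le> c * ?h" unfolding D_def using hb(3)[of ?h x] h h0 by simp
    have r1: "\<bar>\<rho> (T ?h x) - \<rho> x\<bar> \<le> bp * ?h" by (rule rlip[OF x h(1,2)])
    have r2: "0 \<le> \<rho> (T ?h x)" "\<rho> (T ?h x) \<le> br" using TK[OF x h(1,2)] br rho(3) Om by auto
    have "\<rho> (T ?h x) * D n x - \<rho> x = \<rho> (T ?h x) * (D n x - 1) + (\<rho> (T ?h x) - \<rho> x)" by (simp add: algebra_simps)
    then have "\<bar>\<rho> (T ?h x) * D n x - \<rho> x\<bar> \<le> \<rho> (T ?h x) * \<bar>D n x - 1\<bar> + \<bar>\<rho> (T ?h x) - \<rho> x\<bar>"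
      using r2 by (metis abs_mult abs_of_nonneg abs_triangle_ineq)
    also have "\<dots> \<le> br * (c * ?h) + bp * ?h" using r1 r2 d1 hb(2) h by (intro add_mono mult_mono) auto
    also have "\<dots> \<le> (bp + (br + bp) * c) * ?h" using h bp hb(2) by (simp add: algebra_simps)
    finally show ?thesis unfolding J_def using h by (simp add: field_simps)
  qed
  have Jlim: "(\<lambda>n. J n x) \<longlonglongrightarrow> \<rho>' x (Z x) + \<rho> x * trace (B x)" if x: "x \<in> K" for x
  proof -
    have xO: "x \<in> \<Omega>" using x Om by auto
    have 1: "((\<lambda>t. \<rho> (T t x)) has_derivative (\<lambda>r. \<rho>' x (r *\<^sub>R Z x))) (at 0)"
    proof (rule has_derivative_compose[of "\<lambda>t. T t x" "\<lambda>r. r *\<^sub>R Z x"])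
      show "((\<lambda>t. T t x) has_derivative (\<lambda>r. r *\<^sub>R Z x)) (at 0)" unfolding T_def by (auto intro!: derivative_eq_intros)
      show "(\<rho> has_derivative \<rho>' x) (at (T 0 x))" using rho(1)[OF xO] by (simp add: T_def)
    qed
    have 2: "((\<lambda>t. det (mat 1 + t *\<^sub>R B x)) has_derivative (\<lambda>r. trace (r *\<^sub>R B x))) (at 0)"
    proof (rule has_derivative_compose[of "\<lambda>t. mat 1 + t *\<^sub>R B x" "\<lambda>r. r *\<^sub>R B x"])
      show "((\<lambda>t. mat 1 + t *\<^sub>R B x) has_derivative (\<lambda>r. r *\<^sub>R B x)) (at 0)" by (auto intro!: derivative_eq_intros)
      show "(det has_derivative trace) (at (mat 1 + 0 *\<^sub>R B x))" using has_derivative_det_1 by simp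
    qed
    have lin: "linear (\<rho>' x)" using has_derivative_linear[OF rho(1)[OF xO]] .
    have "((\<lambda>t. \<rho> (T t x) * det (mat 1 + t *\<^sub>R B x)) has_derivative
        (\<lambda>r. \<rho> (T 0 x) * trace (r *\<^sub>R B x) + \<rho>' x (r *\<^sub>R Z x) * det (mat 1 + 0 *\<^sub>R B x))) (at 0)"
      by (rule has_derivative_mult[OF 1 2])
    then have "((\<lambda>t. \<rho> (T t x) * det (mat 1 + t *\<^sub>R B x)) has_real_derivative (\<rho>' x (Z x) + \<rho> x * trace (B x))) (at 0)"
      unfolding has_field_derivative_def
      by (rule has_derivative_eq_rhs) (auto simp: T_def linear_scale[OF lin] trace_def sum_distrib_left algebra_simps)
    then have "((\<lambda>h. (\<rho> (T h x) * det (mat 1 + h *\<^sub>R B x) - \<rho> x) / h) \<longlongrightarrow> \<rho>' x (Z x) + \<rho> x * trace (B x)) (at 0)"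
      unfolding DERIV_def by (simp add: T_def)
    then show ?thesis unfolding J_def D_def
      by (rule filterlim_compose) (use hn0 hn(1) in \<open>auto simp: filterlim_at less_imp_neq[symmetric] intro!: always_eventually\<close>)
  qed
  have wlim: "(\<lambda>n. w (T (hn n) x)) \<longlonglongrightarrow> w x" if x: "x \<in> K" for x
  proof -
    have "(\<lambda>n. L * hn n) \<longlonglongrightarrow> L * 0" by (intro tendsto_intros hn0)
    then have "(\<lambda>n. L * hn n) \<longlonglongrightarrow> 0" by simp
    moreover have "norm (w x - w (T (hn n) x)) \<le> L * hn n" for n
      using L(1)[OF x, of "hn n"] hn[of n] h0 by (simp add: abs_minus_commute)
    ultimately have "(\<lambda>n. w x - w (T (hn n) x)) \<longlonglongrightarrow> 0"
      by (intro Lim_null_comparison[of "\<lambda>n. w x - w (T (hn n) x)" "\<lambda>n. L * hn n"] always_eventually allI)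
    from tendsto_diff[OF tendsto_const[of "w x"] this] show ?thesis by simp
  qed
  have lim1: "(\<lambda>n. \<integral>x. indicator K x * (w (T (hn n) x) * J n x) \<partial>lborel) \<longlonglongrightarrow>
      (\<integral>x. indicator K x * (w x * (\<rho>' x (Z x) + \<rho> x * trace (B x))) \<partial>lborel)"
  proof (rule integral_dominated_convergence[where w="\<lambda>x. indicator K x * (bw * (bp + (br + bp) * c))"])
    show "(\<lambda>x. indicator K x * (w x * (\<rho>' x (Z x) + \<rho> x * trace (B x)))) \<in> borel_measurable lborel"
      by (rule borel_measurable_integrable, rule integrable_on_compact[OF K], intro continuous_intros w(1) rpc rc tc)
    show "(\<lambda>x. indicator K x * (w (T (hn n) x) * J n x)) \<in> borel_measurable lborel" for n
      by (rule borel_measurable_integrable, rule integrable_on_compact[OF K], intro continuous_intros wTc Jc)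
    show "integrable lborel (\<lambda>x. indicator K x * (bw * (bp + (br + bp) * c)))"
      by (intro integrable_on_compact K continuous_intros)
    show "AE x in lborel. (\<lambda>n. indicator K x * (w (T (hn n) x) * J n x)) \<longlonglongrightarrow> indicator K x * (w x * (\<rho>' x (Z x) + \<rho> x * trace (B x)))"
    proof (intro AE_I2)
      fix x :: "real^'m"
      show "(\<lambda>n. indicator K x * (w (T (hn n) x) * J n x)) \<longlonglongrightarrow> indicator K x * (w x * (\<rho>' x (Z x) + \<rho> x * trace (B x)))"
        by (cases "x \<in> K") (auto intro!: tendsto_intros wlim Jlim)
    qed
    show "AE x in lborel. norm (indicator K x * (w (T (hn n) x) * J n x)) \<le> indicator K x * (bw * (bp + (br + bp) * c))" for n
    proof (intro AE_I2)
      fix x :: "real^'m"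
      show "norm (indicator K x * (w (T (hn n) x) * J n x)) \<le> indicator K x * (bw * (bp + (br + bp) * c))"
      proof (cases "x \<in> K")
        case True
        have "T (hn n) x \<in> K" using TK[OF True, of "hn n"] hn[of n] by simp
        then have "\<bar>w (T (hn n) x)\<bar> * \<bar>J n x\<bar> \<le> bw * (bp + (br + bp) * c)"
          using bw w(2) Jb[OF True, of n] by (intro mult_mono) auto
        then show ?thesis using True by (simp add: abs_mult)
      qed simp
    qed
  qed
  \<comment> \<open>The hypothesis on \<open>\<kappa>\<close> controls \<open>q n\<close> from above
    only, so it is the excess of \<open>q n\<close> over \<open>\<kappa>\<close> that tends to 0. It
    is bounded by \<open>L * br\<close>, and dominated convergence removes it.\<close>
  define v where "v n x = max (q n x - \<kappa> x) 0 * \<rho> x" for n x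
  have kq: "(\<lambda>x. indicator K x * q n x) \<in> borel_measurable borel" for n
    using borel_measurable_continuous_on_indicator[OF Kb qc[of n]] by simp
  have rm: "(\<lambda>x. indicator K x * \<rho> x) \<in> borel_measurable borel"
    using borel_measurable_continuous_on_indicator[OF Kb rc] by simp
  have km: "(\<lambda>x. indicator K x * (\<kappa> x * \<rho> x)) \<in> borel_measurable borel"
  proof -
    have "(\<lambda>x. (indicator K x * \<kappa> x) * (indicator K x * \<rho> x)) \<in> borel_measurable borel"
      by (intro borel_measurable_times kap rm)
    moreover have "(\<lambda>x. (indicator K x * \<kappa> x) * (indicator K x * \<rho> x)) = (\<lambda>x. indicator K x * (\<kappa> x * \<rho> x))"
      by (auto simp: indicator_def)
    ultimately show ?thesis by simp
  qed
  have ki: "integrable lborel (\<lambda>x. indicator K x * (\<kappa> x * \<rho> x))"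
  proof (rule integrable_indicator_bounded[OF K km])
    show "\<bar>\<kappa> x * \<rho> x\<bar> \<le> kb * br" if "x \<in> K" for x
      using that kap(2)[OF that] kap(3)[OF that] br(2)[OF that] rho(3)[of x] Om by (auto simp: abs_mult intro!: mult_mono)
  qed
  have vm: "(\<lambda>x. indicator K x * v n x) \<in> borel_measurable borel" for n
  proof -
    have "(\<lambda>x. max (indicator K x * q n x - indicator K x * \<kappa> x) 0 * (indicator K x * \<rho> x)) \<in> borel_measurable borel"
      by (intro borel_measurable_times borel_measurable_max borel_measurable_diff kq kap rm) simp
    moreover have "(\<lambda>x. max (indicator K x * q n x - indicator K x * \<kappa> x) 0 * (indicator K x * \<rho> x)) = (\<lambda>x. indicator K x * v n x)"
      by (auto simp: indicator_def v_def)
    ultimately show ?thesis by simp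
  qed
  have L0: "L \<ge> 0" if "x \<in> K" for x using qb[OF that, of 0] by linarith
  have vb: "\<bar>v n x\<bar> \<le> L * br" if x: "x \<in> K" for n x
  proof -
    have "max (q n x - \<kappa> x) 0 \<le> L" using qb[OF x, of n] kap(2)[OF x] L0[OF x] by auto
    then show ?thesis unfolding v_def using rho(3)[of x] Om x br(2)[OF x] L0[OF x] by (auto simp: abs_mult intro!: mult_mono)
  qed
  have vlim: "(\<lambda>n. v n x) \<longlonglongrightarrow> 0" if x: "x \<in> K" for x
  proof -
    have "(\<lambda>n. max (q n x - \<kappa> x) 0) \<longlonglongrightarrow> 0"
    proof (rule LIMSEQ_I)
      fix r :: real assume r: "0 < r"
      then obtain \<delta> where d: "\<delta> > 0" "\<And>h. 0 \<le> h \<and> h < \<delta> \<Longrightarrow> w x - w (T h x) \<le> (\<kappa> x + r/2) * h"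
        using kap(4)[OF x, of "r/2"] by auto
      have "\<forall>\<^sub>F n in sequentially. hn n < \<delta>" using hn0 d(1) by (simp add: order_tendsto_iff)
      then obtain N where N: "\<And>n. n \<ge> N \<Longrightarrow> hn n < \<delta>" unfolding eventually_sequentially by blast
      have "q n x \<le> \<kappa> x + r/2" if "n \<ge> N" for n
        using d(2)[of "hn n"] N[OF that] hn(1)[of n] unfolding q_def by (simp add: field_simps)
      then have "norm (max (q n x - \<kappa> x) 0 - 0) < r" if "n \<ge> N" for n using that r by fastforce
      then show "\<exists>no. \<forall>n\<ge>no. norm (max (q n x - \<kappa> x) 0 - 0) < r" by blast
    qed
    then have "(\<lambda>n. max (q n x - \<kappa> x) 0 * \<rho> x) \<longlonglongrightarrow> 0 * \<rho> x" by (intro tendsto_intros)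
    then show ?thesis by (simp add: v_def)
  qed
  have lim2: "(\<lambda>n. \<integral>x. indicator K x * v n x \<partial>lborel) \<longlonglongrightarrow> (\<integral>x. 0 \<partial>(lborel :: (real^'m) measure))"
  proof (rule integral_dominated_convergence[where w="\<lambda>x. indicator K x * (L * br)"])
    show "(\<lambda>x. indicator K x * v n x) \<in> borel_measurable lborel" for n using vm by simp
    show "integrable lborel (\<lambda>x. indicator K x * (L * br))" by (intro integrable_on_compact K continuous_intros)
    show "AE x in lborel. (\<lambda>n. indicator K x * v n x) \<longlonglongrightarrow> 0"
    proof (intro AE_I2)
      fix x :: "real^'m" show "(\<lambda>n. indicator K x * v n x) \<longlonglongrightarrow> 0"
        using vlim[of x] by (cases "x \<in> K") auto
    qed
    show "AE x in lborel. norm (indicator K x * v n x) \<le> indicator K x * (L * br)" for n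
      using vb by (intro AE_I2) (auto simp: indicator_def)
  qed simp
  have le: "(\<integral>x. indicator K x * (w (T (hn n) x) * J n x) \<partial>lborel)
      \<le> (\<integral>x. indicator K x * (\<kappa> x * \<rho> x) \<partial>lborel) + (\<integral>x. indicator K x * v n x \<partial>lborel)" for n
  proof -
    have iv: "integrable lborel (\<lambda>x. indicator K x * v n x)"
      by (rule integrable_indicator_bounded[OF K vm vb])
    have iq: "integrable lborel (\<lambda>x. indicator K x * (q n x * \<rho> x))"
      by (intro integrable_on_compact K continuous_intros qc rc)
    have "(\<integral>x. indicator K x * (q n x * \<rho> x) \<partial>lborel) \<le> (\<integral>x. indicator K x * (\<kappa> x * \<rho> x) + indicator K x * v n x \<partial>lborel)"
    proof (rule integral_mono[OF iq Bochner_Integration.integrable_add[OF ki iv]])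
      fix x
      have "q n x * \<rho> x \<le> \<kappa> x * \<rho> x + v n x" if "x \<in> K"
      proof -
        have "q n x * \<rho> x \<le> (\<kappa> x + max (q n x - \<kappa> x) 0) * \<rho> x"
          using rho(3)[of x] that Om by (intro mult_right_mono) auto
        then show ?thesis by (simp add: v_def algebra_simps)
      qed
      then show "indicator K x * (q n x * \<rho> x) \<le> indicator K x * (\<kappa> x * \<rho> x) + indicator K x * v n x"
        by (auto simp: indicator_def)
    qed
    then show ?thesis using ki iv unfolding ident by simp
  qed
  have "(\<integral>x. indicator K x * (w x * (\<rho>' x (Z x) + \<rho> x * trace (B x))) \<partial>lborel) \<le> (\<integral>x. indicator K x * (\<kappa> x * \<rho> x) \<partial>lborel) + 0"
    by (rule LIMSEQ_le[OF lim1 tendsto_add[OF tendsto_const lim2[simplified]]]) (use le in auto)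
  then show ?thesis by simp
qed

section \<open>Second fundamental form and mean curvature\<close>

lemma Ck_on_subset_open:
  fixes f :: "real^'m \<Rightarrow> 'b::real_normed_vector"
  assumes "open S" "S \<subseteq> T" "open T"
  shows "Ck_on k T f \<Longrightarrow> Ck_on k S f"
proof (induction k arbitrary: f)
  case 0
  then show ?case using assms(2) continuous_on_subset by auto
next
  case (Suc k)
  then show ?case using assms by (auto intro: differentiable_on_subset)
qed

lemma bounded_bilinear_mat_vec: "bounded_bilinear (\<lambda>(H::real^'m::finite^'n::finite) w. H *v w)"
  unfolding bilinear_conv_bounded_bilinear[symmetric] bilinear_def
  by (auto intro!: linearI simp: matrix_vector_mult_add_rdistrib matrix_vector_right_distrib
      scaleR_matrix_vector_assoc[symmetric] matrix_vector_mult_scaleR)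

lemma has_derivative_ip:
  assumes "(H has_derivative H') (at x)" "(a has_derivative a') (at x)" "(b has_derivative b') (at x)"
  shows "((\<lambda>y. ip (H y) (a y) (b y)) has_derivative
    (\<lambda>u. ip (H' u) (a x) (b x) + ip (H x) (a' u) (b x) + ip (H x) (a x) (b' u))) (at x)"
proof -
  have "((\<lambda>y. H y *v b y) has_derivative (\<lambda>u. H x *v b' u + H' u *v b x)) (at x)"
    by (rule bounded_bilinear.FDERIV[OF bounded_bilinear_mat_vec assms(1,3)])
  then have "((\<lambda>y. a y \<bullet> (H y *v b y)) has_derivative (\<lambda>u. a x \<bullet> (H x *v b' u + H' u *v b x) + a' u \<bullet> (H x *v b x))) (at x)"
    by (rule has_derivative_inner[OF assms(2)])
  then show ?thesis unfolding ip_def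
    by (rule has_derivative_eq_rhs) (simp add: inner_simps fun_eq_iff)
qed

text \<open>With vector arguments the Christoffel symbols can be evaluated on orthonormal frames and
  on images under derivatives of transition maps.\<close>

definition chr :: "(real^'m::finite \<Rightarrow> real^'m^'m) \<Rightarrow> real^'m \<Rightarrow> real^'m \<Rightarrow> real^'m \<Rightarrow> real^'m" where
  "chr G x u v = (\<chi> k. \<Sum>i\<in>UNIV. \<Sum>j\<in>UNIV. u $ i * v $ j * christoffel G k i j x)"

text \<open>Christoffel symbols of the first kind, contracted with \<open>u\<close> and
  \<open>v\<close>; \<open>chr_eq\<close> raises the index.\<close>

definition clow :: "(real^'m::finite \<Rightarrow> real^'m^'m) \<Rightarrow> real^'m \<Rightarrow> real^'m \<Rightarrow> real^'m \<Rightarrow> real^'m" where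
  "clow G x u v = (\<chi> l. (1/2) * (ip (fd G x u) v (axis l 1) + ip (fd G x v) u (axis l 1) - ip (fd G x (axis l 1)) u v))"

lemma chr_axis: "chr G x (axis i 1) (axis j 1) $ k = christoffel G k i j x"
proof -
  have "chr G x (axis i 1) (axis j 1) $ k = (\<Sum>a\<in>UNIV. \<Sum>b\<in>UNIV. if a = i then (if b = j then christoffel G k a b x else 0) else 0)"
    unfolding chr_def by (simp, intro sum.cong refl) (auto simp: axis_def)
  also have "\<dots> = (\<Sum>a\<in>UNIV. if a = i then (\<Sum>b\<in>UNIV. if b = j then christoffel G k a b x else 0) else 0)"
    by (intro sum.cong refl) auto
  finally show ?thesis by simp
qed

lemma linear_chr: "linear (chr G x u)" "linear (\<lambda>u. chr G x u v)"
  by (auto intro!: linearI simp: chr_def vec_eq_iff algebra_simps sum.distrib sum_distrib_left)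

lemma ip_axis_right: "ip H v (axis l 1) = (\<Sum>j\<in>UNIV. v $ j * H $ j $ l)"
  by (simp add: ip_def inner_vec_def matrix_vector_mult_basis column_def)

lemma pd_entry:
  assumes "G differentiable at x"
  shows "pd i (\<lambda>y. G y $ j $ l) x = fd G x (axis i 1) $ j $ l"
  unfolding pd_def
  by (rule fd_bounded_linear[OF bounded_linear_compose[OF bounded_linear_vec_nth bounded_linear_vec_nth] assms])

lemma fd_mat_expand:
  assumes "(G :: real^'p::finite \<Rightarrow> real^'m::finite^'n::finite) differentiable at x"
  shows "fd G x u $ j $ l = (\<Sum>i\<in>UNIV. u $ i * fd G x (axis i 1) $ j $ l)"
  using arg_cong[OF linear_axis_sum[OF linear_fd[OF assms], of u], of "\<lambda>H. H $ j $ l"] by simp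

lemma chr_eq:
  fixes G :: "real^'m::finite \<Rightarrow> real^'m^'m"
  assumes "G differentiable at x"
  shows "chr G x u v = matrix_inv (G x) *v clow G x u v"
proof (subst vec_eq_iff, rule allI)
  fix k
  let ?d = "\<lambda>i j l. fd G x (axis i 1) $ j $ l"
  have 1: "ip (fd G x u) v (axis l 1) = (\<Sum>i\<in>UNIV. \<Sum>j\<in>UNIV. u $ i * v $ j * ?d i j l)" for l
  proof -
    have "ip (fd G x u) v (axis l 1) = (\<Sum>j\<in>UNIV. \<Sum>i\<in>UNIV. u $ i * v $ j * ?d i j l)"
      unfolding ip_axis_right fd_mat_expand[OF assms, of u] by (simp add: sum_distrib_left mult_ac)
    then show ?thesis by (subst (asm) sum.swap)
  qed
  have 2: "ip (fd G x v) u (axis l 1) = (\<Sum>i\<in>UNIV. \<Sum>j\<in>UNIV. u $ i * v $ j * ?d j i l)" for l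
    unfolding ip_axis_right fd_mat_expand[OF assms, of v] by (simp add: sum_distrib_left mult_ac)
  have 3: "ip (fd G x (axis l 1)) u v = (\<Sum>i\<in>UNIV. \<Sum>j\<in>UNIV. u $ i * v $ j * ?d l i j)" for l
    unfolding ip_sum by (simp add: mult_ac)
  have "(matrix_inv (G x) *v clow G x u v) $ k = (\<Sum>l\<in>UNIV. matrix_inv (G x) $ k $ l *
      ((1/2) * (\<Sum>i\<in>UNIV. \<Sum>j\<in>UNIV. u $ i * v $ j * (?d i j l + ?d j i l - ?d l i j))))"
    unfolding matrix_vector_mult_def clow_def 1 2 3
    by (simp add: algebra_simps sum.distrib sum_subtractf)
  also have "\<dots> = (\<Sum>l\<in>UNIV. \<Sum>i\<in>UNIV. \<Sum>j\<in>UNIV. u $ i * v $ j * ((1/2) * (matrix_inv (G x) $ k $ l * (?d i j l + ?d j i l - ?d l i j))))"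
    by (simp add: sum_distrib_left mult_ac)
  also have "\<dots> = (\<Sum>i\<in>UNIV. \<Sum>j\<in>UNIV. \<Sum>l\<in>UNIV. u $ i * v $ j * ((1/2) * (matrix_inv (G x) $ k $ l * (?d i j l + ?d j i l - ?d l i j))))"
    by (subst sum.swap, subst (2) sum.swap) (rule refl)
  also have "\<dots> = chr G x u v $ k"
    unfolding chr_def christoffel_def by (simp add: pd_entry[OF assms] sum_distrib_left)
  finally show "chr G x u v $ k = (matrix_inv (G x) *v clow G x u v) $ k" by simp
qed

text \<open>The Koszul formula for constant coordinate vector fields.\<close>

lemma chr_ip:
  fixes G :: "real^'m::finite \<Rightarrow> real^'m^'m"
  assumes "G differentiable at x" "posdef (G x)"
  shows "ip (G x) (chr G x u v) w = (1/2) * (ip (fd G x u) v w + ip (fd G x v) u w - ip (fd G x w) u v)"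
proof -
  have "ip (G x) (chr G x u v) w = clow G x u v \<bullet> w"
    unfolding chr_eq[OF assms(1)] by (rule posdef_inv(3)[OF assms(2)])
  also have "\<dots> = (\<Sum>l\<in>UNIV. w $ l * ((1/2) * (ip (fd G x u) v (axis l 1) + ip (fd G x v) u (axis l 1) - ip (fd G x (axis l 1)) u v)))"
    by (simp add: clow_def inner_vec_def mult.commute)
  also have "\<dots> = (1/2) * ((\<Sum>l\<in>UNIV. w $ l * ip (fd G x u) v (axis l 1)) + (\<Sum>l\<in>UNIV. w $ l * ip (fd G x v) u (axis l 1))
      - (\<Sum>l\<in>UNIV. w $ l * ip (fd G x (axis l 1)) u v))"
    by (simp add: sum_distrib_left algebra_simps sum.distrib sum_subtractf)
  also have "(\<Sum>l\<in>UNIV. w $ l * ip (fd G x u) v (axis l 1)) = ip (fd G x u) v w"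
    using linear_axis_sum[OF linear_ip_right[of "fd G x u" v], of w] by simp
  also have "(\<Sum>l\<in>UNIV. w $ l * ip (fd G x v) u (axis l 1)) = ip (fd G x v) u w"
    using linear_axis_sum[OF linear_ip_right[of "fd G x v" u], of w] by simp
  also have "(\<Sum>l\<in>UNIV. w $ l * ip (fd G x (axis l 1)) u v) = ip (fd G x w) u v"
  proof -
    have "linear (\<lambda>w. ip (fd G x w) u v)"
      by (rule linear_compose[OF linear_fd[OF assms(1)] bounded_linear.linear[OF bounded_linear_ip_mat], unfolded o_def])
    from linear_axis_sum[OF this, of w] show ?thesis by simp
  qed
  finally show ?thesis .
qed

lemma fd_ip:
  assumes "G differentiable at x" shows "fd (\<lambda>y. ip (G y) v w) x u = ip (fd G x u) v w"
  by (rule fd_bounded_linear[OF bounded_linear_ip_mat assms])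

text \<open>Differentiate the pulled back metric and insert the result in \<open>chr_ip\<close>. By
  the symmetry of \<open>sd \<sigma> x\<close> just one term with second derivatives survives, and
  surjectivity of \<open>fd \<sigma> x\<close> makes the test vectors arbitrary.\<close>

lemma chr_trans:
  fixes G :: "real^'m::finite \<Rightarrow> real^'m^'m" and G' :: "real^'m \<Rightarrow> real^'m^'m"
  assumes s: "smooth_on S \<sigma>" "open S" "x \<in> S"
    and G: "G differentiable at x" "posdef (G x)" and G': "G' differentiable at (\<sigma> x)" "posdef (G' (\<sigma> x))"
    and pull: "\<And>y v w. y \<in> S \<Longrightarrow> ip (G y) v w = ip (G' (\<sigma> y)) (fd \<sigma> y v) (fd \<sigma> y w)"
    and surj: "surj (fd \<sigma> x)"
  shows "fd \<sigma> x (chr G x u v) = sd \<sigma> x u v + chr G' (\<sigma> x) (fd \<sigma> x u) (fd \<sigma> x v)"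
proof -
  let ?J = "fd \<sigma> x" and ?s = "sd \<sigma> x" and ?H = "G' (\<sigma> x)"
  have ds: "\<sigma> differentiable at x" by (rule smooth_on_differentiable[OF s])
  have D: "ip (fd G x u) v w = ip (fd G' (\<sigma> x) (?J u)) (?J v) (?J w) + ip ?H (?s u v) (?J w) + ip ?H (?J v) (?s u w)" for u v w
  proof -
    have "((\<lambda>y. G' (\<sigma> y)) has_derivative (\<lambda>u. fd G' (\<sigma> x) (?J u))) (at x)"
      by (rule has_derivative_compose[OF fd_works[OF ds] fd_works[OF G'(1)]])
    then have "((\<lambda>y. ip (G' (\<sigma> y)) (fd \<sigma> y v) (fd \<sigma> y w)) has_derivative
        (\<lambda>u. ip (fd G' (\<sigma> x) (?J u)) (?J v) (?J w) + ip ?H (?s u v) (?J w) + ip ?H (?J v) (?s u w))) (at x)"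
      by (rule has_derivative_ip[OF _ sd_has_derivative[OF s] sd_has_derivative[OF s]])
    then have "fd (\<lambda>y. ip (G y) v w) x u = ip (fd G' (\<sigma> x) (?J u)) (?J v) (?J w) + ip ?H (?s u v) (?J w) + ip ?H (?J v) (?s u w)"
      by (subst fd_cong[OF s(2,3) pull]) (auto dest: fd_eqI)
    then show ?thesis unfolding fd_ip[OF G(1)] .
  qed
  have ss: "?s a b = ?s b a" for a b by (rule sd_sym[OF s])
  have E: "ip ?H (?J (chr G x u v)) (?J w) = ip ?H (?s u v + chr G' (\<sigma> x) (?J u) (?J v)) (?J w)" for w
  proof -
    have "ip ?H (?J (chr G x u v)) (?J w) = ip (G x) (chr G x u v) w" by (simp add: pull[OF s(3)])
    also have "\<dots> = ip ?H (chr G' (\<sigma> x) (?J u) (?J v)) (?J w) + ip ?H (?s u v) (?J w)"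
      unfolding chr_ip[OF G] chr_ip[OF G'] D
      by (simp add: ss[of v u] ss[of w u] ss[of w v] posdef_sym[OF G'(2), of "?s u w" "?J v"]
          posdef_sym[OF G'(2), of "?s v w" "?J u"] algebra_simps)
    finally show ?thesis by (simp add: ip_add_left)
  qed
  have "ip ?H (?J (chr G x u v)) w' = ip ?H (?s u v + chr G' (\<sigma> x) (?J u) (?J v)) w'" for w'
  proof -
    obtain w where "w' = ?J w" using surj by (rule surjE)
    then show ?thesis using E[of w] by simp
  qed
  then show ?thesis by (rule ip_nondeg[OF G'(2)])
qed

text \<open>The Gauss formula with arbitrary tangent vectors; \<open>second_ff\<close> is its value
  on coordinate vectors.\<close>

definition sff :: "(real^'m::finite \<Rightarrow> real^'m^'m) \<Rightarrow> (real^'n::finite \<Rightarrow> real^'n^'n) \<Rightarrow> (real^'m \<Rightarrow> real^'n)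
    \<Rightarrow> real^'m \<Rightarrow> real^'m \<Rightarrow> real^'m \<Rightarrow> real^'n" where
  "sff G H f x u v = sd f x u v + chr H (f x) (fd f x u) (fd f x v) - fd f x (chr G x u v)"

lemma bilinear_sff:
  assumes f: "smooth_on S f" "open S" "x \<in> S"
  shows "linear (sff G H f x u)" "linear (\<lambda>u. sff G H f x u v)"
proof -
  have lf: "linear (fd f x)" by (rule linear_fd[OF smooth_on_differentiable[OF f]])
  have b: "linear (sd f x u)" "linear (\<lambda>u. sd f x u v)" for u v using sd_bilinear[OF f] unfolding bilinear_def by auto
  have "linear (\<lambda>v. chr H (f x) (fd f x u) (fd f x v))" "linear (\<lambda>v. fd f x (chr G x u v))" for u
    using linear_compose[OF lf linear_chr(1)[of H "f x" "fd f x u"]] linear_compose[OF linear_chr(1)[of G x u] lf] by (simp_all add: o_def)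
  then show "linear (sff G H f x u)"
    unfolding sff_def[abs_def] by (intro linear_compose_sub linear_compose_add b(1))
  have "linear (\<lambda>u. chr H (f x) (fd f x u) (fd f x v))" "linear (\<lambda>u. fd f x (chr G x u v))" for v
    using linear_compose[OF lf linear_chr(2)[of H "f x" "fd f x v"]] linear_compose[OF linear_chr(2)[of G x v] lf] by (simp_all add: o_def)
  then show "linear (\<lambda>u. sff G H f x u v)"
    unfolding sff_def[abs_def] by (intro linear_compose_sub linear_compose_add b(2))
qed

lemma second_ff_sff:
  assumes f: "smooth_on S (coord_map c d \<phi>)" "open S" "x \<in> S"
  shows "second_ff P N \<phi> c d i j x = sff (gmat P c) (gmat N d) (coord_map c d \<phi>) x (axis i 1) (axis j 1)"
proof -
  let ?f = "coord_map c d \<phi>"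
  have df: "?f differentiable at x" by (rule smooth_on_differentiable[OF f])
  have 1: "pd i (pd j ?f) x = sd ?f x (axis i 1) (axis j 1)"
    unfolding pd_def sd_def ..
  have 2: "fd ?f x (chr (gmat P c) x (axis i 1) (axis j 1)) = (\<Sum>k\<in>UNIV. christoffel (gmat P c) k i j x *\<^sub>R pd k ?f x)"
    unfolding fd_pd[OF df] chr_axis ..
  have 3: "(\<chi> k. \<Sum>r\<in>UNIV. \<Sum>s\<in>UNIV. christoffel (gmat N d) k r s (?f x) * pd i ?f x $ r * pd j ?f x $ s)
      = chr (gmat N d) (?f x) (fd ?f x (axis i 1)) (fd ?f x (axis j 1))"
    unfolding chr_def pd_def by (simp add: mult_ac)
  show ?thesis unfolding second_ff_def Let_def sff_def 1 2 3 ..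
qed

section \<open>The isometric immersion in charts, and independence of the mean curvature from
  them\<close>

locale imm = P: rmfd P + N: rmfd N
  for P :: "('a::{t2_space,second_countable_topology}, 'm::finite) riem"
    and N :: "('b::{t2_space,second_countable_topology}, 'n::finite) riem" +
  fixes \<phi> :: "'a \<Rightarrow> 'b"
  assumes immersion: "isometric_immersion P N \<phi>"
begin

abbreviation dom :: "('a, 'm) chart \<Rightarrow> ('b, 'n) chart \<Rightarrow> (real^'m) set" where
  "dom c d \<equiv> cmap c ` (cdom c \<inter> \<phi> -` cdom d)"

lemma cont_phi: "continuous_on UNIV \<phi>"
  using immersion unfolding isometric_immersion_def by blast

lemma open_vimage_phi: "open U \<Longrightarrow> open (\<phi> -` U)"
  using cont_phi by (simp add: continuous_on_open_vimage)

lemma open_dom: "c \<in> atlas P \<Longrightarrow> d \<in> atlas N \<Longrightarrow> open (dom c d)"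
  by (intro P.open_cmap_image open_vimage_phi N.open_cdom)

lemma smooth_f: "c \<in> atlas P \<Longrightarrow> d \<in> atlas N \<Longrightarrow> smooth_on (dom c d) (coord_map c d \<phi>)"
  using immersion unfolding isometric_immersion_def by blast

lemma f_eq: "c \<in> atlas P \<Longrightarrow> q \<in> cdom c \<Longrightarrow> coord_map c d \<phi> (cmap c q) = cmap d (\<phi> q)"
  by (simp add: P.cinv_cmap)

lemma f_img: "c \<in> atlas P \<Longrightarrow> x \<in> dom c d \<Longrightarrow> coord_map c d \<phi> x \<in> N.img d"
  using P.cinv_cmap by auto

lemma metric_pull:
  assumes "c \<in> atlas P" "d \<in> atlas N" "x \<in> dom c d"
  shows "ip (gmat P c x) v w = ip (gmat N d (coord_map c d \<phi> x)) (fd (coord_map c d \<phi>) x v) (fd (coord_map c d \<phi>) x w)"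
proof -
  obtain q where q: "q \<in> cdom c" "\<phi> q \<in> cdom d" "x = cmap c q" using assms(3) by blast
  let ?J = "jacobian (coord_map c d \<phi>) (cmap c q)"
  have "gmat P c (cmap c q) = transpose ?J ** gmat N d (cmap d (\<phi> q)) ** ?J"
    using immersion assms(1,2) q(1,2) unfolding isometric_immersion_def Let_def by blast
  then have "ip (gmat P c (cmap c q)) v w = ip (gmat N d (cmap d (\<phi> q))) (?J *v v) (?J *v w)"
    by (simp only: ip_congruence)
  then show ?thesis
    unfolding q(3) f_eq[OF assms(1) q(1)]
    using P.jacobian_mult[OF smooth_on_differentiable[OF smooth_f[OF assms(1,2)] open_dom[OF assms(1,2)]]] assms(3) q(3)
    by (simp only:)
qed

end

lemma (in rmfd) g_differentiable: "c \<in> atlas M \<Longrightarrow> x \<in> img c \<Longrightarrow> gmat M c differentiable at x"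
  by (rule smooth_on_differentiable[OF smooth_g open_img])

lemma (in rmfd) trans_facts:
  assumes "c \<in> atlas M" "d \<in> atlas M" "q \<in> cdom c" "q \<in> cdom d"
  defines "S \<equiv> cmap c ` (cdom c \<inter> cdom d)" and "\<sigma> \<equiv> cmap d \<circ> cinv c" and "x \<equiv> cmap c q"
  shows "smooth_on S \<sigma>" "open S" "x \<in> S" "\<sigma> x = cmap d q" "\<sigma> ` S \<subseteq> img d"
    "\<And>y v w. y \<in> S \<Longrightarrow> ip (gmat M c y) v w = ip (gmat M d (\<sigma> y)) (fd \<sigma> y v) (fd \<sigma> y w)"
    "surj (fd \<sigma> x)"
    "fd \<sigma> x (chr (gmat M c) x u v) = sd \<sigma> x u v + chr (gmat M d) (\<sigma> x) (fd \<sigma> x u) (fd \<sigma> x v)"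
proof -
  show 1: "smooth_on S \<sigma>" unfolding S_def \<sigma>_def by (rule smooth_trans[OF assms(1,2)])
  show 2: "open S" unfolding S_def by (rule open_cmap_image[OF assms(1) open_cdom[OF assms(2)]])
  show 3: "x \<in> S" unfolding S_def x_def using assms by blast
  show 4: "\<sigma> x = cmap d q" unfolding \<sigma>_def x_def using cinv_cmap[OF assms(1,3)] by simp
  show "\<sigma> ` S \<subseteq> img d" unfolding S_def \<sigma>_def using cinv_cmap[OF assms(1)] by auto
  show 5: "ip (gmat M c y) v w = ip (gmat M d (\<sigma> y)) (fd \<sigma> y v) (fd \<sigma> y w)" if h: "y \<in> S" for y v w
  proof -
    obtain p where p: "p \<in> cdom c" "p \<in> cdom d" "y = cmap c p" using h unfolding S_def by blast
    have "\<sigma> y = cmap d p" unfolding \<sigma>_def p(3) using cinv_cmap[OF assms(1) p(1)] by simp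
    then show ?thesis using metric_trans[OF assms(1,2) p(1,2), of v w] unfolding p(3) \<sigma>_def by simp
  qed
  have xi: "x \<in> img c" unfolding x_def using assms by blast
  have di: "\<sigma> x \<in> img d" unfolding 4 using assms by blast
  have lin: "linear (fd \<sigma> x)" by (rule linear_fd[OF smooth_on_differentiable[OF 1 2 3]])
  have "inj (fd \<sigma> x)"
    unfolding linear_injective_0[OF lin]
  proof (intro allI impI)
    fix v assume "fd \<sigma> x v = 0"
    then have "ip (gmat M c x) v v = 0" using 5[OF 3, of v v] by (simp add: ip_simps)
    then show "v = 0" using posdef_eq0[OF posdef_g[OF assms(1) xi]] by simp
  qed
  then show 6: "surj (fd \<sigma> x)" by (rule linear_injective_imp_surjective[OF lin]) (rule refl)
  show "fd \<sigma> x (chr (gmat M c) x u v) = sd \<sigma> x u v + chr (gmat M d) (\<sigma> x) (fd \<sigma> x u) (fd \<sigma> x v)"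
    by (rule chr_trans[OF 1 2 3 g_differentiable[OF assms(1) xi] posdef_g[OF assms(1) xi]
          g_differentiable[OF assms(2) di] posdef_g[OF assms(2) di] 5 6])
qed

context imm
begin

lemma mean_curv_frame:
  fixes A :: "real^'m^'m"
  assumes c: "c \<in> atlas P" and d: "d \<in> atlas N" and x: "x \<in> dom c d" and A: "transpose A ** gmat P c x ** A = mat 1"
  shows "mean_curv P N \<phi> c d x = (1 / real CARD('m)) *\<^sub>R (\<Sum>k\<in>UNIV. sff (gmat P c) (gmat N d) (coord_map c d \<phi>) x (col A k) (col A k))"
  unfolding mean_curv_def second_ff_sff[OF smooth_f[OF c d] open_dom[OF c d] x]
  by (subst frame_trace[OF A]) (rule bilinear_sff[OF smooth_f[OF c d] open_dom[OF c d] x] refl)+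

text \<open>The second derivatives of the transition map that \<open>sd_chain\<close> produces
  cancel those in the transformation law of \<open>chr\<close>, so the values transform like tangent
  vectors of \<open>N\<close>.\<close>

lemma sff_trans_N:
  assumes c: "c \<in> atlas P" and d: "d \<in> atlas N" "d' \<in> atlas N" and q: "q \<in> cdom c" "\<phi> q \<in> cdom d" "\<phi> q \<in> cdom d'"
  shows "sff (gmat P c) (gmat N d') (coord_map c d' \<phi>) (cmap c q) u v =
    fd (cmap d' \<circ> cinv d) (cmap d (\<phi> q)) (sff (gmat P c) (gmat N d) (coord_map c d \<phi>) (cmap c q) u v)"
proof -
  let ?x = "cmap c q" and ?f = "coord_map c d \<phi>" and ?f' = "coord_map c d' \<phi>" and ?t = "cmap d' \<circ> cinv d"
  let ?S = "cmap c ` (cdom c \<inter> (\<phi> -` cdom d \<inter> \<phi> -` cdom d'))" and ?T = "cmap d ` (cdom d \<inter> cdom d')"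
  note tf = N.trans_facts[OF d q(2,3)]
  have oS: "open ?S" by (intro P.open_cmap_image c open_Int open_vimage_phi N.open_cdom d)
  have xS: "?x \<in> ?S" using q by blast
  have S1: "?S \<subseteq> dom c d" by blast
  have sm: "smooth_on ?S ?f"
    using smooth_f[OF c d(1)] Ck_on_subset_open[OF oS S1 open_dom[OF c d(1)]] unfolding smooth_on_def by blast
  have fS: "?f ` ?S \<subseteq> ?T" using P.cinv_cmap[OF c] by auto
  have eq: "?f' y = ?t (?f y)" if "y \<in> ?S" for y using that P.cinv_cmap[OF c] N.cinv_cmap[OF d(1)] by auto
  have fx: "?f ?x = cmap d (\<phi> q)" by (rule f_eq[OF c q(1)])
  have fx': "?f' ?x = cmap d' (\<phi> q)" by (rule f_eq[OF c q(1)])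
  have D1: "fd ?f' y w = fd ?t (?f y) (fd ?f y w)" if "y \<in> ?S" for y w
    by (rule trans[OF fun_cong[OF fd_cong[OF oS that eq]] sd_chain(2)[OF sm oS that tf(1,2) fS]])
  have D2: "sd ?f' ?x u v = sd ?t (?f ?x) (fd ?f ?x u) (fd ?f ?x v) + fd ?t (?f ?x) (sd ?f ?x u v)"
  proof -
    have "sd ?f' ?x u v = sd (\<lambda>y. ?t (?f y)) ?x u v"
      unfolding sd_def by (rule fun_cong[OF fd_cong[OF oS xS]], rule fun_cong[OF fd_cong[OF oS _ eq]])
    then show ?thesis using sd_chain(1)[OF sm oS xS tf(1,2) fS] by simp
  qed
  have lin: "linear (fd ?t (cmap d (\<phi> q)))" by (rule linear_fd[OF N.trans_differentiable[OF d q(2,3)]])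
  have ch: "chr (gmat N d') (?f' ?x) (fd ?f' ?x u) (fd ?f' ?x v) =
    fd ?t (?f ?x) (chr (gmat N d) (?f ?x) (fd ?f ?x u) (fd ?f ?x v)) - sd ?t (?f ?x) (fd ?f ?x u) (fd ?f ?x v)"
    unfolding D1[OF xS] fx' fx tf(8)[unfolded tf(4)] by simp
  show ?thesis
    unfolding sff_def D2 D1[OF xS] fx fx' ch[unfolded D1[OF xS] fx fx']
    by (simp add: linear_add[OF lin] linear_diff[OF lin])
qed

text \<open>The same cancellation on the side of \<open>P\<close>: here the second derivatives of
  the transition map come from \<open>sd_chain\<close> and from \<open>chr\<close> of the domain
  metric.\<close>

lemma sff_trans_P:
  assumes c: "c \<in> atlas P" "c' \<in> atlas P" and d: "d \<in> atlas N" and q: "q \<in> cdom c" "q \<in> cdom c'" "\<phi> q \<in> cdom d"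
  defines "J \<equiv> fd (cmap c' \<circ> cinv c) (cmap c q)"
  shows "sff (gmat P c) (gmat N d) (coord_map c d \<phi>) (cmap c q) u v =
    sff (gmat P c') (gmat N d) (coord_map c' d \<phi>) (cmap c' q) (J u) (J v)"
proof -
  let ?x = "cmap c q" and ?f = "coord_map c d \<phi>" and ?f' = "coord_map c' d \<phi>" and ?s = "cmap c' \<circ> cinv c"
  let ?S = "cmap c ` (cdom c \<inter> (cdom c' \<inter> \<phi> -` cdom d))" and ?T = "dom c' d"
  note tf = P.trans_facts[OF c q(1,2)]
  have oS: "open ?S" by (intro P.open_cmap_image c open_Int open_vimage_phi N.open_cdom P.open_cdom d)
  have xS: "?x \<in> ?S" using q by blast
  have sm: "smooth_on ?S ?s"
    using tf(1) Ck_on_subset_open[OF oS _ tf(2)] unfolding smooth_on_def by blast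
  have sS: "?s ` ?S \<subseteq> ?T" using P.cinv_cmap[OF c(1)] by auto
  have eq: "?f y = ?f' (?s y)" if "y \<in> ?S" for y using that P.cinv_cmap[OF c(1)] P.cinv_cmap[OF c(2)] by auto
  note smf = smooth_f[OF c(2) d] and od = open_dom[OF c(2) d]
  have D1: "fd ?f ?x w = fd ?f' (?s ?x) (fd ?s ?x w)" for w
    by (rule trans[OF fun_cong[OF fd_cong[OF oS xS eq]] sd_chain(2)[OF sm oS xS smf od sS]])
  have D2: "sd ?f ?x u v = sd ?f' (?s ?x) (fd ?s ?x u) (fd ?s ?x v) + fd ?f' (?s ?x) (sd ?s ?x u v)"
  proof -
    have "sd ?f ?x u v = sd (\<lambda>y. ?f' (?s y)) ?x u v"
      unfolding sd_def by (rule fun_cong[OF fd_cong[OF oS xS]], rule fun_cong[OF fd_cong[OF oS _ eq]])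
    then show ?thesis using sd_chain(1)[OF sm oS xS smf od sS] by simp
  qed
  have xd: "?s ?x \<in> ?T" using sS xS by blast
  have lin: "linear (fd ?f' (?s ?x))" by (rule linear_fd[OF smooth_on_differentiable[OF smf od xd]])
  show ?thesis
    unfolding sff_def D1 D2 tf(8) eq[OF xS] J_def unfolding tf(4)
    by (simp add: linear_add[OF lin[unfolded tf(4)]])
qed

text \<open>\<open>mean_curv_norm\<close> is defined with arbitrary charts. A change of chart in
  \<open>P\<close> carries orthonormal frames to orthonormal frames, and one in \<open>N\<close>
  acts on the mean curvature vector by an isometry.\<close>

lemma mean_curv_norm_chart:
  assumes c: "c \<in> atlas P" and d: "d \<in> atlas N" and q: "q \<in> cdom c" "\<phi> q \<in> cdom d"
  defines "H \<equiv> mean_curv P N \<phi> c d (cmap c q)"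
  shows "mean_curv_norm P N \<phi> q = sqrt (ip (gmat N d (cmap d (\<phi> q))) H H)"
proof -
  define c0 where "c0 = chart_at P q"
  define d0 where "d0 = chart_at N (\<phi> q)"
  have c0: "c0 \<in> atlas P" "q \<in> cdom c0" unfolding c0_def using P.chart_at by auto
  have d0: "d0 \<in> atlas N" "\<phi> q \<in> cdom d0" unfolding d0_def using N.chart_at by auto
  let ?s = "cmap c \<circ> cinv c0" and ?t = "cmap d \<circ> cinv d0"
  let ?J = "matrix (fd ?s (cmap c0 q))"
  have pd: "posdef (gmat P c0 (cmap c0 q))" using c0 by (intro P.posdef_g) auto
  obtain A :: "real^'m^'m" where A: "transpose A ** gmat P c0 (cmap c0 q) ** A = mat 1" by (rule posdef_frame[OF pd])
  have ds: "?s differentiable at (cmap c0 q)" by (rule P.trans_differentiable[OF c0(1) c c0(2) q(1)])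
  have Jv: "?J *v v = fd ?s (cmap c0 q) v" for v by (simp add: matrix_works linear_fd[OF ds])
  have gJ: "transpose ?J ** gmat P c (cmap c q) ** ?J = gmat P c0 (cmap c0 q)"
  proof -
    have "gmat P c0 (cmap c0 q) = transpose (jacobian ?s (cmap c0 q)) ** gmat P c (cmap c q) ** jacobian ?s (cmap c0 q)"
      using P.rm c0 c q unfolding riemannian_manifold_def Let_def by blast
    then show ?thesis unfolding jacobian_def by (rule sym)
  qed
  have A': "transpose (?J ** A) ** gmat P c (cmap c q) ** (?J ** A) = mat 1"
  proof -
    have "transpose (?J ** A) ** gmat P c (cmap c q) ** (?J ** A) = transpose A ** (transpose ?J ** gmat P c (cmap c q) ** ?J) ** A"
      by (simp add: matrix_transpose_mul matrix_mul_assoc)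
    then show ?thesis unfolding gJ A .
  qed
  have colJ: "col (?J ** A) k = fd ?s (cmap c0 q) (col A k)" for k
    by (simp add: col_def Jv flip: matrix_vector_mul_assoc)
  have "mean_curv P N \<phi> c0 d0 (cmap c0 q) = mean_curv P N \<phi> c d0 (cmap c q)"
    by (subst mean_curv_frame[OF c0(1) d0(1) _ A], use c0 d0 in blast, subst mean_curv_frame[OF c d0(1) _ A'], use q d0 in blast)
      (simp add: colJ sff_trans_P[OF c0(1) c d0(1) c0(2) q(1) d0(2)])
  moreover have "mean_curv P N \<phi> c d (cmap c q) = fd ?t (cmap d0 (\<phi> q)) (mean_curv P N \<phi> c d0 (cmap c q))"
  proof -
    have lin: "linear (fd ?t (cmap d0 (\<phi> q)))" by (rule linear_fd[OF N.trans_differentiable[OF d0(1) d d0(2) q(2)]])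
    show ?thesis
      by (subst mean_curv_frame[OF c d _ A'], use q in blast, subst mean_curv_frame[OF c d0(1) _ A'], use q d0 in blast)
        (simp add: sff_trans_N[OF c d0(1) d q(1) d0(2) q(2)] linear_scale[OF lin] linear_sum[OF lin])
  qed
  ultimately show ?thesis
    unfolding mean_curv_norm_def Let_def c0_def[symmetric] d0_def[symmetric] H_def
    using N.metric_trans[OF d0(1) d d0(2) q(2)] by simp
qed

end

section \<open>Local comparison with Euclidean space\<close>

lemma continuous_on_chr:
  fixes G :: "real^'m::finite \<Rightarrow> real^'m^'m"
  assumes G: "smooth_on S G" "open S" "\<And>x. x \<in> S \<Longrightarrow> posdef (G x)"
    and puv: "continuous_on T p" "continuous_on T u" "continuous_on T v" "p ` T \<subseteq> S"
  shows "continuous_on T (\<lambda>z. chr G (p z) (u z) (v z))"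
proof -
  have cG: "continuous_on T (\<lambda>z. G (p z))"
    by (rule continuous_on_compose2[OF smooth_on_continuous[OF G(1)] puv(1,4)])
  have "continuous_on T (\<lambda>z. clow G (p z) (u z) (v z))"
    unfolding clow_def
    by (intro continuous_on_vec_lambda continuous_on_mult continuous_on_const continuous_on_add continuous_on_diff
        continuous_on_ip smooth_fd_continuous[OF G(1,2)] puv)
  then have "continuous_on T (\<lambda>z. matrix_inv (G (p z)) *v clow G (p z) (u z) (v z))"
    using puv(4) G(3) by (intro continuous_on_inv_mult cG) blast+
  moreover have "chr G (p z) (u z) (v z) = matrix_inv (G (p z)) *v clow G (p z) (u z) (v z)" if "z \<in> T" for z
    using that puv(4) by (intro chr_eq smooth_on_differentiable[OF G(1,2)]) blast
  ultimately show ?thesis by simp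
qed

text \<open>Compactness of \<open>K\<close> bounds the metric, its derivative and the Christoffel
  symbols, and \<open>l\<close> converts Euclidean norms into metric ones. \<open>A\<close> comes
  from the Lipschitz bound of the metric on the convex set \<open>K\<close>, and \<open>E\<close>
  from the Christoffel symbols.\<close>

lemma (in rmfd) chart_comparison:
  assumes d: "d \<in> atlas M" and K: "compact K" "convex K" "K \<subseteq> img d"
  obtains l A E where "l > 0" "A \<ge> 0" "E \<ge> 0"
    "\<And>z v. z \<in> K \<Longrightarrow> l * norm v \<le> sqrt (ip (gmat M d z) v v)"
    "\<And>z z' v. z \<in> K \<Longrightarrow> z' \<in> K \<Longrightarrow> \<bar>ip (gmat M d z) v v - ip (gmat M d z') v v\<bar> \<le> A * norm (z - z') * ip (gmat M d z') v v"
    "\<And>z z' w v. z \<in> K \<Longrightarrow> z' \<in> K \<Longrightarrow> \<bar>ip (gmat M d z) w (chr (gmat M d) z' v v)\<bar> \<le> E * norm w * ip (gmat M d z') v v"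
proof -
  let ?G = "gmat M d" and ?m = "real CARD('m)"
  obtain l where l: "l > 0" "\<And>z v. z \<in> K \<Longrightarrow> l * norm v \<le> sqrt (ip (?G z) v v)"
    by (rule chart_lower_bound[OF d K(1,3)]) blast
  have l2: "(norm v)\<^sup>2 \<le> ip (?G z) v v / l\<^sup>2" if "z \<in> K" for z v
  proof -
    have "(l * norm v)\<^sup>2 \<le> (sqrt (ip (?G z) v v))\<^sup>2" by (intro power_mono l that) (use l(1) in simp)
    also have "\<dots> = ip (?G z) v v" using posdef_nonneg[OF posdef_g[OF d]] that K(3) by (intro real_sqrt_pow2) blast
    finally show ?thesis using l(1) by (simp add: field_simps power_mult_distrib)
  qed
  obtain g0 where g0: "g0 > 0" "\<And>z. z \<in> K \<Longrightarrow> norm (?G z) \<le> g0"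
    by (rule compact_bound[OF K(1) continuous_on_subset[OF cont_g[OF d] K(3)]]) blast
  have "continuous_on (K \<times> sphere 0 1) (\<lambda>z. fd ?G (fst z) (snd z))"
    by (rule smooth_fd_continuous[OF smooth_g[OF d] open_img[OF d]]) (use K(3) in \<open>auto intro!: continuous_intros\<close>)
  then obtain g1 where g1: "g1 > 0" "\<And>z. z \<in> K \<times> sphere (0 :: real^'m) 1 \<Longrightarrow> norm (fd ?G (fst z) (snd z)) \<le> g1"
    using compact_bound[OF compact_Times[OF K(1) compact_sphere]] by blast
  have g1': "norm (fd ?G z v) \<le> g1 * norm v" if z: "z \<in> K" for z v
  proof (cases "v = 0")
    case False
    have lin: "linear (fd ?G z)" using z K(3) by (intro linear_fd g_differentiable[OF d]) blast
    have "norm (fd ?G z (v /\<^sub>R norm v)) \<le> g1" using g1(2)[of "(z, v /\<^sub>R norm v)"] z False by simp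
    then show ?thesis using False by (simp add: linear_scale[OF lin] field_simps)
  qed (use linear_0[OF linear_fd[OF g_differentiable[OF d]]] z K(3) in auto)
  have L: "norm (?G z - ?G z') \<le> g1 * norm (z - z')" if "z \<in> K" "z' \<in> K" for z z'
  proof (rule differentiable_bound[OF K(2), of ?G "fd ?G"])
    fix x assume "x \<in> K"
    show "(?G has_derivative fd ?G x) (at x within K)"
      by (rule has_derivative_at_withinI[OF fd_works[OF g_differentiable[OF d]]]) (use \<open>x \<in> K\<close> K(3) in blast)
    show "onorm (fd ?G x) \<le> g1" by (rule onorm_le) (rule g1'[OF \<open>x \<in> K\<close>])
  qed (use that in auto)
  have "continuous_on (K \<times> sphere 0 1) (\<lambda>z. chr ?G (fst z) (snd z) (snd z))"
    by (rule continuous_on_chr[OF smooth_g[OF d] open_img[OF d] posdef_g[OF d]]) (use K(3) in \<open>auto intro!: continuous_intros\<close>)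
  then obtain e where e: "e > 0" "\<And>z. z \<in> K \<times> sphere (0 :: real^'m) 1 \<Longrightarrow> norm (chr ?G (fst z) (snd z) (snd z)) \<le> e"
    using compact_bound[OF compact_Times[OF K(1) compact_sphere]] by blast
  have e': "norm (chr ?G z v v) \<le> e * (norm v)\<^sup>2" if z: "z \<in> K" for z v
  proof (cases "v = 0")
    case False
    have "norm (chr ?G z (v /\<^sub>R norm v) (v /\<^sub>R norm v)) \<le> e" using e(2)[of "(z, v /\<^sub>R norm v)"] z False by simp
    then show ?thesis using False
      by (simp add: linear_scale[OF linear_chr(1)] linear_scale[OF linear_chr(2)] field_simps power2_eq_square)
  qed (use linear_0[OF linear_chr(1)] in simp)
  show ?thesis
  proof (rule that[of l "?m * g1 / l\<^sup>2" "?m * g0 * e / l\<^sup>2"])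
    fix z z' v assume z: "z \<in> K" "z' \<in> K"
    have "\<bar>ip (?G z) v v - ip (?G z') v v\<bar> \<le> ?m * norm (?G z - ?G z') * norm v * norm v"
      using ip_mat_bound[of "?G z - ?G z'" v v] by (simp add: ip_diff_mat)
    also have "\<dots> \<le> ?m * (g1 * norm (z - z')) * norm v * norm v"
      by (intro mult_right_mono mult_left_mono L z) auto
    also have "\<dots> = ?m * g1 * norm (z - z') * (norm v)\<^sup>2" by (simp add: power2_eq_square)
    also have "\<dots> \<le> ?m * g1 * norm (z - z') * (ip (?G z') v v / l\<^sup>2)"
      by (intro mult_left_mono l2 z) (use g1(1) in simp)
    finally show "\<bar>ip (?G z) v v - ip (?G z') v v\<bar> \<le> ?m * g1 / l\<^sup>2 * norm (z - z') * ip (?G z') v v"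
      by (simp add: field_simps)
  next
    fix z z' w v assume z: "z \<in> K" "z' \<in> K"
    have "\<bar>ip (?G z) w (chr ?G z' v v)\<bar> \<le> ?m * norm (?G z) * norm w * norm (chr ?G z' v v)" by (rule ip_mat_bound)
    also have "\<dots> \<le> ?m * g0 * norm w * (e * (ip (?G z') v v / l\<^sup>2))"
    proof (intro mult_mono g0(2) z order_refl)
      show "norm (chr ?G z' v v) \<le> e * (ip (?G z') v v / l\<^sup>2)"
        using e'[OF z(2), of v] mult_left_mono[OF l2[OF z(2), of v], of e] e(1) by linarith
    qed (use g0(1) in auto)
    finally show "\<bar>ip (?G z) w (chr ?G z' v v)\<bar> \<le> ?m * g0 * e / l\<^sup>2 * norm w * ip (?G z') v v"
      by (simp add: field_simps)
  qed (use l g1(1) g0(1) e(1) in auto)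
qed

text \<open>Near \<open>q0\<close>, the function \<open>\<onehalf> |y' - y|\<^sup>2\<close> of \<open>y'\<close>, with respect to the metric at \<open>y\<close>, almost has
  the gradient and the Hessian of half the squared distance in Euclidean space.\<close>

definition (in rmfd) local_model :: "'a \<Rightarrow> ('a, 'm) chart \<Rightarrow> real \<Rightarrow> real \<Rightarrow> bool" where
  "local_model q0 d R C \<longleftrightarrow> d \<in> atlas M \<and> 0 < R \<and> R \<le> 1 \<and> 0 \<le> C \<and>
     (\<forall>q q'. dist_M q0 q < R \<longrightarrow> dist_M q q' \<le> R \<longrightarrow> q \<in> cdom d \<and> q' \<in> cdom d \<and>
       (\<forall>v. (1 - C * dist_M q q') * ip (gmat M d (cmap d q')) v v
              \<le> ip (gmat M d (cmap d q)) v v - ip (gmat M d (cmap d q)) (cmap d q' - cmap d q) (chr (gmat M d) (cmap d q') v v) \<and>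
          \<bar>ip (gmat M d (cmap d q)) (cmap d q' - cmap d q) v\<bar>
            \<le> (1 + C * dist_M q q') * dist_M q q' * sqrt (ip (gmat M d (cmap d q')) v v)))"

text \<open>A curve from \<open>q\<close> of length less than \<open>L\<close> stays in the
  coordinate ball of radius \<open>L / l\<close>, where the norm at \<open>q\<close> is at most
  \<open>1 + A * L / l\<close> times the norm of the metric. So the coordinate vector from
  \<open>q\<close> to \<open>q'\<close>, measured at \<open>q\<close>, is at most
  \<open>(1 + a * L) * L\<close>; then \<open>L\<close> tends to the distance.\<close>

lemma (in rmfd) local_model_ex: obtains d R C where "local_model q0 d R C"
proof -
  obtain d where d: "d \<in> atlas M" "q0 \<in> cdom d" using chart_ex by blast
  let ?G = "gmat M d"
  define y0 where "y0 = cmap d q0"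
  have "y0 \<in> img d" unfolding y0_def using d by blast
  then obtain r3 where r3: "r3 > 0" "cball y0 r3 \<subseteq> img d" using open_img[OF d(1)] open_contains_cball by blast
  \<comment> \<open>\<open>q\<close> will lie within \<open>r\<close> of the center of the chart and
    \<open>q'\<close> within \<open>2 * r\<close> of \<open>q\<close>, all inside the ball of radius
    \<open>3 * r\<close>.\<close>
  define r where "r = r3 / 3"
  have r: "r > 0" "cball y0 (3 * r) \<subseteq> img d" using r3 by (simp_all add: r_def)
  let ?K = "cball y0 (3 * r)"
  obtain l A E where l: "l > 0" "\<And>z v. z \<in> ?K \<Longrightarrow> l * norm v \<le> sqrt (ip (?G z) v v)" and AE: "A \<ge> 0" "E \<ge> 0"
    and A: "\<And>z z' v. z \<in> ?K \<Longrightarrow> z' \<in> ?K \<Longrightarrow> \<bar>ip (?G z) v v - ip (?G z') v v\<bar> \<le> A * norm (z - z') * ip (?G z') v v"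
    and E: "\<And>z z' w v. z \<in> ?K \<Longrightarrow> z' \<in> ?K \<Longrightarrow> \<bar>ip (?G z) w (chr ?G z' v v)\<bar> \<le> E * norm w * ip (?G z') v v"
    by (rule chart_comparison[OF d(1) compact_cball convex_cball r(2)]) blast
  define R where "R = min 1 (l * r)"
  have R: "0 < R" "R \<le> 1" "R \<le> l * r" using l(1) r(1) by (auto simp: R_def)
  define a where "a = A / l"
  define D where "D = (1 + a) / l"
  \<comment> \<open>\<open>a\<close> is the relative error of the metric per unit of distance, and
    \<open>D\<close> times the distance bounds the Euclidean norm of the coordinate vector when the
    distance is at most 1. \<open>C\<close> dominates the errors of both estimates.\<close>
  define C where "C = a + A * D + a * (A * D) + E * D"
  have aD: "a \<ge> 0" "D \<ge> 0" using AE l(1) by (auto simp: a_def D_def)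
  have C0: "C \<ge> 0" unfolding C_def using AE aD by simp
  have pos: "posdef (?G z)" if "z \<in> ?K" for z using that r(2) by (intro posdef_g[OF d(1)]) blast
  have sq: "sqrt (ip (?G z) v v) \<le> (1 + A * norm (z - z')) * sqrt (ip (?G z') v v)" if z: "z \<in> ?K" "z' \<in> ?K" for z z' v
  proof -
    define t where "t = A * norm (z - z')"
    have t: "t \<ge> 0" using AE by (simp add: t_def)
    have p: "ip (?G z') v v \<ge> 0" by (rule posdef_nonneg[OF pos[OF z(2)]])
    have "ip (?G z) v v \<le> (1 + t) * ip (?G z') v v" using A[OF z, of v] unfolding t_def by (simp add: algebra_simps)
    also have "\<dots> \<le> (1 + t)\<^sup>2 * ip (?G z') v v" by (intro mult_right_mono p) (use t in \<open>simp add: power2_eq_square algebra_simps\<close>)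
    finally have "sqrt (ip (?G z) v v) \<le> sqrt ((1 + t)\<^sup>2 * ip (?G z') v v)" by simp
    then show ?thesis using t by (simp add: real_sqrt_mult t_def)
  qed
  have main: "q \<in> cdom d \<and> q' \<in> cdom d \<and> (\<forall>v. (1 - C * dist_M q q') * ip (?G (cmap d q')) v v
              \<le> ip (?G (cmap d q)) v v - ip (?G (cmap d q)) (cmap d q' - cmap d q) (chr ?G (cmap d q') v v) \<and>
          \<bar>ip (?G (cmap d q)) (cmap d q' - cmap d q) v\<bar>
            \<le> (1 + C * dist_M q q') * dist_M q q' * sqrt (ip (?G (cmap d q')) v v))"
    if near: "dist_M q0 q < R" "dist_M q q' \<le> R" for q q'
  proof -
    have "ed q0 q < ennreal (l * r)" using near(1) R unfolding rdist_less_iff[symmetric] by linarith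
    then obtain g where g: "pwc g 0 1" "g 0 = q0" "g 1 = q" "len g 0 1 < ennreal (l * r)" by (rule ed_less) blast
    have "g 1 \<in> cinv d ` ball y0 r"
      by (rule curve_stays[OF d(1) _ r(1) l(1) l(2) g(1) _ g(4)])
        (use r l g cinv_cmap[OF d] in \<open>auto simp: y0_def dist_norm\<close>)
    then obtain y where y: "y \<in> ball y0 r" "q = cinv d y" using g(3) by blast
    have yi: "y \<in> img d" using y(1) r by (intro subsetD[OF r(2)]) auto
    have q: "q \<in> cdom d" "cmap d q = y" using cinv_in[OF yi] cmap_cinv[OF yi] y(2) by auto
    define \<rho> where "\<rho> = dist_M q q'"
    have \<rho>: "0 \<le> \<rho>" "\<rho> \<le> R" "\<rho> < 2 * R" using near(2) rdist_nonneg R(1) by (auto simp: \<rho>_def)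
    have stay: "q' \<in> cdom d \<and> cmap d q' \<in> ?K \<and> sqrt (ip (?G y) (cmap d q' - y) (cmap d q' - y)) \<le> (1 + a * L) * L"
      if L: "\<rho> < L" "L < 2 * R" for L
    proof -
      define s where "s = L / l"
      have s: "s > 0" "l * s = L" "s < 2 * r" using \<rho>(1) L l(1) R(3) by (auto simp: s_def field_simps)
      have "ed q q' < ennreal (l * s)" unfolding rdist_less_iff[symmetric] using L s by (simp add: \<rho>_def)
      then obtain g where g: "pwc g 0 1" "g 0 = q" "g 1 = q'" "len g 0 1 < ennreal (l * s)" by (rule ed_less) blast
      have sK: "cball y s \<subseteq> ?K"
      proof
        fix z assume "z \<in> cball y s"
        then show "z \<in> ?K" using y(1) s(3) dist_triangle[of y0 z y] by simp
      qed
      have st: "g t \<in> cinv d ` ball y s" if "t \<in> {0..1}" for t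
        by (rule curve_stays[OF d(1) _ s(1) l(1) l(2) g(1) _ g(4) that]) (use sK r(2) g(2) y(2) in auto)
      have st': "g t \<in> cdom d" "cmap d (g t) \<in> ball y s" if t: "t \<in> {0..1}" for t
      proof -
        obtain z where z: "z \<in> ball y s" "g t = cinv d z" using st[OF t] by blast
        have "z \<in> img d" by (rule subsetD[OF r(2)], rule subsetD[OF sK]) (use z(1) in simp)
        then show "g t \<in> cdom d" "cmap d (g t) \<in> ball y s" using z cinv_in[of z d] cmap_cinv[of z d] by auto
      qed
      have yK: "y \<in> ?K" using y(1) r(1) by simp
      have "ennreal (sqrt (ip (?G y) (cmap d (g 1) - cmap d (g 0)) (cmap d (g 1) - cmap d (g 0)))) \<le> ennreal (1 + A * s) * len g 0 1"
      proof (rule coord_length[OF d(1) g(1)])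
        show "posdef (?G y)" by (rule pos[OF yK])
        show "1 + A * s > 0" using AE s(1) by (simp add: add_pos_nonneg)
        fix t v assume t: "t \<in> {0..1::real}"
        have z: "cmap d (g t) \<in> ?K" "norm (y - cmap d (g t)) \<le> s" using st'(2)[OF t] ball_subset_cball subsetD[OF sK] by (blast, simp add: dist_norm)
        have p: "ip (?G (cmap d (g t))) v v \<ge> 0" by (rule posdef_nonneg[OF pos[OF z(1)]])
        have "sqrt (ip (?G y) v v) \<le> (1 + A * norm (y - cmap d (g t))) * sqrt (ip (?G (cmap d (g t))) v v)" by (rule sq[OF yK z(1)])
        also have "\<dots> \<le> (1 + A * s) * sqrt (ip (?G (cmap d (g t))) v v)"
          by (intro mult_right_mono add_left_mono mult_left_mono z AE) (use p in simp)
        finally show "sqrt (ip (?G y) v v) \<le> (1 + A * s) * sqrt (ip (?G (cmap d (g t))) v v)" .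
      qed (use st' in auto)
      also have "\<dots> \<le> ennreal (1 + A * s) * ennreal L" by (intro mult_left_mono) (use g(4) s(2) in auto)
      also have "\<dots> = ennreal ((1 + a * L) * L)" using AE s(1) L \<rho>(1) l(1) by (subst ennreal_mult) (auto simp: a_def s_def)
      finally have "sqrt (ip (?G y) (cmap d q' - y) (cmap d q' - y)) \<le> (1 + a * L) * L"
        unfolding g(2,3) q(2) using L \<rho>(1) aD(1) by (simp add: ennreal_le_iff)
      moreover have "q' \<in> cdom d" "cmap d q' \<in> ?K" using st'[of 1] ball_subset_cball subsetD[OF sK] unfolding g(3) by auto
      ultimately show ?thesis by blast
    qed
    have yK: "y \<in> ?K" using y(1) r(1) by simp
    have q': "q' \<in> cdom d" "cmap d q' \<in> ?K" using stay[of "(\<rho> + 2 * R) / 2"] \<rho>(3) by auto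
    define y' where "y' = cmap d q'"
    have y'K: "y' \<in> ?K" using q'(2) by (simp add: y'_def)
    define w where "w = y' - y"
    \<comment> \<open>The distance is an infimum of lengths, so \<open>stay\<close> is available for
      \<open>L > \<rho>\<close> only; hence the limit from the right.\<close>
    have n1: "sqrt (ip (?G y) w w) \<le> (1 + a * \<rho>) * \<rho>"
    proof (rule tendsto_lowerbound)
      show "((\<lambda>L. (1 + a * L) * L) \<longlongrightarrow> (1 + a * \<rho>) * \<rho>) (at_right \<rho>)" by (intro tendsto_intros)
      show "eventually (\<lambda>L. sqrt (ip (?G y) w w) \<le> (1 + a * L) * L) (at_right \<rho>)"
        unfolding eventually_at_right_field w_def y'_def using stay \<rho>(3) by (intro exI[of _ "2 * R"]) blast
    qed simp
    have \<rho>1: "\<rho> \<le> 1" using \<rho>(2) R(2) by linarith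
    have nw: "norm w \<le> D * \<rho>"
    proof -
      have "l * norm w \<le> (1 + a * \<rho>) * \<rho>" using l(2)[OF yK, of w] n1 by linarith
      also have "\<dots> \<le> (1 + a) * \<rho>" by (intro mult_right_mono) (use aD(1) \<rho> \<rho>1 mult_left_mono[of \<rho> 1 a] in auto)
      finally show ?thesis using l(1) by (simp add: D_def field_simps)
    qed
    have yy: "norm (y - y') \<le> D * \<rho>" using nw by (simp add: w_def norm_minus_commute)
    have Cs: "a + A * D + a * (A * D) \<le> C" "A * D + E * D \<le> C" unfolding C_def using AE aD by simp_all
    have "(1 - C * \<rho>) * ip (?G y') v v \<le> ip (?G y) v v - ip (?G y) w (chr ?G y' v v) \<and>
        \<bar>ip (?G y) w v\<bar> \<le> (1 + C * \<rho>) * \<rho> * sqrt (ip (?G y') v v)" for v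
    proof
      have p: "ip (?G y') v v \<ge> 0" by (rule posdef_nonneg[OF pos[OF y'K]])
      have "A * norm (y - y') * ip (?G y') v v \<le> A * (D * \<rho>) * ip (?G y') v v"
        by (intro mult_right_mono mult_left_mono yy AE p)
      moreover have "E * norm w * ip (?G y') v v \<le> E * (D * \<rho>) * ip (?G y') v v"
        by (intro mult_right_mono mult_left_mono nw AE p)
      moreover have "(A * D + E * D) * (\<rho> * ip (?G y') v v) \<le> C * (\<rho> * ip (?G y') v v)"
        by (intro mult_right_mono Cs mult_nonneg_nonneg p \<rho>)
      ultimately show "(1 - C * \<rho>) * ip (?G y') v v \<le> ip (?G y) v v - ip (?G y) w (chr ?G y' v v)"
        using A[OF yK y'K, of v] E[OF yK y'K, of w v] by (simp add: algebra_simps)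
      have "\<bar>ip (?G y) w v\<bar> \<le> sqrt (ip (?G y) w w) * sqrt (ip (?G y) v v)" by (rule ip_Cauchy_Schwarz[OF pos[OF yK]])
      also have "\<dots> \<le> ((1 + a * \<rho>) * \<rho>) * ((1 + A * (D * \<rho>)) * sqrt (ip (?G y') v v))"
      proof (intro mult_mono n1)
        have "sqrt (ip (?G y) v v) \<le> (1 + A * norm (y - y')) * sqrt (ip (?G y') v v)" by (rule sq[OF yK y'K])
        also have "\<dots> \<le> (1 + A * (D * \<rho>)) * sqrt (ip (?G y') v v)"
          by (intro mult_right_mono add_left_mono mult_left_mono yy AE) (use p in simp)
        finally show "sqrt (ip (?G y) v v) \<le> (1 + A * (D * \<rho>)) * sqrt (ip (?G y') v v)" .
      qed (use aD \<rho> posdef_nonneg[OF pos[OF yK]] in auto)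
      also have "\<dots> = ((1 + a * \<rho>) * (1 + A * D * \<rho>)) * (\<rho> * sqrt (ip (?G y') v v))" by (simp add: mult_ac)
      also have "\<dots> \<le> (1 + C * \<rho>) * (\<rho> * sqrt (ip (?G y') v v))"
      proof (rule mult_right_mono)
        have "a * (A * D) * (\<rho> * \<rho>) \<le> a * (A * D) * \<rho>" using \<rho>(1) \<rho>1 aD AE by (intro mult_left_mono) (auto intro: mult_left_le)
        moreover have "(a + A * D + a * (A * D)) * \<rho> \<le> C * \<rho>" by (intro mult_right_mono Cs \<rho>)
        ultimately show "(1 + a * \<rho>) * (1 + A * D * \<rho>) \<le> 1 + C * \<rho>" by (simp add: algebra_simps)
      qed (use \<rho> p in auto)
      finally show "\<bar>ip (?G y) w v\<bar> \<le> (1 + C * \<rho>) * \<rho> * sqrt (ip (?G y') v v)" by (simp add: mult_ac)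
    qed
    then show ?thesis using q q'(1) unfolding w_def y'_def \<rho>_def by simp
  qed
  show ?thesis by (rule that[of d R C]) (use d(1) R C0 main in \<open>auto simp: local_model_def\<close>)
qed

section \<open>Continuity of the mean curvature, and lengths of curves under the immersion\<close>

context imm
begin

abbreviation hn :: "'a \<Rightarrow> real" where "hn \<equiv> mean_curv_norm P N \<phi>"

lemma continuous_on_mean_curv:
  assumes c: "c \<in> atlas P" and d: "d \<in> atlas N"
  shows "continuous_on (dom c d) (mean_curv P N \<phi> c d)"
proof -
  let ?f = "coord_map c d \<phi>"
  note f = smooth_f[OF c d] open_dom[OF c d]
  have sub: "(\<lambda>x. x) ` dom c d \<subseteq> P.img c" "(\<lambda>x. x) ` dom c d \<subseteq> dom c d" "?f ` dom c d \<subseteq> N.img d"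
    using f_img[OF c] by auto
  have cf: "continuous_on (dom c d) ?f" by (rule smooth_on_continuous[OF f(1)])
  have cg: "continuous_on (dom c d) (gmat P c)" by (rule continuous_on_subset[OF P.cont_g[OF c]]) blast
  have "continuous_on (dom c d) (\<lambda>x. (1 / real CARD('m)) *\<^sub>R
       (\<Sum>i\<in>UNIV. \<Sum>j\<in>UNIV. (matrix_inv (gmat P c x) *v axis j 1) $ i *\<^sub>R sff (gmat P c) (gmat N d) ?f x (axis i 1) (axis j 1)))"
    unfolding sff_def
    by (intro continuous_on_scaleR continuous_on_sum continuous_on_const continuous_on_component continuous_on_inv_mult cg
        continuous_on_add continuous_on_diff smooth_sd_continuous[OF f] smooth_fd_continuous[OF f] continuous_on_id sub
        continuous_on_chr[OF N.smooth_g[OF d] N.open_img[OF d] N.posdef_g[OF d]]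
        continuous_on_chr[OF P.smooth_g[OF c] P.open_img[OF c] P.posdef_g[OF c]] cf P.posdef_g[OF c]) auto
  then show ?thesis
    by (rule continuous_on_eq) (simp add: mean_curv_def second_ff_sff[OF f] matrix_inv_component[symmetric])
qed

lemma continuous_hn: "continuous_on UNIV hn"
proof (subst continuous_on_eq_continuous_at[OF open_UNIV], rule ballI)
  fix q
  obtain c where c: "c \<in> atlas P" "q \<in> cdom c" using P.chart_ex by blast
  obtain d where d: "d \<in> atlas N" "\<phi> q \<in> cdom d" using N.chart_ex by blast
  let ?U = "cdom c \<inter> \<phi> -` cdom d"
  have oU: "open ?U" by (intro open_Int P.open_cdom c open_vimage_phi N.open_cdom d)
  have cc: "continuous_on ?U (cmap c)" by (rule continuous_on_subset[OF P.cont_cmap[OF c(1)]]) blast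
  have cd: "continuous_on ?U (\<lambda>q. cmap d (\<phi> q))"
    by (rule continuous_on_compose2[OF N.cont_cmap[OF d(1)] continuous_on_subset[OF cont_phi]]) auto
  have cH: "continuous_on ?U (\<lambda>q. mean_curv P N \<phi> c d (cmap c q))"
    by (rule continuous_on_compose2[OF continuous_on_mean_curv[OF c(1) d(1)] cc]) auto
  have cG: "continuous_on ?U (\<lambda>q. gmat N d (cmap d (\<phi> q)))"
    by (rule continuous_on_compose2[OF N.cont_g[OF d(1)] cd]) auto
  have "continuous_on ?U hn"
    by (rule continuous_on_eq[OF continuous_on_real_sqrt[OF continuous_on_ip[OF cG cH cH]]])
      (simp add: mean_curv_norm_chart[OF c(1) d(1)])
  then show "isCont hn q" using c d by (simp add: continuous_on_eq_continuous_at[OF oU])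
qed

lemma hn_nonneg: "hn q \<ge> 0"
proof -
  obtain c where c: "c \<in> atlas P" "q \<in> cdom c" using P.chart_ex by blast
  obtain d where d: "d \<in> atlas N" "\<phi> q \<in> cdom d" using N.chart_ex by blast
  show ?thesis unfolding mean_curv_norm_chart[OF c(1) d(1) c(2) d(2)]
    using posdef_nonneg[OF N.posdef_g[OF d(1)]] d(2) by simp
qed

lemma near_charts:
  assumes "continuous_on {a..b} \<gamma>" "t \<in> {a..b}" "c \<in> atlas P" "\<gamma> t \<in> cdom c" "d \<in> atlas N" "\<phi> (\<gamma> t) \<in> cdom d"
  obtains e :: real where "e > 0" "\<And>s. s \<in> {a..b} \<Longrightarrow> \<bar>s - t\<bar> < e \<Longrightarrow> \<gamma> s \<in> cdom c \<inter> \<phi> -` cdom d"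
proof -
  have "open (cdom c \<inter> \<phi> -` cdom d)" by (intro open_Int P.open_cdom assms open_vimage_phi N.open_cdom)
  then have "openin (top_of_set {a..b}) ({a..b} \<inter> \<gamma> -` (cdom c \<inter> \<phi> -` cdom d))"
    using continuous_openin_preimage_gen[OF assms(1)] by blast
  moreover have "t \<in> {a..b} \<inter> \<gamma> -` (cdom c \<inter> \<phi> -` cdom d)" using assms by blast
  ultimately obtain e where e: "e > 0" "\<forall>s\<in>{a..b}. dist s t < e \<longrightarrow> s \<in> {a..b} \<inter> \<gamma> -` (cdom c \<inter> \<phi> -` cdom d)"
    unfolding openin_euclidean_subtopology_iff by blast
  show ?thesis by (rule that[OF e(1)]) (use e(2) in \<open>auto simp: dist_real_def\<close>)
qed

lemma pwc_phi:
  assumes g: "P.pwc \<gamma> a b" shows "N.pwc (\<phi> \<circ> \<gamma>) a b"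
proof (rule N.pwcI)
  have cg: "continuous_on {a..b} \<gamma>" using g unfolding P.pwc_def by blast
  then show "continuous_on {a..b} (\<phi> \<circ> \<gamma>)" by (intro continuous_on_compose continuous_on_subset[OF cont_phi]) auto
  fix t assume t: "t \<in> {a..b}"
  obtain c where c: "c \<in> atlas P" "\<gamma> t \<in> cdom c" using P.chart_ex by blast
  obtain d where d: "d \<in> atlas N" "\<phi> (\<gamma> t) \<in> cdom d" using N.chart_ex by blast
  obtain e where e: "e > 0" "\<And>s. s \<in> {a..b} \<Longrightarrow> \<bar>s - t\<bar> < e \<Longrightarrow> \<gamma> s \<in> cdom c \<inter> \<phi> -` cdom d"
    by (rule near_charts[OF cg t c d]) blast
  have "(\<phi> \<circ> \<gamma>) ` {u..v} \<subseteq> cdom d \<and> (cmap d \<circ> (\<phi> \<circ> \<gamma>)) piecewise_C1_differentiable_on {u..v}"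
    if uv: "a \<le> u" "u \<le> t" "t \<le> v" "v \<le> b" "v - u < e" for u v
  proof -
    have im: "\<gamma> s \<in> cdom c \<inter> \<phi> -` cdom d" if "s \<in> {u..v}" for s using that uv by (intro e(2)) auto
    have "\<gamma> ` {u..v} \<subseteq> cdom c" using im by blast
    then have "(cmap c \<circ> \<gamma>) piecewise_C1_differentiable_on {u..v}"
      using g c(1) uv(1,4) order_trans[OF uv(2,3)] unfolding P.pwc_def by blast
    then have "(\<lambda>s. coord_map c d \<phi> ((cmap c \<circ> \<gamma>) s)) piecewise_C1_differentiable_on {u..v}"
      by (rule pw_C1_compose[OF _ _ open_dom[OF c(1) d(1)] smooth_f[OF c(1) d(1)]]) (use im in auto)
    moreover have "coord_map c d \<phi> ((cmap c \<circ> \<gamma>) s) = (cmap d \<circ> (\<phi> \<circ> \<gamma>)) s" if "s \<in> {u..v}" for s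
      using f_eq[OF c(1), of "\<gamma> s" d] im[OF that] by simp
    ultimately have "(cmap d \<circ> (\<phi> \<circ> \<gamma>)) piecewise_C1_differentiable_on {u..v}" by (rule P.pw_C1_cong)
    then show ?thesis using im by auto
  qed
  then show "\<exists>d\<in>atlas N. \<exists>e>0. \<forall>u v. a \<le> u \<and> u \<le> t \<and> t \<le> v \<and> v \<le> b \<and> v - u < e \<longrightarrow>
      (\<phi> \<circ> \<gamma>) ` {u..v} \<subseteq> cdom d \<and> (cmap d \<circ> (\<phi> \<circ> \<gamma>)) piecewise_C1_differentiable_on {u..v}"
    using d(1) e(1) by blast
qed

lemma len_phi:
  assumes g: "P.pwc \<gamma> a b" "a \<le> b" shows "N.len (\<phi> \<circ> \<gamma>) a b = P.len \<gamma> a b"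
proof -
  obtain S where S: "finite S"
    "\<And>t. t \<in> {a<..<b} - S \<Longrightarrow> \<exists>c\<in>atlas P. \<gamma> t \<in> cdom c \<and> (cmap c \<circ> \<gamma>) differentiable (at t)"
    using P.pwc_regular[OF g] by blast
  have "speed N (\<phi> \<circ> \<gamma>) t = speed P \<gamma> t" if t: "t \<in> {a<..<b} - S" for t
  proof -
    obtain c where c: "c \<in> atlas P" "\<gamma> t \<in> cdom c" "(cmap c \<circ> \<gamma>) differentiable (at t)" using S(2)[OF t] by blast
    obtain d where d: "d \<in> atlas N" "\<phi> (\<gamma> t) \<in> cdom d" using N.chart_ex by blast
    let ?f = "coord_map c d \<phi>"
    have ct: "isCont \<gamma> t" using P.pwc_isCont[OF g(1)] t by auto
    have ct': "isCont (\<phi> \<circ> \<gamma>) t"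
      unfolding o_def by (rule isCont_o2[OF ct]) (use cont_phi in \<open>simp add: continuous_on_eq_continuous_at\<close>)
    obtain v where v: "((cmap c \<circ> \<gamma>) has_vector_derivative v) (at t)"
      using c(3) vector_derivative_works by blast
    have x: "cmap c (\<gamma> t) \<in> dom c d" using c d by blast
    have "?f differentiable at ((cmap c \<circ> \<gamma>) t)"
      using smooth_on_differentiable[OF smooth_f[OF c(1) d(1)] open_dom[OF c(1) d(1)] x] by simp
    note vd_chain[OF v this, unfolded o_apply[of "cmap c" \<gamma> t]]
    moreover obtain A where A: "open A" "t \<in> A" "\<And>s. s \<in> A \<Longrightarrow> \<gamma> s \<in> cdom c"
      by (rule isCont_open_nhd[OF ct P.open_cdom[OF c(1)] c(2)]) blast
    ultimately have v': "((cmap d \<circ> (\<phi> \<circ> \<gamma>)) has_vector_derivative fd ?f (cmap c (\<gamma> t)) v) (at t)"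
      by (subst (asm) vd_cong_open[OF A(1,2), of _ "cmap d \<circ> (\<phi> \<circ> \<gamma>)"]) (use A(3) P.cinv_cmap[OF c(1)] in auto)
    have "speed N (\<phi> \<circ> \<gamma>) t = sqrt (ip (gmat N d (cmap d ((\<phi> \<circ> \<gamma>) t))) (fd ?f (cmap c (\<gamma> t)) v) (fd ?f (cmap c (\<gamma> t)) v))"
      by (rule N.speed_eq[OF d(1) _ ct' v']) (use d(2) in simp)
    also have "\<dots> = speed P \<gamma> t"
      unfolding P.speed_eq[OF c(1,2) ct v] metric_pull[OF c(1) d(1) x] f_eq[OF c(1,2)] by simp
    finally show ?thesis .
  qed
  then have "AE t in lborel. ennreal (indicator {a<..<b} t * speed N (\<phi> \<circ> \<gamma>) t) = ennreal (indicator {a<..<b} t * speed P \<gamma> t)"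
    by (intro P.AE_finite_lborel[OF S(1)]) (auto simp: indicator_def)
  then show ?thesis unfolding N.len_def P.len_def by (rule nn_integral_cong_AE)
qed

text \<open>Composition with \<phi> maps curves in \<open>P\<close> to curves in \<open>N\<close> of
  equal length (\<open>len_phi\<close>).\<close>

lemma phi_lipschitz: "rdist N (\<phi> p) (\<phi> q) \<le> rdist P p q"
proof -
  have "N.ed (\<phi> p) (\<phi> q) \<le> P.ed p q"
  proof (rule ccontr)
    assume "\<not> ?thesis"
    then have "P.ed p q < N.ed (\<phi> p) (\<phi> q)" by simp
    then obtain \<gamma> where g: "P.pwc \<gamma> 0 1" "\<gamma> 0 = p" "\<gamma> 1 = q" "P.len \<gamma> 0 1 < N.ed (\<phi> p) (\<phi> q)"
      by (rule P.ed_less) blast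
    have "N.ed ((\<phi> \<circ> \<gamma>) 0) ((\<phi> \<circ> \<gamma>) 1) \<le> N.len (\<phi> \<circ> \<gamma>) 0 1" by (rule N.ed_le[OF pwc_phi[OF g(1)]]) simp
    then show False using g len_phi[OF g(1)] by simp
  qed
  then show ?thesis unfolding N.rdist_le_iff[OF P.rdist_nonneg] P.ennreal_rdist .
qed

end

section \<open>Cutoff functions and integrals in charts\<close>

text \<open>The squared positive part is a simple C^1 function that vanishes for negative arguments;
  the cutoff functions are composed of it.\<close>

lemma max0_square_derivative: "((\<lambda>t::real. (max 0 t)\<^sup>2) has_field_derivative 2 * max 0 t) (at t)"
proof -
  consider "t < 0" | "t > 0" | "t = 0" by linarith
  then show ?thesis
  proof cases
    case 1
    have "((\<lambda>_. 0) has_field_derivative 2 * max 0 t) (at t)" using 1 by simp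
    then show ?thesis by (rule has_field_derivative_transform_within_open[of _ _ _ "{..<0}"]) (use 1 in auto)
  next
    case 2
    have "((\<lambda>t. t\<^sup>2) has_field_derivative 2 * max 0 t) (at t)" using 2 by (auto intro!: derivative_eq_intros)
    then show ?thesis by (rule has_field_derivative_transform_within_open[of _ _ _ "{0<..}"]) (use 2 in auto)
  next
    case 3
    have "((\<lambda>h. (max 0 h)\<^sup>2 / h) \<longlongrightarrow> 0) (at (0::real))"
    proof (rule Lim_null_comparison)
      show "\<forall>\<^sub>F h in at 0. norm ((max 0 h)\<^sup>2 / h) \<le> \<bar>h\<bar>"
        by (auto simp: eventually_at_filter max_def power2_eq_square)
      show "((\<lambda>h. \<bar>h\<bar>) \<longlongrightarrow> 0) (at (0::real))" by (rule tendsto_rabs_zero) (rule tendsto_ident_at)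
    qed
    then show ?thesis using 3 by (simp add: DERIV_def)
  qed
qed

section \<open>Continuously differentiable functions, cutoffs, and the volume density\<close>

context rmfd
begin

text \<open>Cutoff functions enter the divergence inequality only through their first derivatives,
  so this class is large enough and explicit formulas suffice.\<close>

definition C1 :: "('a \<Rightarrow> real) \<Rightarrow> bool" where
  "C1 \<psi> \<longleftrightarrow> (\<forall>c\<in>atlas M. (\<forall>x\<in>img c. (\<lambda>x. \<psi> (cinv c x)) differentiable at x) \<and>
     (\<forall>v. continuous_on (img c) (\<lambda>x. fd (\<lambda>x. \<psi> (cinv c x)) x v)))"

lemma C1_differentiable: "C1 \<psi> \<Longrightarrow> c \<in> atlas M \<Longrightarrow> x \<in> img c \<Longrightarrow> (\<lambda>x. \<psi> (cinv c x)) differentiable at x"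
  unfolding C1_def by blast

lemma C1_continuous_fd:
  assumes "C1 \<psi>" "c \<in> atlas M" "continuous_on S v" "S \<subseteq> img c"
  shows "continuous_on S (\<lambda>x. fd (\<lambda>x. \<psi> (cinv c x)) x (v x))"
proof -
  have *: "continuous_on S (\<lambda>x. fd (\<lambda>x. \<psi> (cinv c x)) x w)" for w
    using assms(1,2) continuous_on_subset[OF _ assms(4)] unfolding C1_def by blast
  have "continuous_on S (\<lambda>x. \<Sum>i\<in>UNIV. v x $ i *\<^sub>R fd (\<lambda>x. \<psi> (cinv c x)) x (axis i 1))"
    by (intro continuous_on_sum continuous_on_scaleR continuous_on_component assms(3) *)
  moreover have "(\<Sum>i\<in>UNIV. v x $ i *\<^sub>R fd (\<lambda>x. \<psi> (cinv c x)) x (axis i 1)) = fd (\<lambda>x. \<psi> (cinv c x)) x (v x)" if "x \<in> S" for x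
    by (rule linear_axis_sum[OF linear_fd[OF C1_differentiable[OF assms(1,2)]], symmetric]) (use that assms(4) in blast)
  ultimately show ?thesis by (rule continuous_on_eq)
qed

lemma C1_continuous_chart: "C1 \<psi> \<Longrightarrow> c \<in> atlas M \<Longrightarrow> continuous_on (img c) (\<lambda>x. \<psi> (cinv c x))"
  by (intro differentiable_imp_continuous_on differentiable_at_imp_differentiable_on C1_differentiable)

lemma C1_continuous:
  assumes "C1 \<psi>" shows "continuous_on UNIV \<psi>"
proof (subst continuous_on_eq_continuous_at[OF open_UNIV], rule ballI)
  fix q
  obtain c where c: "c \<in> atlas M" "q \<in> cdom c" using chart_ex by blast
  have "continuous_on (cdom c) (\<lambda>q. \<psi> (cinv c (cmap c q)))"
    by (rule continuous_on_compose2[OF C1_continuous_chart[OF assms c(1)] cont_cmap[OF c(1)]]) auto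
  then have "continuous_on (cdom c) \<psi>"
    by (rule continuous_on_eq) (simp add: cinv_cmap[OF c(1)])
  then show "isCont \<psi> q" using c by (simp add: continuous_on_eq_continuous_at[OF open_cdom[OF c(1)]])
qed

lemma C1_const: "C1 (\<lambda>_. a)"
  unfolding C1_def by (auto simp: fd_eqI[OF has_derivative_const])

lemma C1_mult:
  assumes "C1 a" "C1 b" shows "C1 (\<lambda>q. a q * b q)"
  unfolding C1_def
proof (intro ballI conjI allI)
  fix c x v assume c: "c \<in> atlas M"
  note d = C1_differentiable[OF assms(1) c] C1_differentiable[OF assms(2) c]
  show "(\<lambda>x. a (cinv c x) * b (cinv c x)) differentiable at x" if "x \<in> img c"
    using d[OF that] by (rule differentiable_mult)
  have "fd (\<lambda>x. a (cinv c x) * b (cinv c x)) x v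
      = a (cinv c x) * fd (\<lambda>x. b (cinv c x)) x v + fd (\<lambda>x. a (cinv c x)) x v * b (cinv c x)" if "x \<in> img c" for x v
    by (subst fd_eqI[OF has_derivative_mult[OF fd_works[OF d(1)[OF that]] fd_works[OF d(2)[OF that]]]]) (rule refl)
  moreover have "continuous_on (img c) (\<lambda>x. a (cinv c x) * fd (\<lambda>x. b (cinv c x)) x v + fd (\<lambda>x. a (cinv c x)) x v * b (cinv c x))"
    by (intro continuous_on_add continuous_on_mult C1_continuous_chart C1_continuous_fd assms c continuous_on_const order_refl)
  ultimately show "continuous_on (img c) (\<lambda>x. fd (\<lambda>x. a (cinv c x) * b (cinv c x)) x v)" by simp
qed

lemma C1_one_minus:
  assumes "C1 a" shows "C1 (\<lambda>q. 1 - a q)"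
  unfolding C1_def
proof (intro ballI conjI allI)
  fix c x v assume c: "c \<in> atlas M"
  note d = C1_differentiable[OF assms(1) c]
  show "(\<lambda>x. 1 - a (cinv c x)) differentiable at x" if "x \<in> img c"
    using d[OF that] by simp
  have "fd (\<lambda>x. 1 - a (cinv c x)) x v = - fd (\<lambda>x. a (cinv c x)) x v" if "x \<in> img c" for x v
    by (subst fd_eqI[OF has_derivative_diff[OF has_derivative_const fd_works[OF d[OF that]]]]) simp
  moreover have "continuous_on (img c) (\<lambda>x. - fd (\<lambda>x. a (cinv c x)) x v)"
    by (intro continuous_on_minus C1_continuous_fd assms c continuous_on_const order_refl)
  ultimately show "continuous_on (img c) (\<lambda>x. fd (\<lambda>x. 1 - a (cinv c x)) x v)" by simp
qed

text \<open>In one chart the cutoff is built from two nested squared positive parts, the inner one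
  of \<open>r\<^sup>2\<close> minus the squared distance to the center, and it is extended by 1. It
  is 0 near \<open>p\<close> and 1 far away so that \<open>1 - e\<close> localizes to a chart in
  \<open>global_ineq\<close>.\<close>

lemma C1_cutoff:
  assumes V: "open V" "p \<in> V"
  obtains c K W e where "c \<in> atlas M" "compact K" "K \<subseteq> cdom c \<inter> V" "open W" "p \<in> W" "C1 e"
    "\<And>q. 0 \<le> e q \<and> e q \<le> 1" "\<And>q. q \<notin> K \<Longrightarrow> e q = 1" "\<And>q. q \<in> W \<Longrightarrow> e q = 0"
proof -
  obtain c where c: "c \<in> atlas M" "p \<in> cdom c" using chart_ex by blast
  define x0 where "x0 = cmap c p"
  have "x0 \<in> cmap c ` (cdom c \<inter> V)" using c V by (auto simp: x0_def)
  then obtain r where r: "r > 0" "cball x0 r \<subseteq> cmap c ` (cdom c \<inter> V)"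
    using open_cmap_image[OF c(1) V(1)] open_contains_cball by blast
  \<comment> \<open>On the ball of radius \<open>r / 2\<close> the function \<open>s\<close> is at
    least \<open>3 / 4 * r\<^sup>2\<close>; \<open>k\<close> makes
    \<open>k * (3 / 4 * r\<^sup>2)\<^sup>2 = 1\<close>, so that \<open>E\<close> vanishes
    there.\<close>
  define k where "k = 16 / (9 * r ^ 4)"
  have k: "k > 0" using r by (simp add: k_def)
  define s where "s = (\<lambda>x. r\<^sup>2 - (x - x0) \<bullet> (x - x0))"
  define E where "E = (\<lambda>x. (max 0 (1 - k * (max 0 (s x))\<^sup>2))\<^sup>2)"
  define E' where "E' = (\<lambda>x v. 2 * max 0 (1 - k * (max 0 (s x))\<^sup>2) * (- (k * (2 * max 0 (s x) * (- 2 * (v \<bullet> (x - x0)))))))"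
  have dE: "(E has_derivative E' x) (at x)" for x
  proof -
    have "(s has_derivative (\<lambda>v. - 2 * (v \<bullet> (x - x0)))) (at x)"
      unfolding s_def by (auto intro!: derivative_eq_intros simp: inner_commute)
    from has_derivative_compose[OF this max0_square_derivative[unfolded has_field_derivative_def]]
    have "((\<lambda>x. (max 0 (s x))\<^sup>2) has_derivative (\<lambda>v. 2 * max 0 (s x) * (- 2 * (v \<bullet> (x - x0))))) (at x)" .
    then have "((\<lambda>x. 1 - k * (max 0 (s x))\<^sup>2) has_derivative (\<lambda>v. - (k * (2 * max 0 (s x) * (- 2 * (v \<bullet> (x - x0))))))) (at x)"
      by (rule has_derivative_eq_rhs[OF has_derivative_diff[OF has_derivative_const has_derivative_mult_right]]) simp
    from has_derivative_compose[OF this max0_square_derivative[unfolded has_field_derivative_def]]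
    show ?thesis unfolding E_def E'_def .
  qed
  have E01: "0 \<le> E x \<and> E x \<le> 1" for x
    unfolding E_def using k by (auto intro!: power_le_one simp: max_def)
  have E1: "E x = 1" if "x \<notin> cball x0 r" for x
  proof -
    have "r \<le> norm (x - x0)" using that by (simp add: dist_norm norm_minus_commute)
    then have "s x \<le> 0" using r(1) by (simp add: s_def dot_square_norm)
    then show ?thesis by (simp add: E_def)
  qed
  have E0: "E x = 0" if "x \<in> ball x0 (r / 2)" for x
  proof -
    have "(norm (x - x0))\<^sup>2 \<le> (r / 2)\<^sup>2" using that by (intro power_mono) (auto simp: dist_norm norm_minus_commute)
    then have "s x \<ge> 3 / 4 * r\<^sup>2" by (simp add: s_def dot_square_norm field_simps)
    then have "(3 / 4 * r\<^sup>2)\<^sup>2 \<le> (max 0 (s x))\<^sup>2" by (intro power_mono) auto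
    then have "k * (3 / 4 * r\<^sup>2)\<^sup>2 \<le> k * (max 0 (s x))\<^sup>2" using k by simp
    moreover have "k * (3 / 4 * r\<^sup>2)\<^sup>2 = 1" using r(1) by (simp add: k_def power_mult_distrib power2_eq_square power4_eq_xxxx)
    ultimately show ?thesis by (simp add: E_def)
  qed
  define e where "e = (\<lambda>q. if q \<in> cdom c then E (cmap c q) else 1)"
  define K where "K = cinv c ` cball x0 r"
  have rc: "cball x0 r \<subseteq> img c" using r(2) by blast
  have cK: "compact K" unfolding K_def
    by (rule compact_continuous_image[OF continuous_on_subset[OF cont_cinv[OF c(1)] rc] compact_cball])
  have KV: "K \<subseteq> cdom c \<inter> V"
  proof
    fix q assume "q \<in> K"
    then obtain x where x: "x \<in> cball x0 r" "q = cinv c x" unfolding K_def by blast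
    then obtain q' where "q' \<in> cdom c \<inter> V" "x = cmap c q'" using r(2) by blast
    then show "q \<in> cdom c \<inter> V" using x cinv_cmap[OF c(1)] by simp
  qed
  have eK: "e q = 1" if "q \<notin> K" for q
  proof (cases "q \<in> cdom c")
    case True
    then have "cmap c q \<notin> cball x0 r" using that cinv_cmap[OF c(1) True] unfolding K_def by (metis image_eqI)
    then show ?thesis using True E1 by (simp add: e_def)
  qed (simp add: e_def)
  have "C1 e"
    unfolding C1_def
  proof (intro ballI conjI allI)
    fix c' v assume c': "c' \<in> atlas M"
    \<comment> \<open>Two open pieces cover the image of the chart: one where \<open>e\<close> is
      given by \<open>E\<close>, and one where it is constantly 1.\<close>
    let ?A = "cmap c' ` (cdom c' \<inter> cdom c)" and ?B = "cmap c' ` (cdom c' \<inter> - K)" and ?t = "cmap c \<circ> cinv c'" and ?e = "\<lambda>x. e (cinv c' x)"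
    have o: "open ?A" "open ?B"
      using open_cmap_image[OF c' open_cdom[OF c(1)]] open_cmap_image[OF c' open_Compl[OF compact_imp_closed[OF cK]]] by auto
    have un: "?A \<union> ?B = img c'" using KV by blast
    have eA: "?e x = E (?t x)" if "x \<in> ?A" for x using that cinv_cmap[OF c'] by (auto simp: e_def)
    have eB: "?e x = 1" if "x \<in> ?B" for x using that cinv_cmap[OF c'] eK by auto
    have dA: "(?e has_derivative (\<lambda>v. E' (?t x) (fd ?t x v))) (at x)" if x: "x \<in> ?A" for x
    proof -
      have "?t differentiable at x" using x trans_differentiable[OF c' c(1)] by auto
      from has_derivative_compose[OF fd_works[OF this] dE]
      show ?thesis by (subst has_derivative_cong_open[OF o(1) x eA])
    qed
    have dB: "(?e has_derivative (\<lambda>v. 0)) (at x)" if x: "x \<in> ?B" for x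
      by (subst has_derivative_cong_open[OF o(2) x eB]) auto
    show "?e differentiable at x" if "x \<in> img c'" for x
      using that dA[of x] dB[of x] un unfolding differentiable_def by blast
    have "continuous_on ?A (\<lambda>x. E' (?t x) (fd ?t x v))"
      unfolding E'_def s_def
      by (intro continuous_on_mult continuous_on_const continuous_on_max continuous_on_diff continuous_on_power continuous_on_minus
          continuous_on_inner smooth_on_continuous[OF smooth_trans[OF c' c(1)]]
          smooth_fd_continuous[OF smooth_trans[OF c' c(1)] o(1)] continuous_on_id) simp
    then have "continuous_on ?A (\<lambda>x. fd ?e x v)"
      by (rule continuous_on_eq) (simp add: fd_eqI[OF dA])
    moreover have "continuous_on ?B (\<lambda>x. fd ?e x v)"
      by (rule continuous_on_eq[OF continuous_on_const[of _ 0]]) (simp add: fd_eqI[OF dB])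
    ultimately show "continuous_on (img c') (\<lambda>x. fd ?e x v)"
      using continuous_on_open_Un[OF o] unfolding un by blast
  qed
  moreover have "open (cinv c ` ball x0 (r / 2))"
    by (rule open_cinv_image[OF c(1)]) (use rc r(1) in auto)
  moreover have "p \<in> cinv c ` ball x0 (r / 2)"
    using cinv_cmap[OF c] r(1) unfolding x0_def by (metis centre_in_ball half_gt_zero image_eqI)
  moreover have "e q = 0" if q: "q \<in> cinv c ` ball x0 (r / 2)" for q
  proof -
    obtain x where x: "x \<in> ball x0 (r / 2)" "q = cinv c x" using q by blast
    have "x \<in> img c" by (rule subsetD[OF rc]) (use x(1) r(1) in simp)
    then show ?thesis using E0[OF x(1)] x(2) cmap_cinv cinv_in by (simp add: e_def)
  qed
  moreover have "0 \<le> e q \<and> e q \<le> 1" for q using E01 by (simp add: e_def)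
  ultimately show ?thesis using that[OF c(1) cK KV] eK by blast
qed

lemma dn_derivative:
  assumes c: "c \<in> atlas M" "x \<in> img c"
  shows "(dn c has_derivative (\<lambda>v. dn c x * ((1/2) * trace (matrix_inv (gmat M c x) ** fd (gmat M c) x v)))) (at x)"
proof -
  let ?G = "gmat M c"
  have det: "det (?G x) > 0" by (rule posdef_det_pos[OF posdef_g[OF c]])
  obtain A :: "real^'m^'m" where A: "transpose A ** ?G x ** A = mat 1" by (rule posdef_frame[OF posdef_g[OF c]]) blast
  have "(dn c has_derivative (\<lambda>v. (det (?G x) * trace (matrix_inv (?G x) ** fd ?G x v)) * (inverse (sqrt (det (?G x))) / 2))) (at x)"
    unfolding dn_def[abs_def]
    using has_derivative_compose[OF fd_works[OF g_differentiable[OF c]] has_derivative_det[OF frame_props(2)[OF A]]]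
    by (intro has_derivative_real_sqrt det)
  moreover have "(det (?G x) * t) * (inverse (sqrt (det (?G x))) / 2) = dn c x * ((1/2) * t)" for t
    unfolding dn_def using det by (simp add: field_simps)
  ultimately show ?thesis by (simp only:)
qed

lemma continuous_on_fd_dn:
  assumes c: "c \<in> atlas M" and pv: "continuous_on T p" "continuous_on T v" "p ` T \<subseteq> img c"
  shows "continuous_on T (\<lambda>z. fd (dn c) (p z) (v z))"
proof -
  have "continuous_on T (\<lambda>z. dn c (p z) * ((1/2) * (\<Sum>k\<in>UNIV. (matrix_inv (gmat M c (p z)) *v (fd (gmat M c) (p z) (v z) *v axis k 1)) $ k)))"
    using pv(3)
    by (intro continuous_on_mult continuous_on_const continuous_on_sum continuous_on_component continuous_on_inv_mult
        continuous_on_compose2[OF cont_dn[OF c] pv(1)] continuous_on_compose2[OF cont_g[OF c] pv(1)] posdef_g[OF c]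
        bounded_linear.continuous_on[OF bounded_bilinear.bounded_linear_left[OF bounded_bilinear_mat_vec]]
        smooth_fd_continuous[OF smooth_g[OF c] open_img[OF c]] pv) auto
  then show ?thesis
    by (rule continuous_on_eq)
      (use pv(3) in \<open>auto simp: fd_eqI[OF dn_derivative[OF c]] trace_axis matrix_vector_mul_assoc\<close>)
qed

lemma integrable_vol_bounded:
  assumes K: "compact K" and F: "F \<in> borel_measurable borel" "\<And>q. q \<in> K \<Longrightarrow> \<bar>F q\<bar> \<le> b" "\<And>q. q \<notin> K \<Longrightarrow> F q = 0"
  shows "integrable vol (F :: 'a \<Rightarrow> real)"
  by (rule integrableI_bounded_set[of K]) (use assms vol_compact_finite[OF K] in \<open>auto simp: borel_compact\<close>)

lemma integral_vol_chart:
  assumes c: "c \<in> atlas M" and F: "integrable vol F" "\<And>q. q \<notin> cdom c \<Longrightarrow> F q = (0::real)"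
  shows "(\<integral>q. F q \<partial>vol) = (\<integral>y. indicator (img c) y * (dn c y * F (cinv c y)) \<partial>lborel)"
proof -
  have mF: "F \<in> borel_measurable borel" using borel_measurable_integrable[OF F(1)] by simp
  let ?g = "\<lambda>y. indicator (img c) y * (dn c y * F (cinv c y))"
  have eq: "?g = (\<lambda>y. (indicator (img c) y * dn c y) * F (cinv' c y))"
    by (auto simp: cinv'_def indicator_def fun_eq_iff)
  have mg: "?g \<in> borel_measurable borel"
    unfolding eq by (intro borel_measurable_times ind_dn_measurable c img_borel order_refl measurable_compose[OF cinv'_measurable[OF c] mF])
  \<comment> \<open>Instantiated with the absolute value for integrability, and with the identity
    and the negation for the positive and negative parts.\<close>
  have nn: "(\<integral>\<^sup>+ q. ennreal (s (F q)) \<partial>vol) = (\<integral>\<^sup>+ y. ennreal (s (?g y)) \<partial>lborel)"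
    if s: "s 0 = 0" "s \<in> borel_measurable borel" "\<And>a t. a \<ge> 0 \<Longrightarrow> s (a * t) = a * s t" for s :: "real \<Rightarrow> real"
  proof -
    have "(\<integral>\<^sup>+ q. ennreal (s (F q)) \<partial>vol) = (\<integral>\<^sup>+ y. ennreal (indicator (img c) y * dn c y) * ennreal (s (F (cinv c y))) \<partial>lborel)"
      by (rule nn_integral_vol_chart[OF c]) (use F(2) s mF in auto)
    also have "\<dots> = (\<integral>\<^sup>+ y. ennreal (s (?g y)) \<partial>lborel)"
      by (intro nn_integral_cong) (auto simp: indicator_def s ennreal_mult' dn_nonneg[OF c])
    finally show ?thesis .
  qed
  have "(\<integral>\<^sup>+ y. ennreal (norm (?g y)) \<partial>lborel) < \<infinity>"
    using F(1) nn[of abs] unfolding integrable_iff_bounded by (simp add: abs_mult)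
  then have "integrable lborel ?g" unfolding integrable_iff_bounded using mg by simp
  then show ?thesis
    unfolding real_lebesgue_integral_def[OF F(1)] real_lebesgue_integral_def[OF \<open>integrable lborel ?g\<close>]
    using nn[of "\<lambda>t. t"] nn[of uminus] by simp
qed

end

section \<open>The extrinsic distance function on the submanifold\<close>

lemma fd_sym_mat:
  fixes G :: "'x::real_normed_vector \<Rightarrow> real^'m::finite^'m"
  assumes "open S" "x \<in> S" "G differentiable at x" "\<And>y. y \<in> S \<Longrightarrow> transpose (G y) = G y"
  shows "ip (fd G x w) u v = ip (fd G x w) v u"
proof -
  have "fd (\<lambda>y. ip (G y) u v) x = fd (\<lambda>y. ip (G y) v u) x"
    by (rule fd_cong[OF assms(1,2)]) (rule ip_sym[OF assms(4)])
  then have "fd (\<lambda>y. ip (G y) u v) x w = fd (\<lambda>y. ip (G y) v u) x w" by simp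
  then show ?thesis unfolding fd_bounded_linear[OF bounded_linear_ip_mat assms(3)] .
qed

text \<open>\<open>q0\<close> is the point where the images of the centers accumulate, and
  \<open>d\<close>, \<open>R\<close>, \<open>C\<close> belong to it alone; \<xi> is any point with
  image nearby.\<close>

locale center = imm P N \<phi>
  for P :: "('a::{t2_space,second_countable_topology}, 'm::finite) riem"
    and N :: "('b::{t2_space,second_countable_topology}, 'n::finite) riem" and \<phi> +
  fixes q0 :: 'b and d :: "('b, 'n) chart" and R C :: real and \<xi> :: 'a
  assumes lm: "N.local_model q0 d R C" and near: "rdist N q0 (\<phi> \<xi>) < R"
begin

abbreviation r :: "'a \<Rightarrow> real" where "r \<equiv> rdist P \<xi>"
abbreviation y0 :: "real^'n" where "y0 \<equiv> cmap d (\<phi> \<xi>)"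
abbreviation G0 :: "real^'n^'n" where "G0 \<equiv> gmat N d y0"
abbreviation U :: "'a set" where "U \<equiv> {q. r q < R}"

lemma d: "d \<in> atlas N" and RC: "0 < R" "R \<le> 1" "0 \<le> C"
  using lm unfolding N.local_model_def by auto

lemma r_nonneg: "r q \<ge> 0" by (rule P.rdist_nonneg)

lemma continuous_r: "continuous_on S r"
  by (rule continuous_on_subset[OF P.continuous_rdist]) simp

lemma open_U: "open U" by (rule P.open_db)

lemma U_dom: "q \<in> U \<Longrightarrow> \<phi> q \<in> cdom d"
  using lm near phi_lipschitz[of \<xi> q] unfolding N.local_model_def by fastforce

text \<open>\<open>local_model\<close> speaks of the distance in \<open>N\<close>, which is at most
  \<open>r q\<close> by \<open>phi_lipschitz\<close>; both bounds are monotone in the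
  distance.\<close>

lemma model:
  assumes q: "q \<in> U"
  shows "(1 - C * r q) * ip (gmat N d (cmap d (\<phi> q))) v v
      \<le> ip G0 v v - ip G0 (cmap d (\<phi> q) - y0) (chr (gmat N d) (cmap d (\<phi> q)) v v)"
    and "\<bar>ip G0 (cmap d (\<phi> q) - y0) v\<bar> \<le> (1 + C * r q) * r q * sqrt (ip (gmat N d (cmap d (\<phi> q))) v v)"
proof -
  let ?s = "rdist N (\<phi> \<xi>) (\<phi> q)" and ?G = "gmat N d (cmap d (\<phi> q))"
  have s: "0 \<le> ?s" "?s \<le> r q" "?s \<le> R" using N.rdist_nonneg phi_lipschitz[of \<xi> q] q by auto
  have *: "(1 - C * ?s) * ip ?G v v \<le> ip G0 v v - ip G0 (cmap d (\<phi> q) - y0) (chr (gmat N d) (cmap d (\<phi> q)) v v)"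
    "\<bar>ip G0 (cmap d (\<phi> q) - y0) v\<bar> \<le> (1 + C * ?s) * ?s * sqrt (ip ?G v v)"
    using lm near s(3) unfolding N.local_model_def by blast+
  have p: "ip ?G v v \<ge> 0" by (rule posdef_nonneg[OF N.posdef_g[OF d]]) (use U_dom[OF q] in blast)
  have "(1 - C * r q) * ip ?G v v \<le> (1 - C * ?s) * ip ?G v v"
    by (intro mult_right_mono p) (use mult_left_mono[OF s(2) RC(3)] in simp)
  then show "(1 - C * r q) * ip ?G v v \<le> ip G0 v v - ip G0 (cmap d (\<phi> q) - y0) (chr (gmat N d) (cmap d (\<phi> q)) v v)"
    using *(1) by linarith
  have "(1 + C * ?s) * ?s * sqrt (ip ?G v v) \<le> (1 + C * r q) * r q * sqrt (ip ?G v v)"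
    by (intro mult_right_mono mult_mono add_left_mono mult_left_mono s RC(3)) (use p s RC(3) r_nonneg in auto)
  then show "\<bar>ip G0 (cmap d (\<phi> q) - y0) v\<bar> \<le> (1 + C * r q) * r q * sqrt (ip ?G v v)" using *(2) by linarith
qed

abbreviation f :: "('a, 'm) chart \<Rightarrow> real^'m \<Rightarrow> real^'n" where "f c \<equiv> coord_map c d \<phi>"

text \<open>The differential of the function \<open>u\<close> whose gradient is
  \<open>Z\<close>.\<close>

definition du :: "('a, 'm) chart \<Rightarrow> real^'m \<Rightarrow> real^'m \<Rightarrow> real" where
  "du c x w = ip G0 (f c x - y0) (fd (f c) x w)"

definition ddu :: "('a, 'm) chart \<Rightarrow> real^'m \<Rightarrow> real^'m \<Rightarrow> real^'m \<Rightarrow> real" where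
  "ddu c x v w = ip G0 (fd (f c) x v) (fd (f c) x w) + ip G0 (f c x - y0) (sd (f c) x v w)"

text \<open>The gradient of \<open>u = \<onehalf> ip G0 (f - y0) (f - y0)\<close>, the replacement for half the squared extrinsic distance.\<close>

definition Z :: "('a, 'm) chart \<Rightarrow> real^'m \<Rightarrow> real^'m" where
  "Z c x = matrix_inv (gmat P c x) *v (\<chi> i. du c x (axis i 1))"

text \<open>The derivative of \<open>Z\<close>, obtained by differentiating the equation in
  \<open>Z_ip\<close> and solving for it.\<close>

definition Zd :: "('a, 'm) chart \<Rightarrow> real^'m \<Rightarrow> real^'m \<Rightarrow> real^'m" where
  "Zd c x v = matrix_inv (gmat P c x) *v (\<chi> i. ddu c x v (axis i 1) - ip (fd (gmat P c) x v) (Z c x) (axis i 1))"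

context
  fixes c assumes c: "c \<in> atlas P"
begin

lemma smf: "smooth_on (dom c d) (f c)" "open (dom c d)"
  using smooth_f[OF c d] open_dom[OF c d] by auto

lemma posdef_gP: "x \<in> dom c d \<Longrightarrow> posdef (gmat P c x)"
  using P.posdef_g[OF c] by blast

lemma differentiable_gP: "x \<in> dom c d \<Longrightarrow> gmat P c differentiable at x"
  using P.g_differentiable[OF c] by blast

lemma linear_du: "x \<in> dom c d \<Longrightarrow> linear (du c x)"
  unfolding du_def[abs_def]
  using linear_compose[OF linear_fd[OF smooth_on_differentiable[OF smf]] linear_ip_right[of G0 "f c x - y0"]] by (simp add: o_def)

lemma vec_inner_linear:
  fixes L :: "real^'m \<Rightarrow> real" assumes "linear L" shows "(\<chi> i. L (axis i 1)) \<bullet> w = L w"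
  using linear_axis_sum[OF assms, of w] by (simp add: inner_vec_def mult.commute)

lemma Z_ip: "x \<in> dom c d \<Longrightarrow> ip (gmat P c x) (Z c x) w = du c x w"
  unfolding Z_def posdef_inv(3)[OF posdef_gP] by (rule vec_inner_linear[OF linear_du])

lemma du_derivative: "x \<in> dom c d \<Longrightarrow> ((\<lambda>x. du c x w) has_derivative (\<lambda>v. ddu c x v w)) (at x)"
  unfolding du_def
  by (rule has_derivative_eq_rhs[OF has_derivative_ip[OF has_derivative_const
        has_derivative_diff[OF fd_works[OF smooth_on_differentiable[OF smf]] has_derivative_const] sd_has_derivative[OF smf]]])
    (auto simp: ddu_def ip_def)

lemma linear_ddu: "x \<in> dom c d \<Longrightarrow> linear (ddu c x v)"
  using sd_bilinear[OF smf] linear_fd[OF smooth_on_differentiable[OF smf]]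
  unfolding ddu_def bilinear_def by (auto intro!: linearI simp: linear_add linear_scale ip_simps algebra_simps)

text \<open>\<open>has_derivative_inv_mult\<close> gives differentiability. Then both sides of
  \<open>Z_ip\<close> may be differentiated, and nondegeneracy of the metric determines the
  value.\<close>

lemma Z_derivative:
  assumes x: "x \<in> dom c d" shows "(Z c has_derivative Zd c x) (at x)"
proof -
  have "((\<lambda>x. (\<chi> i. du c x (axis i 1))) has_derivative (\<lambda>v. (\<chi> i. ddu c x v (axis i 1)))) (at x)"
    by (subst has_derivative_componentwise_within) (auto simp: Basis_vec_def inner_axis intro: du_derivative[OF x])
  from has_derivative_inv_mult[OF smf(2) x fd_works[OF differentiable_gP[OF x]] posdef_gP this]
  have dZ: "Z c differentiable at x" unfolding Z_def[abs_def] .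
  have "fd (Z c) x v = Zd c x v" for v
  proof (rule ip_nondeg[OF posdef_gP[OF x]])
    fix w
    have "((\<lambda>x. ip (gmat P c x) (Z c x) w) has_derivative (\<lambda>v. ip (fd (gmat P c) x v) (Z c x) w + ip (gmat P c x) (fd (Z c) x v) w
        + ip (gmat P c x) (Z c x) 0)) (at x)"
      by (rule has_derivative_ip[OF fd_works[OF differentiable_gP[OF x]] fd_works[OF dZ] has_derivative_const])
    then have "((\<lambda>x. du c x w) has_derivative (\<lambda>v. ip (fd (gmat P c) x v) (Z c x) w + ip (gmat P c x) (fd (Z c) x v) w
        + ip (gmat P c x) (Z c x) 0)) (at x)"
      by (subst has_derivative_cong_open[OF smf(2) x, of _ "\<lambda>x. ip (gmat P c x) (Z c x) w"]) (simp_all add: Z_ip)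
    from fun_cong[OF has_derivative_unique[OF this du_derivative[OF x]], of v]
    have "ip (gmat P c x) (fd (Z c) x v) w = ddu c x v w - ip (fd (gmat P c) x v) (Z c x) w" by (simp add: ip_simps)
    also have "\<dots> = ip (gmat P c x) (Zd c x v) w"
      unfolding Zd_def posdef_inv(3)[OF posdef_gP[OF x]]
      by (rule vec_inner_linear[symmetric]) (intro linear_compose_sub linear_ddu[OF x] linear_ip_right)
    finally show "ip (gmat P c x) (fd (Z c) x v) w = ip (gmat P c x) (Zd c x v) w" .
  qed
  then have "fd (Z c) x = Zd c x" by (rule ext)
  then show ?thesis using fd_works[OF dZ] by simp
qed

lemma continuous_Z: "continuous_on (dom c d) (Z c)"
  by (intro has_derivative_continuous_on[OF has_derivative_at_withinI[OF Z_derivative]])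

lemma continuous_gP: "continuous_on (dom c d) (gmat P c)"
  by (rule continuous_on_subset[OF P.cont_g[OF c]]) blast

lemma continuous_Zd:
  assumes v: "continuous_on S v" "S \<subseteq> dom c d" shows "continuous_on S (\<lambda>x. Zd c x (v x))"
proof -
  have id: "(\<lambda>x. x) ` S \<subseteq> dom c d" "(\<lambda>x. x) ` S \<subseteq> P.img c" using v(2) by blast+
  note s = continuous_on_subset[OF _ v(2)]
  show ?thesis
    unfolding Zd_def ddu_def
    by (intro continuous_on_inv_mult continuous_on_vec_lambda continuous_on_diff continuous_on_add continuous_on_ip continuous_on_const
        s[OF continuous_Z] s[OF continuous_gP] s[OF smooth_on_continuous[OF smf(1)]]
        smooth_fd_continuous[OF smf] smooth_sd_continuous[OF smf] smooth_fd_continuous[OF P.smooth_g[OF c] P.open_img[OF c]]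
        continuous_on_id v(1) id posdef_gP subsetD[OF v(2)])
qed

text \<open>The left side is \<open>dn c\<close> times the divergence of \<open>Z\<close>; on the right, \<open>ddu - du \<circ> chr\<close> is the Hessian of \<open>u\<close>.\<close>

lemma laplace:
  fixes A :: "real^'m^'m"
  assumes x: "x \<in> dom c d" and A: "transpose A ** gmat P c x ** A = mat 1"
  shows "fd (P.dn c) x (Z c x) + P.dn c x * (\<Sum>k\<in>UNIV. ip (gmat P c x) (col A k) (Zd c x (col A k)))
      = P.dn c x * (\<Sum>k\<in>UNIV. ddu c x (col A k) (col A k) - du c x (chr (gmat P c) x (col A k) (col A k)))"
proof -
  let ?G = "gmat P c" and ?a = "col A"
  have "x \<in> P.img c" using x by blast
  then have D: "fd (P.dn c) x v = P.dn c x * ((1/2) * (\<Sum>k\<in>UNIV. ip (fd ?G x v) (?a k) (?a k)))" for v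
    unfolding frame_trace_inv[OF A, symmetric] by (simp add: fd_eqI[OF P.dn_derivative[OF c]])
  have K: "ip (?G x) (?a k) (Zd c x (?a k)) = ddu c x (?a k) (?a k) - du c x (chr ?G x (?a k) (?a k)) - (1/2) * ip (fd ?G x (Z c x)) (?a k) (?a k)" for k
  proof -
    have "ip (?G x) (?a k) (Zd c x (?a k)) = ddu c x (?a k) (?a k) - ip (fd ?G x (?a k)) (Z c x) (?a k)"
      unfolding posdef_sym[OF posdef_gP[OF x], of "?a k"] Zd_def posdef_inv(3)[OF posdef_gP[OF x]]
      by (rule vec_inner_linear) (intro linear_compose_sub linear_ddu[OF x] linear_ip_right)
    moreover have "ip (fd ?G x (?a k)) (Z c x) (?a k) = ip (fd ?G x (?a k)) (?a k) (Z c x)"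
      by (rule fd_sym_mat[OF smf(2) x differentiable_gP[OF x]]) (use posdef_gP posdef_def in blast)
    moreover have "du c x (chr ?G x (?a k) (?a k)) = (1/2) * (ip (fd ?G x (?a k)) (?a k) (Z c x)
        + ip (fd ?G x (?a k)) (?a k) (Z c x) - ip (fd ?G x (Z c x)) (?a k) (?a k))"
      unfolding Z_ip[OF x, symmetric] posdef_sym[OF posdef_gP[OF x], of "Z c x"]
      by (rule chr_ip[OF differentiable_gP[OF x] posdef_gP[OF x]])
    ultimately show ?thesis by (simp add: field_simps)
  qed
  show ?thesis unfolding D K
    by (simp add: sum_subtractf sum.distrib sum_divide_distrib algebra_simps)
qed

text \<open>In an orthonormal frame the Gauss formula splits the Hessian of \<open>u\<close> into
  the term of \<open>model(1)\<close> and the \<open>G0\<close>-product of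
  \<open>cmap d (\<phi> q) - y0\<close> with the second fundamental form. The latter sums to
  \<open>CARD('m)\<close> times the product with the mean curvature vector, which
  \<open>model(2)\<close> bounds.\<close>

lemma laplace_lower:
  fixes A :: "real^'m^'m"
  assumes q: "q \<in> cdom c" "q \<in> U" and A: "transpose A ** gmat P c (cmap c q) ** A = mat 1"
  defines "x \<equiv> cmap c q"
  shows "real CARD('m) * (1 - C * r q - (1 + C * r q) * r q * hn q)
      \<le> (\<Sum>k\<in>UNIV. ddu c x (col A k) (col A k) - du c x (chr (gmat P c) x (col A k) (col A k)))"
proof -
  let ?m = "real CARD('m)" and ?e = "\<lambda>k. fd (f c) x (col A k)" and ?H = "mean_curv P N \<phi> c d x" and ?y = "cmap d (\<phi> q)"
  have x: "x \<in> dom c d" using q U_dom unfolding x_def by blast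
  have fx: "f c x = ?y" unfolding x_def by (rule f_eq[OF c q(1)])
  have e1: "ip (gmat N d ?y) (?e k) (?e k) = 1" for k
    using metric_pull[OF c d x, of "col A k" "col A k"] frame_props(5)[OF A[folded x_def], of k k] unfolding fx by simp
  have H: "(\<Sum>k\<in>UNIV. sff (gmat P c) (gmat N d) (f c) x (col A k) (col A k)) = ?m *\<^sub>R ?H"
    using mean_curv_frame[OF c d x A[folded x_def]] by simp
  have T: "ddu c x (col A k) (col A k) - du c x (chr (gmat P c) x (col A k) (col A k))
      = (ip G0 (?e k) (?e k) - ip G0 (?y - y0) (chr (gmat N d) ?y (?e k) (?e k)))
        + ip G0 (?y - y0) (sff (gmat P c) (gmat N d) (f c) x (col A k) (col A k))" for k
    unfolding ddu_def du_def sff_def fx by (simp add: ip_simps)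
  have "(\<Sum>k\<in>(UNIV :: 'm set). 1 - C * r q) \<le> (\<Sum>k\<in>UNIV. ip G0 (?e k) (?e k) - ip G0 (?y - y0) (chr (gmat N d) ?y (?e k) (?e k)))"
  proof (rule sum_mono)
    fix k show "1 - C * r q \<le> ip G0 (?e k) (?e k) - ip G0 (?y - y0) (chr (gmat N d) ?y (?e k) (?e k))"
      using model(1)[OF q(2), of "?e k"] unfolding e1 by simp
  qed
  moreover have "(\<Sum>k\<in>UNIV. ip G0 (?y - y0) (sff (gmat P c) (gmat N d) (f c) x (col A k) (col A k))) = ?m * ip G0 (?y - y0) ?H"
    unfolding linear_sum[OF linear_ip_right, symmetric, unfolded o_def] H ip_scale_right ..
  moreover have "\<bar>ip G0 (?y - y0) ?H\<bar> \<le> (1 + C * r q) * r q * hn q"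
    using model(2)[OF q(2), of ?H] mean_curv_norm_chart[OF c d q(1) U_dom[OF q(2)]] unfolding x_def by simp
  then have "?m * (- ((1 + C * r q) * r q * hn q)) \<le> ?m * ip G0 (?y - y0) ?H"
    by (intro mult_left_mono) auto
  ultimately show ?thesis unfolding T sum.distrib by (simp add: algebra_simps)
qed

text \<open>The squared norm of the gradient is \<open>du\<close> of the gradient itself, which
  \<open>model(2)\<close> bounds by a multiple of the norm; one factor cancels.\<close>

lemma Z_norm:
  assumes q: "q \<in> cdom c" "q \<in> U"
  shows "sqrt (ip (gmat P c (cmap c q)) (Z c (cmap c q)) (Z c (cmap c q))) \<le> (1 + C * r q) * r q"
proof -
  let ?x = "cmap c q" let ?z = "Z c ?x" let ?s = "sqrt (ip (gmat P c ?x) ?z ?z)"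
  have x: "?x \<in> dom c d" using q U_dom by blast
  have n: "ip (gmat P c ?x) ?z ?z \<ge> 0" by (rule posdef_nonneg[OF posdef_gP[OF x]])
  have "?s * ?s = du c ?x ?z" using n Z_ip[OF x, of ?z] by simp
  also have "\<dots> \<le> (1 + C * r q) * r q * ?s"
    using model(2)[OF q(2), of "fd (f c) ?x ?z"] unfolding du_def f_eq[OF c q(1)] metric_pull[OF c d x] by linarith
  finally have *: "?s * ?s \<le> (1 + C * r q) * r q * ?s" .
  show ?thesis
  proof (cases "?s = 0")
    case True
    then show ?thesis using RC(3) r_nonneg[of q] by simp
  next
    case False
    then have "?s > 0" using n by (simp add: order_less_le)
    then show ?thesis using * by (rule mult_right_le_imp_le[rotated])
  qed
qed

end

text \<open>The gradient is determined by the metric and the differential of \<open>u\<close>, so it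
  does not depend on the chart.\<close>

lemma Z_trans:
  assumes c: "c \<in> atlas P" "c' \<in> atlas P" and q: "q \<in> cdom c" "q \<in> cdom c'" "q \<in> U"
  shows "fd (cmap c' \<circ> cinv c) (cmap c q) (Z c (cmap c q)) = Z c' (cmap c' q)"
proof -
  let ?s = "cmap c' \<circ> cinv c" and ?x = "cmap c q" and ?x' = "cmap c' q"
  note tf = P.trans_facts[OF c q(1,2)]
  have x: "?x \<in> dom c d" "?x' \<in> dom c' d" using q U_dom by blast+
  let ?S = "cmap c ` (cdom c \<inter> (cdom c' \<inter> \<phi> -` cdom d))"
  have oS: "open ?S" by (intro P.open_cmap_image c open_Int open_vimage_phi N.open_cdom P.open_cdom d)
  have xS: "?x \<in> ?S" using q U_dom by blast
  have eq: "f c y = f c' (?s y)" if "y \<in> ?S" for y using that P.cinv_cmap[OF c(1)] P.cinv_cmap[OF c(2)] by auto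
  have F: "fd (f c) ?x w = fd (f c') ?x' (fd ?s ?x w)" for w
  proof -
    have "fd (f c) ?x w = fd (\<lambda>y. f c' (?s y)) ?x w" by (rule fun_cong[OF fd_cong[OF oS xS eq]])
    also have "\<dots> = fd (f c') (?s ?x) (fd ?s ?x w)"
      by (rule fd_chain[OF P.trans_differentiable[OF c q(1,2)]])
        (unfold tf(4), rule smooth_on_differentiable[OF smf[OF c(2)] x(2)])
    finally show ?thesis unfolding tf(4) .
  qed
  have "ip (gmat P c' ?x') (fd ?s ?x (Z c ?x)) w = ip (gmat P c' ?x') (Z c' ?x') w" for w
  proof -
    obtain v where v: "w = fd ?s ?x v" using tf(7) by (rule surjE)
    have "ip (gmat P c' ?x') (fd ?s ?x (Z c ?x)) w = du c ?x v"
      unfolding v Z_ip[OF c(1) x(1), symmetric] using tf(6)[OF tf(3), of "Z c ?x" v] unfolding tf(4) by simp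
    also have "\<dots> = du c' ?x' w" unfolding du_def F v f_eq[OF c(1) q(1)] f_eq[OF c(2) q(2)] ..
    finally show ?thesis unfolding Z_ip[OF c(2) x(2)] .
  qed
  then show ?thesis by (rule ip_nondeg[OF posdef_gP[OF c(2) x(2)]])
qed

end

section \<open>The monotonicity inequality\<close>

context rmfd
begin

text \<open>One radius \<delta> and one constant \<open>B\<close> for all of \<open>K\<close>: in
  \<open>chart_ineq\<close> this gives the uniform Lipschitz bound of the weight along the
  shifts.\<close>

lemma uniform_move:
  assumes c: "c \<in> atlas M" and K: "compact K" "K \<subseteq> img c"
  obtains \<delta> B where "\<delta> > 0" "B > 0"
    "\<And>x v :: real^'m. x \<in> K \<Longrightarrow> norm v \<le> \<delta> \<Longrightarrow> x + v \<in> img c \<and> dist_M (cinv c x) (cinv c (x + v)) \<le> B * norm v"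
proof -
  obtain e where e: "e > 0" "(\<Union>x\<in>K. ball x e) \<subseteq> img c"
    by (rule compact_subset_open_imp_ball_epsilon_subset[OF K(1) open_img[OF c] K(2)]) blast
  let ?L = "{x + y |x y. x \<in> K \<and> y \<in> cball 0 (e / 2)}"
  have L: "compact ?L" by (rule compact_sums[OF K(1) compact_cball])
  have Li: "?L \<subseteq> img c" using e by (auto simp: dist_norm intro!: subsetD[OF e(2)])
  obtain B where B: "B > 0" "\<And>z v. z \<in> ?L \<Longrightarrow> sqrt (ip (gmat M c z) v v) \<le> B * norm v"
    by (rule chart_segment_bound[OF c L Li]) blast
  show ?thesis
  proof (rule that[of "e / 2" B])
    fix x v :: "real^'m" assume x: "x \<in> K" and v: "norm v \<le> e / 2"
    have seg: "closed_segment x (x + v) \<subseteq> ?L"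
    proof
      fix z assume "z \<in> closed_segment x (x + v)"
      then obtain t where t: "0 \<le> t" "t \<le> 1" "z = (1 - t) *\<^sub>R x + t *\<^sub>R (x + v)" unfolding in_segment by blast
      have "norm (t *\<^sub>R v) \<le> e / 2" using t v mult_left_le_one_le[of "norm v" t] by simp
      then show "z \<in> ?L" using x t(3) by (intro CollectI exI[of _ x] exI[of _ "t *\<^sub>R v"]) (simp add: algebra_simps)
    qed
    have "ed (cinv c x) (cinv c (x + v)) \<le> ennreal (B * norm v)"
    proof (rule ed_segment[OF c])
      fix z assume "z \<in> closed_segment x (x + v)"
      then have z: "z \<in> ?L" using seg by blast
      have "ip (gmat M c z) v v \<ge> 0" by (rule posdef_nonneg[OF posdef_g[OF c subsetD[OF Li z]]])
      then have "ip (gmat M c z) v v = (sqrt (ip (gmat M c z) v v))\<^sup>2" by simp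
      also have "\<dots> \<le> (B * norm v)\<^sup>2"
        by (intro power_mono B(2) z) (use \<open>ip (gmat M c z) v v \<ge> 0\<close> in simp)
      finally show "ip (gmat M c z) (x + v - x) (x + v - x) \<le> (B * norm v)\<^sup>2" by simp
    qed (use seg Li B(1) in auto)
    then have "dist_M (cinv c x) (cinv c (x + v)) \<le> B * norm v" using B(1) by (simp add: rdist_le_iff)
    then show "x + v \<in> img c \<and> dist_M (cinv c x) (cinv c (x + v)) \<le> B * norm v" using seg Li by auto
  qed (use e B in auto)
qed

text \<open>The sharp rate at a single point, from continuity of the metric at \<open>x\<close>. In
  \<open>chart_ineq\<close> it gives the one-sided bound for the derivative of the weight.\<close>

lemma infinitesimal_move:
  assumes c: "c \<in> atlas M" and x: "x \<in> img c" and e: "e > 0"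
  obtains \<delta> where "\<delta> > 0"
    "\<And>h. 0 \<le> h \<Longrightarrow> h < \<delta> \<Longrightarrow> x + h *\<^sub>R v \<in> img c \<and> dist_M (cinv c x) (cinv c (x + h *\<^sub>R v)) \<le> h * (sqrt (ip (gmat M c x) v v) + e)"
proof -
  let ?s = "\<lambda>z. sqrt (ip (gmat M c z) v v)"
  have "continuous_on (img c) ?s"
    by (intro continuous_on_real_sqrt continuous_on_ip cont_g[OF c] continuous_on_const)
  then have "isCont ?s x" using x unfolding continuous_on_eq_continuous_at[OF open_img[OF c]] by blast
  then obtain a where a: "a > 0" "\<And>z. dist z x < a \<Longrightarrow> dist (?s z) (?s x) < e"
    using e unfolding continuous_at_eps_delta by blast
  obtain b where b: "b > 0" "ball x b \<subseteq> img c" using open_img[OF c] x open_contains_ball by blast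
  define \<delta> where "\<delta> = min a b / (norm v + 1)"
  have \<delta>: "\<delta> > 0" using a b by (simp add: \<delta>_def add_nonneg_pos)
  show ?thesis
  proof (rule that[OF \<delta>])
    fix h assume h: "0 \<le> h" "h < \<delta>"
    have small: "t * norm v < min a b" if "0 \<le> t" "t \<le> h" for t
    proof -
      have "t * norm v \<le> h * (norm v + 1)" using that h by (intro mult_mono) auto
      also have "\<dots> < min a b" using h(2) unfolding \<delta>_def by (simp add: pos_less_divide_eq add_nonneg_pos)
      finally show ?thesis .
    qed
    have near: "dist z x < min a b" if z: "z \<in> closed_segment x (x + h *\<^sub>R v)" for z
    proof -
      obtain t where t: "0 \<le> t" "t \<le> 1" "z = (1 - t) *\<^sub>R x + t *\<^sub>R (x + h *\<^sub>R v)" using z unfolding in_segment by blast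
      have "z - x = (t * h) *\<^sub>R v" using t(3) by (simp add: algebra_simps)
      then have "dist z x = (t * h) * norm v" using t h by (simp add: dist_norm)
      then show ?thesis using small[of "t * h"] t h by (simp add: mult_left_le_one_le)
    qed
    have seg: "closed_segment x (x + h *\<^sub>R v) \<subseteq> img c" using near b(2) by (auto simp: dist_commute)
    have p0: "?s x \<ge> 0" using posdef_nonneg[OF posdef_g[OF c x]] by simp
    have "ed (cinv c x) (cinv c (x + h *\<^sub>R v)) \<le> ennreal (h * (?s x + e))"
    proof (rule ed_segment[OF c seg])
      show "0 \<le> h * (?s x + e)" using h e p0 by simp
      fix z assume z: "z \<in> closed_segment x (x + h *\<^sub>R v)"
      have p: "ip (gmat M c z) v v \<ge> 0" by (rule posdef_nonneg[OF posdef_g[OF c]]) (use seg z in blast)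
      have "?s z \<le> ?s x + e" using a(2)[of z] near[OF z] by (simp add: dist_real_def abs_less_iff)
      then have "(h * ?s z)\<^sup>2 \<le> (h * (?s x + e))\<^sup>2" using h p by (intro power_mono mult_left_mono) auto
      moreover have "ip (gmat M c z) (x + h *\<^sub>R v - x) (x + h *\<^sub>R v - x) = (h * ?s z)\<^sup>2"
        using p by (simp add: ip_simps power_mult_distrib power2_eq_square)
      ultimately show "ip (gmat M c z) (x + h *\<^sub>R v - x) (x + h *\<^sub>R v - x) \<le> (h * (?s x + e))\<^sup>2" by simp
    qed
    then have "dist_M (cinv c x) (cinv c (x + h *\<^sub>R v)) \<le> h * (?s x + e)"
      using h e p0 by (subst rdist_le_iff) auto
    then show "x + h *\<^sub>R v \<in> img c \<and> dist_M (cinv c x) (cinv c (x + h *\<^sub>R v)) \<le> h * (?s x + e)" using seg by auto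
  qed
qed

end

text \<open>\<open>\<eta>'\<close> bounds the rate of decrease of \<open>\<eta>\<close> to the
  right. As \<open>\<eta>\<close> is nonincreasing, a condition on one side suffices: where
  \<open>r\<close> decreases along \<open>Z\<close>, the weight does not decrease.\<close>

locale weighted = center P N \<phi> q0 d R C \<xi>
  for P :: "('a::{t2_space,second_countable_topology}, 'm::finite) riem"
    and N :: "('b::{t2_space,second_countable_topology}, 'n::finite) riem" and \<phi> q0 d R C \<xi> +
  fixes \<eta> \<eta>' :: "real \<Rightarrow> real" and L0 b0 :: real
  assumes eta: "\<And>t. \<eta> t \<ge> 0" "\<And>s t. s \<le> t \<Longrightarrow> \<eta> t \<le> \<eta> s" "\<And>s t. \<bar>\<eta> s - \<eta> t\<bar> \<le> L0 * \<bar>s - t\<bar>"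
    and eta': "\<eta>' \<in> borel_measurable borel" "\<And>t. 0 \<le> \<eta>' t" "\<And>t. \<eta>' t \<le> b0"
    and dini: "\<And>t. 0 \<le> t \<Longrightarrow> \<exists>\<delta>>0. \<forall>s. t \<le> s \<and> s < t + \<delta> \<longrightarrow> \<eta> t - \<eta> s \<le> \<eta>' t * (s - t)"
begin

text \<open>The derivative of \<psi> along the gradient \<open>Z\<close>; by \<open>DZ_chart\<close>
  every chart gives the same value on \<open>U\<close>.\<close>

definition DZ :: "('a \<Rightarrow> real) \<Rightarrow> 'a \<Rightarrow> real" where
  "DZ \<psi> q = (let c = chart_at P q in fd (\<lambda>x. \<psi> (cinv c x)) (cmap c q) (Z c (cmap c q)))"

lemma DZ_chart:
  assumes \<psi>: "P.C1 \<psi>" and c: "c \<in> atlas P" and q: "q \<in> cdom c" "q \<in> U"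
  shows "DZ \<psi> q = fd (\<lambda>x. \<psi> (cinv c x)) (cmap c q) (Z c (cmap c q))"
proof -
  define c0 where "c0 = chart_at P q"
  have c0: "c0 \<in> atlas P" "q \<in> cdom c0" unfolding c0_def using P.chart_at by auto
  let ?t = "cmap c \<circ> cinv c0" and ?S = "cmap c0 ` (cdom c0 \<inter> cdom c)" and ?x = "cmap c0 q"
  note tf = P.trans_facts[OF c0(1) c c0(2) q(1)]
  have eq: "\<psi> (cinv c0 y) = \<psi> (cinv c (?t y))" if "y \<in> ?S" for y
    using that P.cinv_cmap[OF c] P.cinv_cmap[OF c0(1)] by auto
  have "fd (\<lambda>x. \<psi> (cinv c0 x)) ?x v = fd (\<lambda>y. \<psi> (cinv c (?t y))) ?x v" for v
    by (rule fun_cong[OF fd_cong[OF tf(2,3) eq]])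
  also have "\<dots> v = fd (\<lambda>x. \<psi> (cinv c x)) (?t ?x) (fd ?t ?x v)" for v
    by (rule fd_chain[OF P.trans_differentiable[OF c0(1) c c0(2) q(1)]])
      (unfold tf(4), rule P.C1_differentiable[OF \<psi> c], use q in blast)
  finally show ?thesis
    unfolding DZ_def Let_def c0_def[symmetric] tf(4) Z_trans[OF c0(1) c c0(2) q, symmetric] by simp
qed

lemma DZ_local_const:
  assumes W: "open W" "q \<in> W" "\<And>q. q \<in> W \<Longrightarrow> \<psi> q = a" shows "DZ \<psi> q = 0"
proof -
  define c where "c = chart_at P q"
  have c: "c \<in> atlas P" "q \<in> cdom c" unfolding c_def using P.chart_at by auto
  let ?S = "cmap c ` (cdom c \<inter> W)"
  have "fd (\<lambda>x. \<psi> (cinv c x)) (cmap c q) = fd (\<lambda>x. a) (cmap c q)"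
    by (rule fd_cong[OF P.open_cmap_image[OF c(1) W(1)]]) (use c W P.cinv_cmap[OF c(1)] in auto)
  then show ?thesis unfolding DZ_def Let_def c_def[symmetric] by (simp add: fd_eqI[OF has_derivative_const])
qed

lemma DZ_add:
  assumes "P.C1 a" "P.C1 b"
  shows "DZ (\<lambda>q. a q + b q) q = DZ a q + DZ b q"
proof -
  define c where "c = chart_at P q"
  have c: "c \<in> atlas P" "cmap c q \<in> P.img c" unfolding c_def using P.chart_at by auto
  show ?thesis unfolding DZ_def Let_def c_def[symmetric]
    by (subst fd_eqI[OF has_derivative_add[OF fd_works[OF P.C1_differentiable[OF assms(1) c]] fd_works[OF P.C1_differentiable[OF assms(2) c]]]]) (rule refl)
qed

lemma continuous_DZ:
  assumes \<psi>: "P.C1 \<psi>" shows "continuous_on U (DZ \<psi>)"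
proof (subst continuous_on_eq_continuous_at[OF open_U], rule ballI)
  fix q assume q: "q \<in> U"
  obtain c where c: "c \<in> atlas P" "q \<in> cdom c" using P.chart_ex by blast
  have o: "open (cdom c \<inter> U)" by (intro open_Int P.open_cdom c open_U)
  have "continuous_on (dom c d) (\<lambda>x. fd (\<lambda>x. \<psi> (cinv c x)) x (Z c x))"
    by (rule P.C1_continuous_fd[OF \<psi> c(1) continuous_Z[OF c(1)]]) blast
  then have "continuous_on (cdom c \<inter> U) (\<lambda>q. fd (\<lambda>x. \<psi> (cinv c x)) (cmap c q) (Z c (cmap c q)))"
    by (rule continuous_on_compose2[OF _ continuous_on_subset[OF P.cont_cmap[OF c(1)]]]) (use U_dom in auto)
  then have "continuous_on (cdom c \<inter> U) (DZ \<psi>)"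
    by (rule continuous_on_eq) (simp add: DZ_chart[OF \<psi> c(1)])
  then show "isCont (DZ \<psi>) q" using c q by (simp add: continuous_on_eq_continuous_at[OF o])
qed

definition w :: "'a \<Rightarrow> real" where "w q = \<eta> (r q)"
text \<open>By \<open>Z_norm\<close>, a bound for the rate at which \<open>w\<close> decreases along
  \<open>Z\<close>.\<close>

definition \<kappa> :: "'a \<Rightarrow> real" where "\<kappa> q = \<eta>' (r q) * ((1 + C * r q) * r q)"
text \<open>The lower bound of \<open>laplace_lower\<close> for the Laplacian of
  \<open>u\<close>.\<close>

definition \<Lambda> :: "'a \<Rightarrow> real" where
  "\<Lambda> q = real CARD('m) * (1 - C * r q - (1 + C * r q) * r q * hn q)"

lemma L0_nonneg: "L0 \<ge> 0"
  using eta(3)[of 0 1] by simp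

lemma b0_nonneg: "b0 \<ge> 0"
  using eta'(2,3)[of 0] by simp

lemma continuous_w: "continuous_on S w"
proof -
  have "L0-lipschitz_on UNIV \<eta>" using eta(3) L0_nonneg by (intro lipschitz_onI) (auto simp: dist_real_def)
  then show ?thesis unfolding w_def[abs_def]
    by (rule continuous_on_compose2[OF lipschitz_on_continuous_on continuous_r]) simp
qed

lemma continuous_Lambda: "continuous_on S \<Lambda>"
  unfolding \<Lambda>_def[abs_def] by (intro continuous_intros continuous_r continuous_on_subset[OF continuous_hn]) simp

lemma kappa_measurable: "\<kappa> \<in> borel_measurable borel"
proof -
  have r: "r \<in> borel_measurable borel" by (rule borel_measurable_continuous_onI[OF continuous_r])
  show ?thesis unfolding \<kappa>_def[abs_def]
    by (intro borel_measurable_times borel_measurable_add measurable_compose[OF r eta'(1)] r measurable_const) simp_all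
qed

lemma kappa_nonneg: "\<kappa> q \<ge> 0"
  unfolding \<kappa>_def using eta'(2) RC(3) r_nonneg by simp

lemma kappa_bound: "q \<in> U \<Longrightarrow> \<kappa> q \<le> b0 * ((1 + C) * 1)"
  unfolding \<kappa>_def using eta'(2,3) RC r_nonneg[of q] b0_nonneg
  by (intro mult_mono add_mono) (auto simp: mult_left_le)

text \<open>Formally a lower bound for the divergence of \<open>\<psi> * w * Z\<close>, whose
  integral vanishes: \<open>\<Lambda>\<close> replaces the Laplacian of \<open>u\<close>, and
  \<open>- \<kappa>\<close> the derivative of \<open>w\<close> along \<open>Z\<close>.\<close>

definition J :: "('a \<Rightarrow> real) \<Rightarrow> 'a \<Rightarrow> real" where
  "J \<psi> q = w q * (\<psi> q * \<Lambda> q + DZ \<psi> q) - \<psi> q * \<kappa> q"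

lemma J_outside:
  assumes "compact K" "\<And>q. q \<notin> K \<Longrightarrow> \<psi> q = 0" "q \<notin> K" shows "J \<psi> q = 0"
  using DZ_local_const[of "- K" q \<psi> 0] assms by (simp add: J_def compact_imp_closed open_Compl)

lemma integrable_J:
  assumes \<psi>: "P.C1 \<psi>" and K: "compact K" "K \<subseteq> U" "\<And>q. q \<notin> K \<Longrightarrow> \<psi> q = 0"
  shows "integrable P.vol (J \<psi>)"
proof -
  let ?a = "\<lambda>q. w q * (\<psi> q * \<Lambda> q + DZ \<psi> q)"
  note c\<psi> = P.C1_continuous[OF \<psi>]
  have oK: "open (- K)" using K(1) by (simp add: compact_imp_closed open_Compl)
  have "continuous_on U ?a"
    by (intro continuous_on_mult continuous_on_add continuous_w continuous_Lambda continuous_DZ[OF \<psi>] continuous_on_subset[OF c\<psi>]) simp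
  moreover have "continuous_on (- K) ?a"
    by (rule continuous_on_eq[OF continuous_on_const[of _ 0]])
      (use K(3) DZ_local_const[OF oK, of _ \<psi> 0] in auto)
  moreover have "U \<union> - K = UNIV" using K(2) by blast
  ultimately have ca: "continuous_on UNIV ?a" using continuous_on_open_Un[OF open_U oK, of ?a] by simp
  have J: "J \<psi> = (\<lambda>q. ?a q - \<psi> q * \<kappa> q)" by (simp add: J_def fun_eq_iff)
  have m: "J \<psi> \<in> borel_measurable borel"
    unfolding J by (intro borel_measurable_diff borel_measurable_times kappa_measurable borel_measurable_continuous_onI c\<psi> ca)
  obtain b1 where b1: "b1 > 0" "\<And>q. q \<in> K \<Longrightarrow> norm (?a q) \<le> b1"
    by (rule compact_bound[OF K(1) continuous_on_subset[OF ca]]) auto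
  obtain b2 where b2: "b2 > 0" "\<And>q. q \<in> K \<Longrightarrow> norm (\<psi> q) \<le> b2"
    by (rule compact_bound[OF K(1) continuous_on_subset[OF c\<psi>]]) auto
  have "\<bar>J \<psi> q\<bar> \<le> b1 + b2 * (b0 * ((1 + C) * 1))" if q: "q \<in> K" for q
  proof -
    have "\<bar>\<psi> q * \<kappa> q\<bar> \<le> b2 * (b0 * ((1 + C) * 1))"
      unfolding abs_mult using b2(2)[OF q] b2(1) kappa_bound[of q] kappa_nonneg[of q] q K(2) by (intro mult_mono) auto
    then show ?thesis using b1(2)[OF q] unfolding J by (simp add: abs_le_iff)
  qed
  then show ?thesis by (rule P.integrable_vol_bounded[OF K(1) m _ J_outside[OF K(1,3)]])
qed

text \<open>\<open>divergence_ineq\<close> for the field \<psi> Z in coordinates, with the volume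
  density in the place of \<open>\<rho>\<close> and the weight \<open>w\<close>.\<close>

lemma chart_ineq:
  assumes \<psi>: "P.C1 \<psi>" "\<And>q. \<psi> q \<ge> 0" and c: "c \<in> atlas P"
    and K: "compact K" "K \<subseteq> cdom c \<inter> U" "\<And>q. q \<notin> K \<Longrightarrow> \<psi> q = 0"
  shows "(\<integral>q. J \<psi> q \<partial>P.vol) \<le> 0"
proof -
  define K' where "K' = cmap c ` K"
  define D where "D = cmap c ` (cdom c \<inter> U)"
  let ?a = "\<lambda>x. \<psi> (cinv c x)"
  let ?F = "\<lambda>x v. ?a x *\<^sub>R Zd c x v + fd ?a x v *\<^sub>R Z c x"
  have K': "compact K'" unfolding K'_def
    by (rule compact_continuous_image[OF continuous_on_subset[OF P.cont_cmap[OF c]] K(1)]) (use K(2) in blast)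
  have K'D: "K' \<subseteq> D" unfolding K'_def D_def using K(2) by blast
  have oD: "open D" unfolding D_def by (rule P.open_cmap_image[OF c open_U])
  have oK: "open (- K')" using K' by (simp add: compact_imp_closed open_Compl)
  have Di: "D \<subseteq> P.img c" and Dd: "D \<subseteq> dom c d" unfolding D_def using U_dom by blast+
  have inK: "cinv c x \<in> K \<longleftrightarrow> x \<in> K'" if xi: "x \<in> P.img c" for x
  proof -
    obtain q where q: "q \<in> cdom c" "x = cmap c q" using xi by blast
    then show ?thesis unfolding K'_def q(2) P.cinv_cmap[OF c q(1)]
      using inj_on_image_mem_iff[OF P.inj_cmap[OF c] q(1), of K] K(2) by blast
  qed
  have cD: "\<exists>q. q \<in> cdom c \<and> q \<in> U \<and> x = cmap c q \<and> cinv c x = q" if "x \<in> D" for x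
    using that P.cinv_cmap[OF c] unfolding D_def by blast
  \<comment> \<open>Extended by 0 this is still C^1, because \<psi> vanishes outside the compact set
    \<open>K\<close>.\<close>
  define Zt where "Zt = (\<lambda>x. if x \<in> D then ?a x *\<^sub>R Z c x else 0)"
  have a0: "?a x = 0" if "x \<in> P.img c" "x \<notin> K'" for x using K(3) inK[OF that(1)] that(2) by simp
  have Zt0: "Zt x = 0" if "x \<notin> K'" for x using a0[of x] that Di unfolding Zt_def by auto
  have dZ1: "(Zt has_derivative ?F x) (at x)" if x: "x \<in> D" for x
  proof -
    have "((\<lambda>x. ?a x *\<^sub>R Z c x) has_derivative ?F x) (at x)"
      by (rule has_derivative_scaleR[OF fd_works[OF P.C1_differentiable[OF \<psi>(1) c]] Z_derivative[OF c]]) (use x Di Dd in auto)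
    then show ?thesis by (subst has_derivative_cong_open[OF oD x]) (auto simp: Zt_def)
  qed
  have dZ0: "(Zt has_derivative (\<lambda>_. 0)) (at x)" if x: "x \<notin> K'" for x
    by (subst has_derivative_cong_open[OF oK, of x Zt "\<lambda>_. 0"]) (use x Zt0 in auto)
  have dZ: "Zt differentiable at x" for x using dZ1[of x] dZ0[of x] K'D unfolding differentiable_def by blast
  define B where "B = (\<lambda>x. matrix (fd Zt x))"
  have Bv: "B x *v v = fd Zt x v" for x v by (simp add: B_def matrix_works linear_fd[OF dZ])
  have "continuous_on D (\<lambda>x. (\<chi> i j. ?F x (axis j 1) $ i))"
    by (intro continuous_on_vec_lambda continuous_on_component continuous_on_add continuous_on_scaleR
        continuous_on_subset[OF P.C1_continuous_chart[OF \<psi>(1) c] Di] continuous_Zd[OF c] Dd continuous_on_const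
        P.C1_continuous_fd[OF \<psi>(1) c] Di continuous_on_subset[OF continuous_Z[OF c] Dd])
  then have "continuous_on D B"
    by (rule continuous_on_eq) (simp add: B_def matrix_def fd_eqI[OF dZ1])
  moreover have "continuous_on (- K') B"
    by (rule continuous_on_eq[OF continuous_on_const[of _ 0]]) (simp add: B_def matrix_def fd_eqI[OF dZ0] vec_eq_iff)
  moreover have "D \<union> - K' = UNIV" using K'D by blast
  ultimately have cB: "continuous_on UNIV B" using continuous_on_open_Un[OF oD oK, of B] by simp
  interpret sf: shift_field Zt B K'
  proof
    show "(Zt has_derivative (*v) (B x)) (at x)" for x using fd_works[OF dZ, of x] unfolding Bv[symmetric, abs_def] by simp
  qed (use cB K' Zt0 in auto)
  have cZt: "continuous_on K' Zt" by (intro has_derivative_continuous_on[OF has_derivative_at_withinI[OF fd_works[OF dZ]]])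
  obtain zb where zb: "zb > 0" "\<And>x. x \<in> K' \<Longrightarrow> norm (Zt x) \<le> zb" by (rule compact_bound[OF K' cZt]) blast
  let ?dn = "P.dn c" and ?w = "\<lambda>x. w (cinv c x)" and ?k = "\<lambda>x. ?a x * \<kappa> (cinv c x)"
  have ccinv: "continuous_on K' (cinv c)" by (rule continuous_on_subset[OF P.cont_cinv[OF c]]) (use K'D Di in blast)
  have cw: "continuous_on K' ?w" by (rule continuous_on_compose2[OF continuous_w[of UNIV] ccinv]) simp
  have ca: "continuous_on K' ?a" by (rule continuous_on_subset[OF P.C1_continuous_chart[OF \<psi>(1) c]]) (use K'D Di in blast)
  have cdn: "continuous_on K' ?dn" by (rule continuous_on_subset[OF P.cont_dn[OF c]]) (use K'D Di in blast)
  obtain ab where ab: "ab > 0" "\<And>x. x \<in> K' \<Longrightarrow> norm (?a x) \<le> ab" by (rule compact_bound[OF K' ca]) blast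
  have K'q: "cinv c x \<in> cdom c" "cinv c x \<in> U" "x \<in> P.img c" "cmap c (cinv c x) = x" if "x \<in> K'" for x
    using cD[of x] that K'D by auto
  have mk: "(\<lambda>x. indicator K' x * ?k x) \<in> borel_measurable borel"
  proof -
    have eq: "(\<lambda>x. indicator K' x * ?k x) = (\<lambda>x. (indicator K' x * ?a x) * (indicator K' x * \<kappa> (P.cinv' c x)))"
      using K'q(3) by (auto simp: P.cinv'_def indicator_def fun_eq_iff)
    have "(\<lambda>x. indicator K' x *\<^sub>R ?a x) \<in> borel_measurable borel"
      by (rule borel_measurable_continuous_on_indicator[OF _ ca]) (use K' borel_compact in blast)
    then have ma: "(\<lambda>x. indicator K' x * ?a x) \<in> borel_measurable borel" by simp
    have mi: "indicator K' \<in> borel_measurable borel" using K' borel_compact by (intro borel_measurable_indicator) blast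
    show ?thesis unfolding eq
      by (intro borel_measurable_times[OF ma] borel_measurable_times[OF mi] measurable_compose[OF P.cinv'_measurable[OF c] kappa_measurable])
  qed
  have kb: "?k x \<le> ab * (b0 * ((1 + C) * 1))" "0 \<le> ?k x" if "x \<in> K'" for x
    using ab(2)[OF that] ab(1) kappa_bound[of "cinv c x"] kappa_nonneg[of "cinv c x"] K'q[OF that] \<psi>(2)
    by (auto intro!: mult_mono)
  obtain \<delta>1 B1 where m1: "\<delta>1 > 0" "B1 > 0" "\<And>x v. x \<in> K' \<Longrightarrow> norm v \<le> \<delta>1 \<Longrightarrow> x + v \<in> P.img c \<and>
      rdist P (cinv c x) (cinv c (x + v)) \<le> B1 * norm v"
    by (rule P.uniform_move[OF c K']) (use K'q(3) in blast)+
  have r_lip: "\<bar>r q - r q'\<bar> \<le> rdist P q q'" for q q'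
    using P.rdist_triangle[of \<xi> q' q] P.rdist_triangle[of \<xi> q q'] P.rdist_sym[of q q'] by linarith
  have Lip: "\<bar>?w (sf.T h x) - ?w x\<bar> \<le> L0 * (B1 * zb) * h" if x: "x \<in> K'" and h: "0 \<le> h" "h < \<delta>1 / zb" for x h
  proof -
    have "norm (h *\<^sub>R Zt x) \<le> h * zb" using zb(2)[OF x] h by (simp add: mult_left_mono)
    moreover have "h * zb < \<delta>1" using h(2) zb(1) by (simp add: pos_less_divide_eq)
    ultimately have "rdist P (cinv c x) (cinv c (sf.T h x)) \<le> B1 * (h * zb)"
      using m1(3)[OF x, of "h *\<^sub>R Zt x"] mult_left_mono[of "norm (h *\<^sub>R Zt x)" "h * zb" B1] m1(2) unfolding sf.T_def by linarith
    then have "\<bar>r (cinv c (sf.T h x)) - r (cinv c x)\<bar> \<le> B1 * (h * zb)" using r_lip[of "cinv c x" "cinv c (sf.T h x)"] by linarith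
    then have "L0 * \<bar>r (cinv c (sf.T h x)) - r (cinv c x)\<bar> \<le> L0 * (B1 * (h * zb))" by (intro mult_left_mono L0_nonneg)
    then show ?thesis using eta(3)[of "r (cinv c (sf.T h x))" "r (cinv c x)"] unfolding w_def by (simp add: mult_ac)
  qed
  have Dini: "\<exists>\<delta>>0. \<forall>h. 0 \<le> h \<and> h < \<delta> \<longrightarrow> ?w x - ?w (sf.T h x) \<le> (?k x + e) * h" if x: "x \<in> K'" and e: "e > 0" for x e
  proof -
    define q where "q = cinv c x"
    have q: "q \<in> cdom c" "q \<in> U" "cmap c q = x" "x \<in> P.img c" using K'q[OF x] unfolding q_def by auto
    \<comment> \<open>The slack of \<open>infinitesimal_move\<close> gets multiplied by
      \<open>\<eta>' (r q) \<le> b0\<close>; the \<open>+ 1\<close> is for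
      \<open>b0 = 0\<close>.\<close>
    define e' where "e' = e / (b0 + 1)"
    have e': "e' > 0" "b0 * e' \<le> e" using e b0_nonneg by (auto simp: e'_def field_simps)
    let ?s = "sqrt (ip (gmat P c x) (Zt x) (Zt x))"
    obtain \<delta>2 where \<delta>2: "\<delta>2 > 0" "\<And>h. 0 \<le> h \<Longrightarrow> h < \<delta>2 \<Longrightarrow> x + h *\<^sub>R Zt x \<in> P.img c \<and>
        rdist P (cinv c x) (cinv c (x + h *\<^sub>R Zt x)) \<le> h * (?s + e')"
      by (rule P.infinitesimal_move[OF c q(4) e'(1)]) blast
    obtain \<delta>3 where \<delta>3: "\<delta>3 > 0" "\<And>s. r q \<le> s \<Longrightarrow> s < r q + \<delta>3 \<Longrightarrow> \<eta> (r q) - \<eta> s \<le> \<eta>' (r q) * (s - r q)"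
      using dini[OF r_nonneg] by blast
    have p: "?s \<ge> 0" using posdef_nonneg[OF P.posdef_g[OF c q(4)]] by simp
    have "Zt x = ?a x *\<^sub>R Z c x" using x K'D by (auto simp: Zt_def)
    then have "?s = ?a x * sqrt (ip (gmat P c x) (Z c x) (Z c x))" using \<psi>(2) by (simp add: ip_simps real_sqrt_mult)
    then have s: "?s \<le> ?a x * ((1 + C * r q) * r q)" using mult_left_mono[OF Z_norm[OF c q(1,2)] \<psi>(2)] unfolding q(3) by simp
    show ?thesis
    proof (intro exI[of _ "min \<delta>2 (\<delta>3 / (?s + e'))"] conjI allI impI)
      show "0 < min \<delta>2 (\<delta>3 / (?s + e'))" using \<delta>2(1) \<delta>3(1) p e' by (simp add: add_nonneg_pos)
      fix h assume h: "0 \<le> h \<and> h < min \<delta>2 (\<delta>3 / (?s + e'))"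
      define q' where "q' = cinv c (sf.T h x)"
      have dq: "rdist P q q' \<le> h * (?s + e')" using \<delta>2(2)[of h] h unfolding q_def q'_def sf.T_def by auto
      have hs: "h * (?s + e') < \<delta>3" using h p e'(1) by (simp add: pos_less_divide_eq add_nonneg_pos)
      have k0: "0 \<le> (?k x + e) * h" using kb(2)[OF x] e h by simp
      show "?w x - ?w (sf.T h x) \<le> (?k x + e) * h"
      \<comment> \<open>If \<open>r\<close> decreases, monotonicity of \<open>\<eta>\<close> is
        enough; otherwise the condition \<open>dini\<close> to the right applies.\<close>
      proof (cases "r q \<le> r q'")
        case False
        then show ?thesis using eta(2)[of "r q'" "r q"] k0 unfolding w_def q_def q'_def by linarith
      next
        case True
        have rq: "r q' - r q \<le> h * (?s + e')" using r_lip[of q q'] dq by linarith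
        have "\<eta> (r q) - \<eta> (r q') \<le> \<eta>' (r q) * (r q' - r q)" using \<delta>3(2)[OF True] rq hs by linarith
        also have "\<dots> \<le> \<eta>' (r q) * (h * (?s + e'))" by (intro mult_left_mono rq eta')
        also have "\<dots> \<le> \<eta>' (r q) * (h * (?a x * ((1 + C * r q) * r q) + e'))"
          by (intro mult_left_mono eta' add_right_mono s) (use h in auto)
        also have "\<dots> = h * (?k x + \<eta>' (r q) * e')" unfolding \<kappa>_def q_def by (simp add: algebra_simps)
        also have "\<dots> \<le> h * (?k x + e)"
        proof (intro mult_left_mono add_left_mono)
          show "\<eta>' (r q) * e' \<le> e" using e' mult_right_mono[OF eta'(3)[of "r q"], of e'] by linarith
        qed (use h in simp)
        finally show ?thesis unfolding w_def q_def q'_def by (simp add: mult.commute)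
      qed
    qed
  qed
  have div: "(\<integral>x. indicator K' x * (?w x * (fd ?dn x (Zt x) + ?dn x * trace (B x))) \<partial>lborel) \<le> (\<integral>x. indicator K' x * (?k x * ?dn x) \<partial>lborel)"
  proof (rule sf.divergence_ineq[OF oD K'D _ _ _ cw _ Lip _ mk kb(2,1) Dini])
    show "(?dn has_derivative fd ?dn x) (at x)" if "x \<in> D" for x
      using P.dn_derivative[OF c, of x] that Di by (intro fd_works) (auto simp: differentiable_def)
    show "continuous_on (K' \<times> K') (\<lambda>(x, y). fd ?dn x (Zt y))"
      unfolding case_prod_beta
      by (rule P.continuous_on_fd_dn[OF c continuous_on_fst[OF continuous_on_id] continuous_on_compose2[OF cZt continuous_on_snd[OF continuous_on_id]]])
        (use K'q(3) in auto)
    show "?dn x \<ge> 0" if "x \<in> D" for x using P.dn_nonneg[OF c] that Di by blast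
    show "?w x \<ge> 0" for x unfolding w_def by (rule eta)
    show "\<delta>1 / zb > 0" using m1(1) zb(1) by simp
  qed
  \<comment> \<open>The right side is the density times the divergence of \<psi> Z. The product rule
    and \<open>laplace\<close> express it by the Laplacian of \<open>u\<close>, which
    \<open>laplace_lower\<close> bounds by \<Lambda>.\<close>
  have pt: "?dn x * (?a x * \<Lambda> (cinv c x) + fd ?a x (Z c x)) \<le> fd ?dn x (Zt x) + ?dn x * trace (B x)" if x: "x \<in> K'" for x
  proof -
    note q = K'q[OF x]
    have xd: "x \<in> dom c d" using x K'D Dd by blast
    obtain A :: "real^'m^'m" where A: "transpose A ** gmat P c x ** A = mat 1" by (rule posdef_frame[OF P.posdef_g[OF c q(3)]]) blast
    have lin: "linear (fd ?a x)" by (rule linear_fd[OF P.C1_differentiable[OF \<psi>(1) c q(3)]])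
    have "trace (B x) = (\<Sum>k\<in>UNIV. ip (gmat P c x) (col A k) (?F x (col A k)))"
      unfolding frame_trace_linear[OF A] Bv using x K'D by (simp add: fd_eqI[OF dZ1] subset_iff)
    also have "\<dots> = ?a x * (\<Sum>k\<in>UNIV. ip (gmat P c x) (col A k) (Zd c x (col A k))) + (\<Sum>k\<in>UNIV. ip (gmat P c x) (col A k) (Z c x) * fd ?a x (col A k))"
      by (simp add: ip_simps sum.distrib sum_distrib_left mult.commute)
    also have "(\<Sum>k\<in>UNIV. ip (gmat P c x) (col A k) (Z c x) * fd ?a x (col A k)) = fd ?a x (\<Sum>k\<in>UNIV. ip (gmat P c x) (col A k) (Z c x) *\<^sub>R col A k)"
      by (simp add: linear_sum[OF lin] linear_scale[OF lin])
    also have "(\<Sum>k\<in>UNIV. ip (gmat P c x) (col A k) (Z c x) *\<^sub>R col A k) = Z c x" by (rule frame_expand[OF A, symmetric])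
    finally have tr: "trace (B x) = ?a x * (\<Sum>k\<in>UNIV. ip (gmat P c x) (col A k) (Zd c x (col A k))) + fd ?a x (Z c x)" .
    have "fd ?dn x (Zt x) = ?a x * fd ?dn x (Z c x)"
      using x K'D linear_scale[OF linear_fd, of ?dn x] P.dn_derivative[OF c q(3)] by (auto simp: Zt_def differentiable_def)
    then have "fd ?dn x (Zt x) + ?dn x * trace (B x) = ?a x * (fd ?dn x (Z c x) + ?dn x * (\<Sum>k\<in>UNIV. ip (gmat P c x) (col A k) (Zd c x (col A k)))) + ?dn x * fd ?a x (Z c x)"
      unfolding tr by (simp add: algebra_simps)
    also have "\<dots> = ?a x * (?dn x * (\<Sum>k\<in>UNIV. ddu c x (col A k) (col A k) - du c x (chr (gmat P c) x (col A k) (col A k)))) + ?dn x * fd ?a x (Z c x)"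
      unfolding laplace[OF c xd A] ..
    also have "\<dots> \<ge> ?a x * (?dn x * \<Lambda> (cinv c x)) + ?dn x * fd ?a x (Z c x)"
      using laplace_lower[OF c q(1,2), of A] A \<psi>(2) P.dn_nonneg[OF c q(3)] unfolding q(4) \<Lambda>_def
      by (intro add_right_mono mult_left_mono) auto
    finally show ?thesis by (simp add: algebra_simps)
  qed
  let ?g1 = "\<lambda>x. ?w x * (?dn x * (?a x * \<Lambda> (cinv c x) + fd ?a x (Z c x)))"
  have i1: "integrable lborel (\<lambda>x. indicator K' x * ?g1 x)"
    by (intro integrable_on_compact K' continuous_on_mult continuous_on_add cw cdn ca P.C1_continuous_fd[OF \<psi>(1) c]
        continuous_on_compose2[OF continuous_Lambda[of UNIV] ccinv] continuous_on_subset[OF continuous_Z[OF c]])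
      (use K'D Dd Di in auto)
  have i2: "integrable lborel (\<lambda>x. indicator K' x * (?w x * (fd ?dn x (Zt x) + ?dn x * trace (B x))))"
  proof -
    have "continuous_on K' (\<lambda>x. trace (B x))"
      unfolding trace_def by (intro continuous_on_sum continuous_on_component continuous_on_subset[OF cB]) simp
    then show ?thesis
      by (intro integrable_on_compact K' continuous_on_mult continuous_on_add cw cdn P.continuous_on_fd_dn[OF c continuous_on_id cZt])
        (use K'q(3) in auto)
  qed
  have i3: "integrable lborel (\<lambda>x. indicator K' x * (?k x * ?dn x))"
  proof -
    obtain db where db: "db > 0" "\<And>x. x \<in> K' \<Longrightarrow> norm (?dn x) \<le> db" by (rule compact_bound[OF K' cdn]) blast
    have "(\<lambda>x. indicator K' x *\<^sub>R ?dn x) \<in> borel_measurable borel"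
      by (rule borel_measurable_continuous_on_indicator[OF _ cdn]) (use K' borel_compact in blast)
    then have md: "(\<lambda>x. indicator K' x * ?dn x) \<in> borel_measurable borel" by simp
    have m: "(\<lambda>x. indicator K' x * (?k x * ?dn x)) \<in> borel_measurable borel"
      by (rule measurable_cong[THEN iffD1, OF _ borel_measurable_times[OF mk md]]) (auto simp: indicator_def)
    show ?thesis
    proof (rule integrable_indicator_bounded[OF K' m])
      fix x assume x: "x \<in> K'"
      show "\<bar>?k x * ?dn x\<bar> \<le> ab * (b0 * ((1 + C) * 1)) * db"
        unfolding abs_mult[of "?k x"] using kb[OF x] db(2)[OF x] by (intro mult_mono) auto
    qed
  qed
  have "(\<integral>x. indicator K' x * ?g1 x \<partial>lborel) \<le> (\<integral>x. indicator K' x * (?w x * (fd ?dn x (Zt x) + ?dn x * trace (B x))) \<partial>lborel)"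
    by (intro integral_mono i1 i2) (use pt eta(1) in \<open>auto simp: indicator_def w_def intro!: mult_left_mono\<close>)
  with div have le: "(\<integral>x. indicator K' x * ?g1 x \<partial>lborel) \<le> (\<integral>x. indicator K' x * (?k x * ?dn x) \<partial>lborel)" by linarith
  have KU: "K \<subseteq> U" using K(2) by blast
  have "(\<integral>q. J \<psi> q \<partial>P.vol) = (\<integral>y. indicator (P.img c) y * (?dn y * J \<psi> (cinv c y)) \<partial>lborel)"
    by (rule P.integral_vol_chart[OF c integrable_J[OF \<psi>(1) K(1) KU K(3)] J_outside[OF K(1,3)]]) (use K(2) in blast)+
  also have "\<dots> = (\<integral>x. indicator K' x * ?g1 x - indicator K' x * (?k x * ?dn x) \<partial>lborel)"
  proof (rule Bochner_Integration.integral_cong[OF refl])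
    fix y :: "real^'m"
    consider "y \<in> K'" | "y \<in> P.img c" "y \<notin> K'" | "y \<notin> P.img c" by blast
    then show "indicator (P.img c) y * (?dn y * J \<psi> (cinv c y)) = indicator K' y * ?g1 y - indicator K' y * (?k y * ?dn y)"
    proof cases
      case 1
      have JJ: "J \<psi> (cinv c y) = ?w y * (?a y * \<Lambda> (cinv c y) + fd ?a y (Z c y)) - ?k y"
        unfolding J_def DZ_chart[OF \<psi>(1) c K'q(1,2)[OF 1]] K'q(4)[OF 1] ..
      show ?thesis unfolding JJ using 1 K'q(3)[OF 1] by (simp add: algebra_simps)
    next
      case 2
      then show ?thesis using J_outside[OF K(1,3)] inK by simp
    next
      case 3
      moreover have "y \<notin> K'" using K'q(3)[of y] 3 by blast
      ultimately show ?thesis by simp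
    qed
  qed
  also have "\<dots> = (\<integral>x. indicator K' x * ?g1 x \<partial>lborel) - (\<integral>x. indicator K' x * (?k x * ?dn x) \<partial>lborel)"
    by (rule Bochner_Integration.integral_diff[OF i1 i3])
  finally show ?thesis using le by linarith
qed

text \<open>The terms \<open>DZ\<close> of a partition of unity cancel, so the local inequalities add up.\<close>

lemma global_ineq:
  assumes K0: "compact (P.cb \<xi> \<rho>)" "\<rho> < R" and supp: "\<And>t. \<rho> < t \<Longrightarrow> \<eta> t = 0" "\<And>t. \<rho> < t \<Longrightarrow> \<eta>' t = 0"
  shows "integrable P.vol (\<lambda>q. w q * \<Lambda> q - \<kappa> q)" "(\<integral>q. w q * \<Lambda> q - \<kappa> q \<partial>P.vol) \<le> 0"
proof -
  let ?K0 = "P.cb \<xi> \<rho>"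
  have K0U: "?K0 \<subseteq> U" using K0(2) by (auto simp: P.cb_def)
  define cutoff where "cutoff = (\<lambda>W c K e. c \<in> atlas P \<and> compact K \<and> K \<subseteq> cdom c \<inter> U \<and> P.C1 e \<and>
      (\<forall>q. 0 \<le> e q \<and> e q \<le> 1) \<and> (\<forall>q. q \<notin> K \<longrightarrow> e q = 1) \<and> (\<forall>q\<in>W. e q = 0))"
  define good where "good = {W. open W \<and> (\<exists>c K e. cutoff W c K e)}"
  have cut: "\<exists>W\<in>good. p \<in> W" if p: "p \<in> ?K0" for p
  proof -
    obtain c K W e where W: "c \<in> atlas P" "compact K" "K \<subseteq> cdom c \<inter> U" "open W" "p \<in> W" "P.C1 e"
      "\<And>q. 0 \<le> e q \<and> e q \<le> 1" "\<And>q. q \<notin> K \<Longrightarrow> e q = 1" "\<And>q. q \<in> W \<Longrightarrow> e q = 0"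
      by (rule P.C1_cutoff[OF open_U subsetD[OF K0U p]]) blast
    have "cutoff W c K e" unfolding cutoff_def using W by simp
    then have "W \<in> good" unfolding good_def using W(4) by blast
    then show ?thesis using W(5) by blast
  qed
  have "?K0 \<subseteq> \<Union>good" using cut by blast
  then obtain \<W> where \<W>: "finite \<W>" "\<W> \<subseteq> good" "?K0 \<subseteq> \<Union>\<W>"
  proof (rule compactE[OF K0(1)])
    show "open W" if "W \<in> good" for W using that unfolding good_def by blast
  qed blast
  define part where "part = (\<lambda>S \<psi> K. P.C1 \<psi> \<and> (\<forall>q. 0 \<le> \<psi> q \<and> \<psi> q \<le> 1) \<and> compact K \<and> K \<subseteq> U \<and> (\<forall>q. q \<notin> K \<longrightarrow> \<psi> q = 0) \<and>
      (\<forall>q\<in>S. \<psi> q = 1) \<and> (\<integral>q. J \<psi> q \<partial>P.vol) \<le> 0)"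
  have "\<exists>\<psi> K. part (\<Union>\<W>) \<psi> K"
    using \<W>(1,2)
  proof (induction \<W> rule: finite_induct)
    case empty
    have "J (\<lambda>_. 0) = (\<lambda>_. 0)" by (rule ext) (rule J_outside[of "{}"], auto)
    then show ?case unfolding part_def by (intro exI[of _ "\<lambda>_. 0"] exI[of _ "{}"]) (simp add: P.C1_const)
  next
    case (insert W \<W>)
    then obtain \<psi> K where "part (\<Union>\<W>) \<psi> K" by blast
    then have \<psi>: "P.C1 \<psi>" "\<And>q. 0 \<le> \<psi> q \<and> \<psi> q \<le> 1" "compact K" "K \<subseteq> U" "\<And>q. q \<notin> K \<Longrightarrow> \<psi> q = 0"
      "\<And>q. q \<in> \<Union>\<W> \<Longrightarrow> \<psi> q = 1" "(\<integral>q. J \<psi> q \<partial>P.vol) \<le> 0"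
      unfolding part_def by auto
    obtain c L e where "cutoff W c L e" using insert.prems unfolding good_def by blast
    then have e: "c \<in> atlas P" "compact L" "L \<subseteq> cdom c \<inter> U" "P.C1 e"
      "\<And>q. 0 \<le> e q \<and> e q \<le> 1" "\<And>q. q \<notin> L \<Longrightarrow> e q = 1" "\<And>q. q \<in> W \<Longrightarrow> e q = 0"
      unfolding cutoff_def by simp_all
    \<comment> \<open>\<open>1 - \<psi>\<close> cut off to \<open>L\<close>: its support lies in one
      chart, so \<open>chart_ineq\<close> applies, and \<open>\<psi> + a\<close> is 1 also where
      \<open>e\<close> vanishes.\<close>
    define a where "a = (\<lambda>q. (1 - \<psi> q) * (1 - e q))"
    have a1: "P.C1 a" unfolding a_def by (rule P.C1_mult[OF P.C1_one_minus[OF \<psi>(1)] P.C1_one_minus[OF e(4)]])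
    have a: "P.C1 a" "\<And>q. a q \<ge> 0" "\<And>q. q \<notin> L \<Longrightarrow> a q = 0"
      using a1 \<psi>(2) e(5,6) by (simp_all add: a_def)
    have LU: "L \<subseteq> U" using e(3) by blast
    let ?\<psi> = "\<lambda>q. \<psi> q + a q"
    have eq: "?\<psi> q = 1 - (1 - \<psi> q) * e q" for q by (simp add: a_def algebra_simps)
    have J: "J ?\<psi> q = J \<psi> q + J a q" for q unfolding J_def DZ_add[OF \<psi>(1) a(1)] by (simp add: algebra_simps)
    have "(\<integral>q. J ?\<psi> q \<partial>P.vol) = (\<integral>q. J \<psi> q \<partial>P.vol) + (\<integral>q. J a q \<partial>P.vol)"
      unfolding J by (rule Bochner_Integration.integral_add[OF integrable_J[OF \<psi>(1,3,4,5)] integrable_J[OF a(1) e(2) LU a(3)]])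
    also have "\<dots> \<le> 0" using \<psi>(7) chart_ineq[OF a(1,2) e(1,2,3) a(3)] by linarith
    finally have "(\<integral>q. J ?\<psi> q \<partial>P.vol) \<le> 0" .
    moreover have "P.C1 ?\<psi>" unfolding eq by (rule P.C1_one_minus[OF P.C1_mult[OF P.C1_one_minus[OF \<psi>(1)] e(4)]])
    moreover have "0 \<le> ?\<psi> q \<and> ?\<psi> q \<le> 1" for q
      unfolding eq using \<psi>(2)[of q] e(5)[of q] by (auto intro: mult_le_one)
    moreover have "?\<psi> q = 0" if "q \<notin> K \<union> L" for q using that \<psi>(5) a(3) by simp
    moreover have "?\<psi> q = 1" if "q \<in> \<Union>(insert W \<W>)" for q unfolding eq using that \<psi>(6) e(7) by auto
    moreover have "compact (K \<union> L)" "K \<union> L \<subseteq> U" using \<psi>(3,4) e(2) LU by (auto intro: compact_Un)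
    ultimately have "part (\<Union>(insert W \<W>)) ?\<psi> (K \<union> L)" unfolding part_def by blast
    then show ?case by blast
  qed
  then obtain \<psi> K where "part (\<Union>\<W>) \<psi> K" by blast
  then have \<psi>: "P.C1 \<psi>" "compact K" "K \<subseteq> U" "\<And>q. q \<notin> K \<Longrightarrow> \<psi> q = 0"
    "\<And>q. q \<in> \<Union>\<W> \<Longrightarrow> \<psi> q = 1" "(\<integral>q. J \<psi> q \<partial>P.vol) \<le> 0"
    unfolding part_def by auto
  have oW: "open (\<Union>\<W>)" using \<W>(2) unfolding good_def by (intro open_Union) blast
  \<comment> \<open>On the closed ball \<psi> is locally 1, so \<open>DZ \<psi>\<close> vanishes;
    outside the ball \<open>w\<close> and \<kappa> vanish.\<close>
  have "J \<psi> q = w q * \<Lambda> q - \<kappa> q" for q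
  proof (cases "q \<in> ?K0")
    case True
    then have "q \<in> \<Union>\<W>" using \<W>(3) by blast
    then show ?thesis using DZ_local_const[OF oW _ \<psi>(5)] \<psi>(5) by (simp add: J_def)
  next
    case False
    then have "w q = 0" "\<kappa> q = 0" using supp by (auto simp: w_def \<kappa>_def P.cb_def)
    then show ?thesis by (simp add: J_def)
  qed
  then have "J \<psi> = (\<lambda>q. w q * \<Lambda> q - \<kappa> q)" by (rule ext)
  then show "integrable P.vol (\<lambda>q. w q * \<Lambda> q - \<kappa> q)" "(\<integral>q. w q * \<Lambda> q - \<kappa> q \<partial>P.vol) \<le> 0"
    using integrable_J[OF \<psi>(1-4)] \<psi>(6) by simp_all
qed

end

text \<open>The convex function t^(-m) lies above its tangent at \<open>a\<close>; this is
  Bernoulli's inequality for \<open>a / b\<close>.\<close>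

lemma inverse_power_convex:
  fixes a b :: real assumes "0 < a" "a \<le> b"
  shows "1 / a ^ m - 1 / b ^ m \<le> real m / a ^ (m + 1) * (b - a)"
proof -
  have "1 + real m * (a / b - 1) \<le> (1 + (a / b - 1)) ^ m"
    by (rule Bernoulli_inequality) (use assms in simp)
  then have "1 + real m * (a / b - 1) \<le> (a / b) ^ m" by simp
  moreover have "a / b - 1 = - ((b - a) / b)" using assms by (simp add: field_simps)
  then have "a / b - 1 \<ge> - ((b - a) / a)"
    using assms divide_left_mono[of a b "b - a"] by simp
  then have "real m * (a / b - 1) \<ge> real m * (- ((b - a) / a))" by (intro mult_left_mono) auto
  ultimately have "1 - real m * ((b - a) / a) \<le> (a / b) ^ m" by simp
  then have "(1 - real m * ((b - a) / a)) / a ^ m \<le> (a / b) ^ m / a ^ m" using assms by (intro divide_right_mono) auto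
  also have "\<dots> = 1 / b ^ m" using assms by (simp add: power_divide)
  finally have "(1 - real m * ((b - a) / a)) / a ^ m \<le> 1 / b ^ m" .
  moreover have "(1 - real m * ((b - a) / a)) / a ^ m = 1 / a ^ m - real m / a ^ (m + 1) * (b - a)"
    using assms(1) by (simp add: field_simps)
  ultimately show ?thesis by linarith
qed

context center
begin

text \<open>\<open>global_ineq\<close> with the weight max(t, \<sigma>)^(-m) - \<rho>^(-m) for t <
  \<rho>, and 0 beyond. For \<open>C = 0\<close> and vanishing mean curvature, the terms m t^(-m) of
  \<open>w * \<Lambda>\<close> and of \<open>\<kappa>\<close> cancel between \<sigma> and \<rho>,
  and exactly the two volume terms remain. All errors together are at most m (1 + 2 C) times the
  integrand of the last integral, because \<open>r q \<le> 1\<close> in the ball.\<close>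

lemma monotonicity:
  assumes s: "0 < \<sigma>" "\<sigma> < \<rho>" "\<rho> < R" and K0: "compact (P.cb \<xi> \<rho>)"
  defines "m \<equiv> CARD('m)"
  shows "integrable P.vol (\<lambda>q. indicator {q. r q < \<rho>} q * (r q * (1 + hn q) / max (r q) \<sigma> ^ m))" (is "integrable _ ?G")
    "measure P.vol {q. r q < \<sigma>} / \<sigma> ^ m \<le> measure P.vol {q. r q < \<rho>} / \<rho> ^ m +
      (1 + 2 * C) * (\<integral>q. indicator {q. r q < \<rho>} q * (r q * (1 + hn q) / max (r q) \<sigma> ^ m) \<partial>P.vol)"
proof -
  have m: "m > 0" by (simp add: m_def)
  \<comment> \<open>Clamping to the interval from \<sigma> to \<rho> keeps the power away from its
    singularity and makes the weight globally Lipschitz.\<close>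
  define cl where "cl = (\<lambda>t. max \<sigma> (min t \<rho>))"
  define \<eta> where "\<eta> = (\<lambda>t. 1 / cl t ^ m - 1 / \<rho> ^ m)"
  \<comment> \<open>At the corners only the slope to the right counts: it is nonzero at \<sigma> and
    0 at \<rho>.\<close>
  define \<eta>' where "\<eta>' = (\<lambda>t. if \<sigma> \<le> t \<and> t < \<rho> then real m / t ^ (m + 1) else 0)"
  define b0 where "b0 = real m / \<sigma> ^ (m + 1)"
  have cl: "\<sigma> \<le> cl t" "0 < cl t" "cl t \<le> \<rho>" for t using s by (auto simp: cl_def)
  have mono: "\<eta> t \<le> \<eta> u" if "u \<le> t" for t u
  proof -
    have "cl u ^ m \<le> cl t ^ m" using that cl(2)[of u] by (intro power_mono) (auto simp: cl_def)
    then show ?thesis using cl(2)[of u] by (simp add: \<eta>_def frac_le)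
  qed
  have b0: "real m / a ^ (m + 1) \<le> b0" if "\<sigma> \<le> a" for a
    unfolding b0_def using that s(1) by (intro divide_left_mono mult_pos_pos power_mono) auto
  have lip: "\<bar>\<eta> u - \<eta> t\<bar> \<le> b0 * \<bar>u - t\<bar>" for u t
  proof -
    have *: "\<eta> u - \<eta> t \<le> b0 * (t - u)" if "u \<le> t" for u t
    proof -
      have "\<eta> u - \<eta> t \<le> real m / cl u ^ (m + 1) * (cl t - cl u)"
        unfolding \<eta>_def using inverse_power_convex[OF cl(2)[of u], of "cl t" m] that by (simp add: cl_def)
      also have "\<dots> \<le> b0 * (t - u)"
        using that cl(1,2)[of u] s by (intro mult_mono b0) (auto simp: cl_def b0_def)
      finally show ?thesis .
    qed
    show ?thesis using *[of u t] *[of t u] mono[of u t] mono[of t u] by (cases "u \<le> t") auto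
  qed
  interpret W: weighted P N \<phi> q0 d R C \<xi> \<eta> \<eta>' b0 b0
  proof
    show "\<eta> t \<ge> 0" for t using mono[of t "max t \<rho>"] s by (auto simp: \<eta>_def cl_def)
    show "\<eta>' \<in> borel_measurable borel" unfolding \<eta>'_def by measurable
    show "0 \<le> \<eta>' t" "\<eta>' t \<le> b0" for t using s b0[of t] by (auto simp: \<eta>'_def b0_def)
    show "\<exists>\<delta>>0. \<forall>u. t \<le> u \<and> u < t + \<delta> \<longrightarrow> \<eta> t - \<eta> u \<le> \<eta>' t * (u - t)" if "0 \<le> t" for t
    proof -
      consider "t < \<sigma>" | "\<sigma> \<le> t" "t < \<rho>" | "\<rho> \<le> t" by linarith
      then show ?thesis
      proof cases
        case 1
        then show ?thesis by (intro exI[of _ "\<sigma> - t"]) (auto simp: \<eta>_def \<eta>'_def cl_def)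
      next
        case 2
        have "\<eta> t - \<eta> u \<le> \<eta>' t * (u - t)" if u: "t \<le> u" "u < \<rho>" for u
          using inverse_power_convex[of t u m] 2 u s(1) by (simp add: \<eta>_def \<eta>'_def cl_def)
        then show ?thesis using 2 by (intro exI[of _ "\<rho> - t"]) auto
      next
        case 3
        then show ?thesis by (intro exI[of _ 1]) (auto simp: \<eta>_def \<eta>'_def cl_def)
      qed
    qed
  qed (use mono lip in auto)
  have z: "\<eta> t = 0" "\<eta>' t = 0" if "\<rho> < t" for t using that s by (auto simp: \<eta>_def \<eta>'_def cl_def)
  have wq: "W.w q = 1 / cl (r q) ^ m - 1 / \<rho> ^ m" for q by (subst W.w_def) (simp add: \<eta>_def)
  have \<kappa>q: "W.\<kappa> q = (if \<sigma> \<le> r q \<and> r q < \<rho> then real m / r q ^ (m + 1) else 0) * ((1 + C * r q) * r q)" for q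
    by (subst W.\<kappa>_def) (simp add: \<eta>'_def)
  note glob = W.global_ineq[OF K0 s(3) z]
  let ?B = "\<lambda>s. {q. r q < s}"
  have bB: "?B s \<in> sets borel" for s using P.open_db by (rule borel_open)
  have sub: "?B s \<subseteq> P.cb \<xi> \<rho>" if "s \<le> \<rho>" for s using that by (auto simp: P.cb_def)
  have gc: "continuous_on UNIV (\<lambda>q. r q * (1 + hn q) / max (r q) \<sigma> ^ m)"
    by (intro continuous_on_divide continuous_on_mult continuous_on_add continuous_on_const continuous_r continuous_hn
        continuous_on_power continuous_on_max) (use s(1) in auto)
  obtain gb where gb: "gb > 0" "\<And>q. q \<in> P.cb \<xi> \<rho> \<Longrightarrow> norm (r q * (1 + hn q) / max (r q) \<sigma> ^ m) \<le> gb"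
    by (rule compact_bound[OF K0 continuous_on_subset[OF gc subset_UNIV]]) blast
  show iG: "integrable P.vol ?G"
  proof (rule P.integrable_vol_bounded[OF K0])
    show "?G \<in> borel_measurable borel"
      by (intro borel_measurable_times borel_measurable_indicator bB borel_measurable_continuous_onI gc)
    show "\<bar>?G q\<bar> \<le> gb" if "q \<in> P.cb \<xi> \<rho>" for q using gb(2)[OF that] gb(1) by (simp add: indicator_def)
    show "?G q = 0" if "q \<notin> P.cb \<xi> \<rho>" for q using that sub[of \<rho>] by (auto simp: indicator_def)
  qed
  have iI: "integrable P.vol (indicator (?B s) :: _ \<Rightarrow> real)" if "s \<le> \<rho>" for s
    by (rule P.integrable_vol_bounded[OF K0, of _ 1])
      (use sub[OF that] in \<open>auto intro!: borel_measurable_indicator bB simp: indicator_def\<close>)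
  have pt: "real m * (indicator (?B \<sigma>) q / \<sigma> ^ m - indicator (?B \<rho>) q / \<rho> ^ m - (1 + 2 * C) * ?G q) \<le> W.w q * W.\<Lambda> q - W.\<kappa> q" for q
  proof -
    define t h where "t = r q" and "h = hn q"
    have th: "0 \<le> t" "0 \<le> h" using r_nonneg hn_nonneg by (auto simp: t_def h_def)
    show ?thesis
    proof (cases "t < \<rho>")
      case False
      then have "W.w q = 0" "W.\<kappa> q = 0" "t \<ge> \<sigma>" using s unfolding wq \<kappa>q by (auto simp: cl_def t_def)
      then show ?thesis using False by (simp add: t_def)
    next
      case t: True
      define M where "M = max t \<sigma>"
      have M: "0 < M" "M \<le> \<rho>" "t \<le> M" using t s by (auto simp: M_def)
      define a where "a = 1 / M ^ m"
      have a: "a > 0" "1 / \<rho> ^ m \<le> a" using M by (auto simp: a_def intro!: frac_le power_mono)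
      have w: "W.w q = a - 1 / \<rho> ^ m"
        using t unfolding wq by (simp add: cl_def a_def M_def t_def[symmetric] max.commute)
      have t1: "t \<le> 1" using t s(3) RC(2) by linarith
      \<comment> \<open>\<open>W.\<Lambda> q\<close> is \<open>real m * (1 - E)\<close>, so
        \<open>E\<close> collects the relative errors from the ambient metric and the mean
        curvature.\<close>
      define E where "E = C * t + (1 + C * t) * t * h"
      have E: "0 \<le> E" "E \<le> (1 + C) * t * (1 + h) - t"
      proof -
        show "0 \<le> E" using th RC(3) by (simp add: E_def)
        have "C * t * (t * h) \<le> C * 1 * (t * h)" using th t1 RC(3) by (intro mult_right_mono mult_left_mono) auto
        then show "E \<le> (1 + C) * t * (1 + h) - t" by (simp add: E_def algebra_simps)
      qed
      have wE: "W.w q * E \<le> a * E" using a(2) E(1) s unfolding w by (intro mult_right_mono) auto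
      have L: "W.\<Lambda> q = real m * (1 - E)" unfolding W.\<Lambda>_def E_def t_def h_def m_def by (simp add: algebra_simps)
      have G: "?G q = a * (t * (1 + h))" using t by (simp add: a_def M_def t_def h_def)
      have aE: "a * E \<le> a * ((1 + C) * t * (1 + h) - t)" using E(2) a(1) by simp
      have Ct: "a * (C * t) \<le> a * (C * (t * (1 + h)) + t)"
        using a(1) th RC(3) by (intro mult_left_mono) (simp_all add: algebra_simps)
      show ?thesis
      proof (cases "t < \<sigma>")
        case True
        then have k0: "W.\<kappa> q = 0" unfolding \<kappa>q by (simp add: t_def)
        have as: "a = 1 / \<sigma> ^ m" using True by (simp add: a_def M_def max_def)
        have "1 / \<sigma> ^ m - 1 / \<rho> ^ m - (1 + 2 * C) * (a * (t * (1 + h))) \<le> W.w q * (1 - E)"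
        proof -
          have "a * ((1 + C) * t * (1 + h) - t) \<le> (1 + 2 * C) * (a * (t * (1 + h)))"
          proof -
            have "0 \<le> a * (t + C * (t * (1 + h)))" using a th RC(3) by simp
            then show ?thesis by (simp add: algebra_simps)
          qed
          then show ?thesis using wE aE unfolding w as[symmetric] by (simp add: algebra_simps diff_divide_distrib)
        qed
        then have "real m * (1 / \<sigma> ^ m - 1 / \<rho> ^ m - (1 + 2 * C) * (a * (t * (1 + h)))) \<le> real m * (W.w q * (1 - E))"
          by (intro mult_left_mono) auto
        then show ?thesis unfolding G L k0 using True t by (simp add: t_def mult_ac)
      next
        case False
        then have Mt: "M = t" "t > 0" using s by (auto simp: M_def)
        have k: "W.\<kappa> q = real m * (a * (1 + C * t))"
          using False t Mt unfolding \<kappa>q by (simp add: t_def[symmetric] a_def)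
        have "- (1 / \<rho> ^ m) - (1 + 2 * C) * (a * (t * (1 + h))) \<le> W.w q * (1 - E) - a * (1 + C * t)"
          using wE aE Ct unfolding w by (simp add: algebra_simps diff_divide_distrib)
        from mult_left_mono[OF this, of "real m"] have "real m * (- (1 / \<rho> ^ m) - (1 + 2 * C) * (a * (t * (1 + h)))) \<le> real m * (W.w q * (1 - E) - a * (1 + C * t))" by simp
        then show ?thesis unfolding G L k using False t by (simp add: t_def[symmetric] algebra_simps)
      qed
    qed
  qed
  have iL: "integrable P.vol (\<lambda>q. real m * (indicator (?B \<sigma>) q / \<sigma> ^ m - indicator (?B \<rho>) q / \<rho> ^ m - (1 + 2 * C) * ?G q))"
    by (intro integrable_mult_right Bochner_Integration.integrable_diff integrable_divide iI iG) (use s in auto)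
  have "real m * (measure P.vol (?B \<sigma>) / \<sigma> ^ m - measure P.vol (?B \<rho>) / \<rho> ^ m - (1 + 2 * C) * (\<integral>q. ?G q \<partial>P.vol))
      = (\<integral>q. real m * (indicator (?B \<sigma>) q / \<sigma> ^ m - indicator (?B \<rho>) q / \<rho> ^ m - (1 + 2 * C) * ?G q) \<partial>P.vol)"
  proof -
    have lin: "(\<integral>q. k * (f1 q - f2 q - f3 q) \<partial>P.vol) = k * ((\<integral>q. f1 q \<partial>P.vol) - (\<integral>q. f2 q \<partial>P.vol) - (\<integral>q. f3 q \<partial>P.vol))"
      if "integrable P.vol f1" "integrable P.vol f2" "integrable P.vol f3" for f1 f2 f3 :: "'a \<Rightarrow> real" and k
      using that by simp
    have e: "(\<integral>q. indicator (?B s) q / k \<partial>P.vol) = measure P.vol (?B s) / k" for s k by simp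
    have "integrable P.vol (\<lambda>q. indicator (?B \<sigma>) q / \<sigma> ^ m)" "integrable P.vol (\<lambda>q. indicator (?B \<rho>) q / \<rho> ^ m)"
      "integrable P.vol (\<lambda>q. (1 + 2 * C) * ?G q)"
      using s iI[of \<sigma>] iI[of \<rho>] integrable_mult_right[of "1 + 2 * C" P.vol ?G] iG by (simp_all only: integrable_divide less_imp_le order_refl)
    from lin[OF this] show ?thesis unfolding e integral_mult_right_zero[of _ _ ?G] by (rule sym)
  qed
  also have "\<dots> \<le> (\<integral>q. W.w q * W.\<Lambda> q - W.\<kappa> q \<partial>P.vol)" by (rule integral_mono[OF iL glob(1) pt])
  also have "\<dots> \<le> 0" by (rule glob(2))
  finally have "measure P.vol (?B \<sigma>) / \<sigma> ^ m - measure P.vol (?B \<rho>) / \<rho> ^ m - (1 + 2 * C) * (\<integral>q. ?G q \<partial>P.vol) \<le> 0"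
    using m by (simp add: mult_le_0_iff)
  then show "measure P.vol (?B \<sigma>) / \<sigma> ^ m \<le> measure P.vol (?B \<rho>) / \<rho> ^ m + (1 + 2 * C) * (\<integral>q. ?G q \<partial>P.vol)" by linarith
qed

end

section \<open>Thin balls\<close>

text \<open>There is \<open>k \<le> K\<close> with
  \<open>t < \<tau> k \<le> 2 * max t (\<tau> K)\<close>, and its term alone is large enough. This
  bounds the error integral of \<open>monotonicity\<close> by a sum of \<open>h_int\<close> over
  dyadic balls.\<close>

lemma dyadic_shell:
  fixes \<rho>0 t :: real
  assumes t: "0 \<le> t" "t < \<rho>0" and \<tau>: "\<And>k. \<tau> k = \<rho>0 / 2 ^ k"
  shows "t / max t (\<tau> K) ^ m \<le> (\<Sum>k\<le>K. if t < \<tau> k then 2 ^ m * (\<tau> k / \<tau> k ^ m) else 0)" (is "_ \<le> sum ?f _")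
proof -
  have pos: "\<tau> k > 0" for k using t by (simp add: \<tau>)
  have f0: "?f k \<ge> 0" for k using pos[of k] by simp
  have key: "t / max t (\<tau> K) ^ m \<le> ?f k" if "k \<le> K" "t < \<tau> k" "\<tau> k / 2 \<le> max t (\<tau> K)" for k
  proof -
    have "t / max t (\<tau> K) ^ m \<le> \<tau> k / (\<tau> k / 2) ^ m"
      using that pos[of k] t by (intro frac_le power_mono zero_less_power) auto
    then show ?thesis using that(2) by (simp add: power_divide mult.commute)
  qed
  have "\<exists>k\<le>K. t < \<tau> k \<and> \<tau> k / 2 \<le> max t (\<tau> K)"
  proof (induction K)
    case 0
    then show ?case using t by (auto simp: \<tau>)
  next
    case (Suc K)
    then obtain k where k: "k \<le> K" "t < \<tau> k" "\<tau> k / 2 \<le> max t (\<tau> K)" by blast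
    show ?case
    proof (cases "t < \<tau> (Suc K)")
      case True
      then show ?thesis using pos[of "Suc K"] by (intro exI[of _ "Suc K"]) auto
    next
      case False
      show ?thesis
      proof (cases "t < \<tau> K")
        case True
        then show ?thesis using False by (intro exI[of _ K]) (auto simp: \<tau>)
      next
        case 2: False
        then show ?thesis using k by (intro exI[of _ k]) auto
      qed
    qed
  qed
  then obtain k where k: "k \<le> K" "t < \<tau> k" "\<tau> k / 2 \<le> max t (\<tau> K)" by blast
  have "?f k \<le> sum ?f {..K}" by (rule member_le_sum) (use k(1) f0 in auto)
  then show ?thesis using key[OF k] by linarith
qed

section \<open>Volumes of intrinsic balls and integrals of the mean curvature over them\<close>

context imm
begin

abbreviation V :: "'a \<Rightarrow> real \<Rightarrow> real" where "V x s \<equiv> measure P.vol {q. rdist P x q < s}"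

definition h_int :: "'a set \<Rightarrow> real" where
  "h_int A = (\<integral>q. indicator A q * (1 + hn q) \<partial>P.vol)"

text \<open>The constant of \<open>vol_ball_lower\<close>: a lower bound for the density of
  sufficiently small balls.\<close>

definition \<omega> :: real where "\<omega> = unit_ball_vol (real CARD('m)) / 2 ^ (CARD('m) + 1)"

lemma omega_pos: "\<omega> > 0"
  unfolding \<omega>_def by (simp add: unit_ball_vol_pos)

lemma integrable_h:
  assumes "complete_riem P" "A \<in> sets borel" "A \<subseteq> P.cb x s"
  shows "integrable P.vol (\<lambda>q. indicator A q * (1 + hn q))"
proof -
  have K: "compact (P.cb x s)" by (rule P.Hopf_Rinow[OF assms(1)])
  have hc: "continuous_on UNIV (\<lambda>q. 1 + hn q)" by (intro continuous_on_add continuous_on_const continuous_hn)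
  obtain b where b: "b > 0" "\<And>q. q \<in> P.cb x s \<Longrightarrow> norm (1 + hn q) \<le> b"
    by (rule compact_bound[OF K continuous_on_subset[OF hc subset_UNIV]]) blast
  show ?thesis
  proof (rule P.integrable_vol_bounded[OF K])
    show "(\<lambda>q. indicator A q * (1 + hn q)) \<in> borel_measurable borel"
      by (intro borel_measurable_times borel_measurable_indicator assms borel_measurable_continuous_onI hc)
    show "\<bar>indicator A q * (1 + hn q)\<bar> \<le> b" if "q \<in> P.cb x s" for q
      using b(2)[OF that] b(1) by (simp add: indicator_def)
  qed (use assms(3) in \<open>auto simp: indicator_def\<close>)
qed

lemma h_int_mono:
  assumes "complete_riem P" "A \<in> sets borel" "B \<in> sets borel" "A \<subseteq> B" "B \<subseteq> P.cb x s"
  shows "h_int A \<le> h_int B"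
  unfolding h_int_def
  by (rule integral_mono[OF integrable_h[OF assms(1,2)] integrable_h[OF assms(1,3,5)]])
    (use assms hn_nonneg in \<open>auto simp: indicator_def add_nonneg_nonneg\<close>)

lemma borel_ball: "{q. rdist P x q < s} \<in> sets borel"
  using P.open_db by (rule borel_open)

lemma emeasure_finite:
  assumes "complete_riem P" "A \<subseteq> P.cb x s" shows "emeasure P.vol A < \<infinity>"
  using emeasure_mono[OF assms(2), of P.vol] P.vol_compact_finite[OF P.Hopf_Rinow[OF assms(1)], of x s] P.closed_cb[of x s]
  by (auto simp: borel_closed intro: le_less_trans)

lemma ball_sub_cb: "{q. rdist P x q < s} \<subseteq> P.cb x s"
  by (auto simp: P.cb_def)

lemma V_mono:
  assumes "complete_riem P" "A \<in> sets borel" "A \<subseteq> {q. rdist P x q < s}"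
  shows "measure P.vol A \<le> V x s"
  by (rule measure_mono_fmeasurable[OF assms(3)])
    (use assms(2) emeasure_finite[OF assms(1) ball_sub_cb] borel_ball in \<open>auto simp: fmeasurable_def\<close>)

lemma V_lower:
  assumes "complete_riem P"
  obtains s0 where "s0 > 0" "\<And>s. 0 < s \<Longrightarrow> s < s0 \<Longrightarrow> \<omega> * s ^ CARD('m) \<le> V x s"
proof -
  obtain s0 where s0: "s0 > 0" "\<And>s. 0 < s \<Longrightarrow> s < s0 \<Longrightarrow>
      ennreal (unit_ball_vol (real CARD('m)) / 2 ^ (CARD('m) + 1) * s ^ CARD('m)) \<le> emeasure P.vol {q. rdist P x q < s}"
    by (rule P.vol_ball_lower[of x]) blast
  have "\<omega> * s ^ CARD('m) \<le> V x s" if "0 < s" "s < s0" for s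
    using s0(2)[OF that] emeasure_finite[OF assms ball_sub_cb, of x s]
    by (simp add: \<omega>_def emeasure_eq_ennreal_measure)
  then show ?thesis using that[OF s0(1)] by blast
qed

lemma V_pos:
  assumes compl: "complete_riem P" and t: "t > 0" shows "0 < V x t"
proof -
  obtain s0 where s0: "s0 > 0" "\<And>t. 0 < t \<Longrightarrow> t < s0 \<Longrightarrow> \<omega> * t ^ CARD('m) \<le> V x t" by (rule V_lower[OF compl]) blast
  define t' where "t' = min t (s0 / 2)"
  have t': "0 < t'" "t' < s0" "t' \<le> t" using t s0(1) by (auto simp: t'_def)
  have "0 < \<omega> * t' ^ CARD('m)" using t' omega_pos by simp
  also have "\<dots> \<le> V x t'" by (rule s0(2)[OF t'(1,2)])
  also have "\<dots> \<le> V x t" by (rule V_mono[OF compl borel_ball]) (use t'(3) in auto)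
  finally show ?thesis .
qed

end

context center
begin

text \<open>If no dyadic radius works, \<open>h_int\<close> is small at all of them. Induction over
  the scales, with \<open>monotonicity\<close> between \<open>\<tau> K\<close> and
  \<open>\<rho>0\<close>, then bounds every density \<open>V \<xi> (\<tau> K) / \<tau> K ^ m\<close>
  by \<open>\<omega> / 2\<close>, against \<open>V_lower\<close>. In \<open>\<Gamma>\<close> the
  power of 8 is the \<open>2 ^ m\<close> of \<open>dyadic_shell\<close> times the
  \<open>4 ^ m\<close> of the radius \<open>4 * \<tau> k\<close>; the factor 4 is the 2 of the bound
  \<open>2 * \<delta>\<close> times the bound 2 of the geometric sum.\<close>

lemma dyadic:
  assumes compl: "complete_riem P" and \<rho>0: "0 < \<rho>0" "\<rho>0 < R"
    and small: "V \<xi> (4 * \<rho>0) \<le> \<omega> / 4 * \<rho>0 ^ CARD('m)"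
  defines "\<Gamma> \<equiv> 4 * (1 + 2 * C) * 8 ^ CARD('m)"
  obtains t where "0 < t" "t \<le> \<rho>0" "V \<xi> (4 * t) \<le> \<Gamma> * \<rho>0 * h_int {q. r q < t}"
proof (rule ccontr)
  assume no: "\<not> thesis"
  define m where "m = CARD('m)"
  define \<tau> where "\<tau> k = \<rho>0 / 2 ^ k" for k :: nat
  have \<tau>: "0 < \<tau> k" "\<tau> k \<le> \<rho>0" for k using \<rho>0(1) by (auto simp: \<tau>_def field_simps)
  define \<delta> where "\<delta> = \<omega> / 4"
  have \<delta>: "\<delta> > 0" using omega_pos by (simp add: \<delta>_def)
  have \<Gamma>: "\<Gamma> > 0" using RC(3) by (simp add: \<Gamma>_def add_pos_nonneg)
  have bad: "\<Gamma> * \<rho>0 * h_int {q. r q < \<tau> k} < V \<xi> (4 * \<tau> k)" for k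
    using no that[OF \<tau>[of k]] by force
  let ?a = "\<lambda>k. V \<xi> (\<tau> k) / \<tau> k ^ m"
  have V4: "V \<xi> s \<le> \<delta> * \<rho>0 ^ m" if "s \<le> 4 * \<rho>0" for s
  proof -
    have "V \<xi> s \<le> V \<xi> (4 * \<rho>0)" by (rule V_mono[OF compl borel_ball]) (use that in auto)
    then show ?thesis using small by (simp add: \<delta>_def m_def)
  qed
  have a: "?a K \<le> 2 * \<delta>" for K
  proof (induction K rule: less_induct)
    case (less K)
    show ?case
    proof (cases "K = 0")
      case True
      have "?a K \<le> \<delta>" using V4[of \<rho>0] \<rho>0(1) by (simp add: True \<tau>_def pos_divide_le_eq)
      then show ?thesis by (rule order_trans) (use \<delta> in simp)
    next
      case False
      have \<tau>K: "\<tau> K < \<rho>0" 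
        using one_less_power[of "2::real" K] False \<rho>0(1) by (simp add: \<tau>_def pos_divide_less_eq)
      have T: "\<tau> k * h_int {q. r q < \<tau> k} / \<tau> k ^ m \<le> (1 / 2) ^ k * (2 * \<delta> * 4 ^ m / \<Gamma>)" if k: "k \<le> K" for k
      proof -
        \<comment> \<open>For \<open>k < 2\<close> the radius \<open>4 * \<tau> k\<close> is at
          least \<open>\<rho>0\<close>, and the hypothesis \<open>small\<close> suffices; otherwise
          it is \<open>\<tau> (k - 2)\<close>, where the induction hypothesis applies.\<close>
        have "V \<xi> (4 * \<tau> k) \<le> 2 * \<delta> * (4 * \<tau> k) ^ m"
        proof (cases "k < 2")
          case True
          have "\<rho>0 \<le> 4 * \<tau> k" 
          proof -
            have "(2::real) ^ k \<le> 2 ^ 2" using True by (intro power_increasing) auto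
            then show ?thesis using \<rho>0(1) by (simp add: \<tau>_def pos_le_divide_eq mult_left_mono[of _ 4 \<rho>0])
          qed
          then have "\<delta> * \<rho>0 ^ m \<le> 2 * \<delta> * (4 * \<tau> k) ^ m"
            using \<delta> \<rho>0(1) by (intro mult_mono power_mono) auto
          then show ?thesis using V4[of "4 * \<tau> k"] \<tau>[of k] by linarith
        next
          case False
          then obtain j where j: "k = j + 2" using le_Suc_ex[of 2 k] by (auto simp: add.commute)
          have "\<tau> j = 4 * \<tau> k" by (simp add: \<tau>_def j)
          then show ?thesis using less.IH[of j] j k \<tau>(1)[of j] by (simp add: pos_divide_le_eq)
        qed
        then have "h_int {q. r q < \<tau> k} \<le> 2 * \<delta> * (4 * \<tau> k) ^ m / (\<Gamma> * \<rho>0)"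
          using bad[of k] \<Gamma> \<rho>0(1) by (simp add: pos_le_divide_eq mult.commute)
        then have "\<tau> k * h_int {q. r q < \<tau> k} / \<tau> k ^ m \<le> \<tau> k * (2 * \<delta> * (4 * \<tau> k) ^ m / (\<Gamma> * \<rho>0)) / \<tau> k ^ m"
          using \<tau>(1)[of k] by (intro divide_right_mono mult_left_mono) auto
        also have "\<dots> = \<tau> k / \<rho>0 * (2 * \<delta> * 4 ^ m / \<Gamma>)"
          using \<tau>(1)[of k] by (simp add: power_mult_distrib mult_ac)
        also have "\<tau> k / \<rho>0 = (1 / 2) ^ k" using \<rho>0(1) by (simp add: \<tau>_def power_divide)
        finally show ?thesis .
      qed
      have int: "integrable P.vol (\<lambda>q. indicator {q. r q < \<tau> k} q * (1 + hn q))" for k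
        by (rule integrable_h[OF compl borel_ball ball_sub_cb])
      let ?G = "\<lambda>q. indicator {q. r q < \<rho>0} q * (r q * (1 + hn q) / max (r q) (\<tau> K) ^ m)"
      let ?S = "\<lambda>q. \<Sum>k\<le>K. 2 ^ m * (\<tau> k / \<tau> k ^ m) * (indicator {q. r q < \<tau> k} q * (1 + hn q))"
      note mon = monotonicity[OF \<tau>(1)[of K] \<tau>K \<rho>0(2) P.Hopf_Rinow[OF compl], folded m_def]
      have "(\<integral>q. ?G q \<partial>P.vol) \<le> (\<integral>q. ?S q \<partial>P.vol)"
      proof (rule integral_mono[OF mon(1)])
        show "integrable P.vol ?S" by (intro Bochner_Integration.integrable_sum integrable_mult_right int)
        fix q
        show "?G q \<le> ?S q"
        proof (cases "r q < \<rho>0")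
          case False
          then have "\<not> r q < \<tau> k" for k using \<tau>(2)[of k] by linarith
          then show ?thesis using False by (simp add: indicator_def)
        next
          case True
          have "r q / max (r q) (\<tau> K) ^ m * (1 + hn q) \<le> (\<Sum>k\<le>K. if r q < \<tau> k then 2 ^ m * (\<tau> k / \<tau> k ^ m) else 0) * (1 + hn q)"
            by (intro mult_right_mono dyadic_shell[OF r_nonneg True \<tau>_def]) (simp add: hn_nonneg add_nonneg_nonneg)
          also have "\<dots> = ?S q" unfolding sum_distrib_right by (intro sum.cong refl) (simp add: indicator_def)
          finally show ?thesis using True by (simp add: mult_ac)
        qed
      qed
      also have "\<dots> = (\<Sum>k\<le>K. 2 ^ m * (\<tau> k * h_int {q. r q < \<tau> k} / \<tau> k ^ m))"
        using int by (subst Bochner_Integration.integral_sum) (auto simp: h_int_def intro!: sum.cong)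
      also have "\<dots> \<le> (\<Sum>k\<le>K. 2 ^ m * ((1 / 2) ^ k * (2 * \<delta> * 4 ^ m / \<Gamma>)))"
        by (intro sum_mono mult_left_mono T) auto
      also have "\<dots> = (\<Sum>k\<le>K. (1 / 2) ^ k) * (2 ^ m * (2 * \<delta> * 4 ^ m / \<Gamma>))"
        unfolding sum_distrib_right by (intro sum.cong refl) (simp only: mult_ac)
      also have "\<dots> \<le> 2 * (2 ^ m * (2 * \<delta> * 4 ^ m / \<Gamma>))"
      proof (rule mult_right_mono)
        have "(\<Sum>k\<le>K. (1 / 2 :: real) ^ k) = 2 - (1 / 2) ^ K" by (induction K) auto
        then show "(\<Sum>k\<le>K. (1 / 2 :: real) ^ k) \<le> 2" by simp
      qed (use \<delta> \<Gamma> in simp)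
      finally have "(1 + 2 * C) * (\<integral>q. ?G q \<partial>P.vol) \<le> (1 + 2 * C) * (2 * (2 ^ m * (2 * \<delta> * 4 ^ m / \<Gamma>)))"
        using RC(3) by (intro mult_left_mono) auto
      \<comment> \<open>The choice of \<open>\<Gamma>\<close> makes the error exactly \<delta>; the
        density at \<open>\<rho>0\<close> contributes at most another \<delta>.\<close>
      also have "\<dots> = \<delta>"
      proof -
        have "(2::real) ^ m * 4 ^ m = 8 ^ m" by (simp flip: power_mult_distrib)
        then have "(1 + 2 * C) * (2 * (2 ^ m * (2 * \<delta> * 4 ^ m / \<Gamma>))) = \<delta> * ((4 * (1 + 2 * C) * 8 ^ m) / \<Gamma>)" by (simp add: field_simps)
        moreover have "\<Gamma> = 4 * (1 + 2 * C) * 8 ^ m" by (simp add: \<Gamma>_def m_def)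
        ultimately show ?thesis using \<Gamma> RC(3) by auto
      qed
      finally have "?a K \<le> V \<xi> \<rho>0 / \<rho>0 ^ m + \<delta>" using mon(2) by linarith
      moreover have "V \<xi> \<rho>0 / \<rho>0 ^ m \<le> \<delta>" using V4[of \<rho>0] \<rho>0(1) by (simp add: pos_divide_le_eq)
      ultimately show ?thesis by linarith
    qed
  qed
  \<comment> \<open>Below \<open>s0\<close> the density is at least \<omega>, twice the bound
    \<open>2 * \<delta>\<close> just proved.\<close>
  obtain s0 where s0: "s0 > 0" "\<And>s. 0 < s \<Longrightarrow> s < s0 \<Longrightarrow> \<omega> * s ^ CARD('m) \<le> V \<xi> s" by (rule V_lower[OF compl]) blast
  obtain K where "(1 / 2) ^ K < s0 / \<rho>0" using real_arch_pow_inv[of "s0 / \<rho>0" "1 / 2"] s0(1) \<rho>0(1) by auto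
  then have "\<tau> K < s0" using \<rho>0(1) by (simp add: \<tau>_def power_divide pos_less_divide_eq mult.commute)
  from s0(2)[OF \<tau>(1) this] have "\<omega> \<le> ?a K" using \<tau>(1)[of K] by (simp add: pos_le_divide_eq m_def)
  moreover have "2 * \<delta> < \<omega>" using omega_pos by (simp add: \<delta>_def)
  ultimately show False using a[of K] by linarith
qed

end

text \<open>Greedy choice: keep a ball of largest radius and drop those that meet it, which lie
  within three times that radius of its center. The factor 4 matches the enlargement in
  \<open>dyadic\<close>.\<close>

lemma (in rmfd) finite_vitali:
  assumes "finite F" "\<And>x. x \<in> F \<Longrightarrow> t x > 0"
  obtains I where "I \<subseteq> F" "disjoint_family_on (\<lambda>x. {q. dist_M x q < t x}) I"
    "\<And>x q. x \<in> F \<Longrightarrow> dist_M x q < t x \<Longrightarrow> \<exists>y\<in>I. dist_M y q < 4 * t y"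
proof -
  let ?B = "\<lambda>x. {q. dist_M x q < t x}"
  have "\<exists>I\<subseteq>F. disjoint_family_on ?B I \<and> (\<forall>x\<in>F. \<forall>q\<in>?B x. \<exists>y\<in>I. dist_M y q < 4 * t y)"
    using assms
  proof (induction F rule: finite_psubset_induct)
    case (psubset F)
    show ?case
    proof (cases "F = {}")
      case True
      then show ?thesis by (auto simp: disjoint_family_on_def)
    next
      case False
      have "Max (t ` F) \<in> t ` F" using False psubset.hyps by (intro Max_in) auto
      then obtain x where x: "x \<in> F" "t x = Max (t ` F)" by force
      have tx: "t z \<le> t x" if "z \<in> F" for z unfolding x(2) using that psubset.hyps by (intro Max_ge) auto
      define F' where "F' = {z\<in>F. ?B z \<inter> ?B x = {}}"
      have "x \<in> ?B x" using rdist_refl psubset.prems[OF x(1)] by simp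
      then have "x \<notin> F'" unfolding F'_def by blast
      then have "F' \<subset> F" using x(1) by (auto simp: F'_def)
      have "t z > 0" if "z \<in> F'" for z using that psubset.prems by (simp add: F'_def)
      from psubset.IH[OF \<open>F' \<subset> F\<close> this] obtain I where I: "I \<subseteq> F'" "disjoint_family_on ?B I"
        "\<forall>z\<in>F'. \<forall>q\<in>?B z. \<exists>y\<in>I. dist_M y q < 4 * t y"
        by blast
      have Ix: "?B y \<inter> ?B x = {}" "?B x \<inter> ?B y = {}" if "y \<in> I" for y
        using I(1) that by (auto simp: F'_def)
      have "disjoint_family_on ?B (insert x I)"
        unfolding disjoint_family_on_def
      proof (intro ballI impI)
        fix y z assume "y \<in> insert x I" "z \<in> insert x I" "y \<noteq> z"
        then show "?B y \<inter> ?B z = {}" using Ix disjoint_family_onD[OF I(2), of y z] by (elim insertE) simp_all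
      qed
      moreover have "\<exists>y\<in>insert x I. dist_M y q < 4 * t y" if z: "z \<in> F" "q \<in> ?B z" for z q
      proof (cases "z \<in> F'")
        case True
        then show ?thesis using I(3) z(2) by blast
      next
        case False
        then obtain p where p: "dist_M z p < t z" "dist_M x p < t x" using z(1) by (auto simp: F'_def)
        have "dist_M x q \<le> dist_M x p + (dist_M p z + dist_M z q)"
          using rdist_triangle[of x q p] rdist_triangle[of p q z] by linarith
        also have "\<dots> < 4 * t x" using p z(2) tx[OF z(1)] psubset.prems[OF x(1)] rdist_sym[of p z] by simp
        finally show ?thesis by blast
      qed
      ultimately show ?thesis using I(1) x(1) \<open>F' \<subset> F\<close> by (intro exI[of _ "insert x I"]) blast
    qed
  qed
  then obtain I where "I \<subseteq> F" "disjoint_family_on ?B I" "\<forall>x\<in>F. \<forall>q\<in>?B x. \<exists>y\<in>I. dist_M y q < 4 * t y" by blast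
  then show ?thesis by (intro that[of I]) auto
qed

context imm
begin

text \<open>\<open>dyadic\<close> applies at every point of the closed ball, since the balls of
  radius \<open>4 * \<rho>\<close> around them stay inside that of radius \<open>s'\<close>. It
  bounds the volume of the enlarged Vitali balls by \<open>h_int\<close> over the original ones;
  these are disjoint, so the bounds add up to \<open>h_int\<close> over the larger ball.\<close>

lemma thin_step:
  assumes lm: "N.local_model q0 d R C" and compl: "complete_riem P"
    and s: "0 < s" "s < s'" "rdist N q0 (\<phi> x) + s < R" and \<rho>: "0 < \<rho>" "\<rho> < R" "s + 4 * \<rho> \<le> s'"
    and V: "V x s' \<le> \<omega> / 4 * \<rho> ^ CARD('m)"
  shows "V x s \<le> 4 * (1 + 2 * C) * 8 ^ CARD('m) * \<rho> * h_int {q. rdist P x q < s'}"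
proof -
  let ?\<Gamma> = "4 * (1 + 2 * C) * 8 ^ CARD('m)" and ?B = "\<lambda>\<xi> s. {q. rdist P \<xi> q < s}"
  have C0: "C \<ge> 0" using lm by (simp add: N.local_model_def)
  have sub: "?B \<xi> (4 * \<rho>) \<subseteq> ?B x s'" if "\<xi> \<in> P.cb x s" for \<xi>
  proof
    fix q assume "q \<in> ?B \<xi> (4 * \<rho>)"
    then show "q \<in> ?B x s'" using that P.rdist_triangle[of x q \<xi>] \<rho>(3) by (simp add: P.cb_def)
  qed
  have "\<exists>t. 0 < t \<and> t \<le> \<rho> \<and> V \<xi> (4 * t) \<le> ?\<Gamma> * \<rho> * h_int (?B \<xi> t)" if \<xi>: "\<xi> \<in> P.cb x s" for \<xi>
  proof -
    have "rdist N q0 (\<phi> \<xi>) < R"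
      using N.rdist_triangle[of q0 "\<phi> \<xi>" "\<phi> x"] phi_lipschitz[of x \<xi>] \<xi> s(3) by (simp add: P.cb_def)
    then interpret c: center P N \<phi> q0 d R C \<xi> using lm by unfold_locales
    have "V \<xi> (4 * \<rho>) \<le> V x s'" by (rule V_mono[OF compl borel_ball sub[OF \<xi>]])
    then have v: "V \<xi> (4 * \<rho>) \<le> \<omega> / 4 * \<rho> ^ CARD('m)" using V by linarith
    show ?thesis by (rule c.dyadic[OF compl \<rho>(1,2) v]) blast
  qed
  then obtain t where t: "\<And>\<xi>. \<xi> \<in> P.cb x s \<Longrightarrow> 0 < t \<xi> \<and> t \<xi> \<le> \<rho> \<and> V \<xi> (4 * t \<xi>) \<le> ?\<Gamma> * \<rho> * h_int (?B \<xi> (t \<xi>))"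
    by metis
  have cov0: "P.cb x s \<subseteq> (\<Union>\<xi>\<in>P.cb x s. ?B \<xi> (t \<xi>))" using t P.rdist_refl by fastforce
  obtain F where F: "F \<subseteq> P.cb x s" "finite F" "P.cb x s \<subseteq> (\<Union>\<xi>\<in>F. ?B \<xi> (t \<xi>))"
    by (rule compactE_image[OF P.Hopf_Rinow[OF compl] P.open_db cov0])
  have tF: "t \<xi> > 0" if "\<xi> \<in> F" for \<xi> using t F(1) that by blast
  obtain I where I: "I \<subseteq> F" "disjoint_family_on (\<lambda>\<xi>. ?B \<xi> (t \<xi>)) I"
    "\<And>\<xi> q. \<xi> \<in> F \<Longrightarrow> rdist P \<xi> q < t \<xi> \<Longrightarrow> \<exists>y\<in>I. rdist P y q < 4 * t y"
    by (rule P.finite_vitali[OF F(2) tF]) blast+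
  have fI: "finite I" using I(1) F(2) by (rule finite_subset)
  have tI: "0 < t \<xi>" "t \<xi> \<le> \<rho>" "V \<xi> (4 * t \<xi>) \<le> ?\<Gamma> * \<rho> * h_int (?B \<xi> (t \<xi>))" "\<xi> \<in> P.cb x s" if "\<xi> \<in> I" for \<xi>
    using t that I(1) F(1) by blast+
  have cov: "?B x s \<subseteq> (\<Union>\<xi>\<in>I. ?B \<xi> (4 * t \<xi>))"
  proof
    fix q assume "q \<in> ?B x s"
    then have "q \<in> P.cb x s" by (simp add: P.cb_def)
    then obtain \<xi> where "\<xi> \<in> F" "rdist P \<xi> q < t \<xi>" using F(3) by blast
    then show "q \<in> (\<Union>\<xi>\<in>I. ?B \<xi> (4 * t \<xi>))" using I(3) by blast
  qed
  have fm: "?B \<xi> u \<in> fmeasurable P.vol" for \<xi> u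
    using emeasure_finite[OF compl ball_sub_cb] borel_ball by (auto simp: fmeasurable_def)
  have "V x s \<le> measure P.vol (\<Union>\<xi>\<in>I. ?B \<xi> (4 * t \<xi>))"
    by (rule measure_mono_fmeasurable[OF cov]) (use borel_ball fm fI in auto)
  also have "\<dots> \<le> (\<Sum>\<xi>\<in>I. V \<xi> (4 * t \<xi>))" by (rule measure_UNION_le[OF fI]) (use borel_ball in auto)
  also have "\<dots> \<le> (\<Sum>\<xi>\<in>I. ?\<Gamma> * \<rho> * h_int (?B \<xi> (t \<xi>)))" by (intro sum_mono tI)
  also have "\<dots> = ?\<Gamma> * \<rho> * (\<Sum>\<xi>\<in>I. h_int (?B \<xi> (t \<xi>)))" by (simp add: sum_distrib_left)
  also have "(\<Sum>\<xi>\<in>I. h_int (?B \<xi> (t \<xi>))) = h_int (\<Union>\<xi>\<in>I. ?B \<xi> (t \<xi>))"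
  proof -
    have "indicator (\<Union>\<xi>\<in>I. ?B \<xi> (t \<xi>)) q * (1 + hn q) = (\<Sum>\<xi>\<in>I. indicator (?B \<xi> (t \<xi>)) q * (1 + hn q))" for q
      unfolding sum_distrib_right[symmetric] indicator_UN_disjoint[OF fI I(2)] ..
    then show ?thesis unfolding h_int_def
      using integrable_h[OF compl borel_ball ball_sub_cb] by (simp add: Bochner_Integration.integral_sum)
  qed
  also have "?\<Gamma> * \<rho> * h_int (\<Union>\<xi>\<in>I. ?B \<xi> (t \<xi>)) \<le> ?\<Gamma> * \<rho> * h_int (?B x s')"
  proof (intro mult_left_mono h_int_mono[OF compl _ borel_ball _ ball_sub_cb])
    show "(\<Union>\<xi>\<in>I. ?B \<xi> (t \<xi>)) \<in> sets borel" using borel_ball fI by (intro sets.finite_UN) auto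
    show "(\<Union>\<xi>\<in>I. ?B \<xi> (t \<xi>)) \<subseteq> ?B x s'"
    proof (rule UN_least)
      fix \<xi> assume \<xi>: "\<xi> \<in> I"
      have "?B \<xi> (t \<xi>) \<subseteq> ?B \<xi> (4 * \<rho>)" using tI(1,2)[OF \<xi>] by auto
      then show "?B \<xi> (t \<xi>) \<subseteq> ?B x s'" using sub[OF tI(4)[OF \<xi>]] by blast
    qed
  qed (use C0 \<rho>(1) in auto)
  finally show ?thesis .
qed

text \<open>De Giorgi's iteration: a ball that is thin at scale \<open>s\<close> would have volume \<open>0\<close> at scale \<open>s / 2\<close>.\<close>

lemma no_thin_ball:
  assumes lm: "N.local_model q0 d R C" and compl: "complete_riem P"
    and s: "0 < s" "s < R" "rdist N q0 (\<phi> x) + s < R" and v: "V x s \<le> \<omega> / 4 * (s / 16) ^ CARD('m)"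
    and h: "\<And>u. 0 < u \<Longrightarrow> u \<le> s \<Longrightarrow>
      4 * (1 + 2 * C) * 8 ^ CARD('m) * h_int {q. rdist P x q < u} \<le> root CARD('m) (\<omega> / 4) / 2 ^ CARD('m) * (V x u / root CARD('m) (V x u))"
  shows False
proof -
  define m where "m = CARD('m)"
  define \<delta> where "\<delta> = \<omega> / 4"
  let ?\<Gamma> = "4 * (1 + 2 * C) * 8 ^ m"
  have m: "m > 0" and \<delta>: "\<delta> > 0" using omega_pos by (simp_all add: m_def \<delta>_def)
  \<comment> \<open>Radii decreasing from \<open>s\<close> towards \<open>s / 2\<close>; their gaps
    and the scales in \<open>dec\<close> both halve in each step.\<close>
  define u where "u j = s * (1 / 2 + (1 / 2) ^ (j + 1))" for j :: nat
  have u: "0 < u j" "u j \<le> s" "s / 2 \<le> u j" "u (Suc j) < u j" "u j - u (Suc j) = s / 4 * (1 / 2) ^ j" for j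
  proof -
    define e where "e = s * (1 / 2) ^ j"
    have "(1 / 2 :: real) ^ j \<le> 1" by (rule power_le_one) auto
    then have e: "0 < e" "e \<le> s" using s(1) by (simp_all add: e_def mult_left_le)
    have "u j = s / 2 + e / 2" "u (Suc j) = s / 2 + e / 4" by (simp_all add: u_def e_def algebra_simps)
    then show "0 < u j" "u j \<le> s" "s / 2 \<le> u j" "u (Suc j) < u j" "u j - u (Suc j) = s / 4 * (1 / 2) ^ j"
      using e by (simp_all add: e_def)
  qed
  have dec: "V x (u j) \<le> \<delta> * (s / 16 * (1 / 2) ^ j) ^ m" for j
  proof (induction j)
    case 0
    have "u 0 = s" by (simp add: u_def)
    then show ?case using v by (simp add: \<delta>_def m_def)
  next
    case (Suc j)
    define v where "v = V x (u j)"
    have v: "0 < v" using V_pos[OF compl u(1)] by (simp add: v_def)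
    \<comment> \<open>The smallest scale that \<open>thin_step\<close> allows:
      \<open>\<delta> * \<rho> ^ m\<close> is the volume itself. By induction
      \<open>4 * \<rho>\<close> fits into the gap between \<open>u (Suc j)\<close> and
      \<open>u j\<close>.\<close>
    define \<rho> where "\<rho> = root m (v / \<delta>)"
    have \<rho>: "0 < \<rho>" "\<delta> * \<rho> ^ m = v" using v \<delta> m by (simp_all add: \<rho>_def)
    have "root m (v / \<delta>) \<le> root m ((s / 16 * (1 / 2) ^ j) ^ m)"
      using Suc \<delta> m by (simp add: v_def pos_divide_le_eq mult.commute)
    then have \<rho>s: "\<rho> \<le> s / 16 * (1 / 2) ^ j" using s(1) m by (simp add: \<rho>_def real_root_power_cancel)
    have p1: "(1 / 2 :: real) ^ j \<le> 1" by (rule power_le_one) auto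
    have "s / 16 * (1 / 2) ^ j \<le> s / 16 * 1" using p1 s(1) by (intro mult_left_mono) auto
    then have \<rho>R: "\<rho> < R" using \<rho>s s(1,2) by linarith
    have "V x (u (Suc j)) \<le> ?\<Gamma> * \<rho> * h_int {q. rdist P x q < u j}"
      unfolding m_def
    proof (rule thin_step[OF lm compl u(1) u(4) _ \<rho>(1) \<rho>R])
      show "rdist N q0 (\<phi> x) + u (Suc j) < R" using s(3) u(2)[of "Suc j"] by linarith
      show "u (Suc j) + 4 * \<rho> \<le> u j" using u(5)[of j] \<rho>s by (simp add: algebra_simps)
      show "V x (u j) \<le> \<omega> / 4 * \<rho> ^ CARD('m)" using \<rho>(2) by (simp add: v_def \<delta>_def m_def)
    qed
    also have "\<dots> = \<rho> * (?\<Gamma> * h_int {q. rdist P x q < u j})" by simp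
    \<comment> \<open>As \<rho> is \<open>root m v / root m \<delta>\<close>, the roots cancel: the
      hypothesis \<open>h\<close> is normalized to leave \<open>v / 2 ^ m\<close>, which is the
      effect of halving the scale in \<open>dec\<close>.\<close>
    also have "\<dots> \<le> \<rho> * (root m \<delta> / 2 ^ m * (v / root m v))"
      unfolding m_def \<delta>_def v_def using \<rho>(1) by (intro mult_left_mono h u) auto
    also have "\<dots> = v / 2 ^ m"
      using \<delta> v m by (simp add: \<rho>_def real_root_divide)
    also have "\<dots> \<le> \<delta> * (s / 16 * (1 / 2) ^ j) ^ m / 2 ^ m" using Suc by (simp add: v_def divide_right_mono)
    also have "\<dots> = \<delta> * (s / 16 * (1 / 2) ^ Suc j) ^ m" 
    proof -
      have "s / 16 * (1 / 2) ^ Suc j = (s / 16 * (1 / 2) ^ j) / 2" by simp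
      then show ?thesis by (simp only: power_divide times_divide_eq_right)
    qed
    finally show ?case .
  qed
  have "(\<lambda>j. \<delta> * (s / 16 * (1 / 2) ^ j) ^ m) \<longlonglongrightarrow> \<delta> * (s / 16 * 0) ^ m"
    by (intro tendsto_intros LIMSEQ_realpow_zero) auto
  then have "(\<lambda>j. \<delta> * (s / 16 * (1 / 2) ^ j) ^ m) \<longlonglongrightarrow> 0" by (simp add: zero_power[OF m])
  then have "V x (s / 2) \<le> 0"
  proof (rule tendsto_lowerbound)
    have "V x (s / 2) \<le> \<delta> * (s / 16 * (1 / 2) ^ j) ^ m" for j
    proof -
      have "V x (s / 2) \<le> V x (u j)" by (rule V_mono[OF compl borel_ball]) (use u(3)[of j] in auto)
      then show ?thesis using dec[of j] by linarith
    qed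
    then show "\<forall>\<^sub>F j in sequentially. V x (s / 2) \<le> \<delta> * (s / 16 * (1 / 2) ^ j) ^ m" by simp
  qed simp
  then show False using V_pos[OF compl, of "s / 2" x] s(1) by simp
qed

end

section \<open>Properness\<close>

text \<open>The measures are the terms of a convergent series.\<close>

lemma measure_disjoint_tendsto_0:
  assumes "disjoint_family B" "\<And>k::nat. B k \<in> sets \<mu>" "emeasure \<mu> (\<Union>k. B k) \<noteq> \<infinity>"
  shows "(\<lambda>k. measure \<mu> (B k)) \<longlonglongrightarrow> 0"
  using sums_summable[OF measure_UNION[OF _ assms(1,3)]] assms(2) by (intro summable_LIMSEQ_zero) blast

context imm
begin

abbreviation ball_P :: "'a \<Rightarrow> real \<Rightarrow> 'a set" where "ball_P x s \<equiv> {q. rdist P x q < s}"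

lemma hn_measurable: "hn \<in> borel_measurable borel"
  by (rule borel_measurable_continuous_onI[OF continuous_hn])

lemma integral_ball_const:
  assumes "complete_riem P"
  shows "integrable P.vol (\<lambda>q. indicator (ball_P x s) q * a)" "(\<integral>q. indicator (ball_P x s) q * a \<partial>P.vol) = a * V x s"
proof -
  have "integrable P.vol (indicator (ball_P x s) :: _ \<Rightarrow> real)"
    using emeasure_finite[OF assms ball_sub_cb, of x s] borel_ball by (intro integrable_real_indicator) auto
  then show "integrable P.vol (\<lambda>q. indicator (ball_P x s) q * a)" by (rule integrable_mult_left)
  show "(\<integral>q. indicator (ball_P x s) q * a \<partial>P.vol) = a * V x s" by simp
qed

text \<open>For \<open>p < \<infinity>\<close> use \<open>t \<le> c + t powr p * c powr (1 - p)\<close> with \<open>c\<close> proportional to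
  \<open>V powr (-1/m)\<close>; here \<open>p \<ge> m\<close> enters.\<close>

lemma h_int_small_finite:
  assumes compl: "complete_riem P" and p: "real CARD('m) \<le> p" and F: "integrable P.vol (\<lambda>q. hn q powr p)"
    and s: "0 < u" "u \<le> s" and e: "\<epsilon> > 0" and v: "V x s \<le> 1" "V x s \<le> \<epsilon> ^ CARD('m)"
    and I: "(\<integral>q. indicator (ball_P x s) q * hn q powr p \<partial>P.vol) \<le> \<epsilon> powr p"
  shows "h_int (ball_P x u) \<le> 3 * \<epsilon> * (V x u / root CARD('m) (V x u))"
proof -
  define m where "m = CARD('m)"
  have m: "m > 0" by (simp add: m_def)
  define w where "w = root m (V x u)"
  have V0: "0 < V x u" by (rule V_pos[OF compl s(1)])
  have w: "0 < w" "w ^ m = V x u" using V0 m by (simp_all add: w_def)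
  have Vus: "V x u \<le> V x s" by (rule V_mono[OF compl borel_ball]) (use s in auto)
  have "root m (V x u) \<le> root m (\<epsilon> ^ m)" using Vus v(2) m by (simp add: m_def)
  then have we: "w \<le> \<epsilon>" using m e by (simp add: w_def real_root_power_cancel)
  have "root m (V x u) \<le> root m 1" using Vus v(1) m by simp
  then have w1: "w \<le> 1" using m by (simp add: w_def)
  \<comment> \<open>Balances the two terms of \<open>pt\<close>: after integration over the ball
    each is at most \<open>\<epsilon> * (V x u / w)\<close>.\<close>
  define c where "c = \<epsilon> / w"
  have c: "c > 0" using e w by (simp add: c_def)
  have pt: "hn q \<le> c + hn q powr p * c powr (1 - p)" for q
  proof (cases "hn q \<le> c")
    case True
    then show ?thesis by (simp add: add_increasing2)
  next
    case False
    then have h: "c < hn q" "0 < hn q" using c by auto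
    have "1 \<le> real m" using m by simp
    then have p1: "1 - p \<le> 0" using p unfolding m_def by linarith
    have "hn q = hn q powr p * hn q powr (1 - p)" using h by (simp flip: powr_add)
    also have "\<dots> \<le> hn q powr p * c powr (1 - p)" using h c p1 by (intro mult_left_mono powr_mono2') auto
    finally show ?thesis using c by linarith
  qed
  let ?B = "ball_P x u"
  have iF: "integrable P.vol (\<lambda>q. indicator (ball_P x t) q * hn q powr p)" for t
    using integrable_mult_indicator[OF _ F, of "ball_P x t"] borel_ball by simp
  have "h_int ?B \<le> (\<integral>q. indicator ?B q * (1 + c) + c powr (1 - p) * (indicator ?B q * hn q powr p) \<partial>P.vol)"
    unfolding h_int_def
  proof (rule integral_mono)
    fix q show "indicator ?B q * (1 + hn q) \<le> indicator ?B q * (1 + c) + c powr (1 - p) * (indicator ?B q * hn q powr p)"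
      using pt[of q] by (auto simp: indicator_def mult.commute)
  qed (intro integrable_h[OF compl borel_ball ball_sub_cb] Bochner_Integration.integrable_add integrable_mult_right integral_ball_const[OF compl] iF)+
  also have "\<dots> = (1 + c) * V x u + c powr (1 - p) * (\<integral>q. indicator ?B q * hn q powr p \<partial>P.vol)"
    using integral_ball_const[OF compl] iF by (subst Bochner_Integration.integral_add) auto
  also have "(\<integral>q. indicator ?B q * hn q powr p \<partial>P.vol) \<le> \<epsilon> powr p"
  proof -
    have "(\<integral>q. indicator ?B q * hn q powr p \<partial>P.vol) \<le> (\<integral>q. indicator (ball_P x s) q * hn q powr p \<partial>P.vol)"
      by (rule integral_mono[OF iF iF]) (use s(2) in \<open>auto simp: indicator_def\<close>)
    then show ?thesis using I by linarith
  qed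
  then have "(1 + c) * V x u + c powr (1 - p) * (\<integral>q. indicator ?B q * hn q powr p \<partial>P.vol) \<le> (1 + c) * V x u + c powr (1 - p) * \<epsilon> powr p"
    by (intro add_left_mono mult_left_mono) auto
  also have "c powr (1 - p) * \<epsilon> powr p = \<epsilon> * w powr (p - 1)"
  proof -
    have "c powr (1 - p) = \<epsilon> powr (1 - p) / w powr (1 - p)" using e w by (simp add: c_def powr_divide)
    moreover have "\<epsilon> powr (1 - p) * \<epsilon> powr p = \<epsilon>" using e by (simp flip: powr_add)
    moreover have "1 / w powr (1 - p) = w powr (p - 1)" using w by (simp add: powr_minus_divide[symmetric])
    moreover have "\<epsilon> powr (1 - p) / w powr (1 - p) * \<epsilon> powr p = (\<epsilon> powr (1 - p) * \<epsilon> powr p) * (1 / w powr (1 - p))" by simp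
    ultimately show ?thesis by metis
  qed
  \<comment> \<open>As \<open>w \<le> 1\<close>, the larger exponent gives the smaller power; this
    is the use of \<open>p\<close>.\<close>
  also have "w powr (p - 1) \<le> w powr (real m - 1)"
    using w(1) w1 p by (intro powr_mono') (auto simp: m_def)
  also have "w powr (real m - 1) = V x u / w"
    using w by (simp add: powr_diff powr_realpow)
  also have "(1 + c) * V x u + \<epsilon> * (V x u / w) \<le> 3 * \<epsilon> * (V x u / w)"
  proof -
    define y where "y = V x u / w"
    have "V x u = w * y" using w by (simp add: y_def)
    also have "\<dots> \<le> \<epsilon> * y" using we V0 w by (intro mult_right_mono) (auto simp: y_def)
    finally have "V x u \<le> \<epsilon> * y" .
    moreover have "c * V x u = \<epsilon> * y" by (simp add: c_def y_def)
    ultimately show ?thesis unfolding y_def[symmetric] by (simp add: algebra_simps)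
  qed
  finally show ?thesis using e by (simp add: w_def m_def mult_left_mono)
qed

text \<open>\<open>1 + hn\<close> is at most \<open>1 + b\<close> almost everywhere, and the volume
  is so small that its root absorbs this factor.\<close>

lemma h_int_small_infinite:
  assumes compl: "complete_riem P" and M: "AE q in P.vol. hn q \<le> b" "0 \<le> b"
    and s: "0 < u" "u \<le> s" and e: "\<epsilon> > 0" and v: "V x s \<le> (\<epsilon> / (1 + b)) ^ CARD('m)"
  shows "h_int (ball_P x u) \<le> \<epsilon> * (V x u / root CARD('m) (V x u))"
proof -
  define m where "m = CARD('m)"
  have m: "m > 0" by (simp add: m_def)
  define w where "w = root m (V x u)"
  have V0: "0 < V x u" by (rule V_pos[OF compl s(1)])
  have w: "0 < w" using V0 m by (simp add: w_def)
  have "V x u \<le> V x s" by (rule V_mono[OF compl borel_ball]) (use s in auto)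
  then have "root m (V x u) \<le> root m ((\<epsilon> / (1 + b)) ^ m)" using v m by (simp add: m_def)
  then have "w \<le> \<epsilon> / (1 + b)" using m e M(2) by (simp add: w_def real_root_power_cancel)
  then have wb: "(1 + b) * w \<le> \<epsilon>" using M(2) by (simp add: field_simps)
  have "h_int (ball_P x u) \<le> (\<integral>q. indicator (ball_P x u) q * (1 + b) \<partial>P.vol)"
    unfolding h_int_def
    by (rule integral_mono_AE[OF integrable_h[OF compl borel_ball ball_sub_cb] integral_ball_const(1)[OF compl]])
      (use M(1) in \<open>auto simp: indicator_def elim!: eventually_mono\<close>)
  also have "\<dots> = (1 + b) * w * (V x u / w)" using integral_ball_const(2)[OF compl] w by simp
  also have "\<dots> \<le> \<epsilon> * (V x u / w)" by (intro mult_right_mono wb) (use V0 w in simp)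
  finally show ?thesis by (simp add: w_def m_def)
qed

text \<open>For finite \<open>p\<close> the integrals of the \<open>p\<close>-th power of
  \<open>hn\<close> over disjoint balls have a finite sum, so they tend to 0; for
  \<open>p = \<infinity>\<close> smallness of the volumes alone suffices.\<close>

lemma eventually_small:
  assumes compl: "complete_riem P" and p: "of_nat CARD('m) \<le> p" and Lp: "Lp_norm p P.vol hn < \<infinity>"
    and s: "0 < s" and V: "(\<lambda>k::nat. V (x k) s) \<longlonglongrightarrow> 0" and disj: "disjoint_family (\<lambda>k. ball_P (x k) s)" and \<theta>: "\<theta> > 0"
  shows "\<forall>\<^sub>F k in sequentially. \<forall>u. 0 < u \<and> u \<le> s \<longrightarrow> h_int (ball_P (x k) u) \<le> \<theta> * (V (x k) u / root CARD('m) (V (x k) u))"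
proof (cases "p = \<infinity>")
  case True
  define b where "b = enn2real (esssup P.vol (\<lambda>x. ennreal \<bar>hn x\<bar>))"
  have fin: "esssup P.vol (\<lambda>x. ennreal \<bar>hn x\<bar>) < top" using Lp True by (simp add: Lp_norm_def)
  have "AE q in P.vol. ennreal \<bar>hn q\<bar> \<le> esssup P.vol (\<lambda>x. ennreal \<bar>hn x\<bar>)" by (rule esssup_AE)
  then have M: "AE q in P.vol. hn q \<le> b"
  proof (rule eventually_mono)
    fix q assume "ennreal \<bar>hn q\<bar> \<le> esssup P.vol (\<lambda>x. ennreal \<bar>hn x\<bar>)"
    then have "enn2real (ennreal \<bar>hn q\<bar>) \<le> b" unfolding b_def using fin by (intro enn2real_mono) auto
    then show "hn q \<le> b" by simp
  qed
  have b: "0 \<le> b" by (simp add: b_def)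
  have "\<forall>\<^sub>F k in sequentially. V (x k) s < (\<theta> / (1 + b)) ^ CARD('m)"
    using V \<theta> b by (intro order_tendstoD(2)) auto
  then show ?thesis
    by (rule eventually_mono) (use h_int_small_infinite[OF compl M b] \<theta> in \<open>auto simp: less_imp_le\<close>)
next
  case False
  define pr where "pr = enn2real p"
  have "p < top" using False by (simp add: less_top)
  then have pe: "p = ennreal pr" by (simp add: pr_def)
  have prm: "real CARD('m) \<le> pr" using p unfolding pe by (simp add: ennreal_of_nat_eq_real_of_nat ennreal_le_iff pr_def)
  let ?F = "\<lambda>q. hn q powr pr"
  have mF: "?F \<in> borel_measurable borel" using hn_measurable by measurable
  have nI: "(\<integral>\<^sup>+ q. ennreal (?F q) \<partial>P.vol) < \<infinity>"
    using Lp False unfolding Lp_norm_def Let_def pr_def[symmetric] by (auto simp: hn_nonneg less_top split: if_splits)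
  then have F: "integrable P.vol ?F" unfolding integrable_iff_bounded using mF by simp
  \<comment> \<open>With \<open>hn powr pr\<close> as a density,
    \<open>measure_disjoint_tendsto_0\<close> applies to the integrals.\<close>
  let ?\<mu> = "density P.vol (\<lambda>q. ennreal (?F q))"
  have em: "emeasure ?\<mu> A = (\<integral>\<^sup>+ q. ennreal (indicator A q * ?F q) \<partial>P.vol)" if "A \<in> sets borel" for A
    using that mF by (subst emeasure_density) (auto intro!: nn_integral_cong simp: indicator_def)
  have "emeasure ?\<mu> (\<Union>k. ball_P (x k) s) \<noteq> \<infinity>"
  proof -
    have "emeasure ?\<mu> (\<Union>k. ball_P (x k) s) \<le> (\<integral>\<^sup>+ q. ennreal (?F q) \<partial>P.vol)"
      by (subst em) (auto intro!: nn_integral_mono borel_ball simp: indicator_def)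
    then show ?thesis using nI by (auto simp: top_unique)
  qed
  then have "(\<lambda>k. measure ?\<mu> (ball_P (x k) s)) \<longlonglongrightarrow> 0"
    by (intro measure_disjoint_tendsto_0 disj) (auto intro: borel_ball)
  moreover have "measure ?\<mu> (ball_P y s) = (\<integral>q. indicator (ball_P y s) q * ?F q \<partial>P.vol)" for y
    unfolding measure_def em[OF borel_ball]
    by (rule integral_eq_nn_integral[symmetric]) (auto intro!: borel_measurable_times borel_measurable_indicator borel_ball mF)
  ultimately have I: "(\<lambda>k. \<integral>q. indicator (ball_P (x k) s) q * ?F q \<partial>P.vol) \<longlonglongrightarrow> 0" by simp
  \<comment> \<open>Makes up for the factor 3 in \<open>h_int_small_finite\<close>.\<close>
  define \<epsilon> where "\<epsilon> = \<theta> / 3"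
  have e: "\<epsilon> > 0" using \<theta> by (simp add: \<epsilon>_def)
  have "\<forall>\<^sub>F k in sequentially. V (x k) s < 1" "\<forall>\<^sub>F k in sequentially. V (x k) s < \<epsilon> ^ CARD('m)"
    "\<forall>\<^sub>F k in sequentially. (\<integral>q. indicator (ball_P (x k) s) q * ?F q \<partial>P.vol) < \<epsilon> powr pr"
    using V I e by (auto intro!: order_tendstoD(2))
  then show ?thesis
  proof eventually_elim
    case (elim k)
    have "h_int (ball_P (x k) u) \<le> 3 * \<epsilon> * (V (x k) u / root CARD('m) (V (x k) u))" if "0 < u" "u \<le> s" for u
      by (rule h_int_small_finite[OF compl prm F that e]) (use elim in auto)
    then show ?case by (simp add: \<epsilon>_def)
  qed
qed

section \<open>The two implications of the theorem\<close>

lemma geodesic_ball_eq: "geodesic_ball N y t = {z. rdist N y z < t}"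
  unfolding geodesic_ball_def N.MS.mball_def by simp

lemma proper_imp_finite:
  assumes "complete_riem N" "proper \<phi>"
  shows "emeasure P.vol (\<phi> -` geodesic_ball N y t) < \<infinity>"
proof -
  have K: "compact (\<phi> -` N.cb y t)" using N.Hopf_Rinow[OF assms(1)] assms(2) unfolding proper_def by blast
  have "\<phi> -` geodesic_ball N y t \<subseteq> \<phi> -` N.cb y t" unfolding geodesic_ball_eq by (auto simp: N.cb_def)
  then have "emeasure P.vol (\<phi> -` geodesic_ball N y t) \<le> emeasure P.vol (\<phi> -` N.cb y t)"
    by (rule emeasure_mono) (simp add: borel_compact[OF K])
  also have "\<dots> < \<infinity>" by (rule P.vol_compact_finite[OF K])
  finally show ?thesis .
qed

text \<open>An unbounded sequence in the preimage of a compact set would be the centers of disjoint balls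
  that are eventually too thin.\<close>

lemma finite_imp_proper:
  assumes compl: "complete_riem P" and p: "of_nat CARD('m) \<le> p" and Lp: "Lp_norm p P.vol hn < \<infinity>"
    and fin: "\<And>y t. t > 0 \<Longrightarrow> emeasure P.vol (\<phi> -` geodesic_ball N y t) < \<infinity>"
  shows "proper \<phi>"
  unfolding proper_def
proof (intro conjI allI impI cont_phi)
  fix K :: "'b set" assume K: "compact K"
  have clK: "closed (\<phi> -` K)" using cont_phi compact_imp_closed[OF K] by (simp add: continuous_on_closed_vimage)
  fix x0 :: 'a
  show "compact (\<phi> -` K)"
  proof (rule ccontr)
    assume nc: "\<not> compact (\<phi> -` K)"
    define x0 :: 'a where "x0 = undefined"
    have "\<exists>x. \<phi> x \<in> K \<and> t < rdist P x0 x" for t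
    proof (rule ccontr)
      assume "\<not> ?thesis"
      then have "\<phi> -` K \<subseteq> P.cb x0 t" by (auto simp: P.cb_def not_less)
      then have "\<phi> -` K = P.cb x0 t \<inter> \<phi> -` K" by blast
      then show False using nc compact_Int_closed[OF P.Hopf_Rinow[OF compl, of x0 t] clK] by simp
    qed
    then obtain g where g: "\<And>t. \<phi> (g t) \<in> K" "\<And>t. t < rdist P x0 (g t)" by metis
    \<comment> \<open>Each point is more than 2 further from \<open>x0\<close> than the one before,
      so balls of radius less than 1 around them are disjoint.\<close>
    define X where "X = rec_nat (g 0) (\<lambda>_ z. g (rdist P x0 z + 2))"
    have XS: "X (Suc k) = g (rdist P x0 (X k) + 2)" for k by (simp add: X_def)
    have XK: "\<phi> (X k) \<in> K" for k by (cases k) (simp_all add: X_def g(1))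
    have step: "rdist P x0 (X k) + 2 < rdist P x0 (X (Suc k))" for k unfolding XS by (rule g(2))
    have sep: "rdist P x0 (X i) + 2 < rdist P x0 (X j)" if "i < j" for i j
      using that
    proof (induction rule: strict_inc_induct)
      case (base i)
      then show ?case using step[of i] by simp
    next
      case (step i)
      then show ?case using \<open>\<And>k. rdist P x0 (X k) + 2 < rdist P x0 (X (Suc k))\<close>[of i] by linarith
    qed
    have "seq_compact K" by (rule compact_imp_seq_compact[OF K])
    then obtain l \<sigma> where l: "l \<in> K" "strict_mono (\<sigma> :: nat \<Rightarrow> nat)" "((\<lambda>k. \<phi> (X k)) \<circ> \<sigma>) \<longlonglongrightarrow> l"
      by (rule seq_compactE[of _ "\<lambda>k. \<phi> (X k)"]) (use XK in blast)+
    obtain d R C where lm: "N.local_model l d R C" by (rule N.local_model_ex) blast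
    then have RC: "0 < R" "R \<le> 1" "0 \<le> C" unfolding N.local_model_def by auto
    \<comment> \<open>The images of the centers will be within \<open>R / 4\<close> of
      \<open>l\<close>, and the balls reach another \<open>R / 4\<close>, still in the range of the
      local model. From \<open>s < 1\<close> the balls are disjoint.\<close>
    define s where "s = R / 4"
    have s: "0 < s" "s < R" "s < 1" using RC by (auto simp: s_def)
    define Y where "Y k = X (\<sigma> k)" for k
    have disjY: "disjoint_family (\<lambda>k. ball_P (Y k) s)"
      unfolding disjoint_family_on_def
    proof (intro ballI impI equals0I)
      fix i j q assume ij: "i \<noteq> j" and q: "q \<in> ball_P (Y i) s \<inter> ball_P (Y j) s"
      have *: False if "i < j" "q \<in> ball_P (Y i) s" "q \<in> ball_P (Y j) s" for i j
        using sep[OF strict_monoD[OF l(2) that(1)]] that(2,3) P.rdist_triangle[of x0 "Y j" "Y i"] P.rdist_triangle[of "Y i" "Y j" q]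
          P.rdist_sym[of "Y j" q] s by (simp add: Y_def)
      show False using *[of i j] *[of j i] ij q by (cases "i < j") auto
    qed
    have "(\<lambda>k. rdist N l (\<phi> (Y k))) \<longlonglongrightarrow> rdist N l l"
      using continuous_on_tendsto_compose[OF N.continuous_rdist[of l] l(3)] by (simp only: Y_def o_def UNIV_I eventually_True simp_thms)
    then have "\<forall>\<^sub>F k in sequentially. rdist N l (\<phi> (Y k)) < R / 4"
      using RC(1) by (intro order_tendstoD(2)) (auto simp: N.rdist_refl)
    then obtain k0 where k0: "\<And>k. k0 \<le> k \<Longrightarrow> rdist N l (\<phi> (Y k)) < R / 4" unfolding eventually_sequentially by blast
    define x where "x k = Y (k + k0)" for k
    have xn: "rdist N l (\<phi> (x k)) < R / 4" for k unfolding x_def by (rule k0) simp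
    have disj: "disjoint_family (\<lambda>k. ball_P (x k) s)"
      using disjY unfolding disjoint_family_on_def x_def by auto
    have "(\<Union>k. ball_P (x k) s) \<subseteq> \<phi> -` geodesic_ball N l 1"
    proof (intro UN_least subsetI)
      fix k q assume "q \<in> ball_P (x k) s"
      then show "q \<in> \<phi> -` geodesic_ball N l 1"
        using N.rdist_triangle[of l "\<phi> q" "\<phi> (x k)"] phi_lipschitz[of "x k" q] xn[of k] RC by (simp add: geodesic_ball_eq s_def)
    qed
    then have "emeasure P.vol (\<Union>k. ball_P (x k) s) \<le> emeasure P.vol (\<phi> -` geodesic_ball N l 1)"
      by (rule emeasure_mono) (use open_vimage_phi[OF N.open_db] in \<open>simp add: geodesic_ball_eq borel_open\<close>)
    also have "\<dots> < \<infinity>" by (rule fin) simp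
    finally have V: "(\<lambda>k. V (x k) s) \<longlonglongrightarrow> 0"
      by (intro measure_disjoint_tendsto_0 disj) (auto simp: borel_ball)
    let ?\<Gamma> = "4 * (1 + 2 * C) * 8 ^ CARD('m)"
    \<comment> \<open>Multiplied by \<open>?\<Gamma>\<close> this is the constant in the last
      hypothesis of \<open>no_thin_ball\<close>.\<close>
    define \<theta> where "\<theta> = root CARD('m) (\<omega> / 4) / 2 ^ CARD('m) / ?\<Gamma>"
    have \<Gamma>: "?\<Gamma> > 0" using RC(3) by (simp add: add_pos_nonneg)
    have \<theta>: "\<theta> > 0" unfolding \<theta>_def using omega_pos \<Gamma> by (intro divide_pos_pos) auto
    have "\<forall>\<^sub>F k in sequentially. V (x k) s < \<omega> / 4 * (s / 16) ^ CARD('m)"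
      using V omega_pos s(1) by (intro order_tendstoD(2)) auto
    then have "\<forall>\<^sub>F k in sequentially. False"
      using eventually_small[OF compl p Lp s(1) V disj \<theta>]
    proof eventually_elim
      case (elim k)
      show False
      proof (rule no_thin_ball[OF lm compl s(1,2)])
        show "rdist N l (\<phi> (x k)) + s < R" using xn[of k] RC(1) by (simp add: s_def)
        show "V (x k) s \<le> \<omega> / 4 * (s / 16) ^ CARD('m)" using elim(1) by simp
        fix u assume u: "0 < u" "u \<le> s"
        have "?\<Gamma> * h_int (ball_P (x k) u) \<le> ?\<Gamma> * (\<theta> * (V (x k) u / root CARD('m) (V (x k) u)))"
          using elim(2) u \<Gamma> by (intro mult_left_mono) auto
        also have "\<dots> = (?\<Gamma> * \<theta>) * (V (x k) u / root CARD('m) (V (x k) u))" by (simp only: mult.assoc)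
        also have "?\<Gamma> * \<theta> = root CARD('m) (\<omega> / 4) / 2 ^ CARD('m)" 
          unfolding \<theta>_def by (subst times_divide_eq_right) (rule nonzero_mult_div_cancel_left[OF less_imp_neq[OF \<Gamma>, symmetric]])
        finally show "?\<Gamma> * h_int (ball_P (x k) u) \<le> root CARD('m) (\<omega> / 4) / 2 ^ CARD('m) * (V (x k) u / root CARD('m) (V (x k) u))" .
      qed
    qed
    then show False by simp
  qed
qed

end

theorem theorem1p1:
  fixes P :: "('a::{t2_space,second_countable_topology}, 'm::finite) riem"
    and N :: "('b::{t2_space,second_countable_topology}, 'n::finite) riem"
    and \<phi> :: "'a \<Rightarrow> 'b"
    and p :: ennreal
  assumes "riemannian_manifold P" and "complete_riem P" and "\<not> compact (UNIV :: 'a set)"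
    and "riemannian_manifold N" and "bounded_geometry N"
    and "isometric_immersion P N \<phi>"
    and "of_nat CARD('m) \<le> p"
    and "Lp_norm p (riem_vol P) (mean_curv_norm P N \<phi>) < \<infinity>"
  shows "proper \<phi> \<longleftrightarrow>
    (\<forall>q. \<forall>t>0. emeasure (riem_vol P) (\<phi> -` geodesic_ball N q t) < \<infinity>)"
proof -
  interpret imm P N \<phi> by unfold_locales (rule assms)+
  have "complete_riem N" using assms(5) unfolding bounded_geometry_def by blast
  then show ?thesis using proper_imp_finite finite_imp_proper[OF assms(2,7,8)] by blast
qed

end
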